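(* Let $n\ge 2$ be an integer, let $G$ be a locally compact abelian group with dual group $\Gamma$ (written additively), and let $\omega=(\omega_1,\dots,\omega_n)\in\Gamma^n$. If the crossed product $\mathcal{O}_n\rtimes_{\alpha^\omega}G$ is simple, then it is either purely infinite or AF-embeddable.
   Context: $\mathcal{O}_n$ is the Cuntz algebra, the universal $C^*$-algebra generated by isometries $S_1,\dots,S_n$ with $\sum_{i=1}^nS_iS_i^*=1$. Denote the pairing of $t\in G$ and $\gamma\in\Gamma$ by $\langle t\,|\,\gamma\rangle\in\mathbb{T}$. The action $\alpha^\omega$ of $G$ on $\mathcal{O}_n$ is determined by $\alpha^\omega_t(S_i)=\langle t\,|\,\omega_i\rangle S_i$ for $t\in G$, $i=1,\dots,n$. $\mathcal{O}_n\rtimes_{\alpha^\omega}G$ is the crossed product (full and reduced coincide since $G$ is amenable). A simple $C^*$-algebra is called purely infinite if every non-zero hereditary $C^*$-subalgebra contains an infinite projection (a projection Murray–von Neumann equivalent to a proper subprojection of itself). A $C^*$-algebra is AF if every finite subset can be approximated arbitrarily well in norm by elements of a finite-dimensional $C^*$-subalgebra (for separable algebras: an inductive limit of a sequence of finite-dimensional $C^*$-algebras); it is AF-embeddable if it is isomorphic to a $C^*$-subalgebra of an AF-algebra. *)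

theory Defs
  imports "HOL-Analysis.Analysis" "HOL-Algebra.Algebraic_Closure_Type"
begin

section \<open>C*-algebras\<close>

text \<open>
  Since the statement quantifies existentially over C*-algebras, these are records with an
  explicit carrier. They extend the modules of \<^theory>\<open>HOL-Algebra.Module\<close> over the field of
  complex numbers. The field \<^const>\<open>one\<close> of the underlying ring record has no meaning for
  a general C*-algebra; a unital C*-algebra is one for which the locale \<^locale>\<open>ring\<close>
  holds as well.
\<close>

record 'a cstar = "(complex, 'a) module" +
  star :: "'a \<Rightarrow> 'a"
  nrm :: "'a \<Rightarrow> real"

abbreviation complex_ring :: "complex ring"
  where "complex_ring \<equiv> ring_of_type_algebra"

locale star_algebra = Module.module complex_ring A for A :: "('a, 'm) cstar_scheme" (structure) +
  assumes mult_closed: "\<lbrakk>x \<in> carrier A; y \<in> carrier A\<rbrakk> \<Longrightarrow> x \<otimes> y \<in> carrier A"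
    and mult_assoc: "\<lbrakk>x \<in> carrier A; y \<in> carrier A; z \<in> carrier A\<rbrakk> \<Longrightarrow> (x \<otimes> y) \<otimes> z = x \<otimes> (y \<otimes> z)"
    and mult_distrib_right:
      "\<lbrakk>x \<in> carrier A; y \<in> carrier A; z \<in> carrier A\<rbrakk> \<Longrightarrow> (x \<oplus> y) \<otimes> z = x \<otimes> z \<oplus> y \<otimes> z"
    and mult_distrib_left:
      "\<lbrakk>x \<in> carrier A; y \<in> carrier A; z \<in> carrier A\<rbrakk> \<Longrightarrow> x \<otimes> (y \<oplus> z) = x \<otimes> y \<oplus> x \<otimes> z"
    and smult_mult_left: "\<lbrakk>x \<in> carrier A; y \<in> carrier A\<rbrakk> \<Longrightarrow> (c \<odot> x) \<otimes> y = c \<odot> (x \<otimes> y)"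
    and smult_mult_right: "\<lbrakk>x \<in> carrier A; y \<in> carrier A\<rbrakk> \<Longrightarrow> x \<otimes> (c \<odot> y) = c \<odot> (x \<otimes> y)"
    and star_closed: "x \<in> carrier A \<Longrightarrow> star A x \<in> carrier A"
    and star_star: "x \<in> carrier A \<Longrightarrow> star A (star A x) = x"
    and star_add: "\<lbrakk>x \<in> carrier A; y \<in> carrier A\<rbrakk> \<Longrightarrow> star A (x \<oplus> y) = star A x \<oplus> star A y"
    and star_smult: "x \<in> carrier A \<Longrightarrow> star A (c \<odot> x) = cnj c \<odot> star A x"
    and star_mult: "\<lbrakk>x \<in> carrier A; y \<in> carrier A\<rbrakk> \<Longrightarrow> star A (x \<otimes> y) = star A y \<otimes> star A x"

text \<open>The distance is cut off outside the carrier, because \<^locale>\<open>Metric_space\<close> requires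
  symmetry and nonnegativity on the whole type.\<close>

definition cs_dist :: "('a, 'm) cstar_scheme \<Rightarrow> 'a \<Rightarrow> 'a \<Rightarrow> real"
  where "cs_dist A x y =
    (if x \<in> carrier A \<and> y \<in> carrier A then nrm A (x \<ominus>\<^bsub>A\<^esub> y) else 0)"

abbreviation cs_topology :: "('a, 'm) cstar_scheme \<Rightarrow> 'a topology"
  where "cs_topology A \<equiv> Metric_space.mtopology (carrier A) (cs_dist A)"

definition cstar_seminorm :: "('a, 'm) cstar_scheme \<Rightarrow> ('a \<Rightarrow> real) \<Rightarrow> bool"
  where "cstar_seminorm A p \<longleftrightarrow>
    (\<forall>x\<in>carrier A. 0 \<le> p x) \<and>
    (\<forall>x\<in>carrier A. \<forall>y\<in>carrier A. p (x \<oplus>\<^bsub>A\<^esub> y) \<le> p x + p y) \<and>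
    (\<forall>c. \<forall>x\<in>carrier A. p (c \<odot>\<^bsub>A\<^esub> x) = cmod c * p x) \<and>
    (\<forall>x\<in>carrier A. \<forall>y\<in>carrier A. p (x \<otimes>\<^bsub>A\<^esub> y) \<le> p x * p y) \<and>
    (\<forall>x\<in>carrier A. p (star A x \<otimes>\<^bsub>A\<^esub> x) = (p x)\<^sup>2)"

locale cstar_algebra = star_algebra A for A :: "('a, 'm) cstar_scheme" (structure) +
  assumes nrm_seminorm: "cstar_seminorm A (nrm A)"
    and nrm_eq_zero: "x \<in> carrier A \<Longrightarrow> nrm A x = 0 \<Longrightarrow> x = \<zero>"
    and complete: "Metric_space.mcomplete (carrier A) (cs_dist A)"

lemma (in cstar_algebra) Metric_space_cs_dist: "Metric_space (carrier A) (cs_dist A)"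
proof
  have neg: "x \<ominus> y = (-1) \<odot> (y \<ominus> x)" if "x \<in> carrier A" "y \<in> carrier A" for x y
  proof -
    have m1: "(-1 :: complex) = \<ominus>\<^bsub>complex_ring\<^esub> \<one>\<^bsub>complex_ring\<^esub>"
      by (rule R.minus_equality[symmetric]) (auto simp: ring_of_type_algebra_def)
    have "(-1) \<odot> (y \<ominus> x) = \<ominus> (y \<ominus> x)"
      using that smult_l_minus[of "\<one>\<^bsub>complex_ring\<^esub>" "y \<ominus> x"] by (simp add: m1)
    also have "\<dots> = x \<ominus> y"
      using that by (simp add: a_minus_def M.minus_add M.a_comm)
    finally show ?thesis by simp
  qed
  fix x y z
  show "0 \<le> cs_dist A x y"
    using nrm_seminorm by (auto simp: cs_dist_def cstar_seminorm_def)
  have "nrm A (x \<ominus> y) = nrm A (y \<ominus> x)" if "x \<in> carrier A" "y \<in> carrier A"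
    using neg[OF that] nrm_seminorm that by (simp add: cstar_seminorm_def)
  then show "cs_dist A x y = cs_dist A y x"
    by (simp add: cs_dist_def)
  assume xy: "x \<in> carrier A" "y \<in> carrier A"
  have "\<zero> = 0 \<odot> \<zero>"
    using smult_r_null[of 0] by (simp add: ring_of_type_algebra_def)
  then have "nrm A \<zero> = cmod 0 * nrm A \<zero>"
    using nrm_seminorm unfolding cstar_seminorm_def by (metis M.zero_closed)
  then have nz: "nrm A \<zero> = 0" by simp
  show "cs_dist A x y = 0 \<longleftrightarrow> x = y"
  proof
    assume "cs_dist A x y = 0"
    then have "x \<ominus> y = \<zero>" using xy nrm_eq_zero by (simp add: cs_dist_def)
    moreover have "(x \<ominus> y) \<oplus> y = x"
      using xy by (simp add: a_minus_def M.a_assoc M.l_neg)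
    ultimately show "x = y" using xy by simp
  next
    assume "x = y"
    then show "cs_dist A x y = 0"
      using xy nz by (simp add: cs_dist_def a_minus_def M.r_neg)
  qed
  assume z: "z \<in> carrier A"
  have "x \<ominus> z = (x \<ominus> y) \<oplus> (y \<ominus> z)"
    using xy z by (simp add: a_minus_def M.a_assoc M.r_neg1)
  then show "cs_dist A x z \<le> cs_dist A x y + cs_dist A y z"
    using xy z nrm_seminorm by (simp add: cs_dist_def cstar_seminorm_def)
qed

definition star_hom :: "('a, 'm) cstar_scheme \<Rightarrow> ('b, 'k) cstar_scheme \<Rightarrow> ('a \<Rightarrow> 'b) \<Rightarrow> bool"
  where "star_hom A B \<phi> \<longleftrightarrow>
    \<phi> \<in> carrier A \<rightarrow> carrier B \<and>
    (\<forall>x\<in>carrier A. \<forall>y\<in>carrier A. \<phi> (x \<oplus>\<^bsub>A\<^esub> y) = \<phi> x \<oplus>\<^bsub>B\<^esub> \<phi> y) \<and>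
    (\<forall>c. \<forall>x\<in>carrier A. \<phi> (c \<odot>\<^bsub>A\<^esub> x) = c \<odot>\<^bsub>B\<^esub> \<phi> x) \<and>
    (\<forall>x\<in>carrier A. \<forall>y\<in>carrier A. \<phi> (x \<otimes>\<^bsub>A\<^esub> y) = \<phi> x \<otimes>\<^bsub>B\<^esub> \<phi> y) \<and>
    (\<forall>x\<in>carrier A. \<phi> (star A x) = star B (\<phi> x))"

definition cstar_subalgebra :: "'a set \<Rightarrow> ('a, 'm) cstar_scheme \<Rightarrow> bool"
  where "cstar_subalgebra H A \<longleftrightarrow>
    submodule H complex_ring A \<and>
    (\<forall>x\<in>H. \<forall>y\<in>H. x \<otimes>\<^bsub>A\<^esub> y \<in> H) \<and>
    (\<forall>x\<in>H. star A x \<in> H) \<and>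
    closedin (cs_topology A) H"

text \<open>Closed two-sided ideals of a C*-algebra are automatically closed under the involution.\<close>

definition closed_ideal :: "'a set \<Rightarrow> ('a, 'm) cstar_scheme \<Rightarrow> bool"
  where "closed_ideal I A \<longleftrightarrow>
    submodule I complex_ring A \<and>
    (\<forall>x\<in>I. \<forall>a\<in>carrier A. a \<otimes>\<^bsub>A\<^esub> x \<in> I \<and> x \<otimes>\<^bsub>A\<^esub> a \<in> I) \<and>
    closedin (cs_topology A) I"

definition simple_cstar :: "('a, 'm) cstar_scheme \<Rightarrow> bool"
  where "simple_cstar A \<longleftrightarrow>
    carrier A \<noteq> {\<zero>\<^bsub>A\<^esub>} \<and> (\<forall>I. closed_ideal I A \<longrightarrow> I = {\<zero>\<^bsub>A\<^esub>} \<or> I = carrier A)"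

section \<open>Purely infinite and AF-embeddable C*-algebras\<close>

definition cs_le :: "('a, 'm) cstar_scheme \<Rightarrow> 'a \<Rightarrow> 'a \<Rightarrow> bool"
  where "cs_le A x y \<longleftrightarrow>
    x \<in> carrier A \<and> y \<in> carrier A \<and> (\<exists>z\<in>carrier A. y \<ominus>\<^bsub>A\<^esub> x = star A z \<otimes>\<^bsub>A\<^esub> z)"

definition hereditary_subalgebra :: "'a set \<Rightarrow> ('a, 'm) cstar_scheme \<Rightarrow> bool"
  where "hereditary_subalgebra H A \<longleftrightarrow>
    cstar_subalgebra H A \<and>
    (\<forall>a\<in>carrier A. \<forall>b\<in>H. cs_le A \<zero>\<^bsub>A\<^esub> a \<and> cs_le A a b \<longrightarrow> a \<in> H)"

definition projection :: "('a, 'm) cstar_scheme \<Rightarrow> 'a \<Rightarrow> bool"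
  where "projection A p \<longleftrightarrow> p \<in> carrier A \<and> star A p = p \<and> p \<otimes>\<^bsub>A\<^esub> p = p"

definition mvn_equiv :: "('a, 'm) cstar_scheme \<Rightarrow> 'a \<Rightarrow> 'a \<Rightarrow> bool"
  where "mvn_equiv A p q \<longleftrightarrow>
    (\<exists>v\<in>carrier A. star A v \<otimes>\<^bsub>A\<^esub> v = p \<and> v \<otimes>\<^bsub>A\<^esub> star A v = q)"

definition infinite_projection :: "('a, 'm) cstar_scheme \<Rightarrow> 'a \<Rightarrow> bool"
  where "infinite_projection A p \<longleftrightarrow>
    projection A p \<and> (\<exists>q. projection A q \<and> cs_le A q p \<and> q \<noteq> p \<and> mvn_equiv A p q)"

definition purely_infinite :: "('a, 'm) cstar_scheme \<Rightarrow> bool"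
  where "purely_infinite A \<longleftrightarrow>
    simple_cstar A \<and>
    (\<forall>H. hereditary_subalgebra H A \<and> H \<noteq> {\<zero>\<^bsub>A\<^esub>} \<longrightarrow> (\<exists>p\<in>H. infinite_projection A p))"

definition finite_dimensional_subalgebra :: "'a set \<Rightarrow> ('a, 'm) cstar_scheme \<Rightarrow> bool"
  where "finite_dimensional_subalgebra H A \<longleftrightarrow>
    cstar_subalgebra H A \<and>
    (\<exists>Z. finite Z \<and> Z \<subseteq> H \<and>
      (\<forall>y\<in>H. \<exists>c. y = finsum A (\<lambda>x. c x \<odot>\<^bsub>A\<^esub> x) Z))"

definition AF_algebra :: "('a, 'm) cstar_scheme \<Rightarrow> bool"
  where "AF_algebra A \<longleftrightarrow>
    cstar_algebra A \<and>
    (\<forall>F \<epsilon>. finite F \<and> F \<subseteq> carrier A \<and> 0 < \<epsilon> \<longrightarrow>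
      (\<exists>H. finite_dimensional_subalgebra H A \<and> (\<forall>x\<in>F. \<exists>y\<in>H. nrm A (x \<ominus>\<^bsub>A\<^esub> y) < \<epsilon>)))"

text \<open>HOL cannot quantify over types inside a formula, so quantification over all
  C*-algebras is replaced by quantification over all C*-algebras on one sufficiently large type,
  large enough for the bounded operators on \<open>\<ell>\<^sup>2('x)\<close>.\<close>

type_synonym 'x l2op = "('x \<Rightarrow> complex) \<Rightarrow> ('x \<Rightarrow> complex)"

text \<open>The restriction on the type of \<open>D\<close> loses nothing: if \<open>B\<close> is a C*-subalgebra of an
  AF-algebra, adjoining countably often the finite-dimensional subalgebras that approximate
  the finite subsets of a dense subset gives an AF-algebra containing \<open>B\<close> with the same density
  character as \<open>B\<close> (or a separable one). It acts faithfully on a Hilbert space of this dimension,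
  hence it has a copy on the type \<^typ>\<open>'b l2op\<close> (for \<open>B = 0\<close> take \<open>D = 0\<close>).\<close>

definition AF_embeddable :: "('b, 'm) cstar_scheme \<Rightarrow> bool"
  where "AF_embeddable B \<longleftrightarrow>
    (\<exists>(D :: 'b l2op cstar) H \<phi>. AF_algebra D \<and> cstar_subalgebra H D \<and>
      star_hom B D \<phi> \<and> bij_betw \<phi> (carrier B) H)"

section \<open>Cuntz algebras\<close>

definition cuntz_family :: "('a, 'm) cstar_scheme \<Rightarrow> nat \<Rightarrow> (nat \<Rightarrow> 'a) \<Rightarrow> bool"
  where "cuntz_family A n S \<longleftrightarrow>
    (\<forall>i\<in>{1..n}. S i \<in> carrier A \<and> star A (S i) \<otimes>\<^bsub>A\<^esub> S i = \<one>\<^bsub>A\<^esub>) \<and>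
    finsum A (\<lambda>i. S i \<otimes>\<^bsub>A\<^esub> star A (S i)) {1..n} = \<one>\<^bsub>A\<^esub>"

text \<open>The pair \<open>(A, S)\<close> is the universal C*-algebra generated by \<open>n\<close> isometries with
  range projections adding up to 1, up to isomorphism. In the universal property the target may be
  cut down to the separable C*-subalgebra generated by \<open>T\<close>, which acts faithfully on \<open>\<ell>\<^sup>2(\<nat>)\<close>, so that
  targets on the type \<^typ>\<open>nat l2op\<close> suffice. The homomorphism \<open>\<phi>\<close> is unital and unique because
  of the relations and since \<open>S\<close> generates \<open>A\<close>.\<close>

definition cuntz_algebra :: "nat \<Rightarrow> ('a, 'm) cstar_scheme \<Rightarrow> (nat \<Rightarrow> 'a) \<Rightarrow> bool"
  where "cuntz_algebra n A S \<longleftrightarrow>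
    cstar_algebra A \<and> Ring.ring A \<and> cuntz_family A n S \<and>
    (\<forall>H. cstar_subalgebra H A \<and> S ` {1..n} \<subseteq> H \<longrightarrow> H = carrier A) \<and>
    (\<forall>(C :: nat l2op cstar) T. cstar_algebra C \<and> Ring.ring C \<and> cuntz_family C n T \<longrightarrow>
      (\<exists>\<phi>. star_hom A C \<phi> \<and> (\<forall>i\<in>{1..n}. \<phi> (S i) = T i)))"

section \<open>Locally compact abelian groups and crossed products\<close>

text \<open>The pairing of \<open>t\<close> with \<open>\<gamma>\<close> in the dual group is the value \<open>\<gamma> t\<close>.\<close>

definition dual_group :: "('g :: topological_ab_group_add \<Rightarrow> complex) set"
  where "dual_group = {\<gamma>. continuous_on UNIV \<gamma> \<and> (\<forall>t. cmod (\<gamma> t) = 1) \<and>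
    (\<forall>s t. \<gamma> (s + t) = \<gamma> s * \<gamma> t)}"

definition haar_measure :: "('g :: topological_ab_group_add) measure \<Rightarrow> bool"
  where "haar_measure \<mu> \<longleftrightarrow>
    sets \<mu> = sets borel \<and>
    emeasure \<mu> UNIV \<noteq> 0 \<and>
    (\<forall>K. compact K \<longrightarrow> emeasure \<mu> K < \<infinity>) \<and>
    (\<forall>E\<in>sets borel. emeasure \<mu> E = (INF U\<in>{U. open U \<and> E \<subseteq> U}. emeasure \<mu> U)) \<and>
    (\<forall>U. open U \<longrightarrow> emeasure \<mu> U = (SUP K\<in>{K. compact K \<and> K \<subseteq> U}. emeasure \<mu> K)) \<and>
    (\<forall>t. \<forall>E\<in>sets borel. emeasure \<mu> ((+) t ` E) = emeasure \<mu> E)"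

definition cstar_action ::
    "('g :: topological_ab_group_add \<Rightarrow> 'a \<Rightarrow> 'a) \<Rightarrow> ('a, 'm) cstar_scheme \<Rightarrow> bool"
  where "cstar_action \<alpha> A \<longleftrightarrow>
    (\<forall>t. star_hom A A (\<alpha> t)) \<and>
    (\<forall>x\<in>carrier A. \<alpha> 0 x = x) \<and>
    (\<forall>s t. \<forall>x\<in>carrier A. \<alpha> (s + t) x = \<alpha> s (\<alpha> t x)) \<and>
    (\<forall>x\<in>carrier A. continuous_map euclidean (cs_topology A) (\<lambda>t. \<alpha> t x))"

definition bounded_functional :: "('a, 'm) cstar_scheme \<Rightarrow> ('a \<Rightarrow> complex) \<Rightarrow> bool"
  where "bounded_functional A \<phi> \<longleftrightarrow>
    (\<forall>x\<in>carrier A. \<forall>y\<in>carrier A. \<phi> (x \<oplus>\<^bsub>A\<^esub> y) = \<phi> x + \<phi> y) \<and>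
    (\<forall>c. \<forall>x\<in>carrier A. \<phi> (c \<odot>\<^bsub>A\<^esub> x) = c * \<phi> x) \<and>
    (\<exists>K. \<forall>x\<in>carrier A. cmod (\<phi> x) \<le> K * nrm A x)"

text \<open>The weak integral in \<open>A\<close>. It exists for continuous functions with compact support (where it is the
  Bochner integral), and it is unique since bounded functionals separate points.\<close>

definition weak_integral :: "('a, 'm) cstar_scheme \<Rightarrow> 'g measure \<Rightarrow> ('g \<Rightarrow> 'a) \<Rightarrow> 'a"
  where "weak_integral A \<mu> h = (THE x. x \<in> carrier A \<and>
    (\<forall>\<phi>. bounded_functional A \<phi> \<longrightarrow>
      integrable \<mu> (\<lambda>s. \<phi> (h s)) \<and> integral\<^sup>L \<mu> (\<lambda>s. \<phi> (h s)) = \<phi> x))"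

text \<open>The *-algebra \<open>C\<^sub>c(G, A)\<close> with twisted convolution and the \<open>L\<^sup>1\<close>-norm. There is no modular
  function, because abelian groups are unimodular.\<close>

definition Cc_algebra ::
    "('g :: topological_ab_group_add) measure \<Rightarrow> ('g \<Rightarrow> 'a \<Rightarrow> 'a) \<Rightarrow> ('a, 'm) cstar_scheme \<Rightarrow>
      ('g \<Rightarrow> 'a) cstar"
  where "Cc_algebra \<mu> \<alpha> A = \<lparr>
    carrier = {f. continuous_map euclidean (cs_topology A) f \<and>
      (\<exists>K. compact K \<and> (\<forall>t. t \<notin> K \<longrightarrow> f t = \<zero>\<^bsub>A\<^esub>))},
    mult = (\<lambda>f g t. weak_integral A \<mu> (\<lambda>s. f s \<otimes>\<^bsub>A\<^esub> \<alpha> s (g (t - s)))),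
    one = undefined,
    zero = (\<lambda>t. \<zero>\<^bsub>A\<^esub>),
    add = (\<lambda>f g t. f t \<oplus>\<^bsub>A\<^esub> g t),
    smult = (\<lambda>c f t. c \<odot>\<^bsub>A\<^esub> f t),
    star = (\<lambda>f t. \<alpha> t (star A (f (- t)))),
    nrm = (\<lambda>f. integral\<^sup>L \<mu> (\<lambda>s. nrm A (f s)))\<rparr>"

text \<open>\<open>B\<close> is the enveloping C*-algebra of the normed *-algebra \<open>E\<close>: the completion of \<open>E\<close> in the
  largest C*-seminorm bounded by the given norm. As C*-seminorms are exactly the seminorms
  \<open>x \<mapsto> \<parallel>\<pi>(x)\<parallel>\<close> coming from *-representations \<open>\<pi>\<close> on Hilbert spaces, this is the
  supremum over all norm-decreasing *-representations.\<close>

definition enveloping_cstar_algebra ::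
    "('e, 'm) cstar_scheme \<Rightarrow> ('b, 'k) cstar_scheme \<Rightarrow> ('e \<Rightarrow> 'b) \<Rightarrow> bool"
  where "enveloping_cstar_algebra E B j \<longleftrightarrow>
    cstar_algebra B \<and> star_hom E B j \<and>
    cs_topology B closure_of (j ` carrier E) = carrier B \<and>
    (\<forall>x\<in>carrier E. nrm B (j x) =
      Sup {p x | p. cstar_seminorm E p \<and> (\<forall>y\<in>carrier E. p y \<le> nrm E y)})"

text \<open>The full crossed product: the enveloping C*-algebra of \<open>L\<^sup>1(G, A)\<close>, in which \<open>C\<^sub>c(G, A)\<close> is
  dense.\<close>

definition crossed_product ::
    "('g :: topological_ab_group_add) measure \<Rightarrow> ('g \<Rightarrow> 'a \<Rightarrow> 'a) \<Rightarrow> ('a, 'm) cstar_scheme \<Rightarrow>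
      ('b, 'k) cstar_scheme \<Rightarrow> bool"
  where "crossed_product \<mu> \<alpha> A B \<longleftrightarrow>
    (\<exists>j. enveloping_cstar_algebra (Cc_algebra \<mu> \<alpha> A) B j)"

end

theory Submission
 imports Defs
begin

text \<open>The Cuntz algebra is represented on \<open>l2\<close> by isometries \<open>S\<^sub>i\<close> that permute the basis, and \<open>G\<close> by diagonal
 unitaries, through a function \<open>c\<close> from the basis to the dual group with \<open>c (s\<^sub>i x) = \<omega>\<^sub>i c x\<close>. The image of the
 crossed product is the closed span of the operators \<open>S\<^sub>u M\<^sub>w S\<^sub>v\<^sup>*\<close>, where \<open>u\<close>, \<open>v\<close> are words and \<open>M\<^sub>w\<close> is the
 multiplication by \<open>w \<circ> c\<close> with \<open>w\<close> in \<open>C\<^sub>0\<close> of the dual group; by simplicity this representation is isometric.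

 If every relatively compact set of characters contains only finitely many of the products \<open>\<omega>\<^sub>u\<close>, then finitely many
 such operators with finitely valued \<open>w\<close> of relatively compact support lie in a finite-dimensional *-algebra, so the
 closed span is contained in an AF-algebra. Otherwise, by Dickson's lemma, the inverse of some \<open>\<omega>\<^sub>i\<close> is a limit of
 products \<open>\<omega>\<^sub>u\<close>. Then every nonnegative multiplier of relatively compact support can be written as \<open>z\<^sup>* M\<^sub>r z\<close> for any
 given nonzero \<open>r \<ge> 0\<close>. This produces nonzero projections, and, compressing with an isometry \<open>S\<^sub>u\<close> for a sufficiently
 aperiodic word \<open>u\<close>, embeds each of them below every nonzero positive element, so that every hereditary subalgebra
 contains an infinite projection.\<close>

text \<open>Simplicity acts through the choice of the itinerary. Every nonzero representation of
  \<open>B\<close> is injective, hence isometric, so two permutative representations give the same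
  norm to the same multiplier. For the constant itinerary \<open>i\<close> started at a character
  \<open>ga'\<close>, the characters that occur are \<open>ga'\<close> times products of the
  \<open>og\<close> times powers of the inverse of \<open>og i\<close>; still, its multipliers must
  see every character of the dual group. Once the inverse of \<open>og i\<close> is approximated by
  words, the words alone move \<open>ga'\<close> into every nonempty open set of characters. This
  replaces a spectral criterion for simplicity. A lacunary itinerary, whose shifts are quickly told
  apart, gives the aperiodic words for the compression. Two obstacles shape the analysis. The
  crossed product may lack a unit, so square roots come from a fixed point equation and norms from
  polynomials without constant term. \<open>G\<close> may be neither second countable nor
  sigma-compact, so Fubini is proved for compactly supported kernels only, by Riemann sums.\<close>

abbreviation (input) lint :: "'a measure \<Rightarrow> ('a \<Rightarrow> 'b :: {banach, second_countable_topology}) \<Rightarrow> 'b"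
 where "lint \<equiv> integral\<^sup>L"

abbreviation (input) cre :: "real \<Rightarrow> complex" where "cre \<equiv> complex_of_real"

abbreviation (input) cmap :: "('a, 'm) cstar_scheme \<Rightarrow> ('t :: topological_space \<Rightarrow> 'a) \<Rightarrow> bool"
 where "cmap A \<equiv> continuous_map euclidean (cs_topology A)"

abbreviation (input) dual :: "('g :: topological_ab_group_add \<Rightarrow> complex) set" where "dual \<equiv> dual_group"

abbreviation (input) seq_lim :: "(nat \<Rightarrow> 'a :: topological_space) \<Rightarrow> 'a \<Rightarrow> bool" (infixr "~~>" 60)
 where "f ~~> l \<equiv> f \<longlonglongrightarrow> l"

abbreviation (input) cts :: "('a :: topological_space \<Rightarrow> 'b :: topological_space) \<Rightarrow> bool" where "cts \<equiv> continuous_on UNIV"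

lemma cts_nhds: "cts f \<longleftrightarrow> (ALL t. (f \<longlongrightarrow> f t) (nhds t))"
 unfolding continuous_on_def by (auto simp: tendsto_at_iff_tendsto_nhds)

lemmas Lim_null = Lim_null_comparison[OF always_eventually]

lemma small_factor: assumes "0 < (ep :: real)" "0 <= c" obtains d where "0 < d" "d * c < ep"
proof
 show "0 < ep / (c + 1)" "ep / (c + 1) * c < ep" using assms by (auto simp: field_simps add_nonneg_pos)
qed

lemma le_0_I: "(!!e. 0 < e ==> x <= e * c) ==> 0 <= c ==> x <= (0 :: real)"
proof (rule field_le_epsilon)
 fix d :: real assume x: "!!e. 0 < e ==> x <= e * c" and "0 <= c" "0 < d"
 obtain e where "0 < e" "e * c < d" by (rule small_factor[OF \<open>0 < d\<close> \<open>0 <= c\<close>])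
 thus "x <= 0 + d" using x[of e] by simp
qed

section \<open>Operators on a Hilbert space\<close>

text \<open>One separable Hilbert space serves every \<open>'g\<close> and \<open>'a\<close>: the
  permutative systems below live on countable sets of basis vectors, and \<open>G\<close> acts
  diagonally, so its size does not matter.\<close>

typedef ell2 = "{xi :: nat => complex. summable (%n. (cmod (xi n))^2)}"
 morphisms coord Abs_ell2 by (rule exI[of _ "%_. 0"]) simp

setup_lifting type_definition_ell2

lemma summable_coord: "summable (%n. (cmod (coord xi n))^2)" using coord by blast

lemma ell2_eqI: "(!!n. coord xi n = coord et n) ==> xi = et" by (simp add: coord_inject[symmetric] fun_eq_iff)

lemma cmod_add_sq_le: "(cmod (a + b))^2 <= 2 * (cmod a)^2 + 2 * (cmod b)^2"
proof -
 have "(cmod (a + b))^2 <= (cmod a + cmod b)^2" by (intro power_mono norm_triangle_ineq) simp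
 also have "... <= 2 * (cmod a)^2 + 2 * (cmod b)^2"
  using zero_le_power2[of "cmod a - cmod b"] by (simp add: power2_eq_square algebra_simps)
 finally show ?thesis .
qed

lift_definition escale :: "complex => ell2 => ell2" is "%c xi n. c * xi n"
 by (simp add: norm_mult power_mult_distrib summable_mult)

instantiation ell2 :: real_vector
begin
lift_definition zero_ell2 :: ell2 is "%_. 0" by simp
lift_definition plus_ell2 :: "ell2 => ell2 => ell2" is "%xi et n. xi n + et n"
proof -
 fix f g :: "nat => complex"
 assume "summable (%n. (cmod (f n))^2)" "summable (%n. (cmod (g n))^2)"
 hence "summable (%n. 2 * (cmod (f n))^2 + 2 * (cmod (g n))^2)" by (intro summable_add summable_mult)
 thus "summable (%n. (cmod (f n + g n))^2)" by (rule summable_comparison_test'[where N=0]) (simp add: cmod_add_sq_le)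
qed
lift_definition uminus_ell2 :: "ell2 => ell2" is "%xi n. - xi n" by simp
definition minus_ell2 :: "ell2 => ell2 => ell2" where "minus_ell2 x y = x + - y"
definition scaleR_ell2 :: "real => ell2 => ell2" where "scaleR_ell2 r x = escale (of_real r) x"
instance
proof
 fix a b c :: ell2 and r s :: real
 show "a + b + c = a + (b + c)" by transfer (simp add: add.assoc)
 show "a + b = b + a" by transfer (simp add: add.commute)
 show "0 + a = a" by transfer simp
 show "- a + a = 0" by transfer simp
 show "a - b = a + - b" by (rule minus_ell2_def)
 show "r *\<^sub>R (a + b) = r *\<^sub>R a + r *\<^sub>R b" unfolding scaleR_ell2_def by transfer (simp add: distrib_left)
 show "(r + s) *\<^sub>R a = r *\<^sub>R a + s *\<^sub>R a" unfolding scaleR_ell2_def by transfer (simp add: distrib_right)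
 show "r *\<^sub>R s *\<^sub>R a = (r * s) *\<^sub>R a" unfolding scaleR_ell2_def by transfer (simp add: mult.assoc)
 show "1 *\<^sub>R a = a" unfolding scaleR_ell2_def by transfer simp
qed
end

lemma coord_simps [simp]:
 "coord 0 n = 0" "coord (xi + et) n = coord xi n + coord et n"
 "coord (- xi) n = - coord xi n" "coord (xi - et) n = coord xi n - coord et n"
 "coord (escale c xi) n = c * coord xi n" "coord (r *\<^sub>R xi) n = of_real r * coord xi n"
 unfolding minus_ell2_def scaleR_ell2_def
 by (simp_all add: plus_ell2.rep_eq zero_ell2.rep_eq uminus_ell2.rep_eq escale.rep_eq
   del: add_uminus_conv_diff)

lemma coord_sum [simp]: "coord (sum f A) n = (\<Sum>a\<in>A. coord (f a) n)"
 by (induction A rule: infinite_finite_induct) auto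

definition ip :: "ell2 => ell2 => complex" where "ip xi et = (\<Sum>n. coord xi n * cnj (coord et n))"

lemma summable_ip_norm: "summable (%n. norm (coord xi n * cnj (coord et n)))"
proof (rule summable_comparison_test'[where N=0])
 show "summable (%n. (cmod (coord xi n))^2 + (cmod (coord et n))^2)" by (intro summable_add summable_coord)
 show "norm (norm (coord xi n * cnj (coord et n))) <= (cmod (coord xi n))^2 + (cmod (coord et n))^2" for n
 proof -
  have "0 <= cmod (coord xi n) * cmod (coord et n)" by simp
  thus ?thesis using sum_squares_bound[of "cmod (coord xi n)" "cmod (coord et n)"]
   unfolding norm_mult complex_mod_cnj real_norm_def by linarith
 qed
qed

lemma summable_ip: "summable (%n. coord xi n * cnj (coord et n))" by (rule summable_norm_cancel[OF summable_ip_norm])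

lemma ip_add_left: "ip (x + y) z = ip x z + ip y z" by (simp add: ip_def distrib_right suminf_add[symmetric] summable_ip)

lemma ip_scale_left: "ip (escale c x) z = c * ip x z" by (simp add: ip_def mult.assoc suminf_mult summable_ip)

lemma ip_commute: "ip x y = cnj (ip y x)"
proof -
 have "(%n. cnj (coord y n * cnj (coord x n))) sums cnj (ip y x)"
  unfolding sums_cnj ip_def by (rule summable_sums[OF summable_ip])
 thus ?thesis by (simp add: ip_def sums_iff mult.commute)
qed

lemma ip_add_right: "ip x (y + z) = ip x y + ip x z" by (metis complex_cnj_add ip_add_left ip_commute)

lemma ip_scale_right: "ip x (escale c y) = cnj c * ip x y" by (metis complex_cnj_mult ip_commute ip_scale_left)

lemma ip_self: "ip x x = of_real (\<Sum>n. (cmod (coord x n))^2)"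
proof -
 have "(%n. cre ((cmod (coord x n))^2)) sums of_real (\<Sum>n. (cmod (coord x n))^2)"
  by (rule sums_of_real[OF summable_sums[OF summable_coord]])
 thus ?thesis unfolding ip_def by (simp add: sums_iff complex_norm_square[symmetric])
qed

instantiation ell2 :: real_inner
begin
definition inner_ell2 :: "ell2 => ell2 => real" where "inner_ell2 x y = Re (ip x y)"
definition norm_ell2 :: "ell2 => real" where "norm_ell2 x = sqrt (inner x x)"
definition dist_ell2 :: "ell2 => ell2 => real" where "dist_ell2 x y = norm (x - y)"
definition sgn_ell2 :: "ell2 => ell2" where "sgn_ell2 x = inverse (norm x) *\<^sub>R x"
definition uniformity_ell2 :: "(ell2 \<times> ell2) filter"
 where "uniformity_ell2 = (INF e\<in>{0 <..}. principal {(x, y). dist x y < e})"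
definition open_ell2 :: "ell2 set => bool"
 where "open_ell2 U \<longleftrightarrow> (ALL x:U. eventually (%(x', y). x' = x --> y : U) uniformity)"
instance
proof
 fix x y z :: ell2 and r :: real
 show "inner x y = inner y x" unfolding inner_ell2_def by (subst ip_commute) simp
 show "inner (x + y) z = inner x z + inner y z" by (simp add: inner_ell2_def ip_add_left)
 show "inner (r *\<^sub>R x) y = r * inner x y" by (simp add: inner_ell2_def scaleR_ell2_def ip_scale_left)
 show "0 <= inner x x" by (simp add: inner_ell2_def ip_self suminf_nonneg[OF summable_coord])
 show "inner x x = 0 \<longleftrightarrow> x = 0"
 proof
  assume "inner x x = 0"
  hence "(\<Sum>n. (cmod (coord x n))^2) = 0" by (simp add: inner_ell2_def ip_self)
  hence "ALL n. (cmod (coord x n))^2 = 0" using suminf_eq_zero_iff[OF summable_coord] by simp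
  thus "x = 0" by (intro ell2_eqI) simp
 qed (simp add: inner_ell2_def ip_self)
qed (simp_all add: norm_ell2_def dist_ell2_def sgn_ell2_def uniformity_ell2_def open_ell2_def)
end

lemma norm_ell2_sq: "(norm x)^2 = (\<Sum>n. (cmod (coord x n))^2)"
 by (simp add: norm_ell2_def inner_ell2_def ip_self suminf_nonneg[OF summable_coord])

lemma ip_norm: "ip x x = of_real ((norm x)^2)" by (simp add: ip_self norm_ell2_sq)

lemma ip_zero [simp]: "ip 0 x = 0" "ip x 0 = 0" by (simp_all add: ip_def)

lemma ip_minus_left: "ip (- x) y = - ip x y" by (metis add.right_inverse add_eq_0_iff ip_add_left ip_zero(1))

lemma ip_diff_left: "ip (x - y) z = ip x z - ip y z" by (simp only: diff_conv_add_uminus ip_add_left ip_minus_left)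

lemma ip_minus_right: "ip x (- y) = - ip x y" by (metis ip_commute ip_minus_left complex_cnj_minus)

lemma ip_diff_right: "ip x (y - z) = ip x y - ip x z" by (simp only: diff_conv_add_uminus ip_add_right ip_minus_right)

lemma ip_sum_left: "ip (sum f A) y = (\<Sum>a\<in>A. ip (f a) y)"
 by (induction A rule: infinite_finite_induct) (auto simp: ip_add_left)

lemma norm_escale: "norm (escale c x) = cmod c * norm x"
proof -
 have "cre ((norm (escale c x))^2) = of_real ((cmod c * norm x)^2)"
  unfolding ip_norm[symmetric] power_mult_distrib of_real_mult complex_norm_square
  by (simp add: ip_scale_left ip_scale_right)
 hence "(norm (escale c x))^2 = (cmod c * norm x)^2" using of_real_eq_iff by blast
 thus ?thesis by (simp add: power2_eq_iff_nonneg)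
qed

lemma ip_Cauchy_Schwarz: "cmod (ip x y) <= norm x * norm y"
proof (cases "ip x y = 0")
 case False
 \<comment> \<open>Rotating \<open>x\<close> by the phase of \<open>ip x y\<close> makes the product
   real and nonnegative, so that the Cauchy-Schwarz inequality of the real inner product
   applies.\<close>
 define c where "c = cnj (ip x y) / of_real (cmod (ip x y))"
 have c1: "cmod c = 1" using False by (simp add: c_def norm_divide)
 have "ip (escale c x) y = of_real (cmod (ip x y))"
  using False by (simp add: ip_scale_left c_def complex_norm_square[symmetric] power2_eq_square
    mult.commute)
 hence "cmod (ip x y) = inner (escale c x) y" by (simp add: inner_ell2_def)
 also have "... <= norm (escale c x) * norm y" by (rule norm_cauchy_schwarz)
 finally show ?thesis by (simp add: norm_escale c1)
qed simp

lift_definition delta :: "nat => ell2" is "%k n. if n = k then 1 else 0"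
 by (rule summable_finite[where N="{k}" for k]) (auto split: if_splits)

lemma coord_delta [simp]: "coord (delta k) n = (if n = k then 1 else 0)" by (simp add: delta.rep_eq)

lemma ip_delta_right [simp]: "ip x (delta k) = coord x k"
proof -
 have "ip x (delta k) = (\<Sum>n\<in>{k}. coord x n * cnj (coord (delta k) n))" unfolding ip_def by (rule suminf_finite) auto
 thus ?thesis by simp
qed

lemma ip_delta_left [simp]: "ip (delta k) x = cnj (coord x k)" by (subst ip_commute) simp

lemma norm_delta [simp]: "norm (delta k) = 1"
proof -
 have "cre ((norm (delta k))^2) = 1" unfolding ip_norm[symmetric] by simp
 hence "(norm (delta k))^2 = 1" using of_real_eq_1_iff by blast
 thus ?thesis by (simp add: power2_eq_1_iff) (metis norm_ge_zero not_one_le_zero neg_0_le_iff_le)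
qed

lemma ip_ext: "(!!y. ip x y = ip x' y) ==> x = x'" by (rule ell2_eqI) (metis ip_delta_right)

lemma norm_le_ip: assumes "!!y. cmod (ip x y) <= C * norm y" "0 <= C" shows "norm x <= C"
proof (cases "norm x = 0")
 case False
 have "norm x * norm x <= C * norm x" using assms(1)[of x] by (simp add: ip_norm power2_eq_square norm_mult)
 thus ?thesis using False by (simp add: mult_le_cancel_right)
qed (use assms in simp)

lemma finite_part_le_norm: assumes "finite A" shows "(\<Sum>n\<in>A. (cmod (coord x n))^2) <= (norm x)^2"
 unfolding norm_ell2_sq by (rule sum_le_suminf[OF summable_coord assms]) simp

lemma ell2_truncate: "(%N. norm (y - (\<Sum>n<N. escale (coord y n) (delta n)))) ~~> 0"
proof -
 let ?t = "%N. \<Sum>n<N. escale (coord y n) (delta n)"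
 have ct: "coord (?t N) n = (if n < N then coord y n else 0)" for n N by (simp add: if_distrib cong: if_cong)
 have nrm: "(norm (y - ?t N))^2 = (\<Sum>n. (cmod (coord y (n + N)))^2)" for N
 proof -
  have "(norm (y - ?t N))^2 = (\<Sum>n. (cmod (coord (y - ?t N) (n + N)))^2) + (\<Sum>n<N. (cmod (coord (y - ?t N) n))^2)"
   unfolding norm_ell2_sq by (rule suminf_split_initial_segment[OF summable_coord])
  thus ?thesis by (simp add: ct del: coord_sum)
 qed
 have "(%N. (norm (y - ?t N))^2) ~~> 0" unfolding nrm by (rule suminf_exist_split2[OF summable_coord])
 hence "(%N. sqrt ((norm (y - ?t N))^2)) ~~> sqrt 0" by (intro tendsto_real_sqrt)
 thus ?thesis by simp
qed

text \<open>The only candidate has the coordinates \<open>ph (delta n)\<close>. Testing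
  \<open>ph\<close> on the truncations of this candidate bounds their norms by \<open>C\<close>, and
  a bounded functional is determined by truncations. The argument works with coordinates alone;
  completeness of \<open>ell2\<close> is deduced from it.\<close>

lemma riesz_vector: assumes add: "!!y z. ph (y + z) = ph y + ph z" and scale: "!!c y. ph (escale c y) = cnj c * ph y"
  and bound: "!!y. cmod (ph y) <= C * norm y" and "0 <= C" shows "EX x. (ALL y. ip x y = ph y) & norm x <= C"
proof -
 define f where "f n = ph (delta n)" for n
 have ph0: "ph 0 = 0" using add[of 0 0] by simp
 have phsum: "ph (sum g A) = (\<Sum>a\<in>A. ph (g a))" for g and A :: "nat set"
  by (induction A rule: infinite_finite_induct) (auto simp: add ph0)
 have fin: "(\<Sum>n<N. (cmod (f n))^2) <= C\<^sup>2" for N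
 proof -
  define y where "y = (\<Sum>n<N. escale (f n) (delta n))"
  define s where "s = (\<Sum>n<N. (cmod (f n))^2)"
  have "ph y = (\<Sum>n<N. cnj (f n) * f n)" by (simp add: y_def phsum scale f_def)
  also have "... = of_real s" by (simp add: s_def complex_norm_square mult.commute flip: of_real_power)
  finally have phy: "ph y = of_real s" .
  have "ip y y = (\<Sum>n<N. f n * cnj (f n))"
  proof -
   have "coord y n = (if n < N then f n else 0)" for n by (simp add: y_def if_distrib cong: if_cong)
   thus ?thesis by (subst y_def) (simp add: ip_sum_left ip_scale_left)
  qed
  hence "cre ((norm y)^2) = of_real s"
   unfolding ip_norm[symmetric] by (simp add: s_def complex_norm_square flip: of_real_power)
  hence ny: "(norm y)^2 = s" using of_real_eq_iff by blast
  have "s >= 0" by (simp add: s_def sum_nonneg)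
  have "(norm y)^2 <= C * norm y" using bound[of y] \<open>s >= 0\<close> by (simp add: phy ny)
  hence "norm y <= C" using \<open>0 <= C\<close> by (cases "norm y = 0") (auto simp: power2_eq_square)
  hence "(norm y)^2 <= C\<^sup>2" by (simp add: power_mono)
  thus ?thesis by (simp add: ny s_def)
 qed
 have summ: "summable (%n. (cmod (f n))^2)"
  by (rule bounded_imp_summable[OF _ fin[of "Suc _", unfolded lessThan_Suc_atMost]]) simp
 define x where "x = Abs_ell2 f"
 have cx: "coord x n = f n" for n using summ by (simp add: x_def Abs_ell2_inverse)
 have cont: "((%N. ph (\<Sum>n<N. escale (coord y n) (delta n))) \<longlongrightarrow> ph y) sequentially" for y
 proof -
  let ?t = "%N. \<Sum>n<N. escale (coord y n) (delta n)"
  have n0: "(%N. C * norm (y - ?t N)) ~~> 0" by (rule tendsto_mult_right_zero[OF ell2_truncate])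
  have "ph y - ph (?t N) = ph (y - ?t N)" for N using add[of "y - ?t N" "?t N"] by simp
  hence "cmod (ph (?t N) - ph y) <= C * norm (y - ?t N)" for N by (metis bound norm_minus_commute)
  thus ?thesis by (intro LIM_zero_cancel[OF Lim_null[OF _ n0]]) auto
 qed
 have "ip x y = ph y" for y
 proof -
  have "(%N. \<Sum>n<N. coord x n * cnj (coord y n)) ~~> ip x y" unfolding ip_def by (rule summable_LIMSEQ[OF summable_ip])
  moreover have "(\<Sum>n<N. coord x n * cnj (coord y n)) = ph (\<Sum>n<N. escale (coord y n) (delta n))" for N
   by (simp add: cx phsum scale f_def mult.commute)
  ultimately show ?thesis using cont[of y] LIMSEQ_unique by auto
 qed
 moreover have "norm x <= C" by (rule norm_le_ip) (use calculation bound assms in auto)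
 ultimately show ?thesis by blast
qed

lifting_update ell2.lifting
lifting_forget ell2.lifting

instance ell2 :: complete_space
proof
 fix Xs :: "nat => ell2" assume Xs: "Cauchy Xs"
 obtain C where C: "!!k. norm (Xs k) <= C" and C0: "0 < C" using cauchy_imp_bounded[OF Xs] unfolding bounded_pos by auto
 have cau: "Cauchy (%k. ip (Xs k) y)" for y
 proof (rule CauchyI)
  fix e :: real assume "0 < e"
  hence "0 < e / (norm y + 1)" by (simp add: add_nonneg_pos)
  from CauchyD[OF Xs this] obtain M where
   M: "!!m n. m >= M ==> n >= M ==> norm (Xs m - Xs n) < e / (norm y + 1)" by blast
  have "norm (ip (Xs m) y - ip (Xs n) y) < e" if "m >= M" "n >= M" for m n
  proof -
   have "norm (ip (Xs m) y - ip (Xs n) y) <= norm (Xs m - Xs n) * norm y"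
    unfolding ip_diff_left[symmetric] by (rule ip_Cauchy_Schwarz)
   also have "... <= norm (Xs m - Xs n) * (norm y + 1)" by (intro mult_left_mono) auto
   also have "... < e" using M[OF that] by (simp add: pos_less_divide_eq add_nonneg_pos)
   finally show ?thesis .
  qed
  thus "EX M. ALL m>=M. ALL n>=M. norm (ip (Xs m) y - ip (Xs n) y) < e" by blast
 qed
 define ph where "ph y = lim (%k. ip (Xs k) y)" for y
 have lim: "(%k. ip (Xs k) y) ~~> ph y" for y using cau[of y] Cauchy_convergent_iff convergent_LIMSEQ_iff ph_def by metis
 \<comment> \<open>The pointwise limit of the functionals is represented by a vector, the weak
   limit; the Cauchy estimate is uniform in \<open>y\<close> and turns weak into norm
   convergence.\<close>
 have "EX x. (ALL y. ip x y = ph y) & norm x <= C"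
 proof (rule riesz_vector)
  show "ph (y + z) = ph y + ph z" for y z using tendsto_add[OF lim[of y] lim[of z]] lim[of "y + z"]
   by (simp add: ip_add_right LIMSEQ_unique)
  show "ph (escale c y) = cnj c * ph y" for c y using tendsto_mult_left[OF lim[of y], of "cnj c"] lim[of "escale c y"]
   by (simp add: ip_scale_right LIMSEQ_unique)
  show "cmod (ph y) <= C * norm y" for y
  proof (rule LIMSEQ_le_const2[OF tendsto_norm[OF lim[of y]]])
   show "EX N. ALL n>=N. norm (ip (Xs n) y) <= C * norm y"
    by (meson C ip_Cauchy_Schwarz mult_right_mono norm_ge_zero order_trans)
  qed
 qed (use C0 in simp)
 then obtain x where x: "!!y. ip x y = ph y" by blast
 have "Xs ~~> x"
 proof (rule LIMSEQ_I)
  fix e :: real assume e: "0 < e"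
  from CauchyD[OF Xs, of "e / 2"] e obtain M where
   M: "!!m n. m >= M ==> n >= M ==> norm (Xs m - Xs n) < e / 2" by auto
  have "norm (Xs m - x) < e" if m: "m >= M" for m
  proof -
   have "norm (Xs m - x) <= e / 2"
   proof (rule norm_le_ip)
    fix y
    have "(%n. ip (Xs m - Xs n) y) ~~> ip (Xs m - x) y" unfolding ip_diff_left x by (intro tendsto_diff tendsto_const lim)
    thus "cmod (ip (Xs m - x) y) <= e / 2 * norm y"
    proof (rule LIMSEQ_le_const2[OF tendsto_norm])
     have "norm (ip (Xs m - Xs n) y) <= e / 2 * norm y" if "n >= M" for n using M[OF m that]
      by (meson ip_Cauchy_Schwarz less_imp_le mult_right_mono norm_ge_zero order_trans)
     thus "EX N. ALL n>=N. norm (ip (Xs m - Xs n) y) <= e / 2 * norm y" by blast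
    qed
   qed (use e in simp)
   thus ?thesis using e by simp
  qed
  thus "EX no. ALL n>=no. norm (Xs n - x) < e" by blast
 qed
 thus "convergent Xs" by (auto simp: convergent_def)
qed

instance ell2 :: banach ..

lemma bounded_linear_escale: "bounded_linear (escale c)"
proof (rule bounded_linear_intro)
 show "escale c (x + y) = escale c x + escale c y" for x y by (rule ell2_eqI) (simp add: algebra_simps)
 show "escale c (r *\<^sub>R x) = r *\<^sub>R escale c x" for r x by (rule ell2_eqI) simp
 show "norm (escale c x) <= norm x * cmod c" for x by (simp add: norm_escale)
qed

lemma escale_simps:
 "escale c (x + y) = escale c x + escale c y"
 "escale (c + d) x = escale c x + escale d x"
 "escale c (escale d x) = escale (c * d) x"
 "escale 1 x = x" "escale c 0 = 0" "escale c (- x) = - escale c x"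
 "escale c (x - y) = escale c x - escale c y"
 "escale c (r *\<^sub>R x) = r *\<^sub>R escale c x"
 "escale (of_real r) x = r *\<^sub>R x" by (rule ell2_eqI; simp add: algebra_simps)+

text \<open>The type classes know only real scalars, so complex linearity is imposed as commutation
  with \<open>escale\<close>, and the complex scalar action \<open>opsc\<close> is kept as a
  separate function.\<close>

typedef op = "{T :: ell2 \<Rightarrow>\<^sub>L ell2. ALL c x. blinfun_apply T (escale c x) = escale c (blinfun_apply T x)}"
 morphisms bl Abs_op by (rule exI[of _ 0]) (simp add: escale_simps)

setup_lifting type_definition_op

lift_definition app :: "op => ell2 => ell2" is blinfun_apply .

lift_definition opsc :: "complex => op => op"
 is "%c T. blinfun_compose (Blinfun (escale c)) T"
 by (simp add: bounded_linear_Blinfun_apply[OF bounded_linear_escale] escale_simps mult.commute)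

lemma app_scale [simp]: "app T (escale c x) = escale c (app T x)" by transfer simp

lemma app_add [simp]: "app T (x + y) = app T x + app T y" by transfer (simp add: blinfun.add_right)

lemma app_zero_right [simp]: "app T 0 = 0" by transfer simp

lemma app_diff [simp]: "app T (x - y) = app T x - app T y" by transfer (simp add: blinfun.diff_right)

lemma app_minus [simp]: "app T (- x) = - app T x" by transfer (simp add: blinfun.minus_right)

lemma op_eqI: "(!!x. app S x = app T x) ==> S = T" by transfer (rule blinfun_eqI)

instantiation op :: real_normed_algebra_1
begin
lift_definition zero_op :: op is 0 by (simp add: escale_simps)
lift_definition one_op :: op is id_blinfun by simp
lift_definition plus_op :: "op => op => op" is "(+)" by (simp add: blinfun.add_left escale_simps)
lift_definition minus_op :: "op => op => op" is "(-)" by (simp add: blinfun.diff_left escale_simps)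
lift_definition uminus_op :: "op => op" is uminus by (simp add: blinfun.minus_left escale_simps)
lift_definition times_op :: "op => op => op" is blinfun_compose by simp
lift_definition scaleR_op :: "real => op => op" is "(*\<^sub>R)" by (simp add: blinfun.scaleR_left escale_simps)
lift_definition norm_op :: "op => real" is norm .
definition dist_op :: "op => op => real" where "dist_op x y = norm (x - y)"
definition sgn_op :: "op => op" where "sgn_op x = inverse (norm x) *\<^sub>R x"
definition uniformity_op :: "(op \<times> op) filter"
 where "uniformity_op = (INF e\<in>{0 <..}. principal {(x, y). dist x y < e})"
definition open_op :: "op set => bool"
 where "open_op U \<longleftrightarrow> (ALL x:U. eventually (%(x', y). x' = x --> y : U) uniformity)"
instance
proof
 fix a b c :: op and r s :: real
 show "a + b + c = a + (b + c)" by transfer (simp add: add.assoc)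
 show "a + b = b + a" by transfer (simp add: add.commute)
 show "0 + a = a" by transfer simp
 show "- a + a = 0" by transfer simp
 show "a - b = a + - b" by transfer simp
 show "r *\<^sub>R (a + b) = r *\<^sub>R a + r *\<^sub>R b" by transfer (simp add: scaleR_add_right)
 show "(r + s) *\<^sub>R a = r *\<^sub>R a + s *\<^sub>R a" by transfer (simp add: scaleR_add_left)
 show "r *\<^sub>R s *\<^sub>R a = (r * s) *\<^sub>R a" by transfer simp
 show "1 *\<^sub>R a = a" by transfer simp
 show "dist a b = norm (a - b)" by (rule dist_op_def)
 show "sgn a = inverse (norm a) *\<^sub>R a" by (rule sgn_op_def)
 show "uniformity = (INF e\<in>{0 <..}. principal {(x, y :: op). dist x y < e})" by (rule uniformity_op_def)
 show "open U \<longleftrightarrow> (ALL x:U. eventually (%(x', y). x' = x --> y : U) uniformity)" for U :: "op set"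
  by (rule open_op_def)
 show "norm a = 0 \<longleftrightarrow> a = 0" by transfer simp
 show "norm (a + b) <= norm a + norm b" by transfer (rule norm_triangle_ineq)
 show "norm (r *\<^sub>R a) = \<bar>r\<bar> * norm a" by transfer simp
 show "a * b * c = a * (b * c)" by transfer (auto intro: blinfun_eqI)
 show "(a + b) * c = a * c + b * c" by transfer (auto intro!: blinfun_eqI simp: blinfun.add_left)
 show "a * (b + c) = a * b + a * c" by transfer (auto intro!: blinfun_eqI simp: blinfun.add_left blinfun.add_right)
 show "(r *\<^sub>R a) * b = r *\<^sub>R (a * b)" by transfer (auto intro!: blinfun_eqI simp: blinfun.scaleR_left)
 show "a * (r *\<^sub>R b) = r *\<^sub>R (a * b)"
  by transfer (auto intro!: blinfun_eqI simp: blinfun.scaleR_left blinfun.scaleR_right)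
 show "1 * a = a" "a * 1 = a" by (transfer; auto intro: blinfun_eqI)+
 show "(0 :: op) ~= 1"
 proof transfer
  have "blinfun_apply id_blinfun (delta 0) ~= blinfun_apply 0 (delta 0)"
   using norm_delta[of 0] by (auto simp del: norm_delta)
  thus "0 ~= (id_blinfun :: ell2 \<Rightarrow>\<^sub>L ell2)" by metis
 qed
 show "norm (a * b) <= norm a * norm b" by transfer (rule norm_blinfun_compose)
 show "norm (1 :: op) = 1"
 proof transfer
  have "norm (blinfun_apply id_blinfun (delta 0)) <= norm (id_blinfun :: ell2 \<Rightarrow>\<^sub>L ell2) * norm (delta 0)"
   by (rule norm_blinfun)
  hence "1 <= norm (id_blinfun :: ell2 \<Rightarrow>\<^sub>L ell2)" by simp
  moreover have "norm (id_blinfun :: ell2 \<Rightarrow>\<^sub>L ell2) <= 1" by (rule norm_blinfun_bound) auto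
  ultimately show "norm (id_blinfun :: ell2 \<Rightarrow>\<^sub>L ell2) = 1" by simp
 qed
qed
end

instance op :: complete_space
proof
 fix Xs :: "nat => op" assume Xs: "Cauchy Xs"
 have isom: "norm (bl (Xs m) - bl (Xs n)) = norm (Xs m - Xs n)" for m n by (simp add: norm_op.rep_eq minus_op.rep_eq)
 have "Cauchy (%n. bl (Xs n))" by (rule CauchyI) (use CauchyD[OF Xs] isom in presburger)
 then obtain L where L: "(%n. bl (Xs n)) ~~> L" using Cauchy_convergent convergent_def by blast
 have "blinfun_apply L (escale c x) = escale c (blinfun_apply L x)" for c x
 proof (rule LIMSEQ_unique)
  show "(%n. blinfun_apply (bl (Xs n)) (escale c x)) ~~> blinfun_apply L (escale c x)"
   by (intro blinfun.tendsto L tendsto_const)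
  have "(%n. escale c (blinfun_apply (bl (Xs n)) x)) ~~> escale c (blinfun_apply L x)"
   by (intro bounded_linear.tendsto[OF bounded_linear_escale] blinfun.tendsto L tendsto_const)
  moreover have "escale c (blinfun_apply (bl (Xs n)) x) = blinfun_apply (bl (Xs n)) (escale c x)" for n
   using bl[of "Xs n"] by simp
  ultimately show "(%n. blinfun_apply (bl (Xs n)) (escale c x)) ~~> escale c (blinfun_apply L x)" by simp
 qed
 hence "bl (Abs_op L) = L" by (simp add: Abs_op_inverse)
 hence "norm (Xs n - Abs_op L) = norm (bl (Xs n) - L)" for n by (simp add: norm_op.rep_eq minus_op.rep_eq)
 hence "Xs ~~> Abs_op L" using L by (simp add: tendsto_iff dist_norm dist_op_def)
 thus "convergent Xs" by (auto simp: convergent_def)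
qed

instance op :: banach ..

lemma app_simps [simp]:
 "app 0 x = 0" "app 1 x = x" "app (S + T) x = app S x + app T x" "app (S - T) x = app S x - app T x"
 "app (- S) x = - app S x" "app (S * T) x = app S (app T x)" "app (r *\<^sub>R S) x = r *\<^sub>R app S x"
 "app (opsc c S) x = escale c (app S x)"
 by (transfer; simp add: blinfun.add_left blinfun.diff_left blinfun.minus_left blinfun.scaleR_left
   bounded_linear_Blinfun_apply[OF bounded_linear_escale])+

lemma norm_app: "norm (app T x) <= norm T * norm x" by transfer (rule norm_blinfun)

lemma op_norm_bound: "0 <= C ==> (!!x. norm (app T x) <= C * norm x) ==> norm T <= C" by transfer (rule norm_blinfun_bound)

lemma opsc_simps:
 "opsc c (S + T) = opsc c S + opsc c T"
 "opsc (c + d) S = opsc c S + opsc d S"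
 "opsc c (opsc d S) = opsc (c * d) S"
 "opsc 1 S = S" "opsc 0 S = 0" "opsc c 0 = 0"
 "opsc c S * T = opsc c (S * T)" "S * opsc c T = opsc c (S * T)"
 "opsc c (- S) = - opsc c S" "opsc (- c) S = - opsc c S"
 "opsc c (S - T) = opsc c S - opsc c T"
 "opsc (of_real r) S = r *\<^sub>R S" by (rule op_eqI; rule ell2_eqI; simp add: algebra_simps)+

lemma norm_opscale: "norm (opsc c S) = cmod c * norm S"
proof -
 have le: "norm (opsc c S) <= cmod c * norm S" for c S
  by (rule op_norm_bound) (simp_all add: norm_escale norm_app mult_left_mono mult.assoc)
 show ?thesis
 proof (cases "c = 0")
  case False
  have "norm S = norm (opsc (inverse c) (opsc c S))" using False by (simp add: opsc_simps)
  also have "... <= cmod (inverse c) * norm (opsc c S)" by (rule le)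
  finally have "cmod c * norm S <= norm (opsc c S)" using False by (simp add: norm_inverse norm_divide field_simps)
  with le[of c S] show ?thesis by simp
 qed (simp add: opsc_simps)
qed

text \<open>Source of all weakly defined operators: adjoints, diagonal operators, the coisometries
  of a permutative system and the integrated form of a covariant pair.\<close>

lemma form_op: assumes addl: "!!x x' y. be (x + x') y = be x y + be x' y"
  and addr: "!!x y y'. be x (y + y') = be x y + be x y'" and scalel: "!!c x y. be (escale c x) y = c * be x y"
  and scaler: "!!c x y. be x (escale c y) = cnj c * be x y" and bound: "!!x y. cmod (be x y) <= C * norm x * norm y"
  and "0 <= C" shows "EX T. (ALL x y. ip (app T x) y = be x y) & norm T <= C"
proof -
 have "EX z. (ALL y. ip z y = be x y) & norm z <= C * norm x" for x
  by (rule riesz_vector) (use assms in \<open>simp_all add: mult.assoc\<close>)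
 then obtain t where t: "!!x y. ip (t x) y = be x y" and nt: "!!x. norm (t x) <= C * norm x" by metis
 have tadd: "t (x + x') = t x + t x'" for x x' by (rule ip_ext) (simp add: t ip_add_left addl)
 have tscale: "t (escale c x) = escale c (t x)" for c x by (rule ip_ext) (simp add: t ip_scale_left scalel)
 have "bounded_linear t"
 proof (rule bounded_linear_intro[OF tadd])
  show "t (r *\<^sub>R x) = r *\<^sub>R t x" for r x using tscale[of "of_real r" x] by (simp add: escale_simps)
  show "norm (t x) <= norm x * C" for x using nt[of x] by (simp add: mult.commute)
 qed
 hence bt: "blinfun_apply (Blinfun t) = t" by (simp add: bounded_linear_Blinfun_apply)
 hence "bl (Abs_op (Blinfun t)) = Blinfun t" by (simp add: Abs_op_inverse tscale)
 hence a: "app (Abs_op (Blinfun t)) x = t x" for x by (simp add: app.rep_eq bt)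
 show ?thesis by (rule exI[of _ "Abs_op (Blinfun t)"]) (use assms nt in \<open>auto simp: a t intro!: op_norm_bound\<close>)
qed

lemma ip_app_bound: "cmod (ip (app T x) y) <= norm T * norm x * norm y"
 by (meson ip_Cauchy_Schwarz mult_right_mono norm_app norm_ge_zero order_trans)

lemma op_ext_ip: "(!!x y. ip (app S x) y = ip (app T x) y) ==> S = T" by (rule op_eqI) (rule ip_ext)

definition adj :: "op => op" where "adj T = (THE S. ALL x y. ip (app S x) y = ip x (app T y))"

lemma adj: "ip (app (adj T) x) y = ip x (app T y)"
proof -
 have "EX S. (ALL x y. ip (app S x) y = ip x (app T y)) & norm S <= norm T"
 proof (rule form_op)
  show "cmod (ip x (app T y)) <= norm T * norm x * norm y" for x y
   using ip_app_bound[of T y x] by (subst ip_commute) (simp add: mult_ac)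
 qed (simp_all add: ip_add_left ip_add_right ip_scale_left ip_scale_right)
 hence "EX! S. ALL x y. ip (app S x) y = ip x (app T y)" by (metis op_ext_ip)
 from theI'[OF this] show ?thesis by (simp add: adj_def)
qed

lemma adj': "ip x (app (adj T) y) = ip (app T x) y" by (metis adj ip_commute)

lemma adj_adj [simp]: "adj (adj T) = T" by (rule op_ext_ip) (simp add: adj adj')

lemma adj_eqI: "(!!x y. ip (app S x) y = ip x (app T y)) ==> adj T = S" by (rule op_ext_ip) (simp add: adj)

lemma adj_simps [simp]:
 "adj (S + T) = adj S + adj T" "adj (S - T) = adj S - adj T" "adj (- S) = - adj S"
 "adj (S * T) = adj T * adj S" "adj (opsc c S) = opsc (cnj c) (adj S)" "adj 0 = 0" "adj 1 = 1"
 "adj (r *\<^sub>R S) = r *\<^sub>R adj S"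
 by (rule adj_eqI; simp add: ip_add_left ip_add_right ip_diff_left ip_diff_right ip_minus_left
   ip_minus_right ip_scale_left ip_scale_right adj adj' flip: escale_simps(9))+

lemma norm_adj_le: "norm (adj T) <= norm T"
proof (rule op_norm_bound)
 fix x
 show "norm (app (adj T) x) <= norm T * norm x"
 proof (rule norm_le_ip)
  show "cmod (ip (app (adj T) x) y) <= norm T * norm x * norm y" for y
   using ip_app_bound[of T y x] by (subst adj, subst ip_commute) (simp add: mult_ac)
 qed simp
qed simp

lemma norm_adj [simp]: "norm (adj T) = norm T" by (metis adj_adj norm_adj_le order_antisym)

lemma op_cstar: "norm (adj T * T) = (norm T)^2"
proof (rule order_antisym)
 show "norm (adj T * T) <= (norm T)^2" using norm_mult_ineq[of "adj T" T] by (simp add: power2_eq_square)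
 have "norm T <= sqrt (norm (adj T * T))"
 proof (rule op_norm_bound)
  fix x
  have "cre ((norm (app T x))^2) = ip (app (adj T * T) x) x" unfolding ip_norm[symmetric] by (simp add: adj)
  hence "(norm (app T x))^2 = cmod (ip (app (adj T * T) x) x)" by (metis norm_of_real abs_power2)
  also have "... <= norm (adj T * T) * (norm x)^2"
   using ip_app_bound[of "adj T * T" x x] by (simp add: power2_eq_square mult.assoc)
  finally have "sqrt ((norm (app T x))^2) <= sqrt (norm (adj T * T) * (norm x)^2)" using real_sqrt_le_mono by blast
  thus "norm (app T x) <= sqrt (norm (adj T * T)) * norm x" by (simp add: real_sqrt_mult)
 qed simp
 thus "(norm T)^2 <= norm (adj T * T)" using real_le_rsqrt[of "norm T"] by (metis norm_ge_zero power_mono real_sqrt_pow2)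
qed

lemma bounded_linear_adj: "bounded_linear adj" by (rule bounded_linear_intro[where K=1]) auto

lemma bounded_linear_opscale: "bounded_linear (opsc c)" by (rule bounded_linear_intro[where K="cmod c"])
  (auto simp: opsc_simps norm_opscale mult.commute simp flip: opsc_simps(12))

text \<open>The zero operator if \<open>d\<close> is unbounded.\<close>

definition diag :: "(nat => complex) => op"
 where "diag d = (THE T. ALL x k. coord (app T x) k = (if bounded (range d) then d k * coord x k else 0))"

lemma diag_exists: assumes "ALL k. cmod (d k) <= C"
 shows "EX T. (ALL x k. coord (app T x) k = d k * coord x k) & norm T <= C"
proof -
 have C0: "0 <= C" using assms norm_ge_zero order_trans by blast
 have le: "(cmod (d k * coord x k))^2 <= C\<^sup>2 * (cmod (coord x k))^2" for x k
  unfolding norm_mult power_mult_distrib by (intro mult_right_mono power_mono assms[rule_format]) auto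
 have summ: "summable (%k. (cmod (d k * coord x k))^2)" for x
  by (rule summable_comparison_test'[OF summable_mult[OF summable_coord[of x], of "C\<^sup>2"], where N=0])
   (use le in simp)
 define t where "t x = Abs_ell2 (%k. d k * coord x k)" for x
 have ct: "coord (t x) k = d k * coord x k" for x k using summ[of x] by (simp add: t_def Abs_ell2_inverse)
 have nt: "norm (t x) <= C * norm x" for x
 proof -
  have "(norm (t x))^2 <= (\<Sum>k. C\<^sup>2 * (cmod (coord x k))^2)"
   unfolding norm_ell2_sq ct by (rule suminf_le[OF le summ]) (intro summable_mult summable_coord)
  also have "... = (C * norm x)^2" by (simp add: suminf_mult[OF summable_coord] power_mult_distrib norm_ell2_sq)
  finally show ?thesis using C0 by (simp add: power2_le_iff_abs_le)
 qed
 have "EX T. (ALL x y. ip (app T x) y = ip (t x) y) & norm T <= C"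
 proof (rule form_op)
  show "cmod (ip (t x) y) <= C * norm x * norm y" for x y
   by (meson ip_Cauchy_Schwarz mult_right_mono nt norm_ge_zero order_trans)
  show "ip (t (x + x')) y = ip (t x) y + ip (t x') y" for x x' y
   unfolding ip_add_left[symmetric] by (rule arg_cong2[where f=ip]) (auto intro!: ell2_eqI simp: ct algebra_simps)
  show "ip (t (escale c x)) y = c * ip (t x) y" for c x y
   unfolding ip_scale_left[symmetric] by (rule arg_cong2[where f=ip]) (auto intro!: ell2_eqI simp: ct algebra_simps)
 qed (simp_all add: ip_add_right ip_scale_right C0)
 then obtain T where T: "!!x y. ip (app T x) y = ip (t x) y" "norm T <= C" by blast
 hence "app T x = t x" for x by (intro ip_ext) simp
 hence "coord (app T x) k = d k * coord x k" for x k using ct by simp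
 thus ?thesis using T(2) by blast
qed

lemma coord_diag: assumes "ALL k. cmod (d k) <= C" shows "coord (app (diag d) x) k = d k * coord x k"
proof -
 have b: "bounded (range d)" using assms by (auto simp: bounded_iff)
 have "EX! T. ALL x k. coord (app T x) k = (if bounded (range d) then d k * coord x k else 0)"
  using diag_exists[OF assms] b by (metis (no_types, lifting) ell2_eqI op_eqI)
 from theI'[OF this] show ?thesis using b by (simp add: diag_def)
qed

lemma norm_diag: assumes "ALL k. cmod (d k) <= C" shows "norm (diag d) <= C"
proof -
 obtain T where T: "!!x k. coord (app T x) k = d k * coord x k" "norm T <= C" using diag_exists[OF assms] by blast
 have "diag d = T" by (rule op_eqI, rule ell2_eqI) (simp add: T coord_diag[OF assms])
 thus ?thesis using T by simp
qed

text \<open>With \<open>norm_diag\<close> this makes the norm of a diagonal operator the supremum of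
  its entries, which is how norms of multipliers are turned into values at characters.\<close>

lemma norm_diag_ge: assumes "ALL k. cmod (d k) <= C" shows "cmod (d k) <= norm (diag d)"
proof -
 have "cmod (d k) = cmod (ip (app (diag d) (delta k)) (delta k))" by (simp add: coord_diag[OF assms])
 also have "... <= norm (diag d)" using ip_app_bound[of "diag d" "delta k" "delta k"] by simp
 finally show ?thesis .
qed

section \<open>C*-algebras\<close>

lemma complex_ring_simps [simp]:
 "carrier complex_ring = UNIV" "a \<otimes>\<^bsub>complex_ring\<^esub> b = a * b" "a \<oplus>\<^bsub>complex_ring\<^esub> b = a + b"
 "\<one>\<^bsub>complex_ring\<^esub> = 1" "\<zero>\<^bsub>complex_ring\<^esub> = 0"
 by (simp_all add: ring_of_type_algebra_def)

lemma cring_complex: "cring complex_ring" by (rule cring_from_type_algebra)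

context star_algebra
begin

lemma smult_cl [simp]: "x : carrier A ==> c \<odot> x : carrier A" by simp

lemma smult_smult [simp]: "x : carrier A ==> c \<odot> (d \<odot> x) = (c * d) \<odot> x"
 using smult_assoc1[of c d x] by simp

lemma smult_1 [simp]: "x : carrier A ==> 1 \<odot> x = x" using smult_one[of x] by simp

lemma smult_left_distr: "x : carrier A ==> (c + d) \<odot> x = c \<odot> x \<oplus> d \<odot> x"
 using smult_l_distr[of c d x] by simp

lemma smult_right_distr: "[|x : carrier A; y : carrier A|] ==> c \<odot> (x \<oplus> y) = c \<odot> x \<oplus> c \<odot> y"
 using smult_r_distr[of c x y] by simp

lemma smult_zero_left [simp]: "x : carrier A ==> 0 \<odot> x = \<zero>" using smult_l_null[of x] by simp

lemma smult_zero_right [simp]: "c \<odot> \<zero> = \<zero>" using smult_r_null[of c] by simp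

lemma smult_m1: "x : carrier A ==> (-1) \<odot> x = \<ominus> x"
proof -
 assume x: "x : carrier A"
 have "x \<oplus> (-1) \<odot> x = \<zero>" using smult_left_distr[OF x, of 1 "-1"] x by simp
 thus ?thesis using x by (metis M.minus_equality M.a_comm smult_cl)
qed

lemma minus_smult: "[|x : carrier A; y : carrier A|] ==> x \<ominus> y = x \<oplus> (-1) \<odot> y"
 by (simp add: smult_m1 a_minus_def)

lemma minus_cl [simp]: "[|x : carrier A; y : carrier A|] ==> x \<ominus> y : carrier A" by simp

lemma minus_self [simp]: "x : carrier A ==> x \<ominus> x = \<zero>" by (simp add: a_minus_def M.r_neg)

lemma minus_zero [simp]: "x : carrier A ==> x \<ominus> \<zero> = x" by (simp add: a_minus_def)

lemma minus_eq_zero: "[|x : carrier A; y : carrier A; x \<ominus> y = \<zero>|] ==> x = y"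
 by (metis M.add.inv_closed M.minus_equality M.minus_minus a_minus_def)

lemma minus_trans: "[|x : carrier A; y : carrier A; z : carrier A|] ==> x \<ominus> z = (x \<ominus> y) \<oplus> (y \<ominus> z)"
 by (simp add: a_minus_def M.a_assoc M.r_neg1)

lemma minus_swap: "[|x : carrier A; y : carrier A|] ==> y \<ominus> x = (-1) \<odot> (x \<ominus> y)"
 by (simp add: smult_m1 a_minus_def M.minus_add M.a_comm)

lemma add_minus: "[|x : carrier A; y : carrier A; x' : carrier A; y' : carrier A|] ==>
 (x \<oplus> y) \<ominus> (x' \<oplus> y') = (x \<ominus> x') \<oplus> (y \<ominus> y')"
 by (simp add: a_minus_def M.minus_add M.a_ac)

lemma smult_minus: "[|x : carrier A; y : carrier A|] ==> c \<odot> (x \<ominus> y) = c \<odot> x \<ominus> c \<odot> y"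
 by (simp add: minus_smult smult_right_distr mult.commute)

lemma mult_zero [simp]: "x : carrier A ==> x \<otimes> \<zero> = \<zero>" "x : carrier A ==> \<zero> \<otimes> x = \<zero>"
 using smult_mult_right[of x "\<zero>" 0] smult_mult_left[of "\<zero>" x 0] mult_closed by auto

lemma mult_minus:
 "[|x : carrier A; y : carrier A; z : carrier A|] ==> x \<otimes> (y \<ominus> z) = x \<otimes> y \<ominus> x \<otimes> z"
 "[|x : carrier A; y : carrier A; z : carrier A|] ==> (x \<ominus> y) \<otimes> z = x \<otimes> z \<ominus> y \<otimes> z"
 by (simp_all add: minus_smult mult_distrib_left mult_distrib_right smult_mult_left smult_mult_right
   mult_closed)

lemma star_minus: "[|x : carrier A; y : carrier A|] ==> star A (x \<ominus> y) = star A x \<ominus> star A y"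
 by (simp add: minus_smult star_add star_smult star_closed)

lemma star_zero [simp]: "star A \<zero> = \<zero>" using star_smult[of "\<zero>" 0] by (simp add: star_closed)

lemmas cl = mult_closed star_closed smult_cl minus_cl

end

context cstar_algebra
begin

lemma nrm_ge0: "x : carrier A ==> 0 <= nrm A x"
 and nrm_triangle: "[|x : carrier A; y : carrier A|] ==> nrm A (x \<oplus> y) <= nrm A x + nrm A y"
 and nrm_smult: "x : carrier A ==> nrm A (c \<odot> x) = cmod c * nrm A x"
 and nrm_mult: "[|x : carrier A; y : carrier A|] ==> nrm A (x \<otimes> y) <= nrm A x * nrm A y"
 and nrm_cstar: "x : carrier A ==> nrm A (star A x \<otimes> x) = (nrm A x)^2"
 using nrm_seminorm by (simp_all add: cstar_seminorm_def)

lemma nrm_zero [simp]: "nrm A \<zero> = 0" using nrm_smult[of "\<zero>" 0] by simp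

lemma nrm_star: "x : carrier A ==> nrm A (star A x) = nrm A x"
proof -
 have le: "nrm A x <= nrm A (star A x)" if x: "x : carrier A" for x
 proof (cases "nrm A x = 0")
  case False
  have "nrm A x * nrm A x <= nrm A (star A x) * nrm A x"
   using nrm_mult[of "star A x" x] x by (simp add: nrm_cstar star_closed power2_eq_square)
  thus ?thesis using False nrm_ge0[OF x] by (simp add: mult_le_cancel_right)
 qed (simp add: nrm_ge0 star_closed that)
 assume x: "x : carrier A"
 show ?thesis using le[OF x] le[of "star A x"] x by (simp add: star_closed star_star)
qed

lemma nrm_commute: "[|x : carrier A; y : carrier A|] ==> nrm A (x \<ominus> y) = nrm A (y \<ominus> x)"
 using minus_swap[of x y] by (simp add: nrm_smult)

lemma nrm_minus_trans:
 "[|x : carrier A; y : carrier A; z : carrier A|] ==> nrm A (x \<ominus> z) <= nrm A (x \<ominus> y) + nrm A (y \<ominus> z)"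
 using nrm_triangle[of "x \<ominus> y" "y \<ominus> z"] minus_trans[of x y z] by simp

lemma nrm_rev_triangle: "[|x : carrier A; y : carrier A|] ==> \<bar>nrm A x - nrm A y\<bar> <= nrm A (x \<ominus> y)"
 using nrm_minus_trans[of x y "\<zero>"] nrm_minus_trans[of y x "\<zero>"] nrm_commute[of x y] by simp

sublocale Ms: Metric_space "carrier A" "cs_dist A" by (rule Metric_space_cs_dist)

lemma cs_dist_eq [simp]: "[|x : carrier A; y : carrier A|] ==> cs_dist A x y = nrm A (x \<ominus> y)"
 by (simp add: cs_dist_def)

lemma closedin_iff:
 "closedin (cs_topology A) H \<longleftrightarrow>
  H \<subseteq> carrier A & (ALL x:carrier A. (ALL ep>0. EX y:H. nrm A (x \<ominus> y) < ep) --> x : H)"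
proof -
 have "closedin (cs_topology A) H \<longleftrightarrow>
  H \<subseteq> carrier A & (ALL x. x : carrier A - H --> (EX r>0. disjnt H (Ms.mball x r)))"
  by (auto simp: Ms.closedin_metric)
 also have "... \<longleftrightarrow> H \<subseteq> carrier A & (ALL x:carrier A. (ALL ep>0. EX y:H. nrm A (x \<ominus> y) < ep) --> x : H)"
  by (auto simp: disjnt_iff Ms.in_mball subset_iff) (metis cs_dist_eq)+
 finally show ?thesis .
qed

lemma closure_of_iff:
 "H \<subseteq> carrier A ==> x : cs_topology A closure_of H \<longleftrightarrow>
  x : carrier A & (ALL ep>0. EX y:H. nrm A (x \<ominus> y) < ep)"
 by (auto simp: Ms.metric_closure_of subset_iff Ms.in_mball) (metis cs_dist_eq)+

lemma continuous_iff:
 "cmap A f \<longleftrightarrow> (ALL t. f t : carrier A) &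
  (ALL t. ALL ep>0. EX U. open U & t : U & (ALL s:U. nrm A (f t \<ominus> f s) < ep))"
proof -
 have "cmap A f \<longleftrightarrow>
  (ALL t. ALL ep>0. EX U. open U & t : U & (ALL s:U. f s : Ms.mball (f t) ep))" by (simp add: Ms.continuous_map_to_metric)
 also have "... \<longleftrightarrow> (ALL t. f t : carrier A) &
  (ALL t. ALL ep>0. EX U. open U & t : U & (ALL s:U. nrm A (f t \<ominus> f s) < ep))"
  (is "?L \<longleftrightarrow> ?C & ?R")
 proof
  assume L: ?L
  have c: "f t : carrier A" for t using L zero_less_one by (metis Ms.in_mball)
  moreover have ?R using L by (simp add: c)
  ultimately show "?C & ?R" by blast
 next
  assume "?C & ?R" thus ?L by simp
 qed
 finally show ?thesis .
qed

lemma cmap_iff: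
 "cmap A f \<longleftrightarrow>
  (ALL t. f t : carrier A) & (ALL t. ((%s. nrm A (f t \<ominus> f s)) \<longlongrightarrow> 0) (nhds t))"
proof (cases "ALL t. f t : carrier A")
 case True
 hence "((%s. nrm A (f t \<ominus> f s)) \<longlongrightarrow> 0) (nhds t) \<longleftrightarrow>
   (ALL ep>0. EX U. open U & t : U & (ALL s:U. nrm A (f t \<ominus> f s) < ep))" for t
  unfolding tendsto_iff eventually_nhds using nrm_ge0 by simp
 thus ?thesis using True unfolding continuous_iff by simp
qed (auto simp: continuous_iff)

lemma cmapI: assumes "!!t. f t : carrier A" "!!t. ((%s. b t s) \<longlongrightarrow> 0) (nhds t)"
  "!!t s. nrm A (f t \<ominus> f s) <= b t s" shows "cmap A f" unfolding cmap_iff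
proof (intro conjI allI)
 fix t
 show "((%s. nrm A (f t \<ominus> f s)) \<longlongrightarrow> 0) (nhds t)"
  by (rule Lim_null[OF _ assms(2)]) (use assms nrm_ge0 in simp)
qed (rule assms)

lemma cmapD: assumes "cmap A f" shows "f t : carrier A" "((%s. nrm A (f t \<ominus> f s)) \<longlongrightarrow> 0) (nhds t)"
 using assms unfolding cmap_iff by blast+

lemma lim_add:
 assumes l: "((%s. nrm A (x \<ominus> f s)) \<longlongrightarrow> 0) F" "((%s. nrm A (y \<ominus> g s)) \<longlongrightarrow> 0) F"
  and c: "x : carrier A" "y : carrier A" "!!s. f s : carrier A" "!!s. g s : carrier A"
 shows "((%s. nrm A ((x \<oplus> y) \<ominus> (f s \<oplus> g s))) \<longlongrightarrow> 0) F"
proof (rule Lim_null)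
 show "((%s. nrm A (x \<ominus> f s) + nrm A (y \<ominus> g s)) \<longlongrightarrow> 0) F" using tendsto_add[OF l] by simp
 show "ALL s. norm (nrm A ((x \<oplus> y) \<ominus> (f s \<oplus> g s))) <= nrm A (x \<ominus> f s) + nrm A (y \<ominus> g s)"
  using c by (simp add: add_minus nrm_ge0 nrm_triangle)
qed

lemma lim_mult:
 assumes l: "((%s. nrm A (x \<ominus> f s)) \<longlongrightarrow> 0) F" "((%s. nrm A (y \<ominus> g s)) \<longlongrightarrow> 0) F"
  and c: "x : carrier A" "y : carrier A" "!!s. f s : carrier A" "!!s. g s : carrier A"
 shows "((%s. nrm A (x \<otimes> y \<ominus> f s \<otimes> g s)) \<longlongrightarrow> 0) F"
proof (rule Lim_null)
 let ?R = "%s. nrm A (x \<ominus> f s) * nrm A y + (nrm A x + nrm A (x \<ominus> f s)) * nrm A (y \<ominus> g s)"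
 have "(?R \<longlongrightarrow> 0 * nrm A y + (nrm A x + 0) * 0) F" by (intro tendsto_intros l)
 thus "(?R \<longlongrightarrow> 0) F" by simp
 show "ALL s. norm (nrm A (x \<otimes> y \<ominus> f s \<otimes> g s)) <= ?R s"
 proof
  fix s
  have "x \<otimes> y \<ominus> f s \<otimes> g s = (x \<ominus> f s) \<otimes> y \<oplus> f s \<otimes> (y \<ominus> g s)"
   using c minus_trans[of "x \<otimes> y" "f s \<otimes> y" "f s \<otimes> g s"] by (simp add: mult_minus cl)
  hence "nrm A (x \<otimes> y \<ominus> f s \<otimes> g s) <= nrm A (x \<ominus> f s) * nrm A y + nrm A (f s) * nrm A (y \<ominus> g s)"
   using c by (simp add: cl order_trans[OF nrm_triangle] add_mono nrm_mult)
  moreover have "nrm A (f s) <= nrm A x + nrm A (x \<ominus> f s)" using nrm_rev_triangle[OF c(1) c(3), of s] by simp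
  hence "nrm A (f s) * nrm A (y \<ominus> g s) <= (nrm A x + nrm A (x \<ominus> f s)) * nrm A (y \<ominus> g s)"
   by (rule mult_right_mono) (use c nrm_ge0 in simp)
  ultimately show "norm (nrm A (x \<otimes> y \<ominus> f s \<otimes> g s)) <= ?R s" using c by (simp add: nrm_ge0 cl)
 qed
qed

lemma lim_scale:
 assumes h: "(h \<longlongrightarrow> w) F" and l: "((%s. nrm A (x \<ominus> f s)) \<longlongrightarrow> 0) F"
  and c: "x : carrier A" "!!s. f s : carrier A"
 shows "((%s. nrm A (w \<odot> x \<ominus> h s \<odot> f s)) \<longlongrightarrow> 0) F"
proof (rule Lim_null)
 let ?R = "%s. cmod (w - h s) * nrm A x + cmod (h s) * nrm A (x \<ominus> f s)"
 have "(?R \<longlongrightarrow> cmod (w - w) * nrm A x + cmod w * 0) F" by (intro tendsto_intros h l)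
 thus "(?R \<longlongrightarrow> 0) F" by simp
 show "ALL s. norm (nrm A (w \<odot> x \<ominus> h s \<odot> f s)) <= ?R s"
 proof
  fix s
  have "(w - h s) \<odot> x = w \<odot> x \<ominus> h s \<odot> x"
   using c smult_left_distr[of x w "- h s"] by (simp add: minus_smult)
  hence "w \<odot> x \<ominus> h s \<odot> f s = (w - h s) \<odot> x \<oplus> h s \<odot> (x \<ominus> f s)"
   using c minus_trans[of "w \<odot> x" "h s \<odot> x" "h s \<odot> f s"] by (simp add: smult_minus)
  thus "norm (nrm A (w \<odot> x \<ominus> h s \<odot> f s)) <= ?R s"
   using c nrm_triangle[of "(w - h s) \<odot> x" "h s \<odot> (x \<ominus> f s)"] by (simp add: nrm_smult nrm_ge0)
 qed
qed

lemma lim_star: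
 assumes l: "((%s. nrm A (x \<ominus> f s)) \<longlongrightarrow> 0) F" and c: "x : carrier A" "!!s. f s : carrier A"
 shows "((%s. nrm A (star A x \<ominus> star A (f s))) \<longlongrightarrow> 0) F"
 using l c by (simp add: star_minus[symmetric] nrm_star)

lemma lim_const: "x : carrier A ==> ((%_. nrm A (x \<ominus> x)) \<longlongrightarrow> 0) F" by simp

lemma Cauchy_limit: assumes y: "!!k :: nat. y k : carrier A"
  and cau: "!!ep. ep > 0 ==> EX N. ALL m>=N. ALL n>=N. nrm A (y m \<ominus> y n) < ep"
 shows "EX x:carrier A. (%k. nrm A (y k \<ominus> x)) ~~> 0"
proof -
 have "Ms.MCauchy y" unfolding Ms.MCauchy_def using y cau by (auto simp: image_subset_iff)
 then obtain x where x: "limitin Ms.mtopology y x sequentially" using complete unfolding Ms.mcomplete_def by blast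
 have xc: "x : carrier A" using x Ms.limitin_mspace by blast
 have "(%k. nrm A (y k \<ominus> x)) ~~> 0" using x unfolding Ms.limitin_metric_dist_null by (simp add: y xc)
 thus ?thesis using xc by blast
qed

lemma limit_unique: assumes "!!k :: nat. y k : carrier A" "x : carrier A" "x' : carrier A"
  "(%k. nrm A (x \<ominus> y k)) ~~> 0" "(%k. nrm A (x' \<ominus> y k)) ~~> 0" shows "x = x'"
proof -
 have "nrm A (x \<ominus> x') <= nrm A (x \<ominus> y k) + nrm A (x' \<ominus> y k)" for k
  using nrm_minus_trans[of x "y k" x'] nrm_commute[of x' "y k"] assms by simp
 moreover have "(%k. nrm A (x \<ominus> y k) + nrm A (x' \<ominus> y k)) ~~> 0" using tendsto_add[OF assms(4,5)] by simp
 ultimately have "nrm A (x \<ominus> x') <= 0" by (intro LIMSEQ_le_const) auto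
 hence "x \<ominus> x' = \<zero>" using nrm_ge0[of "x \<ominus> x'"] assms by (intro nrm_eq_zero) auto
 thus ?thesis using minus_eq_zero assms by blast
qed

text \<open>The solution \<open>s\<close> of \<open>2s = h + s\<^sup>2\<close> is \<open>1 - sqrt (1 - h)\<close>. Obtaining it as the limit of a
 contraction avoids both a unit and power series.\<close>

primrec root_iter :: "'a => nat => 'a" where
 "root_iter h 0 = \<zero>"
| "root_iter h (Suc k) = (1/2) \<odot> (h \<oplus> root_iter h k \<otimes> root_iter h k)"

text \<open>The norm bound and the commutation clause hold for all iterates and pass to the limit.
  The latter allows \<open>s\<close> to be combined with any element that commutes with
  \<open>h\<close>, both for contractivity of homomorphisms and for the correction of
  projections.\<close>

lemma root_exists: assumes h: "h : carrier A" "star A h = h" "nrm A h <= rh" "rh < 1"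
 shows "EX s:carrier A. star A s = s & nrm A s <= rh & 2 \<odot> s = h \<oplus> s \<otimes> s &
  (ALL a:carrier A. a \<otimes> h = h \<otimes> a --> a \<otimes> s = s \<otimes> a)"
proof -
 have rh0: "0 <= rh" using h nrm_ge0 order_trans by blast
 let ?s = "root_iter h"
 have c [simp]: "?s k : carrier A" for k by (induction k) (auto simp: h mult_closed)
 have st: "star A (?s k) = ?s k" for k by (induction k) (auto simp: star_smult star_add star_mult h mult_closed)
 have n: "nrm A (?s k) <= rh" for k
 proof (induction k)
  case (Suc k)
  have "nrm A (h \<oplus> ?s k \<otimes> ?s k) <= nrm A h + nrm A (?s k) * nrm A (?s k)"
   using nrm_triangle[of h "?s k \<otimes> ?s k"] nrm_mult[of "?s k" "?s k"] h by (simp add: mult_closed)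
  also have "... <= rh + rh * rh" using h Suc by (intro add_mono mult_mono) (auto simp: nrm_ge0 rh0)
  finally have "nrm A (h \<oplus> ?s k \<otimes> ?s k) <= rh + rh * rh" .
  moreover have "rh * rh <= rh * 1" using h rh0 by (intro mult_left_mono) auto
  ultimately show ?case using h by (simp add: nrm_smult mult_closed)
 qed (simp add: rh0)
 have com: "a \<otimes> ?s k = ?s k \<otimes> a" if "a : carrier A" "a \<otimes> h = h \<otimes> a" for a k
 proof (induction k)
  case (Suc k)
  have "a \<otimes> (?s k \<otimes> ?s k) = (?s k \<otimes> ?s k) \<otimes> a" using Suc that by (metis c mult_assoc)
  thus ?case using that h by (simp add: smult_mult_left smult_mult_right mult_distrib_left mult_distrib_right mult_closed)
 qed (use that in simp)
 \<comment> \<open>From \<open>a a - b b = a (a - b) + (a - b) b\<close>, with both factors bounded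
   by \<open>rh\<close>: the factor \<open>1/2\<close> absorbs the two terms and leaves the ratio
   \<open>rh < 1\<close>.\<close>
 have step: "nrm A (?s (Suc k) \<ominus> ?s k) <= rh ^ k" for k
 proof (induction k)
  case 0
  show ?case using h nrm_ge0[OF h(1)] by (simp add: nrm_smult)
 next
  case (Suc k)
  let ?a = "?s (Suc k)" and ?b = "?s k"
  have ab: "?a : carrier A" "?b : carrier A" by (rule c)+
  have "?s (Suc (Suc k)) \<ominus> ?s (Suc k) = (1/2) \<odot> ((h \<oplus> ?a \<otimes> ?a) \<ominus> (h \<oplus> ?b \<otimes> ?b))"
   using ab h by (subst smult_minus) (auto simp: mult_closed)
  also have "(h \<oplus> ?a \<otimes> ?a) \<ominus> (h \<oplus> ?b \<otimes> ?b) = ?a \<otimes> ?a \<ominus> ?b \<otimes> ?b"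
   using ab h by (subst add_minus) (auto simp: mult_closed simp del: root_iter.simps)
  also have "... = ?a \<otimes> (?a \<ominus> ?b) \<oplus> (?a \<ominus> ?b) \<otimes> ?b"
   using ab by (simp only: mult_minus) (rule minus_trans; simp add: mult_closed del: root_iter.simps)
  finally have eq: "nrm A (?s (Suc (Suc k)) \<ominus> ?s (Suc k))
    = 1/2 * nrm A (?a \<otimes> (?a \<ominus> ?b) \<oplus> (?a \<ominus> ?b) \<otimes> ?b)"
   using ab by (simp add: nrm_smult mult_closed del: root_iter.simps)
  have "nrm A (?a \<otimes> (?a \<ominus> ?b) \<oplus> (?a \<ominus> ?b) \<otimes> ?b)
    <= nrm A ?a * nrm A (?a \<ominus> ?b) + nrm A (?a \<ominus> ?b) * nrm A ?b"
   using ab by (intro order_trans[OF nrm_triangle] add_mono nrm_mult)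
    (auto simp: mult_closed simp del: root_iter.simps)
  also have "... <= rh * nrm A (?a \<ominus> ?b) + nrm A (?a \<ominus> ?b) * rh"
   using ab by (intro add_mono mult_right_mono mult_left_mono n nrm_ge0 minus_cl)
  also have "... = 2 * (rh * nrm A (?a \<ominus> ?b))" by simp
  finally have "nrm A (?s (Suc (Suc k)) \<ominus> ?s (Suc k)) <= rh * nrm A (?a \<ominus> ?b)" unfolding eq by linarith
  also have "... <= rh * rh ^ k" using Suc rh0 by (intro mult_left_mono)
  finally show ?case by simp
 qed
 have far: "nrm A (?s (m + d) \<ominus> ?s m) <= rh ^ m / (1 - rh)" for m d
 proof -
  have "nrm A (?s (m + d) \<ominus> ?s m) <= (\<Sum>i<d. rh ^ (m + i))"
  proof (induction d)
   case (Suc d)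
   show ?case using nrm_minus_trans[of "?s (m + Suc d)" "?s (m + d)" "?s m"] step[of "m + d"] Suc
    by (simp del: root_iter.simps)
  qed simp
  also have "... = rh ^ m * (\<Sum>i<d. rh ^ i)" by (simp add: power_add sum_distrib_left)
  also have "... <= rh ^ m * (1 / (1 - rh))"
  proof (rule mult_left_mono)
   have "(\<Sum>i<d. rh ^ i) <= (\<Sum>i. rh ^ i)"
    by (rule sum_le_suminf) (use rh0 h in \<open>auto intro: summable_geometric\<close>)
   thus "(\<Sum>i<d. rh ^ i) <= 1 / (1 - rh)" using rh0 h by (simp add: suminf_geometric)
  qed (use rh0 in simp)
  finally show ?thesis by simp
 qed
 have "EX x:carrier A. (%k. nrm A (?s k \<ominus> x)) ~~> 0"
 proof (rule Cauchy_limit[OF c])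
  fix ep :: real assume e: "ep > 0"
  have "(%m. rh ^ m / (1 - rh)) ~~> 0 / (1 - rh)"
   by (intro tendsto_divide LIMSEQ_power_zero tendsto_const) (use rh0 h in auto)
  hence "\<forall>\<^sub>F m in sequentially. rh ^ m / (1 - rh) < ep / 2" by (rule order_tendstoD) (use e in simp)
  then obtain N where N: "rh ^ N / (1 - rh) < ep / 2" by (auto simp: eventually_sequentially)
  have f: "nrm A (?s m \<ominus> ?s N) < ep / 2" if "m >= N" for m
   using order.strict_trans1[OF far[of N "m - N"] N] that by simp
  have "nrm A (?s m \<ominus> ?s n) < ep" if "m >= N" "n >= N" for m n
   using f[OF that(1)] f[OF that(2)] nrm_minus_trans[of "?s m" "?s N" "?s n"] nrm_commute[of "?s N" "?s n"] by simp
  thus "EX N. ALL m>=N. ALL n>=N. nrm A (?s m \<ominus> ?s n) < ep" by blast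
 qed
 then obtain s where s: "s : carrier A" and "(%k. nrm A (?s k \<ominus> s)) ~~> 0" by blast
 hence lim: "(%k. nrm A (s \<ominus> ?s k)) ~~> 0" by (simp only: nrm_commute[OF s c])
 have "star A s = s"
  by (rule limit_unique[OF c star_closed[OF s] s _ lim]) (use lim_star[OF lim s c] in \<open>simp add: st\<close>)
 moreover have "nrm A s <= rh"
 proof -
  have "nrm A s <= nrm A (s \<ominus> ?s k) + rh" for k using nrm_rev_triangle[of s "?s k"] n[of k] s by simp
  moreover have "(%k. nrm A (s \<ominus> ?s k) + rh) ~~> 0 + rh" by (intro tendsto_add lim tendsto_const)
  ultimately show ?thesis by (intro LIMSEQ_le_const[where a="nrm A s"]) auto
 qed
 moreover have "a \<otimes> s = s \<otimes> a" if a: "a : carrier A" "a \<otimes> h = h \<otimes> a" for a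
  using lim_mult[OF lim_const[OF a(1)] lim a(1) s a(1) c] lim_mult[OF lim lim_const[OF a(1)] s a(1) c a(1)]
   limit_unique[of "%k. a \<otimes> ?s k" "a \<otimes> s" "s \<otimes> a"] a s by (simp add: com mult_closed)
 moreover have half: "s = (1/2) \<odot> (h \<oplus> s \<otimes> s)"
 proof (rule limit_unique[OF c[of "Suc _"] s])
  show "(%k. nrm A (s \<ominus> ?s (Suc k))) ~~> 0" using lim by (rule LIMSEQ_Suc)
  show "(%k. nrm A ((1/2) \<odot> (h \<oplus> s \<otimes> s) \<ominus> ?s (Suc k))) ~~> 0" unfolding root_iter.simps
   by (intro lim_scale lim_add lim_mult tendsto_const lim lim_const h s c mult_closed M.add.m_closed)
 qed (use h s in \<open>auto simp: mult_closed\<close>)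
 moreover have "2 \<odot> s = h \<oplus> s \<otimes> s"
 proof -
  have "2 \<odot> ((1/2) \<odot> (h \<oplus> s \<otimes> s)) = h \<oplus> s \<otimes> s"
   using h s by (subst smult_smult) (simp_all add: mult_closed)
  thus ?thesis by (simp only: half[symmetric])
 qed
 ultimately show ?thesis using s by blast
qed

end

text \<open>In a unitization, \<open>T + \<i>(1 - W)\<close> would be unitary with real part \<open>T\<close>.\<close>

lemma (in cstar_algebra) nrm_le_1_of_root: assumes T: "T : carrier A" "star A T = T" and W: "W : carrier A" "star A W = W"
  and com: "T \<otimes> W = W \<otimes> T" and root: "2 \<odot> W = T \<otimes> T \<oplus> W \<otimes> W"
 shows "nrm A T <= 1"
proof -
 have key: "nrm A (T \<otimes> y) <= nrm A y" if y: "y : carrier A" for y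
 proof -
  \<comment> \<open>These are \<open>T y\<close> and \<open>(1 - W) y\<close>. Applying the formal
    unitary to an element \<open>y\<close> keeps the whole computation inside \<open>A\<close>; at
    the end \<open>y = T\<close>.\<close>
  define z1 z2 where "z1 = T \<otimes> y" and "z2 = y \<ominus> W \<otimes> y"
  have c [simp]: "z1 : carrier A" "z2 : carrier A" "star A y : carrier A" using T W y by (auto simp: z1_def z2_def cl)
  have s1: "star A z1 = star A y \<otimes> T" and s2: "star A z2 = star A y \<ominus> star A y \<otimes> W"
   using T W y by (auto simp: z1_def z2_def star_mult star_minus cl)
  let ?a = "star A y \<otimes> (T \<otimes> y)" and ?b = "star A y \<otimes> (T \<otimes> (W \<otimes> y))"
  have z12: "star A z1 \<otimes> z2 = ?a \<ominus> ?b"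
   unfolding s1 z2_def using T W y by (simp add: mult_minus mult_assoc cl)
  have "star A z2 \<otimes> z1 = ?a \<ominus> star A y \<otimes> (W \<otimes> (T \<otimes> y))"
   unfolding s2 z1_def using T W y by (simp add: mult_minus mult_assoc cl)
  also have "W \<otimes> (T \<otimes> y) = T \<otimes> (W \<otimes> y)" using com T W y by (simp flip: mult_assoc)
  finally have z21: "star A z2 \<otimes> z1 = star A z1 \<otimes> z2" by (simp add: z12)
  let ?TT = "star A y \<otimes> (T \<otimes> (T \<otimes> y))" and ?WW = "star A y \<otimes> (W \<otimes> (W \<otimes> y))"
   and ?w = "star A y \<otimes> (W \<otimes> y)" and ?y = "star A y \<otimes> y"
  have c2 [simp]: "?TT : carrier A" "?WW : carrier A" "?w : carrier A" "?y : carrier A" using T W y by (auto simp: cl)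
  have z11: "star A z1 \<otimes> z1 = ?TT" using T y by (subst s1) (simp add: z1_def mult_assoc cl)
  have z22: "star A z2 \<otimes> z2 = (?y \<ominus> ?w) \<ominus> (?w \<ominus> ?WW)"
   using W y by (subst s2, unfold z2_def) (simp add: mult_minus mult_assoc cl)
  have ww: "?TT \<oplus> ?WW = 2 \<odot> ?w"
  proof -
   have "?TT \<oplus> ?WW = star A y \<otimes> ((T \<otimes> T \<oplus> W \<otimes> W) \<otimes> y)"
    using T W y by (simp add: mult_distrib_left mult_distrib_right mult_assoc cl)
   also have "... = 2 \<odot> ?w" unfolding root[symmetric] using W y by (simp add: smult_mult_left smult_mult_right cl)
   finally show ?thesis .
  qed
  have aux2: "P \<oplus> ((Q \<oplus> r) \<oplus> (r \<oplus> t)) = Q \<oplus> ((P \<oplus> t) \<oplus> (r \<oplus> r))"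
   if "P : carrier A" "Q : carrier A" "r : carrier A" "t : carrier A" for P Q r t using that by (simp add: M.a_ac)
  have sum: "star A z1 \<otimes> z1 \<oplus> star A z2 \<otimes> z2 = ?y"
  proof -
   have "star A z1 \<otimes> z1 \<oplus> star A z2 \<otimes> z2 = ?y \<oplus> ((?TT \<oplus> ?WW) \<oplus> ((-1) \<odot> ?w \<oplus> (-1) \<odot> ?w))"
    unfolding z11 z22 using aux2[of ?TT ?y "(-1) \<odot> ?w" ?WW] by (simp add: minus_smult smult_right_distr)
   also have "(-1) \<odot> ?w \<oplus> (-1) \<odot> ?w = (-2) \<odot> ?w" using smult_left_distr[of ?w "-1" "-1"] by simp
   also have "(?TT \<oplus> ?WW) \<oplus> (-2) \<odot> ?w = \<zero>"
    unfolding ww using smult_left_distr[of ?w 2 "-2"] by simp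
   finally show ?thesis by simp
  qed
  \<comment> \<open>The root equation says that the squares of \<open>T\<close> and
    \<open>1 - W\<close> add up to 1, and the two commute, so \<open>T + c (1 - W)\<close> with
    \<open>c\<close> one of the two imaginary units leaves \<open>star A y \<otimes> y\<close>
    unchanged. \<open>T\<close> is the mean of these two formal unitaries.\<close>
  have unit: "nrm A (z1 \<oplus> c \<odot> z2) = nrm A y" if "c = \<i> | c = - \<i>" for c
  proof -
   have cc: "cnj c * c = 1" "cnj c + c = 0" using that by auto
   let ?p = "star A z1 \<otimes> z2"
   have pc: "?p : carrier A" by (simp add: cl)
   have cc': "c * cnj c = 1" using cc by (simp add: mult.commute)
   have aux: "(P \<oplus> q) \<oplus> (r \<oplus> Q) = (P \<oplus> Q) \<oplus> (q \<oplus> r)"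
    if "P : carrier A" "Q : carrier A" "q : carrier A" "r : carrier A" for P Q q r using that by (simp add: M.a_ac)
   have "star A (z1 \<oplus> c \<odot> z2) \<otimes> (z1 \<oplus> c \<odot> z2)
     = (star A z1 \<otimes> z1 \<oplus> cnj c \<odot> (star A z2 \<otimes> z1)) \<oplus>
      (c \<odot> (star A z1 \<otimes> z2) \<oplus> (c * cnj c) \<odot> (star A z2 \<otimes> z2))"
    by (simp add: star_add star_smult mult_distrib_left mult_distrib_right smult_mult_left
      smult_mult_right cl smult_right_distr)
   also have "... = (star A z1 \<otimes> z1 \<oplus> star A z2 \<otimes> z2) \<oplus> (cnj c \<odot> ?p \<oplus> c \<odot> ?p)"
    unfolding z21 cc' using aux pc by (simp add: cl)
   also have "cnj c \<odot> ?p \<oplus> c \<odot> ?p = \<zero>" using smult_left_distr[OF pc, of "cnj c" c] cc pc by simp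
   finally have "star A (z1 \<oplus> c \<odot> z2) \<otimes> (z1 \<oplus> c \<odot> z2) = star A y \<otimes> y"
    by (simp add: sum)
   hence "(nrm A (z1 \<oplus> c \<odot> z2))^2 = (nrm A y)^2"
    using nrm_cstar[of "z1 \<oplus> c \<odot> z2"] nrm_cstar[OF y] by simp
   thus ?thesis by (simp add: nrm_ge0 y)
  qed
  have "(z1 \<oplus> \<i> \<odot> z2) \<oplus> (z1 \<oplus> (- \<i>) \<odot> z2) = (z1 \<oplus> z1) \<oplus> (\<i> \<odot> z2 \<oplus> (- \<i>) \<odot> z2)"
   by (simp add: M.a_ac)
  also have "\<i> \<odot> z2 \<oplus> (- \<i>) \<odot> z2 = \<zero>" using smult_left_distr[of z2 \<i> "- \<i>"] by simp
  also have "z1 \<oplus> z1 = 2 \<odot> z1" using smult_left_distr[of z1 1 1] by simp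
  finally have "nrm A (2 \<odot> z1) <= nrm A y + nrm A y"
   using nrm_triangle[of "z1 \<oplus> \<i> \<odot> z2" "z1 \<oplus> (- \<i>) \<odot> z2"] unit by simp
  thus ?thesis using T y by (simp add: nrm_smult z1_def mult_closed)
 qed
 have "nrm A T * nrm A T <= nrm A T" using key[OF T(1)] nrm_cstar[OF T(1)] T by (simp add: power2_eq_square)
 thus ?thesis using nrm_ge0[OF T(1)] by (cases "nrm A T = 0") (auto simp: mult_le_cancel_right2)
qed

section \<open>Contractivity of homomorphisms\<close>

lemma star_homD: assumes "star_hom A B ph" shows "x : carrier A ==> ph x : carrier B"
  "[|x : carrier A; y : carrier A|] ==> ph (x \<oplus>\<^bsub>A\<^esub> y) = ph x \<oplus>\<^bsub>B\<^esub> ph y"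
  "x : carrier A ==> ph (c \<odot>\<^bsub>A\<^esub> x) = c \<odot>\<^bsub>B\<^esub> ph x"
  "[|x : carrier A; y : carrier A|] ==> ph (x \<otimes>\<^bsub>A\<^esub> y) = ph x \<otimes>\<^bsub>B\<^esub> ph y"
  "x : carrier A ==> ph (star A x) = star B (ph x)" using assms by (auto simp: star_hom_def)

text \<open>For selfadjoint \<open>a\<close> of norm below 1, the equation that defines
  \<open>1 - sqrt (1 - a a)\<close> has a solution in \<open>A\<close>. Homomorphisms preserve the
  equation, and by \<open>nrm_le_1_of_root\<close> its solvability bounds the norm of the image by
  1. Scaling and the C*-identity give the rest.\<close>

lemma star_hom_contractive:
 fixes A (structure) assumes A: "cstar_algebra A" and B: "cstar_algebra B" and hom: "star_hom A B ph" and x: "x : carrier A"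
 shows "nrm B (ph x) <= nrm A x"
proof -
 interpret A: cstar_algebra A by fact
 interpret B: cstar_algebra B by fact
 note h = star_homD[OF hom]
 have small: "nrm B (ph a) <= 1" if a: "a : carrier A" "star A a = a" "nrm A a < 1" for a
 proof -
  let ?h = "a \<otimes> a"
  have hh: "?h : carrier A" "star A ?h = ?h" using a by (auto simp: A.cl A.star_mult)
  have "nrm A ?h = (nrm A a)^2" using A.nrm_cstar[OF a(1)] a by simp
  also have "... < 1" using a A.nrm_ge0[OF a(1)] by (simp add: power_less_one_iff)
  finally obtain s where s: "s : carrier A" "star A s = s" "2 \<odot> s = ?h \<oplus> s \<otimes> s"
   and com: "ALL b:carrier A. b \<otimes> ?h = ?h \<otimes> b --> b \<otimes> s = s \<otimes> b"
   using A.root_exists[OF hh order_refl] by blast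
  have as: "a \<otimes> s = s \<otimes> a" using com a by (simp add: A.mult_assoc)
  show ?thesis
  proof (rule B.nrm_le_1_of_root[of "ph a" "ph s"])
   show "star B (ph a) = ph a" "star B (ph s) = ph s" using h(5)[OF a(1)] h(5)[OF s(1)] a s by simp_all
   show "ph a \<otimes>\<^bsub>B\<^esub> ph s = ph s \<otimes>\<^bsub>B\<^esub> ph a" using as h(4)[OF a(1) s(1)] h(4)[OF s(1) a(1)] by simp
   have "2 \<odot>\<^bsub>B\<^esub> ph s = ph (2 \<odot> s)" using s(1) h(3) by simp
   also have "... = ph (?h \<oplus> s \<otimes> s)" by (simp only: s(3))
   also have "... = ph a \<otimes>\<^bsub>B\<^esub> ph a \<oplus>\<^bsub>B\<^esub> ph s \<otimes>\<^bsub>B\<^esub> ph s"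
    using a(1) s(1) by (simp add: h A.mult_closed)
   finally show "2 \<odot>\<^bsub>B\<^esub> ph s = ph a \<otimes>\<^bsub>B\<^esub> ph a \<oplus>\<^bsub>B\<^esub> ph s \<otimes>\<^bsub>B\<^esub> ph s" .
  qed (use h(1)[OF a(1)] h(1)[OF s(1)] in auto)
 qed
 have sa: "nrm B (ph a) <= nrm A a" if a: "a : carrier A" "star A a = a" for a
 proof (rule dense_ge)
  fix r assume r: "nrm A a < r"
  hence r0: "0 < r" using A.nrm_ge0[OF a(1)] by simp
  let ?a = "cre (1 / r) \<odot> a"
  have "nrm B (ph ?a) <= 1"
  proof (rule small)
   show "nrm A ?a < 1" using r r0 a by (simp add: A.nrm_smult norm_divide)
   show "?a : carrier A" by (rule A.smult_cl[OF a(1)])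
   show "star A ?a = ?a" unfolding A.star_smult[OF a(1)] a(2) by simp
  qed
  thus "nrm B (ph a) <= r" unfolding h(3)[OF a(1)] B.nrm_smult[OF h(1)[OF a(1)]] using r0 by (simp add: norm_divide)
 qed
 have "(nrm B (ph x))^2 = nrm B (ph (star A x \<otimes> x))"
  unfolding h(4)[OF A.star_closed[OF x] x] h(5)[OF x] B.nrm_cstar[OF h(1)[OF x]] ..
 also have "... <= nrm A (star A x \<otimes> x)"
  by (rule sa) (use x in \<open>auto simp: A.cl A.star_mult A.star_star\<close>)
 also have "... = (nrm A x)^2" using x by (simp add: A.nrm_cstar)
 finally show ?thesis by (rule power2_le_imp_le[OF _ A.nrm_ge0[OF x]])
qed

section \<open>Operator algebras on prescribed types\<close>

definition star_sub :: "op set => bool"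
 where "star_sub D \<longleftrightarrow> 0 : D & (ALL x:D. ALL y:D. x + y : D) & (ALL c. ALL x:D. opsc c x : D) &
  (ALL x:D. ALL y:D. x * y : D) & (ALL x:D. adj x : D)"

lemma star_subD: assumes "star_sub D" shows "0 : D" "x : D ==> y : D ==> x + y : D" "x : D ==> opsc c x : D"
  "x : D ==> y : D ==> x * y : D" "x : D ==> adj x : D" "x : D ==> - x : D"
  "x : D ==> y : D ==> x - y : D" "x : D ==> r *\<^sub>R x : D"
proof -
 show a: "0 : D" "x : D ==> y : D ==> x + y : D" "x : D ==> opsc c x : D"
  "x : D ==> y : D ==> x * y : D" "x : D ==> adj x : D" for x y c using assms unfolding star_sub_def by blast+
 have m1: "opsc (- 1) x = - x" "opsc (of_real r) x = r *\<^sub>R x" for x by (simp_all only: opsc_simps)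
 show m: "x : D ==> - x : D" for x using a(3)[of x "- 1"] unfolding m1 .
 show "x : D ==> y : D ==> x - y : D" using a(2)[OF _ m, of x y] by (simp only: add_uminus_conv_diff)
 show "x : D ==> r *\<^sub>R x : D" using a(3)[of x "of_real r"] unfolding m1 .
qed

text \<open>The universal properties and the existence of an AF-algebra range over C*-algebras on prescribed types, so
 algebras of operators have to be transported along an injection \<open>e\<close>.\<close>

definition opalg :: "(op => 'd) => op set => 'd cstar" where "opalg e D = \<lparr>
  carrier = e ` D, mult = (%x y. e (inv_into UNIV e x * inv_into UNIV e y)), one = e 1,
  zero = e 0, add = (%x y. e (inv_into UNIV e x + inv_into UNIV e y)), smult = (%c x. e (opsc c (inv_into UNIV e x))),
  star = (%x. e (adj (inv_into UNIV e x))), nrm = (%x. norm (inv_into UNIV e x))\<rparr>"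

context
 fixes e :: "op => 'd" and D :: "op set" assumes e: "inj e" and D: "star_sub D"
begin

lemma opalg_sel [simp]:
 "carrier (opalg e D) = e ` D" "\<zero>\<^bsub>opalg e D\<^esub> = e 0" "\<one>\<^bsub>opalg e D\<^esub> = e 1"
 "e S \<otimes>\<^bsub>opalg e D\<^esub> e T = e (S * T)" "e S \<oplus>\<^bsub>opalg e D\<^esub> e T = e (S + T)"
 "c \<odot>\<^bsub>opalg e D\<^esub> e S = e (opsc c S)" "star (opalg e D) (e S) = e (adj S)"
 "nrm (opalg e D) (e S) = norm S" by (simp_all add: opalg_def inv_f_f[OF e])

lemma opalg_star_algebra: "star_algebra (opalg e D)"
proof -
 have ag: "abelian_group (opalg e D)"
 proof (rule abelian_groupI)
  fix x assume "x : carrier (opalg e D)"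
  then obtain S where "S : D" "x = e S" by auto
  thus "EX y:carrier (opalg e D). y \<oplus>\<^bsub>opalg e D\<^esub> x = \<zero>\<^bsub>opalg e D\<^esub>"
   by (intro bexI[of _ "e (- S)"]) (auto simp: star_subD(6)[OF D])
 qed (auto simp: star_subD[OF D] add_ac)
 have "Module.module complex_ring (opalg e D)" by (rule moduleI) (auto simp: ag cring_complex opsc_simps star_subD[OF D])
 moreover have "star_algebra_axioms (opalg e D)" by unfold_locales (auto simp: star_subD[OF D] algebra_simps opsc_simps)
 ultimately show ?thesis by (rule star_algebra.intro)
qed

lemma opalg_minus [simp]: "S : D ==> T : D ==> e S \<ominus>\<^bsub>opalg e D\<^esub> e T = e (S - T)"
proof -
 interpret star_algebra "opalg e D" by (rule opalg_star_algebra)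
 show "S : D ==> T : D ==> ?thesis" by (simp add: minus_smult opsc_simps)
qed

lemma opalg_cstar: assumes "closed D" shows "cstar_algebra (opalg e D)"
proof -
 interpret star_algebra "opalg e D" by (rule opalg_star_algebra)
 have sn: "cstar_seminorm (opalg e D) (nrm (opalg e D))"
  unfolding cstar_seminorm_def by (auto simp: norm_opscale norm_triangle_ineq norm_mult_ineq op_cstar)
 have dist: "cs_dist (opalg e D) (e S) (e T) = dist S T" if "S : D" "T : D" for S T
  using that by (simp add: cs_dist_def dist_norm)
 have e0: "e S = e T \<longleftrightarrow> S = T" for S T using e by (auto simp: inj_def)
 have M: "Metric_space (e ` D) (cs_dist (opalg e D))"
 proof
  fix x y z
  have out: "cs_dist (opalg e D) x y = 0" if "~ (x : e ` D & y : e ` D)" for x y using that by (auto simp: cs_dist_def)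
  show "0 <= cs_dist (opalg e D) x y" by (cases "x : e ` D & y : e ` D") (auto simp: dist out)
  show "cs_dist (opalg e D) x y = cs_dist (opalg e D) y x"
   by (cases "x : e ` D & y : e ` D") (auto simp: dist dist_commute out)
  assume "x : e ` D" "y : e ` D"
  thus "(cs_dist (opalg e D) x y = 0) = (x = y)" by (auto simp: dist e0)
  assume "z : e ` D"
  thus "cs_dist (opalg e D) x z <= cs_dist (opalg e D) x y + cs_dist (opalg e D) y z"
   using \<open>x : e ` D\<close> \<open>y : e ` D\<close> by (auto simp: dist dist_triangle)
 qed
 interpret Ms: Metric_space "e ` D" "cs_dist (opalg e D)" by (rule M)
 have "Ms.mcomplete" unfolding Ms.mcomplete_def
 proof (intro allI impI)
  fix si assume c: "Ms.MCauchy si"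
  hence "ALL n. EX S:D. si n = e S" unfolding Ms.MCauchy_def by blast
  then obtain S where S: "!!n. S n : D" "!!n. si n = e (S n)" by metis
  have "Cauchy S" unfolding Cauchy_def
  proof (intro allI impI)
   fix r :: real assume "r > 0"
   then obtain N where "ALL n n'. N <= n --> N <= n' --> cs_dist (opalg e D) (si n) (si n') < r"
    using c unfolding Ms.MCauchy_def by blast
   thus "EX M. ALL m>=M. ALL n>=M. dist (S m) (S n) < r" by (auto simp: S dist)
  qed
  then obtain L where L: "S ~~> L" using Cauchy_convergent convergent_def by blast
  have LD: "L : D" using closed_sequentially[OF assms S(1) L] .
  have "(%n. dist (S n) L) ~~> 0" by (rule iffD1[OF tendsto_dist_iff L])
  hence "limitin Ms.mtopology si (e L) sequentially" unfolding Ms.limitin_metric_dist_null using LD by (simp add: S dist)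
  thus "EX x. limitin Ms.mtopology si x sequentially" by blast
 qed
 hence mc: "Metric_space.mcomplete (carrier (opalg e D)) (cs_dist (opalg e D))" by simp
 have nz: "x = \<zero>\<^bsub>opalg e D\<^esub>" if x: "x : carrier (opalg e D)" "nrm (opalg e D) x = 0" for x
 proof -
  obtain S where S: "x = e S" using x(1) by auto
  hence "S = 0" using x(2) by simp
  thus ?thesis using S by simp
 qed
 show ?thesis by (rule cstar_algebra.intro[OF opalg_star_algebra cstar_algebra_axioms.intro[OF sn nz mc]])
qed

lemma opalg_closed_sub: assumes "closed D" "closed H" "H \<subseteq> D" "star_sub H"
 shows "cstar_subalgebra (e ` H) (opalg e D)"
proof -
 interpret cstar_algebra "opalg e D" by (rule opalg_cstar) fact
 have "submodule (e ` H) complex_ring (opalg e D)"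
 proof (rule submoduleI)
  show "\<ominus>\<^bsub>opalg e D\<^esub> a : e ` H" if a: "a : e ` H" for a
  proof -
   obtain S where S: "S : H" "a = e S" using a by auto
   have "\<ominus>\<^bsub>opalg e D\<^esub> a = (-1) \<odot>\<^bsub>opalg e D\<^esub> a"
    by (rule smult_m1[symmetric]) (use S assms(3) in \<open>simp add: subset_iff\<close>)
   also have "... = e (- S)" unfolding S(2) opalg_sel opsc_simps ..
   finally have "\<ominus>\<^bsub>opalg e D\<^esub> a = e (- S)" .
   thus ?thesis using S star_subD(6)[OF assms(4)] by auto
  qed
 qed (use assms(3) in \<open>auto simp: star_subD[OF assms(4)]\<close>)
 moreover have "closedin (cs_topology (opalg e D)) (e ` H)" unfolding closedin_iff
 proof (intro conjI ballI impI)
  fix x assume x: "x : carrier (opalg e D)" and l: "ALL ep>0. EX y:e ` H. nrm (opalg e D) (x \<ominus>\<^bsub>opalg e D\<^esub> y) < ep"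
  then obtain S where S: "S : D" "x = e S" by auto
  have "EX T:H. dist T S < ep" if "ep > 0" for ep
   using l that S assms(3) by (fastforce simp: dist_norm norm_minus_commute subset_iff)
  hence "S : closure H" by (simp add: closure_approachable)
  thus "x : e ` H" using assms(2) S by simp
 qed (use assms in auto)
 moreover have "ALL x:e ` H. ALL y:e ` H. x \<otimes>\<^bsub>opalg e D\<^esub> y : e ` H"
  using star_subD(4)[OF assms(4)] by simp
 moreover have "ALL x:e ` H. star (opalg e D) x : e ` H" using star_subD(5)[OF assms(4)] by simp
 ultimately show ?thesis unfolding cstar_subalgebra_def by (intro conjI)
qed

end

lemma star_sub_UNIV [simp]: "star_sub UNIV" by (simp add: star_sub_def)

lemma opalg_ring: "inj e ==> Ring.ring (opalg e UNIV)"
proof -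
 assume e: "inj e"
 note sel = opalg_sel[OF e star_sub_UNIV]
 have sa: "star_algebra (opalg e UNIV)" by (rule opalg_star_algebra[OF e]) simp
 show ?thesis
 proof (rule ringI)
  show "abelian_group (opalg e UNIV)" by (rule module.axioms(2)[OF star_algebra.axioms(1)[OF sa]])
  show "Group.monoid (opalg e UNIV)" by (rule monoidI) ((unfold sel(1))?; (elim rangeE)?; simp add: sel mult.assoc)+
 qed (unfold sel(1); elim rangeE; simp add: sel distrib_left distrib_right)+
qed

abbreviation (input) psm :: "complex => complex poly => complex poly" where "psm == Polynomial.smult"

section \<open>Polynomials in a selfadjoint element\<close>

abbreviation pcnj :: "complex poly => complex poly" where "pcnj \<equiv> map_poly cnj"

lemma pcnj_simps [simp]:
 "pcnj 0 = 0" "pcnj 1 = 1" "pcnj (p + q) = pcnj p + pcnj q" "pcnj (p * q) = pcnj p * pcnj q"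
 "pcnj (psm c p) = psm (cnj c) (pcnj p)" "pcnj (pcnj p) = p"
 "pcnj (p - q) = pcnj p - pcnj q" "pcnj (- p) = - pcnj p"
proof -
 show "pcnj (p * q) = pcnj p * pcnj q" by (rule poly_eqI) (simp add: coeff_map_poly coeff_mult)
qed (rule poly_eqI; simp add: coeff_map_poly one_pCons coeff_pCons split: nat.splits)+

lemma pcnj_pCons [simp]: "pcnj (pCons a p) = pCons (cnj a) (pcnj p)"
 by (rule poly_eqI) (simp add: coeff_map_poly coeff_pCons split: nat.splits)

lemma pcnj_power [simp]: "pcnj (p ^ n) = pcnj p ^ n" by (induction n) auto

text \<open>C*-seminorms on the polynomials in one selfadjoint variable. The aim is
  \<open>N_le_sup\<close>: such a seminorm is bounded by the supremum over any symmetric interval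
  whose radius exceeds the seminorm of the variable. This is the part of the spectral theorem that
  the proof relies on.\<close>

locale poly_seminorm =
 fixes N :: "complex poly => real" assumes N_ge0: "0 <= N p" and N_add: "N (p + q) <= N p + N q"
  and N_smult: "N (psm c p) = cmod c * N p" and N_mult: "N (p * q) <= N p * N q" and N_cstar: "N (pcnj p * p) = (N p)^2"
begin

lemma N_0 [simp]: "N 0 = 0" using N_smult[of 0 0] by simp

lemma N_minus [simp]: "N (- p) = N p" using N_smult[of "-1" p] by simp

lemma N_diff: "N (p - q) <= N p + N q" using N_add[of p "- q"] by simp

lemma N_1: "N 1 <= 1"
proof -
 have "N 1 = (N 1)^2" using N_cstar[of 1] by simp
 thus ?thesis by (metis N_ge0 linear mult_cancel_left2 order_refl power2_eq_square zero_le_one)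
qed

lemma N_sum: "N (\<Sum>k\<in>K. f k) <= (\<Sum>k\<in>K. N (f k))"
proof (induction K rule: infinite_finite_induct)
 case (insert k K)
 thus ?case using N_add[of "f k" "sum f K"] by simp
qed auto

lemma N_power: "N (p ^ n) <= N p ^ n"
proof (induction n)
 case (Suc n)
 have "N (p * p ^ n) <= N p * N (p ^ n)" by (rule N_mult)
 also have "... <= N p * N p ^ n" by (intro mult_left_mono Suc N_ge0)
 finally show ?case by simp
qed (simp add: N_1)

lemma N_power_two: assumes "pcnj p = p" shows "N (p ^ (2 ^ j)) = N p ^ (2 ^ j)"
proof (induction j)
 case (Suc j)
 have "N (p ^ (2 ^ Suc j)) = N (pcnj (p ^ (2 ^ j)) * p ^ (2 ^ j))" by (simp add: assms power_add[symmetric] mult_2)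
 also have "... = (N p ^ (2 ^ j))^2" by (simp only: N_cstar Suc)
 finally show ?case by (simp add: power_mult[symmetric] mult.commute)
qed simp

end

abbreviation px :: "complex poly" where "px \<equiv> [:0, 1:]"

text \<open>The Chebyshev polynomials of the first kind. They suit both sides of the estimate: on
  \<open>[-1, 1]\<close> they are cosines, so coefficients are Fourier coefficients, and in a
  selfadjoint contraction they are half the sum of the \<open>m\<close>-th powers of two mutually
  inverse unitaries.\<close>

fun cheb :: "nat => complex poly" where
 "cheb 0 = 1"
| "cheb (Suc 0) = px"
| "cheb (Suc (Suc m)) = psm 2 (px * cheb (Suc m)) - cheb m"

lemma poly_cheb: "poly (cheb m) (of_real (cos th)) = of_real (cos (real m * th))"
proof (induction m rule: cheb.induct)
 case (3 m)
 have "cos (real (Suc (Suc m)) * th) + cos (real m * th) = 2 * (cos th * cos (real (Suc m) * th))"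
  using cos_plus_cos[of "real (Suc (Suc m)) * th" "real m * th"] by (simp add: algebra_simps add_divide_distrib mult.commute)
 hence "cos (real (Suc (Suc m)) * th) = 2 * (cos th * cos (real (Suc m) * th)) - cos (real m * th)" by linarith
 thus ?case using 3 by (simp only: cheb.simps) simp
qed auto

definition cheb_span :: "nat => complex poly set" where "cheb_span D = {p. EX b. p = (\<Sum>k\<le>D. psm (b k) (cheb k))}"

lemma cheb_span_add: "p : cheb_span D ==> q : cheb_span D ==> p + q : cheb_span D" unfolding cheb_span_def
 by clarsimp (metis (no_types, lifting) smult_add_left sum.cong sum.distrib)

lemma cheb_span_smult: "p : cheb_span D ==> psm c p : cheb_span D" unfolding cheb_span_def
proof clarify
 fix b
 show "EX ba. psm c (\<Sum>k\<le>D. psm (b k) (cheb k)) = (\<Sum>k\<le>D. psm (ba k) (cheb k))"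
  by (rule exI[of _ "%k. c * b k"], induction D) (simp_all add: smult_add_right)
qed

lemma cheb_span_sum: "(!!k. k : K ==> f k : cheb_span D) ==> sum f K : cheb_span D"
proof (induction K rule: infinite_finite_induct)
 case (insert k K)
 thus ?case by (simp add: cheb_span_add)
qed (auto simp: cheb_span_def intro: exI[of _ "%_. 0"])

lemma cheb_in_span: "k <= D ==> cheb k : cheb_span D" unfolding cheb_span_def
proof clarify
 assume "k <= D"
 thus "EX b. cheb k = (\<Sum>k\<le>D. psm (b k) (cheb k))" by (intro exI[of _ "%i. if i = k then 1 else 0"])
   (simp add: if_distrib[of "%c. psm c _"] cong: if_cong)
qed

lemma px_cheb_in_span: "k <= D ==> px * cheb k : cheb_span (Suc D)"
proof (cases k)
 case 0
 thus ?thesis using cheb_in_span[of 1 "Suc D"] by simp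
next
 case (Suc j)
 assume "k <= D"
 have "px * cheb k = psm (1/2) (cheb (Suc k) + cheb j)" by (simp add: Suc del: mult_pCons_left)
 thus ?thesis using \<open>k <= D\<close> Suc by (simp only:) (intro cheb_span_smult cheb_span_add cheb_in_span; simp)
qed

lemma poly_in_cheb_span: "Polynomial.degree p <= D ==> p : cheb_span D"
proof (induction D arbitrary: p)
 case 0
 then obtain a where "p = [:a:]" by (metis degree_0_id le_zero_eq)
 hence "p = psm a (cheb 0)" by simp
 thus ?case using cheb_span_smult[OF cheb_in_span[of 0 0]] by simp
next
 case (Suc D)
 obtain a q where p: "p = pCons a q" by (cases p)
 have "Polynomial.degree q <= D" using Suc.prems by (cases "q = 0") (auto simp: p)
 then obtain b where q: "q = (\<Sum>k\<le>D. psm (b k) (cheb k))" using Suc.IH[of q] by (auto simp: cheb_span_def)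
 have "p = psm a (cheb 0) + px * q" by (simp add: p)
 also have "px * q = (\<Sum>k\<le>D. psm (b k) (px * cheb k))" unfolding q sum_distrib_left by (simp only: mult_smult_right)
 finally show ?case by (simp only:) (intro cheb_span_add cheb_span_sum cheb_span_smult cheb_in_span px_cheb_in_span; simp)
qed

lemma has_integral_cos_multiple: "((%th. cos (real_of_int m * th)) has_integral (if m = 0 then 2 * pi else 0)) {0..2 * pi}"
proof (cases "m = 0")
 case False
 have "((%th. cos (real_of_int m * th)) has_integral
   (sin (real_of_int m * (2 * pi)) / real_of_int m - sin (real_of_int m * 0) / real_of_int m)) {0..2 * pi}"
  by (rule fundamental_theorem_of_calculus)
   (use False in \<open>auto simp flip: has_real_derivative_iff_has_vector_derivative intro!: derivative_eq_intros\<close>)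
 moreover have "sin (real_of_int m * (2 * pi)) = 0" using sin_int_2pin[of m] by (simp add: mult_ac)
 ultimately show ?thesis using False by simp
qed (use has_integral_const_real[of "1 :: real" 0 "2 * pi"] in simp)

lemma has_integral_cos_cos: "((%th. cos (real k * th) * cos (real l * th)) has_integral
  (if k = l then (if l = 0 then 2 * pi else pi) else 0)) {0..2 * pi}"
proof -
 have eq: "cos (real k * th) * cos (real l * th) =
  (cos (real_of_int (int k - int l) * th) + cos (real_of_int (int k + int l) * th)) / 2" for th
  by (simp add: cos_times_cos left_diff_distrib distrib_right)
 have "((%th. (cos (real_of_int (int k - int l) * th) + cos (real_of_int (int k + int l) * th)) / 2) has_integral
  ((if int k - int l = 0 then 2 * pi else 0) + (if int k + int l = 0 then 2 * pi else 0)) / 2) {0..2 * pi}"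
  by (intro has_integral_divide has_integral_add has_integral_cos_multiple)
 moreover have "((if int k - int l = 0 then 2 * pi else 0) + (if int k + int l = 0 then 2 * pi else 0)) / 2
  = (if k = l then (if l = 0 then 2 * pi else pi) else 0)" by auto
 ultimately show ?thesis unfolding eq by simp
qed

text \<open>Substituting \<open>t = cos th\<close> turns the expansion into a cosine series, whose
  coefficients are integrals against \<open>cos (l * th)\<close>. The factor 2 arises because the
  norming integral \<open>J l\<close> is at least \<open>pi\<close> on an interval of length
  \<open>2 * pi\<close>.\<close>

lemma cheb_coeff_bound:
 assumes b: "!!t. -1 <= t ==> t <= 1 ==> cmod (poly (\<Sum>k\<le>D. psm (b k) (cheb k)) (of_real t)) <= B" and l: "l <= D"
 shows "cmod (b l) <= 2 * B"
proof -
 define f where "f th = poly (\<Sum>k\<le>D. psm (b k) (cheb k)) (of_real (cos th)) * of_real (cos (real l * th))" for th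
 define J where "J k = (if k = l then (if l = 0 then 2 * pi else pi) else 0)" for k
 have B0: "0 <= B" using order_trans[OF norm_ge_zero b[of 0]] by simp
 have "f th = (\<Sum>k\<le>D. b k * of_real (cos (real k * th) * cos (real l * th)))" for th
  by (simp add: f_def poly_sum poly_cheb sum_distrib_right mult.assoc)
 moreover have "((%th. \<Sum>k\<le>D. b k * of_real (cos (real k * th) * cos (real l * th))) has_integral
  (\<Sum>k\<le>D. b k * of_real (J k))) {0..2 * pi}"
  unfolding J_def by (intro has_integral_sum has_integral_mult_right has_integral_of_real has_integral_cos_cos) auto
 ultimately have int: "(f has_integral (\<Sum>k\<le>D. b k * of_real (J k))) {0..2 * pi}" by presburger
 have "(\<Sum>k\<le>D. b k * of_real (J k)) = (\<Sum>k\<le>D. if k = l then b l * of_real (J l) else 0)"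
  by (rule sum.cong) (auto simp: J_def)
 hence val: "(\<Sum>k\<le>D. b k * of_real (J k)) = b l * of_real (J l)" using l by simp
 have "cmod (f th) <= B" for th
 proof -
  have "cmod (f th) <= B * 1" unfolding f_def norm_mult by (intro mult_mono b) (auto simp: B0 cos_le_one abs_cos_le_one)
  thus ?thesis by simp
 qed
 hence "cmod (b l * of_real (J l)) <= B * (2 * pi)"
  using has_integral_bound[OF B0, of f "b l * of_real (J l)" 0 "2 * pi"] int val by simp
 moreover have "0 <= J l" by (simp add: J_def)
 ultimately have "cmod (b l) * J l <= B * (2 * pi)" by (simp add: norm_mult)
 moreover have "pi <= J l" by (simp add: J_def)
 ultimately have "cmod (b l) * pi <= B * (2 * pi)" by (meson mult_left_mono norm_ge_zero order_trans)
 hence "cmod (b l) * pi <= (2 * B) * pi" by (simp add: mult_ac)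
 thus ?thesis by (rule mult_right_le_imp_le) simp
qed

text \<open>Polynomial version of \<open>root_iter\<close>: a limit \<open>y\<close> would solve
  \<open>2 y = x^2 + y^2\<close>, so that \<open>1 - y\<close> plays the role of the square root of
  \<open>1 - x^2\<close>.\<close>

primrec root_poly :: "nat => complex poly" where
 "root_poly 0 = 0"
| "root_poly (Suc k) = psm (1/2) (px ^ 2 + root_poly k ^ 2)"

lemma pcnj_root_poly [simp]: "pcnj (root_poly k) = root_poly k" by (induction k) simp_all

context poly_seminorm
begin

context assumes N_x: "N px < 1"
begin

lemma N_root_poly: "N (root_poly k) <= N px"
proof (induction k)
 case (Suc k)
 have "N (px ^ 2 + root_poly k ^ 2) <= N px ^ 2 + N (root_poly k) ^ 2" by (intro order_trans[OF N_add] add_mono N_power)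
 also have "... <= N px ^ 2 + N px ^ 2" by (intro add_mono power_mono Suc N_ge0 order_refl)
 also have "... <= 2 * N px" using mult_right_mono[OF less_imp_le[OF N_x] N_ge0[of px]] by (simp add: power2_eq_square)
 finally show ?case by (simp only: root_poly.simps N_smult) simp
qed (simp add: N_ge0)

lemma N_root_poly_step: "N (root_poly (Suc k) - root_poly k) <= N px ^ k"
proof (induction k)
 case 0
 have "N (px ^ 2) <= 1" using N_power[of px 2] N_x N_ge0[of px] by (smt (verit) power_le_one)
 thus ?case by (simp only: root_poly.simps) (simp add: N_smult del: mult_pCons_left)
next
 case (Suc k)
 let ?a = "root_poly (Suc k)" and ?b = "root_poly k"
 have "root_poly (Suc (Suc k)) - ?a = psm (1/2) ((?a + ?b) * (?a - ?b))" by (subst (1 2) root_poly.simps(2))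
   (simp only: smult_diff_right[symmetric] add_diff_add diff_self add_0 power2_eq_square, simp add: algebra_simps)
 hence "N (root_poly (Suc (Suc k)) - ?a) = 1/2 * N ((?a + ?b) * (?a - ?b))" by (simp only: N_smult) simp
 also have "... <= 1/2 * ((N px + N px) * N px ^ k)"
  by (intro mult_left_mono order_trans[OF N_mult] mult_mono order_trans[OF N_add] add_mono N_root_poly Suc
    N_ge0 add_nonneg_nonneg) auto
 finally show ?case by simp
qed

lemma N_cheb: "N (cheb m) <= 1"
proof -
 define e where "e k = 2 * N (root_poly (Suc k) - root_poly k)" for k
 \<comment> \<open>Approximations to \<open>x\<close> plus or minus
   \<open>\<i> sqrt (1 - x^2)\<close>, adjoint to each other with product \<open>1 + err k\<close>.
   The exact elements are not polynomials, so the identity for \<open>cheb m\<close> holds only up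
   to the error \<open>de m k\<close>.\<close>
 define u v where "u k = px + psm \<i> (1 - root_poly k)" and "v k = px - psm \<i> (1 - root_poly k)" for k
 define err where "err k = psm 2 (root_poly (Suc k) - root_poly k)" for k
 define de where "de m k = u k ^ m + v k ^ m - psm 2 (cheb m)" for m k
 have e: "e ~~> 0"
 proof (rule Lim_null)
  show "ALL k. norm (e k) <= 2 * N px ^ k" using N_root_poly_step N_ge0 by (simp add: e_def)
  show "(%k. 2 * N px ^ k) ~~> 0" by (intro tendsto_mult_right_zero LIMSEQ_power_zero) (use N_x N_ge0[of px] in simp)
 qed
 have e0: "0 <= e k" for k by (simp add: e_def N_ge0)
 have Nerr: "N (err k) = e k" for k by (simp add: err_def e_def N_smult)
 have uv: "u k * v k = 1 + err k" for k
 proof -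
  have "u k * v k = px ^ 2 + (1 - root_poly k) ^ 2"
   by (simp add: u_def v_def algebra_simps power2_eq_square del: mult_pCons_left mult_pCons_right)
  also have "err k = px ^ 2 + root_poly k ^ 2 - psm 2 (root_poly k)"
   by (simp add: err_def smult_diff_right del: mult_pCons_left mult_pCons_right)
  hence "px ^ 2 = err k - root_poly k ^ 2 + psm 2 (root_poly k)" by (simp add: algebra_simps)
  ultimately have "u k * v k = err k - root_poly k ^ 2 + psm 2 (root_poly k) + (1 - root_poly k) ^ 2" by (simp only:)
  moreover have "psm 2 (root_poly k) = root_poly k + root_poly k"
   by (metis mult_2 mult.left_neutral one_add_one smult_add_left smult_1_left)
  ultimately show ?thesis by (simp add: power2_eq_square algebra_simps)
 qed
 have pu: "pcnj (u k) = v k" "pcnj (v k) = u k" for k by (simp_all add: u_def v_def)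
 have Nuv: "N (1 + err k) <= 1 + e k" for k using N_add[of 1 "err k"] N_1 Nerr by simp
 have half: "N w <= 1 + e k" if "(N w)^2 <= 1 + e k" for w k
 proof -
  have "(N w)^2 <= (1 + e k)^2" using that e0[of k] zero_le_power2[of "e k"] by (simp only: power2_sum power_one mult_1_right)
  thus ?thesis by (rule power2_le_imp_le) (use e0[of k] in simp)
 qed
 have Nu: "N (u k) <= 1 + e k" "N (v k) <= 1 + e k" for k
  using Nuv[of k] N_cstar[of "u k"] N_cstar[of "v k"] uv[of k] by (auto simp: pu mult.commute intro!: half)
 have lim1: "(%k. 2 * (1 + e k) ^ m) ~~> 2 * (1 + 0) ^ m" for m by (intro tendsto_intros e)
 have sumN: "N (u k ^ m + v k ^ m) <= 2 * (1 + e k) ^ m" for k m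
 proof -
  have "N (u k ^ m + v k ^ m) <= N (u k) ^ m + N (v k) ^ m" by (intro order_trans[OF N_add] add_mono N_power)
  also have "... <= (1 + e k) ^ m + (1 + e k) ^ m" by (intro add_mono power_mono Nu N_ge0)
  finally show ?thesis by simp
 qed
 have uvs: "u k + v k = psm 2 px" for k by (simp add: u_def v_def numeral_poly)
 \<comment> \<open>The sums \<open>u ^ m + v ^ m\<close> satisfy the Chebyshev recursion up to the
   factor \<open>u v\<close>, so the errors \<open>de\<close> satisfy it up to a term with
   \<open>err k\<close>.\<close>
 have derec: "de (Suc (Suc m)) k = psm 2 px * de (Suc m) k - de m k - err k * (u k ^ m + v k ^ m)" for m k
 proof -
  have "u k ^ Suc (Suc m) + v k ^ Suc (Suc m) = (u k + v k) * (u k ^ Suc m + v k ^ Suc m) - u k * v k * (u k ^ m + v k ^ m)"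
   by (simp add: algebra_simps)
  thus ?thesis unfolding de_def uv uvs cheb.simps
   by (simp only: smult_diff_right) (simp add: algebra_simps del: mult_pCons_left mult_pCons_right smult_pCons)
 qed
 have delim: "(%k. N (de m k)) ~~> 0" for m
 proof (induction m rule: cheb.induct)
  case 1
  have "de 0 k = 0" for k by (simp add: de_def numeral_poly)
  thus ?case by simp
 next
  case 2
  have "de (Suc 0) k = 0" for k using uvs[of k] by (simp add: de_def)
  thus ?case by simp
 next
  case (3 m)
  have bnd: "N (de (Suc (Suc m)) k) <= 2 * N (de (Suc m) k) + N (de m k) + e k * (2 * (1 + e k) ^ m)" for k
  proof -
   have "N (psm 2 px * de (Suc m) k) <= 2 * N (de (Suc m) k)"
   proof -
    have "N (psm 2 px * de (Suc m) k) <= (2 * N px) * N (de (Suc m) k)"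
     using N_mult[of "psm 2 px" "de (Suc m) k"] N_smult[of 2 px] by simp
    also have "... <= 2 * N (de (Suc m) k)" by (intro mult_right_mono N_ge0) (use N_x in simp)
    finally show ?thesis .
   qed
   moreover have "N (err k * (u k ^ m + v k ^ m)) <= e k * (2 * (1 + e k) ^ m)"
    by (intro order_trans[OF N_mult] mult_mono) (simp_all only: Nerr sumN e0 N_ge0 order_refl)
   ultimately show ?thesis unfolding derec using N_diff[of "psm 2 px * de (Suc m) k - de m k" "err k * (u k ^ m + v k ^ m)"]
     N_diff[of "psm 2 px * de (Suc m) k" "de m k"] by linarith
  qed
  have "(%k. 2 * N (de (Suc m) k) + N (de m k) + e k * (2 * (1 + e k) ^ m)) ~~> 2 * 0 + 0 + 0 * (2 * (1 + 0) ^ m)"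
   using 3 by (intro tendsto_intros e)
  hence l: "(%k. 2 * N (de (Suc m) k) + N (de m k) + e k * (2 * (1 + e k) ^ m)) ~~> 0" by simp
  show ?case by (rule Lim_null[OF _ l]) (use bnd N_ge0 in simp)
 qed
 have "2 * N (cheb m) <= 2 * (1 + e k) ^ m + N (de m k)" for k
 proof -
  have "psm 2 (cheb m) = (u k ^ m + v k ^ m) - de m k" by (simp add: de_def)
  hence "2 * N (cheb m) = N ((u k ^ m + v k ^ m) - de m k)" using N_smult[of 2 "cheb m"] by simp
  also have "... <= 2 * (1 + e k) ^ m + N (de m k)" using N_diff[of "u k ^ m + v k ^ m" "de m k"] sumN[of k m] by linarith
  finally show ?thesis .
 qed
 moreover have "(%k. 2 * (1 + e k) ^ m + N (de m k)) ~~> 2 * (1 + 0) ^ m + 0" by (intro tendsto_add lim1 delim)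
 ultimately have "2 * N (cheb m) <= 2 * (1 + 0) ^ m + 0" by (intro LIMSEQ_le_const) auto
 thus ?thesis by simp
qed

lemma N_crude: assumes "!!t. -1 <= t ==> t <= 1 ==> cmod (poly p (of_real t)) <= B" "Polynomial.degree p <= D"
 shows "N p <= 2 * (real D + 1) * B"
proof -
 obtain b where b: "p = (\<Sum>k\<le>D. psm (b k) (cheb k))"
  using poly_in_cheb_span[OF assms(2)] by (auto simp: cheb_span_def)
 have "0 <= B" using order_trans[OF norm_ge_zero assms(1)[of 0]] by simp
 have "N p <= (\<Sum>k\<le>D. cmod (b k) * N (cheb k))"
  unfolding b using N_sum[of "%k. psm (b k) (cheb k)"] by (simp only: N_smult)
 also have "... <= (\<Sum>k\<le>D. (2 * B) * 1)"
  by (intro sum_mono mult_mono N_cheb cheb_coeff_bound[where D=D]) (use assms(1) b \<open>0 <= B\<close> N_ge0 in auto)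
 finally show ?thesis by (simp add: algebra_simps)
qed

text \<open>Applying the crude bound to high powers removes the dimension factor.\<close>

lemma N_le_sup_aux: assumes "!!t. -1 <= t ==> t <= 1 ==> cmod (poly p (of_real t)) <= B" shows "N p <= B"
proof (rule ccontr)
 assume "~ N p <= B"
 hence lt: "B < N p" by simp
 have B0: "0 <= B" using order_trans[OF norm_ge_zero assms[of 0]] by simp
 define q where "q = pcnj p * p"
 define D where "D = Polynomial.degree q"
 have qb: "cmod (poly (q ^ m) (of_real t)) <= (B\<^sup>2) ^ m" if "-1 <= t" "t <= 1" for t m
 proof -
  have "poly (pcnj p) (of_real t) = cnj (poly p (of_real t))" using poly_cnj[of p "of_real t"] by simp
  hence "cmod (poly q (of_real t)) = (cmod (poly p (of_real t)))^2" by (simp add: q_def norm_mult power2_eq_square)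
  also have "... <= B\<^sup>2" using assms[OF that] by (intro power_mono) auto
  finally show ?thesis by (simp add: poly_power norm_power power_mono)
 qed
 \<comment> \<open>The exponents are powers of two because the C*-identity makes \<open>N\<close>
   exactly multiplicative on repeated squares of the selfadjoint \<open>q\<close>; the degree of the
   power grows only linearly in the exponent.\<close>
 have "(N q) ^ (2 ^ j) <= 2 * (real (2 ^ j * D) + 1) * (B\<^sup>2) ^ (2 ^ j)" for j
 proof -
  have "N (q ^ (2 ^ j)) <= 2 * (real (2 ^ j * D) + 1) * (B\<^sup>2) ^ (2 ^ j)"
   by (rule N_crude) (use qb D_def degree_power_le[of q "2 ^ j"] in \<open>auto simp: mult.commute\<close>)
  thus ?thesis using N_power_two[of q j] by (simp add: q_def mult.commute)
 qed
 moreover have Nq: "N q = (N p)^2" by (simp add: q_def N_cstar)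
 define r where "r = B\<^sup>2 / (N p)^2"
 have pos: "0 < (N p)^2" using lt B0 by (simp add: power2_eq_square)
 have r: "0 <= r" "r < 1" using lt B0 pos by (auto simp: r_def power_strict_mono)
 have key: "1 <= 2 * (real (2 ^ j * D) + 1) * r ^ (2 ^ j)" for j
 proof -
  have "((N p)^2) ^ (2 ^ j) <= 2 * (real (2 ^ j * D) + 1) * (B\<^sup>2) ^ (2 ^ j)" using calculation[of j] Nq by simp
  thus ?thesis using pos by (simp add: r_def power_divide field_simps)
 qed
 \<comment> \<open>The linear factor loses against \<open>r ^ m\<close> with \<open>r < 1\<close>.
   This contradicts \<open>key\<close> at \<open>j = M\<close>, since \<open>2 ^ M\<close> is at
   least \<open>M\<close>.\<close>
 have "(%m. real m * r ^ m) ~~> 0" by (rule powser_times_n_limit_0) (use r in simp)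
 hence "(%m. 2 * real D * (real m * r ^ m) + 2 * r ^ m) ~~> 2 * real D * 0 + 2 * 0"
  by (intro tendsto_intros LIMSEQ_power_zero) (use r in auto)
 hence "\<forall>\<^sub>F m in sequentially. 2 * real D * (real m * r ^ m) + 2 * r ^ m < 1" by (rule order_tendstoD) simp
 then obtain M where M: "!!m. m >= M ==> 2 * real D * (real m * r ^ m) + 2 * r ^ m < 1"
  by (auto simp: eventually_sequentially)
 have "M <= 2 ^ M" by (simp add: less_imp_le less_exp)
 from M[OF this] key[of M] show False by (simp add: algebra_simps)
qed

end

end

lemma pcnj_pcompose: "pcnj (pcompose p q) = pcompose (pcnj p) (pcnj q)" by (induction p) (simp_all add: pcompose_pCons)

text \<open>Rescaling the variable by \<open>1 / R\<close> reduces to the interval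
  \<open>[-1, 1]\<close> and brings the seminorm of the variable below 1, as the convergence of
  \<open>root_poly\<close> requires.\<close>

theorem (in poly_seminorm) N_le_sup:
 assumes x: "N px < R" and b: "!!t. \<bar>t\<bar> <= R ==> cmod (poly p (of_real t)) <= B" shows "N p <= B"
proof -
 have R: "0 < R" using x N_ge0[of px] by simp
 define c where "c = [:0, cre (1 / R):]"
 have cc: "pcnj c = c" by (simp add: c_def)
 interpret N': poly_seminorm "%p. N (pcompose p c)"
 proof
  show "N (pcompose (pcnj p * p) c) = (N (pcompose p c))^2" for p
   using N_cstar[of "pcompose p c"] by (simp add: pcompose_mult pcnj_pcompose cc)
 qed (auto simp: pcompose_add pcompose_mult pcompose_smult N_ge0 N_add N_smult N_mult)
 have "c = psm (cre (1 / R)) px" by (simp add: c_def)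
 hence "N c = cmod (cre (1 / R)) * N px" by (simp only: N_smult)
 hence "N c = N px / R" using R by (simp add: norm_divide)
 moreover have "pcompose px c = c" by (simp add: pcompose_pCons)
 ultimately have "N (pcompose px c) < 1" using x R by simp
 hence "N (pcompose (pcompose p [:0, cre R:]) c) <= B"
 proof (rule N'.N_le_sup_aux)
  fix t :: real assume "-1 <= t" "t <= 1"
  hence "\<bar>R * t\<bar> <= R" using R by (simp add: abs_mult)
  from b[OF this] show "cmod (poly (pcompose p [:0, cre R:]) (of_real t)) <= B" by (simp add: poly_pcompose mult.commute)
 qed
 moreover have "pcompose (pcompose p [:0, cre R:]) c = p"
  using R by (simp add: pcompose_assoc[symmetric] pcompose_pCons c_def pcompose_idR)
 ultimately show ?thesis by simp
qed

text \<open>\<open>f\<close> vanishes at 0, so subtracting the constant term of a Weierstrass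
  approximant costs only another \<open>ep / 2\<close> and makes it divisible by the variable. Only
  such polynomials can be evaluated in an algebra without unit.\<close>

lemma weierstrass_poly:
 fixes f :: "real => real" assumes "continuous_on {-R..R} f" "f 0 = 0" "0 < ep" "0 <= R"
 shows "EX r :: complex poly. ALL t. \<bar>t\<bar> <= R --> cmod (poly (px * r) (of_real t) - of_real (f t)) < ep"
proof -
 obtain g where g: "real_polynomial_function g" and gf: "!!x. x : {-R..R} ==> \<bar>f x - g x\<bar> < ep / 2"
  using Stone_Weierstrass_real_polynomial_function[OF _ assms(1), of "ep / 2"] assms by auto
 obtain a n where ga: "g = (%x. \<Sum>i\<le>n. a i * x ^ i)" using g unfolding real_polynomial_function_iff_sum by blast
 define r where "r = (\<Sum>i<n. Polynomial.monom (cre (a (Suc i))) i)"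
 have eq: "poly (px * r) (of_real t) = of_real (g t - g 0)" for t
 proof -
  have "g t = a 0 + (\<Sum>i<n. a (Suc i) * t ^ Suc i)" unfolding ga by (subst sum.atMost_shift) simp
  moreover have "g 0 = a 0" unfolding ga by (subst sum.atMost_shift) simp
  ultimately have "g t - g 0 = (\<Sum>i<n. a (Suc i) * t ^ Suc i)" by simp
  thus ?thesis by (simp add: r_def poly_sum poly_monom sum_distrib_left mult_ac)
 qed
 have "cmod (poly (px * r) (of_real t) - of_real (f t)) < ep" if "\<bar>t\<bar> <= R" for t
 proof -
  have "cmod (poly (px * r) (of_real t) - of_real (f t)) = \<bar>g t - g 0 - f t\<bar>"
   unfolding eq by (metis norm_of_real of_real_diff)
  also have "... <= \<bar>f t - g t\<bar> + \<bar>f 0 - g 0\<bar>" using assms(2) by simp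
  also have "... < ep" using gf[of t] gf[of 0] that assms by (auto simp: abs_le_iff)
  finally show ?thesis .
 qed
 thus ?thesis by blast
qed

section \<open>Polynomial calculus without unit\<close>

context cstar_algebra
begin

text \<open>\<open>ev1 a p\<close> is the element \<open>(x p)(a)\<close>; the factor \<open>x\<close> avoids the unit.\<close>

definition ev1 :: "'a => complex poly => 'a"
 where "ev1 a p = fold_coeffs (%c r. c \<odot> a \<oplus> a \<otimes> r) p \<zero>"

context
 fixes a assumes a: "a : carrier A"
begin

lemma ev1_0 [simp]: "ev1 a 0 = \<zero>" by (simp add: ev1_def)

lemma ev1_pCons: "ev1 a (pCons c p) = c \<odot> a \<oplus> a \<otimes> ev1 a p"
proof (cases "c = 0 & p = 0")
 case True
 thus ?thesis using a by simp
next
 case False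
 thus ?thesis unfolding ev1_def by (auto simp: fold_coeffs_pCons_not_0_0_eq)
qed

lemma ev1_closed [simp]: "ev1 a p : carrier A" by (induction p) (simp_all add: ev1_pCons a cl)

lemma ev1_add: "ev1 a (p + q) = ev1 a p \<oplus> ev1 a q"
proof (induction p q rule: poly_induct2)
 case (pCons b p c q)
 have "(P \<oplus> Q) \<oplus> (P' \<oplus> Q') = (P \<oplus> P') \<oplus> (Q \<oplus> Q')"
  if "P : carrier A" "Q : carrier A" "P' : carrier A" "Q' : carrier A" for P Q P' Q' using that by (simp add: M.a_ac)
 thus ?case using a pCons by (simp add: ev1_pCons smult_left_distr mult_distrib_left cl)
qed simp

lemma ev1_smult: "ev1 a (psm c p) = c \<odot> ev1 a p"
 using a by (induction p) (simp_all add: ev1_pCons smult_right_distr smult_mult_right cl)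

lemma ev1_diff: "ev1 a (p - q) = ev1 a p \<ominus> ev1 a q"
 using ev1_add[of p "psm (-1) q"] unfolding ev1_smult by (simp add: minus_smult)

lemma ev1_mult: "ev1 a (pCons 0 (p * q)) = ev1 a p \<otimes> ev1 a q"
proof (induction p)
 case (pCons c p)
 have "ev1 a (pCons 0 (pCons c p * q)) = a \<otimes> (c \<odot> ev1 a q \<oplus> ev1 a p \<otimes> ev1 a q)"
  using a pCons(2) by (simp add: ev1_pCons ev1_add ev1_smult cl)
 also have "... = ev1 a (pCons c p) \<otimes> ev1 a q"
  using a by (simp add: ev1_pCons mult_distrib_left mult_distrib_right smult_mult_left
    smult_mult_right mult_assoc cl)
 finally show ?case .
qed (use a in \<open>simp add: ev1_pCons\<close>)

lemma ev1_comm: "ev1 a p \<otimes> ev1 a q = ev1 a q \<otimes> ev1 a p" by (simp only: ev1_mult[symmetric] mult.commute)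

lemma ev1_1: "ev1 a 1 = a" using a by (simp add: ev1_pCons one_pCons)

text \<open>The infimum \<open>ev1_norm\<close> of these bounds is the norm of \<open>p(a)\<close>
  as a multiplier of the polynomials in \<open>a\<close> without constant term. It makes sense for
  constant \<open>p\<close> too, and is thus a seminorm on all polynomials, as
  \<open>poly_seminorm\<close> demands.\<close>

definition ev1_bounds :: "complex poly => real set"
 where "ev1_bounds p = {C. 0 <= C & (ALL q. nrm A (ev1 a (p * q)) <= C * nrm A (ev1 a q))}"

definition ev1_norm :: "complex poly => real" where "ev1_norm p = Inf (ev1_bounds p)"

lemma ev1_bounds_nonempty: "ev1_bounds p ~= {}"
proof -
 obtain c p' where p: "p = pCons c p'" by (cases p)
 have "nrm A (ev1 a (p * q)) <= (cmod c + nrm A (ev1 a p')) * nrm A (ev1 a q)" for q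
 proof -
  have "ev1 a (p * q) = c \<odot> ev1 a q \<oplus> ev1 a p' \<otimes> ev1 a q" by (simp add: p ev1_add ev1_smult ev1_mult)
  hence "nrm A (ev1 a (p * q)) <= nrm A (c \<odot> ev1 a q) + nrm A (ev1 a p' \<otimes> ev1 a q)"
   by (simp add: nrm_triangle cl)
  also have "... <= cmod c * nrm A (ev1 a q) + nrm A (ev1 a p') * nrm A (ev1 a q)"
   by (intro add_mono) (simp_all add: nrm_smult nrm_mult)
  finally show ?thesis by (simp add: algebra_simps)
 qed
 hence "cmod c + nrm A (ev1 a p') : ev1_bounds p" by (simp add: ev1_bounds_def nrm_ge0)
 thus ?thesis by blast
qed

lemma ev1_norm_ge0: "0 <= ev1_norm p"
 unfolding ev1_norm_def by (rule cInf_greatest[OF ev1_bounds_nonempty]) (simp add: ev1_bounds_def)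

lemma ev1_norm_le: "0 <= C ==> (!!q. nrm A (ev1 a (p * q)) <= C * nrm A (ev1 a q)) ==> ev1_norm p <= C"
 unfolding ev1_norm_def by (rule cInf_lower) (auto simp: ev1_bounds_def intro: bdd_belowI[where m=0])

lemma ev1_norm_bound: "nrm A (ev1 a (p * q)) <= ev1_norm p * nrm A (ev1 a q)"
proof (cases "nrm A (ev1 a q) = 0")
 case True
 obtain C where "C : ev1_bounds p" using ev1_bounds_nonempty by blast
 hence "nrm A (ev1 a (p * q)) <= C * nrm A (ev1 a q)" by (simp add: ev1_bounds_def)
 thus ?thesis using True by simp
next
 case False
 hence pos: "0 < nrm A (ev1 a q)" using nrm_ge0[OF ev1_closed, of q] by simp
 have "nrm A (ev1 a (p * q)) / nrm A (ev1 a q) <= ev1_norm p" unfolding ev1_norm_def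
  by (rule cInf_greatest[OF ev1_bounds_nonempty]) (use pos in \<open>auto simp: ev1_bounds_def field_simps\<close>)
 thus ?thesis using pos by (simp add: field_simps)
qed

lemma ev1_star: assumes "star A a = a" shows "star A (ev1 a p) = ev1 a (pcnj p)"
proof (induction p)
 case (pCons c p)
 have "ev1 a r \<otimes> a = a \<otimes> ev1 a r" for r using ev1_comm[of r 1] by (simp add: ev1_1)
 thus ?case using a pCons(2) assms by (simp add: ev1_pCons star_add star_smult star_mult cl)
qed simp

lemma ev1_seminorm: assumes sa: "star A a = a" shows "poly_seminorm ev1_norm"
proof
 fix p q :: "complex poly" and c :: complex
 show "0 <= ev1_norm p" by (rule ev1_norm_ge0)
 show "ev1_norm (p + q) <= ev1_norm p + ev1_norm q"
 proof (rule ev1_norm_le)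
  fix r
  have "nrm A (ev1 a ((p + q) * r)) <= nrm A (ev1 a (p * r)) + nrm A (ev1 a (q * r))"
   by (simp add: distrib_right ev1_add nrm_triangle)
  also have "... <= (ev1_norm p + ev1_norm q) * nrm A (ev1 a r)"
   using ev1_norm_bound[of p r] ev1_norm_bound[of q r] by (simp add: distrib_right)
  finally show "nrm A (ev1 a ((p + q) * r)) <= (ev1_norm p + ev1_norm q) * nrm A (ev1 a r)" .
 qed (simp add: ev1_norm_ge0)
 have le: "ev1_norm (psm c p) <= cmod c * ev1_norm p" for c p
 proof (rule ev1_norm_le)
  show "nrm A (ev1 a (psm c p * r)) <= cmod c * ev1_norm p * nrm A (ev1 a r)" for r
   using ev1_norm_bound[of p r] by (simp add: ev1_smult nrm_smult mult_left_mono mult.assoc)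
 qed (simp add: ev1_norm_ge0)
 show "ev1_norm (psm c p) = cmod c * ev1_norm p"
 proof (cases "c = 0")
  case True
  thus ?thesis using le[of 0 p] ev1_norm_ge0[of 0] by simp
 next
  case False
  have "ev1_norm p <= cmod (inverse c) * ev1_norm (psm c p)" using le[of "inverse c" "psm c p"] False by simp
  hence "cmod c * ev1_norm p <= ev1_norm (psm c p)" using False by (simp add: norm_inverse norm_divide field_simps)
  thus ?thesis using le[of c p] by simp
 qed
 show mul: "ev1_norm (p * q) <= ev1_norm p * ev1_norm q" for p q
 proof (rule ev1_norm_le)
  fix r
  have "nrm A (ev1 a (p * q * r)) <= ev1_norm p * nrm A (ev1 a (q * r))"
   using ev1_norm_bound[of p "q * r"] by (simp add: mult.assoc)
  also have "... <= ev1_norm p * (ev1_norm q * nrm A (ev1 a r))" by (intro mult_left_mono ev1_norm_bound ev1_norm_ge0)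
  finally show "nrm A (ev1 a (p * q * r)) <= ev1_norm p * ev1_norm q * nrm A (ev1 a r)" by (simp add: mult.assoc)
 qed (simp add: ev1_norm_ge0)
 \<comment> \<open>As for operators: the square of the norm of \<open>p r\<close> is the norm of the
   adjoint of \<open>r\<close> times \<open>pcnj p * p * r\<close>, which is controlled by the
   multiplier norm of \<open>pcnj p * p\<close>.\<close>
 have sq: "(ev1_norm p)^2 <= ev1_norm (pcnj p * p)" for p
 proof -
  have "ev1_norm p <= sqrt (ev1_norm (pcnj p * p))"
  proof (rule ev1_norm_le)
   fix r
   have "(nrm A (ev1 a (p * r)))^2 = nrm A (star A (ev1 a (p * r)) \<otimes> ev1 a (p * r))" by (simp add: nrm_cstar)
   also have "... = nrm A (ev1 a (pCons 0 (pcnj (p * r) * (p * r))))" by (simp only: ev1_star[OF sa] ev1_mult)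
   also have "pcnj (p * r) * (p * r) = pcnj r * (pcnj p * p * r)" by (simp add: mult_ac)
   also have "ev1 a (pCons 0 (pcnj r * (pcnj p * p * r))) = star A (ev1 a r) \<otimes> ev1 a (pcnj p * p * r)"
    by (simp only: ev1_star[OF sa] ev1_mult)
   also have "nrm A ... <= nrm A (ev1 a r) * nrm A (ev1 a (pcnj p * p * r))"
    using nrm_mult[of "star A (ev1 a r)" "ev1 a (pcnj p * p * r)"] by (simp add: nrm_star star_closed)
   also have "... <= nrm A (ev1 a r) * (ev1_norm (pcnj p * p) * nrm A (ev1 a r))"
    by (intro mult_left_mono ev1_norm_bound nrm_ge0 ev1_closed)
   finally have "sqrt ((nrm A (ev1 a (p * r)))^2) <= sqrt (ev1_norm (pcnj p * p) * (nrm A (ev1 a r))^2)"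
    by (intro real_sqrt_le_mono) (simp add: power2_eq_square mult_ac)
   thus "nrm A (ev1 a (p * r)) <= sqrt (ev1_norm (pcnj p * p)) * nrm A (ev1 a r)" by (simp add: real_sqrt_mult nrm_ge0)
  qed (simp add: ev1_norm_ge0)
  hence "(ev1_norm p)^2 <= (sqrt (ev1_norm (pcnj p * p)))^2" by (intro power_mono ev1_norm_ge0)
  thus ?thesis by (simp add: ev1_norm_ge0)
 qed
 have cnj_le: "ev1_norm p <= ev1_norm (pcnj p)" for p
 proof (cases "ev1_norm p = 0")
  case False
  hence "0 < ev1_norm p" using ev1_norm_ge0[of p] by simp
  moreover have "ev1_norm p * ev1_norm p <= ev1_norm (pcnj p) * ev1_norm p"
   using order_trans[OF sq mul, of p] by (simp add: power2_eq_square)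
  ultimately show ?thesis by simp
 qed (simp add: ev1_norm_ge0)
 have "ev1_norm (pcnj p * p) <= ev1_norm (pcnj p) * ev1_norm p" by (rule mul)
 also have "ev1_norm (pcnj p) = ev1_norm p" using cnj_le[of p] cnj_le[of "pcnj p"] by simp
 finally show "ev1_norm (pcnj p * p) = (ev1_norm p)^2" using sq[of p] by (simp add: power2_eq_square)
qed

text \<open>Multiplier norm and norm agree on polynomials without constant term; the lower bound
  comes from multiplying by the adjoint, that is from \<open>q = pcnj r\<close>.\<close>

lemma ev1_norm_px: assumes sa: "star A a = a" shows "ev1_norm (px * r) = nrm A (ev1 a r)"
proof (rule order_antisym)
 show "ev1_norm (px * r) <= nrm A (ev1 a r)"
 proof (rule ev1_norm_le)
  show "nrm A (ev1 a (px * r * q)) <= nrm A (ev1 a r) * nrm A (ev1 a q)" for q by (simp add: ev1_mult nrm_mult)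
 qed (simp add: nrm_ge0)
 show "nrm A (ev1 a r) <= ev1_norm (px * r)"
 proof (cases "nrm A (ev1 a r) = 0")
  case False
  hence pos: "0 < nrm A (ev1 a r)" using nrm_ge0[OF ev1_closed, of r] by simp
  have "(nrm A (ev1 a r))^2 = nrm A (ev1 a (px * r * pcnj r))"
   using nrm_cstar[of "ev1 a r"] ev1_comm[of r "pcnj r"] by (simp add: ev1_mult ev1_star[OF sa])
  also have "... <= ev1_norm (px * r) * nrm A (ev1 a (pcnj r))" by (rule ev1_norm_bound)
  also have "nrm A (ev1 a (pcnj r)) = nrm A (ev1 a r)" by (simp add: ev1_star[OF sa, symmetric] nrm_star)
  finally show ?thesis using pos by (simp add: power2_eq_square)
 qed (simp add: ev1_norm_ge0)
qed

end

lemma nrm_ev1_le_sup: assumes "a : carrier A" "star A a = a" "nrm A a < R"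
  and "!!t. \<bar>t\<bar> <= R ==> cmod (poly (px * r) (of_real t)) <= C" shows "nrm A (ev1 a r) <= C"
proof -
 interpret poly_seminorm "ev1_norm a" by (rule ev1_seminorm) fact+
 have "ev1_norm a px = nrm A a" using ev1_norm_px[OF assms(1,2), of 1] ev1_1[OF assms(1)] by simp
 hence "ev1_norm a (px * r) <= C" using assms by (intro N_le_sup[where R=R]) auto
 thus ?thesis using ev1_norm_px[OF assms(1,2)] by simp
qed

end

text \<open>If the norm of a normalized selfadjoint \<open>a\<close> dropped to
  \<open>r < r1 < 1\<close>, apply to \<open>a\<close> a function \<open>f\<close> that vanishes on
  \<open>[- r1, r1]\<close> and stays within \<open>r1\<close> of the identity. The image of
  \<open>f(a)\<close> is \<open>f\<close> of the image of \<open>a\<close>, which is 0, while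
  \<open>f(a)\<close> is within \<open>r1\<close> of \<open>a\<close> and so is not 0.\<close>

theorem injective_star_hom_isometric:
 fixes B (structure) assumes B: "cstar_algebra B" and C: "cstar_algebra C" and hom: "star_hom B C ph"
  and inj: "!!x. x : carrier B ==> ph x = \<zero>\<^bsub>C\<^esub> ==> x = \<zero>" and x: "x : carrier B"
 shows "nrm C (ph x) = nrm B x"
proof (rule ccontr)
 assume "nrm C (ph x) ~= nrm B x"
 interpret B: cstar_algebra B by fact
 interpret C: cstar_algebra C by fact
 note h = star_homD[OF hom]
 have contr: "y : carrier B ==> nrm C (ph y) <= nrm B y" for y by (rule star_hom_contractive[OF B C hom])
 have lt: "nrm C (ph x) < nrm B x" using contr[OF x] \<open>nrm C (ph x) ~= nrm B x\<close> by simp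
 have phx: "ph x : carrier C" using h(1)[OF x] .
 have pos: "0 < nrm B x" using lt C.nrm_ge0[OF phx] by simp
 define y where "y = star B x \<otimes> x"
 have y: "y : carrier B" "star B y = y" "nrm B y = (nrm B x)^2"
  using x by (auto simp: y_def B.cl B.star_mult B.star_star B.nrm_cstar)
 have phy: "nrm C (ph y) = (nrm C (ph x))^2"
  unfolding y_def h(4)[OF B.star_closed[OF x] x] h(5)[OF x] by (rule C.nrm_cstar[OF phx])
 define c where "c = cre (1 / (nrm B x)^2)"
 have cc: "cmod c = 1 / (nrm B x)^2" "cnj c = c" by (simp_all add: c_def norm_divide norm_power)
 define a where "a = c \<odot> y"
 have a: "a : carrier B" "star B a = a" "nrm B a = 1" using y pos by (auto simp: a_def B.star_smult B.nrm_smult cc)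
 define r where "r = nrm C (ph a)"
 have "r = (nrm C (ph x))^2 / (nrm B x)^2" using y h(1)[OF y(1)] by (simp add: r_def a_def h(3) C.nrm_smult cc phy)
 moreover have "(nrm C (ph x))^2 < (nrm B x)^2" using lt C.nrm_ge0[OF phx] by (intro power_strict_mono) auto
 ultimately have "r < 1" using pos by simp
 then obtain r1 where r1: "r < r1" "r1 < 1" using dense by blast
 have r0: "0 <= r" unfolding r_def using C.nrm_ge0 h(1)[OF a(1)] by blast
 have pha: "ph a : carrier C" "star C (ph a) = ph a" using h(1)[OF a(1)] h(5)[OF a(1)] a(2) by auto
 have phev: "ph (B.ev1 a p) = C.ev1 (ph a) p" for p
 proof (induction p)
  case 0
  have "ph \<zero> = 0 \<odot>\<^bsub>C\<^esub> ph \<zero>" using h(3)[of "\<zero>" 0] by simp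
  hence "ph \<zero> = \<zero>\<^bsub>C\<^esub>" using C.smult_zero_left[OF h(1), of "\<zero>"] by simp
  thus ?case using a pha by simp
 next
  case (pCons c p)
  have "B.ev1 a p : carrier B" using a by simp
  thus ?case using a pha pCons(2) by (simp add: B.ev1_pCons C.ev1_pCons h B.cl)
 qed
 define f where "f t = t - max (- r1) (min r1 t)" for t :: real
 have f0: "f t = 0" if "\<bar>t\<bar> <= r1" for t using that by (auto simp: f_def)
 have f1: "\<bar>t - f t\<bar> <= r1" for t using r1 r0 by (auto simp: f_def)
 \<comment> \<open>The radius 2 could be any number above the norm 1 of \<open>a\<close>, as
   \<open>nrm_ev1_le_sup\<close> asks for a strictly larger interval.\<close>
 have "EX q :: complex poly. ALL t. \<bar>t\<bar> <= 2 --> cmod (poly (px * q) (of_real t) - of_real (f t)) < 1 / (real n + 1)" for n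
  by (rule weierstrass_poly) (use r0 r1 in \<open>auto simp: f_def intro!: continuous_intros\<close>)
 then obtain q where q: "!!n t. \<bar>t\<bar> <= 2 ==>
   cmod (poly (px * q n) (of_real t) - of_real (f t)) < 1 / (real n + 1)" by metis
 let ?y = "%n. B.ev1 a (q n)"
 have yc: "?y n : carrier B" for n using a by simp
 have na2: "nrm B a < 2" using a by simp
 have "EX z:carrier B. (%n. nrm B (?y n \<ominus> z)) ~~> 0"
 proof (rule B.Cauchy_limit[OF yc])
  fix ep :: real assume "ep > 0"
  then obtain N where N: "inverse (real (Suc N)) < ep / 2" using reals_Archimedean half_gt_zero by blast
  have "nrm B (?y m \<ominus> ?y n) < ep" if "m >= N" "n >= N" for m n
  proof -
   have "nrm B (B.ev1 a (q m - q n)) <= 1 / (real m + 1) + 1 / (real n + 1)"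
   proof (rule B.nrm_ev1_le_sup[OF a(1,2) na2])
    fix t :: real assume t: "\<bar>t\<bar> <= 2"
    have "cmod (poly (px * (q m - q n)) (of_real t))
     = cmod ((poly (px * q m) (of_real t) - of_real (f t)) - (poly (px * q n) (of_real t) - of_real (f t)))"
     by (simp add: algebra_simps)
    also have "... <= 1 / (real m + 1) + 1 / (real n + 1)"
     by (intro order_trans[OF norm_triangle_ineq4] add_mono less_imp_le q t)
    finally show "cmod (poly (px * (q m - q n)) (of_real t)) <= 1 / (real m + 1) + 1 / (real n + 1)" .
   qed
   moreover have "1 / (real m + 1) <= inverse (real (Suc N))" "1 / (real n + 1) <= inverse (real (Suc N))"
    using that by (auto simp: field_simps)
   ultimately show ?thesis using N a by (simp add: B.ev1_diff)
  qed
  thus "EX N. ALL m>=N. ALL n>=N. nrm B (?y m \<ominus> ?y n) < ep" by blast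
 qed
 then obtain z where z: "z : carrier B" and lim: "(%n. nrm B (?y n \<ominus> z)) ~~> 0" by blast
 have l1: "(%n. 1 / (real n + 1)) ~~> 0" using LIMSEQ_inverse_real_of_nat by (simp add: inverse_eq_divide add.commute)
 have phsmall: "nrm C (ph (?y n)) <= 1 / (real n + 1)" for n unfolding phev
 proof (rule C.nrm_ev1_le_sup[OF pha])
  show "nrm C (ph a) < r1" using r1 by (simp add: r_def)
  show "cmod (poly (px * q n) (of_real t)) <= 1 / (real n + 1)" if "\<bar>t\<bar> <= r1" for t
   using q[of t n] f0[of t] that r1 by simp
 qed
 have phdiff: "ph (u \<ominus> v) = ph u \<ominus>\<^bsub>C\<^esub> ph v" if "u : carrier B" "v : carrier B" for u v
  using that h(1)[OF that(1)] h(1)[OF that(2)] by (simp add: B.minus_smult C.minus_smult h B.cl)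
 have "nrm C (ph z) <= nrm B (?y n \<ominus> z) + 1 / (real n + 1)" for n
 proof -
  have "nrm C (ph z) <= nrm C (ph (?y n \<ominus> z)) + nrm C (ph (?y n))"
   using C.nrm_rev_triangle[of "ph (?y n)" "ph z"] h(1)[OF yc] h(1)[OF z] phdiff[OF yc z] by simp
  thus ?thesis using contr[of "?y n \<ominus> z"] phsmall[of n] yc z by fastforce
 qed
 moreover have "(%n. nrm B (?y n \<ominus> z) + 1 / (real n + 1)) ~~> 0 + 0" by (intro tendsto_add lim l1)
 ultimately have "nrm C (ph z) <= 0 + 0" by (intro LIMSEQ_le_const) auto
 hence "nrm C (ph z) = 0" using C.nrm_ge0[OF h(1)[OF z]] by simp
 hence "ph z = \<zero>\<^bsub>C\<^esub>" using C.nrm_eq_zero h(1)[OF z] by blast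
 hence "z = \<zero>" using inj z by blast
 hence lim0: "(%n. nrm B (?y n)) ~~> 0" using lim yc by simp
 have "1 <= nrm B (?y n) + (r1 + 1 / (real n + 1))" for n
 proof -
  have "nrm B (B.ev1 a (1 - q n)) <= r1 + 1 / (real n + 1)"
  proof (rule B.nrm_ev1_le_sup[OF a(1,2) na2])
   fix t :: real assume t: "\<bar>t\<bar> <= 2"
   have "cmod (poly (px * (1 - q n)) (of_real t)) = cmod (of_real (t - f t) - (poly (px * q n) (of_real t) - of_real (f t)))"
    by (simp add: algebra_simps)
   also have "... <= r1 + 1 / (real n + 1)" by (intro order_trans[OF norm_triangle_ineq4] add_mono less_imp_le[OF q] t)
     (simp only: norm_of_real f1)
   finally show "cmod (poly (px * (1 - q n)) (of_real t)) <= r1 + 1 / (real n + 1)" .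
  qed
  hence "nrm B (a \<ominus> ?y n) <= r1 + 1 / (real n + 1)" using a by (simp add: B.ev1_diff B.ev1_1)
  thus ?thesis using B.nrm_rev_triangle[of a "?y n"] a yc[of n] by fastforce
 qed
 moreover have "(%n. nrm B (?y n) + (r1 + 1 / (real n + 1))) ~~> 0 + (r1 + 0)" by (intro tendsto_add lim0 l1 tendsto_const)
 ultimately have "1 <= 0 + (r1 + 0)" by (intro LIMSEQ_le_const) auto
 thus False using r1 by simp
qed

section \<open>The Hahn-Banach theorem in a C*-algebra\<close>

context cstar_algebra
begin

abbreviation rsm :: "real => 'a => 'a" where "rsm t x \<equiv> cre t \<odot> x"

text \<open>The value 0 outside the carrier makes functionals that agree on the carrier equal, as
  the antisymmetry in Zorn's lemma requires.\<close>

definition sublin :: "('a => real) => bool"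
 where "sublin q \<longleftrightarrow> (ALL x:carrier A. ALL y:carrier A. q (x \<oplus> y) <= q x + q y) &
  (ALL t>0. ALL x:carrier A. q (rsm t x) <= t * q x) & (ALL x. x ~: carrier A --> q x = 0)"

lemma sublin_add: "sublin q ==> x : carrier A ==> y : carrier A ==> q (x \<oplus> y) <= q x + q y"
 and sublin_out: "sublin q ==> x ~: carrier A ==> q x = 0" by (auto simp: sublin_def)

lemma sublin_zero: "sublin q ==> q \<zero> = 0"
proof -
 assume "sublin q"
 hence "q (rsm t \<zero>) <= t * q \<zero>" if "0 < t" for t using that unfolding sublin_def by blast
 from this[of 2] this[of "1/2"] show ?thesis by simp
qed

lemma sublin_scale: "sublin q ==> x : carrier A ==> 0 <= t ==> q (rsm t x) = t * q x"
proof (cases "t = 0")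
 case False
 assume q: "sublin q" and x: "x : carrier A" and "0 <= t"
 hence t: "0 < t" using False by simp
 have le: "q (rsm s y) <= s * q y" if "0 < s" "y : carrier A" for s y using q that by (simp add: sublin_def)
 have "q x <= 1/t * q (rsm t x)" using le[of "1/t" "rsm t x"] x t by simp
 thus ?thesis using le[OF t x] t by (simp add: field_simps)
qed (simp add: sublin_zero)

lemma rsm_neg: "x : carrier A ==> x \<oplus> rsm (-1) x = \<zero>" using smult_left_distr[of x 1 "-1"] by simp

lemma sublin_neg: "sublin q ==> x : carrier A ==> - q (rsm (-1) x) <= q x"
 using sublin_add[of q x "rsm (-1) x"] sublin_zero[of q] rsm_neg[of x] by simp

text \<open>The conditions \<open>add\<close> and \<open>scale\<close> are what subadditivity and
  homogeneity of an infimum amount to for a family; they are weak enough to cover both the shifts of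
  one functional and a chain of functionals.\<close>

lemma sublin_Inf: assumes ne: "F ~= {}" and low: "!!x. x : carrier A ==> bdd_below ((%f. f x) ` F)"
  and add: "!!f g. f : F ==> g : F ==> EX h:F. ALL x:carrier A. ALL y:carrier A. h (x \<oplus> y) <= f x + g y"
  and scale: "!!f t. f : F ==> 0 < t ==> EX h:F. ALL x:carrier A. h (rsm t x) <= t * f x"
 shows "EX p. sublin p & (ALL f:F. ALL x:carrier A. p x <= f x)"
proof -
 define p where "p x = (if x : carrier A then Inf ((%f. f x) ` F) else 0)" for x
 have ple: "p x <= f x" if "f : F" "x : carrier A" for f x using that low by (auto simp: p_def intro: cInf_lower)
 have pge: "c <= p x" if "x : carrier A" "!!f. f : F ==> c <= f x" for c x
  using that ne by (auto simp: p_def intro: cInf_greatest)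
 have "p (x \<oplus> y) <= p x + p y" if xy: "x : carrier A" "y : carrier A" for x y
 proof -
  have *: "p (x \<oplus> y) <= f x + g y" if "f : F" "g : F" for f g
   using add[OF that] xy ple[of _ "x \<oplus> y"] by (meson M.add.m_closed order_trans)
  have "p (x \<oplus> y) - g y <= p x" if "g : F" for g
   by (rule pge[OF xy(1)]) (use *[OF _ that] in \<open>simp add: algebra_simps\<close>)
  hence "p (x \<oplus> y) - p x <= p y" by (intro pge[OF xy(2)]) (simp add: algebra_simps)
  thus ?thesis by simp
 qed
 moreover have "p (rsm t x) <= t * p x" if t: "0 < t" and x: "x : carrier A" for t x
 proof -
  have "p (rsm t x) / t <= p x"
  proof (rule pge[OF x])
   fix f assume "f : F"
   then obtain h where "h : F" "h (rsm t x) <= t * f x" using scale[OF _ t] x by blast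
   hence "p (rsm t x) <= t * f x" using ple[of h "rsm t x"] x by simp
   thus "p (rsm t x) / t <= f x" using t by (simp add: field_simps)
  qed
  thus ?thesis using t by (simp add: field_simps)
 qed
 moreover have "p x = 0" if "x ~: carrier A" for x using that by (simp add: p_def)
 ultimately have "sublin p" unfolding sublin_def by blast
 thus ?thesis using ple by blast
qed

text \<open>\<open>p x\<close> is the infimum over \<open>t >= 0\<close> of
  \<open>q (x + t y) - t q y\<close>, with \<open>t = 0\<close> and \<open>t = 1\<close> giving the
  two bounds. A minimal \<open>q\<close> therefore satisfies \<open>q (- y) <= - q y\<close> for
  every \<open>y\<close>, which makes it additive.\<close>

lemma sublin_shift: assumes q: "sublin q" and y: "y : carrier A"
 shows "EX p. sublin p & (ALL x:carrier A. p x <= q x) & p (rsm (-1) y) <= - q y"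
proof -
 define G where "G t x = q (x \<oplus> rsm t y) - t * q y" for t x
 have low: "- q (rsm (-1) x) <= G t x" if t: "0 <= t" and x: "x : carrier A" for t x
 proof -
  have "(x \<oplus> rsm t y) \<oplus> rsm (-1) x = (x \<oplus> rsm (-1) x) \<oplus> rsm t y" using x y by (simp add: M.a_ac)
  also have "... = rsm t y" using rsm_neg[OF x] y by simp
  finally have "q (rsm t y) <= q (x \<oplus> rsm t y) + q (rsm (-1) x)"
   using sublin_add[OF q, of "x \<oplus> rsm t y" "rsm (-1) x"] x y by simp
  thus ?thesis using sublin_scale[OF q y t] by (simp add: G_def)
 qed
 have "EX p. sublin p & (ALL f:G ` {0..}. ALL x:carrier A. p x <= f x)"
 proof (rule sublin_Inf)
  show "bdd_below ((%f. f x) ` G ` {0..})" if "x : carrier A" for x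
   by (rule bdd_belowI[of _ "- q (rsm (-1) x)"]) (use low that in auto)
 next
  fix f g assume "f : G ` {0..}" "g : G ` {0..}"
  then obtain t t' where t: "0 <= t" "f = G t" "0 <= t'" "g = G t'" by auto
  have "G (t + t') (x \<oplus> x') <= f x + g x'" if x: "x : carrier A" "x' : carrier A" for x x'
  proof -
   have "(x \<oplus> x') \<oplus> rsm (t + t') y = (x \<oplus> rsm t y) \<oplus> (x' \<oplus> rsm t' y)"
    using x y by (simp add: smult_left_distr M.a_ac)
   thus ?thesis
    using sublin_add[OF q, of "x \<oplus> rsm t y" "x' \<oplus> rsm t' y"] x y t by (simp add: G_def algebra_simps)
  qed
  thus "EX h:G ` {0..}. ALL x:carrier A. ALL x':carrier A. h (x \<oplus> x') <= f x + g x'"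
   using t by (intro bexI[of _ "G (t + t')"]) auto
 next
  fix f and s :: real assume "f : G ` {0..}" and s: "0 < s"
  then obtain t where t: "0 <= t" "f = G t" by auto
  have "G (s * t) (rsm s x) <= s * f x" if x: "x : carrier A" for x
  proof -
   have "rsm s x \<oplus> rsm (s * t) y = rsm s (x \<oplus> rsm t y)" using x y by (simp add: smult_right_distr)
   moreover have "q (rsm s (x \<oplus> rsm t y)) = s * q (x \<oplus> rsm t y)"
    by (rule sublin_scale[OF q]) (use x y s in auto)
   ultimately show ?thesis by (simp only: G_def t right_diff_distrib mult.assoc)
  qed
  thus "EX h:G ` {0..}. ALL x:carrier A. h (rsm s x) <= s * f x" using t s by (intro bexI[of _ "G (s * t)"]) auto
 qed auto
 then obtain p where p: "sublin p" "!!t x. 0 <= t ==> x : carrier A ==> p x <= G t x" by auto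
 have "p x <= q x" if "x : carrier A" for x using p(2)[OF order_refl that] that y by (simp add: G_def)
 moreover have "p (rsm (-1) y) <= - q y"
 proof -
  have "rsm (-1) y \<oplus> rsm 1 y = \<zero>" using smult_left_distr[OF y, of "-1" 1] y by simp
  thus ?thesis using p(2)[of 1 "rsm (-1) y"] y sublin_zero[OF q] by (simp add: G_def)
 qed
 ultimately show ?thesis using p(1) by blast
qed

text \<open>Among the sublinear functionals below a given one, a minimal one is additive.\<close>

lemma sublin_minimal: assumes q0: "sublin q0" shows "EX q. sublin q & (ALL x:carrier A. q x <= q0 x) &
  (ALL p. sublin p & (ALL x:carrier A. p x <= q x) --> p = q)"
proof -
 define S where "S = {q. sublin q & (ALL x:carrier A. q x <= q0 x)}"
 define P where "P q p \<longleftrightarrow> (ALL x:carrier A. p x <= q x)" for q p :: "'a => real"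
 have low: "- q0 (rsm (-1) x) <= q x" if "q : S" "x : carrier A" for q x
 proof -
  have "q (rsm (-1) x) <= q0 (rsm (-1) x)" using that unfolding S_def by (metis (no_types, lifting) mem_Collect_eq smult_cl)
  moreover have "- q (rsm (-1) x) <= q x" using sublin_neg that by (auto simp: S_def)
  ultimately show ?thesis by linarith
 qed
 have po: "partial_order_on S (relation_of P S)"
 proof (rule partial_order_on_relation_ofI)
  fix a b assume "a : S" "b : S" "P a b" "P b a"
  thus "a = b" by (auto simp: P_def S_def fun_eq_iff sublin_out) (metis order_antisym sublin_out)
 qed (force simp: P_def)+
 have "EX m:S. ALL a:S. P m a --> a = m"
 proof (rule predicate_Zorn[OF po])
  fix C assume C: "C : Chains (relation_of P S)"
  have CS: "C \<subseteq> S" and ch: "!!a b. a : C ==> b : C ==> P a b | P b a"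
   using C unfolding Chains_def relation_of_def by auto
  show "EX u:S. ALL a:C. P a u"
  proof (cases "C = {}")
   case True
   thus ?thesis using q0 by (auto simp: S_def)
  next
   case False
   have "EX u. sublin u & (ALL f:C. ALL x:carrier A. u x <= f x)"
   proof (rule sublin_Inf[OF False])
    show "bdd_below ((%f. f x) ` C)" if "x : carrier A" for x
     using low CS that by (intro bdd_belowI[where m="- q0 (rsm (-1) x)"]) auto
    show "EX h:C. ALL x:carrier A. ALL y:carrier A. h (x \<oplus> y) <= f x + g y" if fg: "f : C" "g : C" for f g
    proof -
     obtain q where q: "q : C" "P f q" "P g q" using ch[OF fg] fg unfolding P_def by (metis order_refl)
     have "q (x \<oplus> y) <= f x + g y" if "x : carrier A" "y : carrier A" for x y
      using sublin_add[of q x y] that q CS by (fastforce simp: P_def S_def)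
     thus ?thesis using q(1) by blast
    qed
    show "EX h:C. ALL x:carrier A. h (rsm t x) <= t * f x" if "f : C" "0 < t" for f t
     using that CS unfolding S_def sublin_def by blast
   qed
   then obtain u where "sublin u" and ule: "!!q x. q : C ==> x : carrier A ==> u x <= q x" by blast
   moreover have "u x <= q0 x" if "x : carrier A" for x
   proof -
    obtain q where "q : C" using False by blast
    hence "u x <= q x" "q x <= q0 x" using ule CS that by (auto simp: S_def)
    thus ?thesis by simp
   qed
   ultimately have "u : S" by (simp add: S_def)
   thus ?thesis using ule by (auto simp: P_def)
  qed
 qed
 then obtain q where q: "q : S" "!!a. a : S ==> P q a ==> a = q" by blast
 have "p = q" if "sublin p" "ALL x:carrier A. p x <= q x" for p
 proof (rule q(2))
  show "p : S" using that q(1) unfolding S_def by (auto intro: order_trans)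
 qed (use that in \<open>simp add: P_def\<close>)
 thus ?thesis using q(1) by (auto simp: S_def)
qed

theorem norming_functional: assumes x0: "x0 : carrier A"
 shows "EX ph. bounded_functional A ph & (ALL x:carrier A. cmod (ph x) <= nrm A x) & Re (ph x0) = nrm A x0"
proof -
 define q0 where "q0 x = (if x : carrier A then nrm A x else 0)" for x
 have q0: "sublin q0" unfolding sublin_def by (auto simp: q0_def nrm_triangle nrm_smult)
 \<comment> \<open>Shifting first in the direction of \<open>x0\<close> fixes the value at
   \<open>x0\<close>, before minimality is used to gain linearity.\<close>
 obtain q1 where q1: "sublin q1" "ALL x:carrier A. q1 x <= q0 x" "q1 (rsm (-1) x0) <= - q0 x0"
  using sublin_shift[OF q0 x0] by blast
 obtain f where f: "sublin f" "ALL x:carrier A. f x <= q1 x"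
  and fmin: "!!p. sublin p ==> ALL x:carrier A. p x <= f x ==> p = f" using sublin_minimal[OF q1(1)] by blast
 have neg: "f (rsm (-1) y) = - f y" if y: "y : carrier A" for y
 proof -
  obtain p where p: "sublin p" "ALL x:carrier A. p x <= f x" "p (rsm (-1) y) <= - f y" using sublin_shift[OF f(1) y] by blast
  have "p = f" by (rule fmin) (use p in auto)
  hence "f (rsm (-1) y) <= - f y" using p by simp
  moreover have "- f (rsm (-1) y) <= f y" by (rule sublin_neg[OF f(1) y])
  ultimately show ?thesis by simp
 qed
 have fle: "f x <= nrm A x" if "x : carrier A" for x using f(2) q1(2) that by (auto simp: q0_def intro: order_trans)
 have fadd: "f (x \<oplus> y) = f x + f y" if xy: "x : carrier A" "y : carrier A" for x y
 proof (rule order_antisym[OF sublin_add[OF f(1) xy]])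
  have "(x \<oplus> y) \<oplus> rsm (-1) y = x \<oplus> (y \<oplus> rsm (-1) y)" using xy by (simp add: M.a_assoc)
  also have "... = x" using rsm_neg[OF xy(2)] xy by simp
  finally have "f x <= f (x \<oplus> y) + f (rsm (-1) y)"
   using sublin_add[OF f(1), of "x \<oplus> y" "rsm (-1) y"] xy by simp
  thus "f x + f y <= f (x \<oplus> y)" using neg[OF xy(2)] by simp
 qed
 have fscale: "f (rsm t x) = t * f x" if x: "x : carrier A" for t x
 proof (cases "0 <= t")
  case False
  have "rsm t x = rsm (-1) (rsm (- t) x)" using x by simp
  hence "f (rsm t x) = - f (rsm (- t) x)" using neg[of "rsm (- t) x"] x by simp
  also have "f (rsm (- t) x) = - t * f x" by (rule sublin_scale[OF f(1) x]) (use False in simp)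
  finally show ?thesis by simp
 qed (rule sublin_scale[OF f(1) x])
 have fx0: "f x0 = nrm A x0"
 proof -
  have "f (rsm (-1) x0) <= q1 (rsm (-1) x0)" using f(2) x0 smult_cl by blast
  hence "- f x0 <= - nrm A x0" using q1(3) neg[OF x0] x0 by (simp add: q0_def)
  thus ?thesis using fle[OF x0] by simp
 qed
 \<comment> \<open>The usual complexification: a complex functional is determined by its real part,
   and a rotation by a phase transfers the norm bound.\<close>
 define ph where "ph x = Complex (f x) (- f (\<i> \<odot> x))" for x
 have phadd: "ph (x \<oplus> y) = ph x + ph y" if "x : carrier A" "y : carrier A" for x y
  using that by (simp add: ph_def fadd smult_right_distr complex_eq_iff)
 have phscale: "ph (c \<odot> x) = c * ph x" if x: "x : carrier A" for c x
 proof -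
  have lin: "f (w \<odot> x) = Re w * f x + Im w * f (\<i> \<odot> x)" for w
  proof -
   have "w \<odot> x = rsm (Re w) x \<oplus> rsm (Im w) (\<i> \<odot> x)"
    using x smult_left_distr[OF x, of "of_real (Re w)" "of_real (Im w) * \<i>"]
    by (simp add: complex_eq[of w, symmetric] mult.commute)
   thus ?thesis using x by (simp only: fadd smult_cl fscale)
  qed
  have "f (\<i> \<odot> (c \<odot> x)) = f ((\<i> * c) \<odot> x)" using x by simp
  thus ?thesis using lin[of c] lin[of "\<i> * c"] by (simp add: ph_def complex_eq_iff)
 qed
 have phle: "cmod (ph x) <= nrm A x" if x: "x : carrier A" for x
 proof (cases "ph x = 0")
  case False
  define c where "c = cnj (ph x) / of_real (cmod (ph x))"
  have "cmod c = 1" using False by (simp add: c_def norm_divide)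
  have "ph (c \<odot> x) = of_real (cmod (ph x))"
   using False by (simp add: phscale[OF x] c_def complex_norm_square[symmetric] power2_eq_square mult.commute)
  hence "cmod (ph x) = f (c \<odot> x)" by (metis Re_complex_of_real ph_def complex.sel(1))
  also have "... <= nrm A (c \<odot> x)" by (rule fle) (use x in simp)
  finally show ?thesis using x \<open>cmod c = 1\<close> by (simp add: nrm_smult)
 qed (use nrm_ge0 x in simp)
 have "bounded_functional A ph" unfolding bounded_functional_def using phadd phscale phle by (auto intro!: exI[of _ 1])
 thus ?thesis using phle fx0 by (auto simp: ph_def)
qed

lemma bounded_functional_zero: "bounded_functional A ph ==> ph \<zero> = 0"
 unfolding bounded_functional_def by (metis M.zero_closed mult_zero_left smult_zero_right)

lemma bounded_functional_diff:
 "bounded_functional A ph ==> x : carrier A ==> y : carrier A ==> ph (x \<ominus> y) = ph x - ph y"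
 by (simp add: bounded_functional_def minus_smult)

lemma bounded_functional_bound: assumes ph: "bounded_functional A ph"
 shows "EX K>0. ALL x:carrier A. ALL y:carrier A. cmod (ph x - ph y) <= K * nrm A (x \<ominus> y)"
proof -
 obtain K where K: "!!x. x : carrier A ==> cmod (ph x) <= K * nrm A x" using ph unfolding bounded_functional_def by blast
 have "cmod (ph x - ph y) <= (\<bar>K\<bar> + 1) * nrm A (x \<ominus> y)" if xy: "x : carrier A" "y : carrier A" for x y
  using order_trans[OF K[of "x \<ominus> y"] mult_right_mono[of K "\<bar>K\<bar> + 1"]] nrm_ge0[of "x \<ominus> y"]
   bounded_functional_diff[OF ph xy] xy by simp
 thus ?thesis by (intro exI[of _ "\<bar>K\<bar> + 1"]) simp
qed

lemma continuous_functional_comp: assumes ph: "bounded_functional A ph" and k: "cmap A k" shows "cts (%t. ph (k t))"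
proof -
 obtain K where K: "!!x y. x : carrier A ==> y : carrier A ==> cmod (ph x - ph y) <= K * nrm A (x \<ominus> y)"
  using bounded_functional_bound[OF ph] by metis
 have "((%s. ph (k s) - ph (k t)) \<longlongrightarrow> 0) (nhds t)" for t
  by (rule Lim_null[OF _ tendsto_mult_right_zero[OF cmapD(2)[OF k], of K]])
   (metis K cmapD(1)[OF k] norm_minus_commute)
 thus ?thesis unfolding cts_nhds by (auto intro: LIM_zero_cancel)
qed

lemma functional_separates: assumes "x : carrier A" "y : carrier A" "!!ph. bounded_functional A ph ==> ph x = ph y"
 shows "x = y"
proof -
 obtain ph where ph: "bounded_functional A ph" "Re (ph (x \<ominus> y)) = nrm A (x \<ominus> y)"
  using norming_functional[of "x \<ominus> y"] assms by auto
 have "nrm A (x \<ominus> y) = 0" using bounded_functional_diff[OF ph(1) assms(1,2)] assms(3)[OF ph(1)] ph(2) by simp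
 thus ?thesis using nrm_eq_zero minus_eq_zero assms by auto
qed

end

section \<open>Haar integrals and weak integrals\<close>

definition cc :: "('g :: t2_space => 'b :: real_normed_vector) => bool"
 where "cc F \<longleftrightarrow> cts F & (EX K. compact K & (ALL t. t ~: K --> F t = 0))"

lemma ccE: assumes "cc F"
 obtains K where "compact K" "!!t. t ~: K ==> F t = 0" "cts F" using assms by (auto simp: cc_def)

lemma cc_bounded: assumes "cc F" shows "EX C>=0. ALL t. norm (F t) <= C"
proof -
 obtain K where K: "compact K" "!!t. t ~: K ==> F t = 0" "cts F" using ccE[OF assms] by metis
 have "compact (F ` K)" using K by (intro compact_continuous_image) (auto intro: continuous_on_subset)
 then obtain C where "!!t. t : K ==> norm (F t) <= C" using compact_imp_bounded[of "F ` K"] by (auto simp: bounded_iff)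
 thus ?thesis using K(2) by (intro exI[of _ "max 0 C"]) (metis max.cobounded1 max.coboundedI2 norm_zero)
qed

text \<open>Disjoint Borel pieces subordinate to a choice of neighbourhoods: the partitions for all
  Riemann sums below.\<close>

lemma compact_partition:
 fixes K :: "'g :: t2_space set" assumes K: "compact K" and U: "!!s. s : K ==> open (U s) & s : U s"
 shows "EX (m :: nat) p E. (ALL i<m. p i : K & E i \<subseteq> U (p i) \<inter> K & E i : sets borel) &
  disjoint_family_on E {..<m} & (\<Union>i<m. E i) = K"
proof -
 obtain T where T: "T \<subseteq> K" "finite T" "K \<subseteq> (\<Union>s\<in>T. U s)"
  using compactE_image[OF K, of K U] U by (metis UN_I subsetI)
 obtain h where h: "bij_betw h {..<card T} T" using ex_bij_betw_nat_finite[OF T(2)] by (auto simp: atLeast0LessThan)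
 define V where "V i = U (h i) \<inter> K" for i
 define E where "E i = V i - (\<Union>j<i. V j)" for i
 have hT: "h i : T" if "i < card T" for i using h that by (auto simp: bij_betw_def)
 have V: "V i : sets borel" if "i < card T" for i
  using hT[OF that] T(1) U[of "h i"] compact_imp_closed[OF K] by (auto simp: V_def)
 have "E i : sets borel" if "i < card T" for i using V that by (auto simp: E_def)
 moreover have "disjoint_family_on E {..<card T}" unfolding disjoint_family_on_def
 proof (intro ballI impI)
  fix i j :: nat assume "i ~= j"
  thus "E i \<inter> E j = {}" unfolding E_def by (cases "i < j") (auto simp: not_less_iff_gr_or_eq)
 qed
 moreover have "(\<Union>i<card T. E i) = K"
 proof
  show "K \<subseteq> (\<Union>i<card T. E i)"
  proof
   fix x assume "x : K"
   then obtain s where "s : T" "x : U s" using T(3) by blast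
   then obtain i where "i < card T & x : V i" using h \<open>x : K\<close> by (force simp: bij_betw_def V_def)
   then obtain i where i: "i < card T & x : V i" "!!j. j < i ==> ~ (j < card T & x : V j)"
    using exists_least_iff[of "%i. i < card T & x : V i"] by blast
   hence "x : E i" by (auto simp: E_def)
   thus "x : (\<Union>i<card T. E i)" using i by blast
  qed
 qed (auto simp: E_def V_def)
 moreover have "h i : K & E i \<subseteq> U (h i) \<inter> K" if "i < card T" for i
  using hT[OF that] T(1) by (auto simp: E_def V_def)
 ultimately show ?thesis by (intro exI[of _ "card T"] exI[of _ h] exI[of _ E]) auto
qed

lemma continuous_on_curried: assumes "cts (%(s, t). F s t)" "cts f" "cts g" shows "cts (%x. F (f x) (g x))"
 using continuous_on_compose2[OF assms(1) continuous_on_Pair[OF assms(2,3)]] by simp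

text \<open>The tube lemma: compactness of \<open>L\<close> makes continuity in the first variable
  uniform in the second.\<close>

lemma tube_uniform:
 fixes F :: "'g :: topological_space => 'h :: topological_space => complex"
 assumes F: "cts (%(s, t). F s t)" and L: "compact L" and "0 < ep"
 shows "EX U. open U & s0 : U & (ALL s:U. ALL t:L. cmod (F s t - F s0 t) < ep)"
proof -
 define W where "W = {st. cmod (F (fst st) (snd st) - F s0 (snd st)) < ep}"
 have "cts (%st :: 'g \<times> 'h. F s0 (snd st))" by (rule continuous_on_curried[OF F]) (intro continuous_intros)+
 hence "open W" using F unfolding W_def by (intro open_Collect_less continuous_intros) (auto simp: case_prod_beta')
 moreover have "{s0} \<times> L \<subseteq> W" using \<open>0 < ep\<close> by (auto simp: W_def)
 ultimately obtain U where "s0 : U" "open U" "U \<times> L \<subseteq> W"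
  using Elementary_Topology.tube_lemma[OF L, of W s0] by auto
 thus ?thesis unfolding W_def by (intro exI[of _ U]) auto
qed

locale haar =
 fixes mu :: "'g :: {topological_ab_group_add, t2_space} measure" assumes haar: "haar_measure mu"
begin

lemma sets_mu [simp]: "sets mu = sets borel" using haar by (simp add: haar_measure_def)

lemma space_mu [simp]: "space mu = UNIV" using sets_eq_imp_space_eq[OF sets_mu] by simp

lemma measurable_mu [measurable]: "cts F ==> F : measurable mu borel"
 using borel_measurable_continuous_onI measurable_cong_sets[OF sets_mu refl] by blast

lemma finite_compact: "compact K ==> emeasure mu K < \<infinity>" using haar by (simp add: haar_measure_def)

lemma compact_sets: "compact K ==> K : sets mu" by (simp add: compact_imp_closed)

lemma integrable_supp:
 fixes F :: "'g => 'b :: {banach, second_countable_topology}"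
 assumes "F : borel_measurable mu" "compact K" "!!t. t ~: K ==> F t = 0" "!!t. norm (F t) <= C" shows "integrable mu F"
 by (rule integrableI_bounded_set[of K _ _ C]) (use assms finite_compact compact_sets in auto)

lemma integrable_cc:
 fixes F :: "'g => 'b :: {banach, second_countable_topology}" assumes "cc F" shows "integrable mu F"
proof -
 obtain C where "!!t. norm (F t) <= C" using cc_bounded[OF assms] by blast
 thus ?thesis using assms by (auto elim!: ccE intro!: integrable_supp measurable_mu)
qed

lemma integral_bound_supp:
 fixes F :: "'g => complex" assumes "integrable mu F" "compact K" "!!t. t ~: K ==> F t = 0" "!!t. cmod (F t) <= C"
 shows "cmod (lint mu F) <= C * measure mu K"
proof -
 have K: "K : sets mu" "emeasure mu K < \<infinity>" using assms compact_sets finite_compact by auto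
 have "0 <= C" using order_trans[OF norm_ge_zero assms(4)[of undefined]] .
 have "cmod (lint mu F) <= lint mu (%t. cmod (F t))" by (rule integral_norm_bound)
 also have "... <= lint mu (%t. C * indicator K t)"
 proof (rule integral_mono)
  show "integrable mu (%t. cmod (F t))" using assms(1) by simp
  show "integrable mu (%t. C * indicator K t)" using K by simp
  show "cmod (F t) <= C * indicator K t" for t using assms(3)[of t] assms(4)[of t] by (cases "t : K") auto
 qed
 finally show ?thesis using K by simp
qed

lemma distr_translate: "distr mu mu (%s. t + s) = mu"
proof (rule measure_eqI)
 fix E assume "E : sets (distr mu mu (%s. t + s))"
 hence E: "E : sets borel" by simp
 have m: "(%s. t + s) : measurable mu mu"
  unfolding measurable_cong_sets[OF refl sets_mu] by (rule measurable_mu) (intro continuous_intros)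
 have "(%s. t + s) -` E = (+) (- t) ` E"
  by (auto simp: image_iff) (metis add.commute add_diff_cancel_left' minus_add_cancel uminus_add_conv_diff)
 hence "emeasure (distr mu mu (%s. t + s)) E = emeasure mu ((+) (- t) ` E)" using E by (simp add: emeasure_distr[OF m])
 also have "... = emeasure mu E" using haar E unfolding haar_measure_def by blast
 finally show "emeasure (distr mu mu (%s. t + s)) E = emeasure mu E" .
qed simp

lemma integral_translate:
 fixes F :: "'g => 'b :: {banach, second_countable_topology}" assumes "F : borel_measurable mu"
 shows "lint mu (%s. F (t + s)) = lint mu F"
proof -
 have m: "(%s. t + s) : measurable mu mu"
  unfolding measurable_cong_sets[OF refl sets_mu] by (rule measurable_mu) (intro continuous_intros)
 show ?thesis using integral_distr[OF m assms] by (simp add: distr_translate)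
qed

lemma riemann_sum:
 fixes F :: "'g => complex" and m :: nat assumes F: "integrable mu F" and K: "compact K" and F0: "!!t. t ~: K ==> F t = 0"
  and E: "!!i. i < m ==> E i : sets borel" "disjoint_family_on E {..<m}" "(\<Union>i<m. E i) = K"
  and close: "!!i s. i < m ==> s : E i ==> cmod (F s - c i) <= ep" and "0 <= ep"
 shows "cmod (lint mu F - (\<Sum>i<m. of_real (measure mu (E i)) * c i)) <= ep * measure mu K"
proof -
 have fin: "emeasure mu (E i) < \<infinity>" if "i < m" for i
 proof -
  have "E i \<subseteq> K" using E(3) that by blast
  from order.strict_trans1[OF emeasure_mono[OF this compact_sets[OF K]] finite_compact[OF K]]
  show ?thesis .
 qed
 have int: "integrable mu (%s. indicator (E i) s *\<^sub>R c i)" if "i < m" for i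
  using E fin that by (intro integrable_scaleR_left integrable_real_indicator) auto
 have ind: "indicator (E i) s *\<^sub>R c i = (if s : E i then c i else 0)" for i s by (simp add: indicator_def)
 have one: "(\<Sum>i<m. indicator (E i) s *\<^sub>R c i) = c j" if "j < m" "s : E j" for j s
 proof -
  have "s ~: E i" if "i < m" "i ~= j" for i
   using E(2) that \<open>j < m\<close> \<open>s : E j\<close> by (auto simp: disjoint_family_on_def)
  hence "(\<Sum>i<m. indicator (E i) s *\<^sub>R c i) = (\<Sum>i<m. if i = j then c j else 0)"
   unfolding ind by (intro sum.cong) (use that in auto)
  also have "... = c j" using \<open>j < m\<close> sum.delta[of "{..<m}" j "%_. c j"] by simp
  finally show ?thesis .
 qed
 have out: "(\<Sum>i<m. indicator (E i) s *\<^sub>R c i) = 0" if "s ~: K" for s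
  using that E(3) by (intro sum.neutral) (auto simp: ind)
 have "lint mu (%s. \<Sum>i<m. indicator (E i) s *\<^sub>R c i) = (\<Sum>i<m. of_real (measure mu (E i)) * c i)"
  using int E fin by (subst Bochner_Integration.integral_sum) (auto intro!: sum.cong simp: scaleR_conv_of_real)
 moreover have intS: "integrable mu (%s. \<Sum>i<m. indicator (E i) s *\<^sub>R c i)"
  using int by (intro Bochner_Integration.integrable_sum) auto
 ultimately have "lint mu F - (\<Sum>i<m. of_real (measure mu (E i)) * c i)
   = lint mu (%s. F s - (\<Sum>i<m. indicator (E i) s *\<^sub>R c i))" using F by simp
 also have "cmod ... <= ep * measure mu K"
 proof (rule integral_bound_supp[OF _ K])
  show "integrable mu (%s. F s - (\<Sum>i<m. indicator (E i) s *\<^sub>R c i))" using F intS by simp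
  show "F s - (\<Sum>i<m. indicator (E i) s *\<^sub>R c i) = 0" if "s ~: K" for s using F0 out that by simp
  show "cmod (F s - (\<Sum>i<m. indicator (E i) s *\<^sub>R c i)) <= ep" for s
  proof (cases "s : K")
   case True
   then obtain j where j: "j < m" "s : E j" using E(3) by auto
   thus ?thesis using close one by simp
  qed (use F0 out \<open>0 <= ep\<close> in simp)
 qed
 finally show ?thesis .
qed

text \<open>Haar measure need not be sigma-finite, and the Borel sets of a product may exceed the
  product sigma-algebra, so product measures are avoided. For a continuous kernel with compact
  support both iterated integrals are close to the same Riemann sum over a partition of
  \<open>K\<close>.\<close>

lemma
 fixes F :: "'g => 'g => complex" assumes F: "cts (%(s, t). F s t)" and K: "compact K" and L: "compact L"
  and F0: "!!s t. s ~: K | t ~: L ==> F s t = 0" shows cc_partial_integral: "cc (%s. lint mu (F s))"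
  and fubini_cc: "lint mu (%s. lint mu (F s)) = lint mu (%t. lint mu (%s. F s t))"
proof -
 have gen: "cc (%s. lint mu (F s))"
  if F: "cts (%(s, t). F s t)" and K: "compact K" and L: "compact L"
  and F0: "!!s t. s ~: K | t ~: L ==> F s t = 0" for F :: "'g => 'g => complex" and K L
 proof -
  have "cts (%t. F s t)" for s by (rule continuous_on_curried[OF F]) (intro continuous_intros)+
  hence c1: "cc (F s)" for s unfolding cc_def using L F0[of s] by blast
  have "((%s. lint mu (F s)) \<longlongrightarrow> lint mu (F s0)) (nhds s0)" for s0 unfolding tendsto_iff
  proof (intro allI impI)
   fix ep :: real assume "0 < ep"
   then obtain de where d: "0 < de" "de * measure mu L < ep" by (rule small_factor[OF _ measure_nonneg])
   obtain U where U: "open U" "s0 : U" "!!s t. s : U ==> t : L ==> cmod (F s t - F s0 t) < de"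
    using tube_uniform[OF F L d(1)] by metis
   have "dist (lint mu (F s)) (lint mu (F s0)) < ep" if "s : U" for s
   proof -
    have "lint mu (F s) - lint mu (F s0) = lint mu (%t. F s t - F s0 t)" using integrable_cc[OF c1] by simp
    also have "cmod ... <= de * measure mu L"
    proof (rule integral_bound_supp[OF _ L])
     show "integrable mu (%t. F s t - F s0 t)" using integrable_cc[OF c1] by simp
     show "cmod (F s t - F s0 t) <= de" for t using U(3)[OF that, of t] F0[of _ t] d by (cases "t : L") auto
    qed (use F0 in simp)
    finally show ?thesis using d(2) by (simp add: dist_norm)
   qed
   thus "\<forall>\<^sub>F s in nhds s0. dist (lint mu (F s)) (lint mu (F s0)) < ep"
    using U(1,2) by (auto simp: eventually_nhds)
  qed
  hence "cts (%s. lint mu (F s))" unfolding cts_nhds by blast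
  moreover have "lint mu (F s) = 0" if "s ~: K" for s
  proof -
   have "F s = (%t. 0)" using F0[of s] that by blast
   thus ?thesis by simp
  qed
  ultimately show ?thesis using K by (auto simp: cc_def)
 qed
 show c1: "cc (%s. lint mu (F s))" by (rule gen[OF F K L F0])
 have F': "cts (%(t, s). F s t)" unfolding case_prod_beta' by (rule continuous_on_curried[OF F]) (intro continuous_intros)+
 have c2: "cc (%t. lint mu (%s. F s t))" by (rule gen[OF F' L K]) (use F0 in auto)
 have "cts (%t. F s t)" for s by (rule continuous_on_curried[OF F]) (intro continuous_intros)+
 hence cs: "cc (F s)" for s unfolding cc_def using L F0[of s] by blast
 have "cts (%s. F s t)" for t by (rule continuous_on_curried[OF F]) (intro continuous_intros)+
 hence ct: "cc (%s. F s t)" for t unfolding cc_def using K F0[of _ t] by blast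
 let ?l = "lint mu (%s. lint mu (F s))" and ?r = "lint mu (%t. lint mu (%s. F s t))"
 have est: "cmod (?l - ?r) <= ep * (2 * measure mu L * measure mu K)" if e: "0 < ep" for ep
 proof -
  obtain U where U: "!!s0. open (U s0) & s0 : U s0" and Uc: "!!s0 s t. s : U s0 ==> t : L ==> cmod (F s t - F s0 t) < ep"
   using tube_uniform[OF F L e] by metis
  obtain m p E where mpE: "!!i. i < (m :: nat) ==> p i : K & E i \<subseteq> U (p i) \<inter> K & E i : sets borel"
   "disjoint_family_on E {..<m}" "(\<Union>i<m. E i) = K" using compact_partition[OF K, of U] U by metis
  have Fc: "cmod (F s t - F (p i) t) <= ep" if "i < m" "s : E i" for i s t
   using mpE(1)[OF that(1)] that Uc[of s "p i" t] F0[of _ t] e by (cases "t : L") (auto simp: less_imp_le)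
  have int0: "lint mu (F s) = 0" if "s ~: K" for s
  proof -
   have "F s = (%t. 0)" using F0[of s] that by blast
   thus ?thesis by simp
  qed
  have mE: "0 <= ep * measure mu L" using e by simp
  have l: "cmod (?l - (\<Sum>i<m. of_real (measure mu (E i)) * lint mu (F (p i)))) <= (ep * measure mu L) * measure mu K"
  proof (rule riemann_sum[OF integrable_cc[OF c1] K int0 _ mpE(2,3) _ mE])
   show "E i : sets borel" if "i < m" for i using mpE(1)[OF that] by blast
   fix i s assume i: "i < m" "s : E i"
   have "lint mu (F s) - lint mu (F (p i)) = lint mu (%t. F s t - F (p i) t)" using integrable_cc[OF cs] by simp
   also have "cmod ... <= ep * measure mu L"
    by (rule integral_bound_supp[OF _ L]) (use integrable_cc[OF cs] F0 Fc[OF i] in auto)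
   finally show "cmod (lint mu (F s) - lint mu (F (p i))) <= ep * measure mu L" .
  qed
  have "lint mu (%t. \<Sum>i<m. of_real (measure mu (E i)) * F (p i) t)
    = (\<Sum>i<m. of_real (measure mu (E i)) * lint mu (F (p i)))"
   using integrable_cc[OF cs] by (subst Bochner_Integration.integral_sum) auto
  moreover have iS: "integrable mu (%t. \<Sum>i<m. of_real (measure mu (E i)) * F (p i) t)"
   using integrable_cc[OF cs] by (intro Bochner_Integration.integrable_sum integrable_mult_right)
  ultimately have "?r - (\<Sum>i<m. of_real (measure mu (E i)) * lint mu (F (p i)))
    = lint mu (%t. lint mu (%s. F s t) - (\<Sum>i<m. of_real (measure mu (E i)) * F (p i) t))"
   using integrable_cc[OF c2] by simp
  also have "cmod ... <= (ep * measure mu K) * measure mu L"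
  proof (rule integral_bound_supp[OF _ L])
   show "cmod (lint mu (%s. F s t) - (\<Sum>i<m. of_real (measure mu (E i)) * F (p i) t)) <= ep * measure mu K" for t
    by (rule riemann_sum[OF integrable_cc[OF ct] K _ _ mpE(2,3) Fc less_imp_le[OF e]])
     (use mpE(1) F0 in auto)
  qed (use integrable_cc[OF c2] iS F0 in auto)
  finally have r: "cmod (?r - (\<Sum>i<m. of_real (measure mu (E i)) * lint mu (F (p i)))) <= ep * measure mu K * measure mu L" .
  have "cmod (?l - ?r) <= (ep * measure mu L) * measure mu K + ep * measure mu K * measure mu L"
   by (rule norm_diff_triangle_le[OF l]) (subst norm_minus_commute, rule r)
  thus ?thesis by (simp add: algebra_simps)
 qed
 have "cmod (?l - ?r) <= 0" by (rule le_0_I[OF est]) auto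
 thus "?l = ?r" by simp
qed

end

section \<open>Compactly supported functions on a locally compact group\<close>

lemma cc_add: "cc F ==> cc G ==> cc (%t. F t + G t)"
proof (elim ccE)
 fix K L
 assume "compact K" "compact L" "cts F" "cts G" "!!t. t ~: K ==> F t = 0" "!!t. t ~: L ==> G t = 0"
 thus ?thesis unfolding cc_def by (intro conjI exI[of _ "K \<union> L"] continuous_on_add) auto
qed

lemma cc_mult:
 fixes F G :: "'g :: t2_space => 'b :: real_normed_algebra" assumes "cts G" "cc F" shows "cc (%t. G t * F t)"
 using assms unfolding cc_def by (auto intro!: continuous_on_mult)

lemma cc_of_real: "cc F ==> cc (%t. cre (F t))" unfolding cc_def by (auto intro!: continuous_on_of_real)

lemma compact_sum:
 fixes K L :: "'g :: {topological_ab_group_add, t2_space} set" assumes "compact K" "compact L"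
 shows "compact {s + t |s t. s : K & t : L}"
proof -
 have "compact ((%(s, t). s + t) ` (K \<times> L))" using assms by (intro compact_continuous_image compact_Times)
   (auto simp: case_prod_beta' intro!: continuous_intros)
 moreover have "(%(s, t). s + t) ` (K \<times> L) = {s + t |s t. s : K & t : L}" by auto
 ultimately show ?thesis by simp
qed

lemma compact_uminus:
 fixes K :: "'g :: {topological_ab_group_add, t2_space} set" shows "compact K ==> compact (uminus ` K)"
 by (intro compact_continuous_image continuous_intros)

lemma cc_uminus:
 fixes F :: "'g :: {topological_ab_group_add, t2_space} => 'b :: real_normed_vector" assumes "cc F" shows "cc (%t. F (- t))"
proof -
 obtain K where K: "compact K" "!!t. t ~: K ==> F t = 0" "cts F" using ccE[OF assms] by metis
 have "cts (%t. F (- t))" by (rule continuous_on_compose2[OF K(3)]) (auto intro!: continuous_intros)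
 moreover have "F (- t) = 0" if "t ~: uminus ` K" for t using that by (intro K(2)) (metis add.inverse_inverse imageI)
 ultimately show ?thesis using compact_uminus[OF K(1)] by (auto simp: cc_def)
qed

text \<open>Locally compact Hausdorff spaces are completely regular. Separating \<open>x\<close>
  from the complement of \<open>U \<inter> V\<close>, with \<open>V\<close> inside a compact set,
  gives compact support at the same time.\<close>

lemma bump:
 fixes x :: "'g :: {topological_ab_group_add, t2_space}"
 assumes lc: "locally_compact_space (euclidean :: 'g topology)" and U: "open U" "x : U"
 shows "EX b :: 'g => real. cc b & (ALL t. 0 <= b t & b t <= 1) & b x = 1 & (ALL t. t ~: U --> b t = 0)"
proof -
 have "ALL x :: 'g. EX U. open U & (EX K. compact K & x : U & U \<subseteq> K)"
  using lc unfolding locally_compact_space_def by (simp add: compactin_euclidean_iff)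
 from spec[OF this, of x] obtain V K where V: "open V" "compact K" "x : V" "V \<subseteq> K" by (elim exE conjE) (rule that)
 have "Hausdorff_space (euclidean :: 'g topology)"
  unfolding Hausdorff_space_def disjnt_def using hausdorff[where 'a='g] by simp
 hence "completely_regular_space (euclidean :: 'g topology)"
  by (intro locally_compact_regular_imp_completely_regular_space[OF lc]) simp
 moreover have "closedin euclidean (- (U \<inter> V))" using U V by (simp add: open_Int closed_open)
 moreover have "x : topspace euclidean - (- (U \<inter> V))" using U V by simp
 ultimately obtain f :: "'g => real" where f: "continuous_map euclidean (top_of_set {0..1}) f" "f x = 0"
   "f ` (- (U \<inter> V)) \<subseteq> {1}" unfolding completely_regular_space_def by blast
 have f01: "0 <= f t & f t <= 1" for t using f(1) by (auto simp: continuous_map_in_subtopology)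
 have fc: "cts f" using f(1) by (auto simp: continuous_map_in_subtopology)
 have f1: "f t = 1" if "t ~: U | t ~: V" for t using f(3) that by blast
 have "cc (%t. 1 - f t)" unfolding cc_def using V f1 fc by (intro conjI exI[of _ K] continuous_intros) auto
 thus ?thesis using f01 f(2) f1 by (intro exI[of _ "%t. 1 - f t"]) auto
qed

lemma bump_compact:
 fixes K :: "'g :: {topological_ab_group_add, t2_space} set"
 assumes lc: "locally_compact_space (euclidean :: 'g topology)" and K: "compact K"
 shows "EX b :: 'g => real. cc b & (ALL t. 0 <= b t) & (ALL t:K. 1 <= b t)"
proof -
 have "ALL x. EX b :: 'g => real. cc b & (ALL t. 0 <= b t) & b x = 1" using bump[OF lc open_UNIV] by blast
 then obtain b :: "'g => 'g => real" where b: "!!x. cc (b x)" "!!x t. 0 <= b x t" "!!x. b x x = 1" by metis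
 have "open {t. 1/2 < b x t}" for x using b(1)[of x] by (intro open_Collect_less) (auto simp: cc_def)
 moreover have "K \<subseteq> (\<Union>x\<in>K. {t. 1/2 < b x t})"
 proof
  fix x assume "x : K"
  thus "x : (\<Union>x\<in>K. {t. 1/2 < b x t})" using b(3)[of x] by (intro UN_I[of x]) auto
 qed
 ultimately obtain T where T: "T \<subseteq> K" "finite T" "K \<subseteq> (\<Union>x\<in>T. {t. 1/2 < b x t})"
  using compactE_image[OF K, of K "%x. {t. 1/2 < b x t}"] by metis
 define f where "f t = (\<Sum>x\<in>T. 2 * b x t)" for t
 have "cc (%t. \<Sum>x\<in>T. 2 * b x t)" using T(2)
 proof (induction T rule: finite_induct)
  case empty thus ?case by (simp add: cc_def exI[of _ "{}"])
 next
  case (insert x F)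
  have "cc (%t. 2 * b x t)" by (rule cc_mult[OF _ b(1)]) (rule continuous_intros)
  thus ?case using insert by (simp add: cc_add)
 qed
 moreover have "0 <= f t" for t using b(2) by (simp add: f_def sum_nonneg)
 moreover have "1 <= f t" if t: "t : K" for t
 proof -
  obtain x where x: "x : T" "1/2 < b x t" using subsetD[OF T(3) t] by blast
  have "2 * b x t <= f t" unfolding f_def by (rule member_le_sum) (use x T b in auto)
  thus ?thesis using x by simp
 qed
 ultimately show ?thesis unfolding f_def by blast
qed

locale lc_haar = haar mu for mu :: "'g :: {topological_ab_group_add, t2_space} measure" +
 assumes lc: "locally_compact_space (euclidean :: 'g topology)"
begin

text \<open>Inner regularity provides a compact set of positive measure, and a compactly supported
  function dominates its indicator.\<close>

lemma positive_cc: "EX b :: 'g => real. cc b & (ALL t. 0 <= b t) & 0 < lint mu b"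
proof -
 have "emeasure mu UNIV = (SUP K\<in>{K. compact K & K \<subseteq> UNIV}. emeasure mu K)" "emeasure mu UNIV ~= 0"
  using haar unfolding haar_measure_def by blast+
 then obtain K where K: "compact K" "emeasure mu K ~= 0"
  by (metis (mono_tags, lifting) SUP_bot_conv(1) bot_ennreal mem_Collect_eq)
 obtain b :: "'g => real" where b: "cc b" "!!t. 0 <= b t" "!!t. t : K ==> 1 <= b t" using bump_compact[OF lc K(1)] by blast
 have Ks: "K : sets mu" "emeasure mu K < \<infinity>" using K compact_sets finite_compact by auto
 have "0 < measure mu K" using K(2) Ks(2) by (simp add: measure_def enn2real_positive_iff zero_less_iff_neq_zero)
 also have "measure mu K = lint mu (indicator K)" using Ks by simp
 also have "... <= lint mu b"
 proof (rule integral_mono)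
  show "integrable mu b" by (rule integrable_cc[OF b(1)])
  show "indicator K t <= b t" for t using b by (auto simp: indicator_def)
 qed (use Ks in simp)
 finally show ?thesis using b by blast
qed

text \<open>Inversion invariance without uniqueness of Haar measure: compute
 \<open>\<integral>\<integral> ph (s + t) F (-t)\<close> in two ways.\<close>

lemma integral_uminus:
 fixes F :: "'g => complex" assumes "cc F" shows "lint mu (%t. F (- t)) = lint mu F"
proof -
 obtain b :: "'g => real" where b: "cc b" "0 < lint mu b" using positive_cc by blast
 define ph where "ph = (%t. cre (b t))"
 have ph: "cc ph" unfolding ph_def by (rule cc_of_real[OF b(1)])
 have ph0: "lint mu ph ~= 0" using b by (simp add: ph_def)
 obtain K where K: "compact K" "!!t. t ~: K ==> F t = 0" "cts F" using ccE[OF assms] by metis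
 obtain L where L: "compact L" "!!t. t ~: L ==> ph t = 0" "cts ph" using ccE[OF ph] by metis
 define S where "S = {s + t |s t. s : L & t : K}"
 have S: "compact S" unfolding S_def by (rule compact_sum[OF L(1) K(1)])
 have c: "cts (%x. ph (f x))" "cts (%x. F (f x))"
  if "cts f" for f :: "'g \<times> 'g => 'g"
  using continuous_on_compose2[OF L(3) that] continuous_on_compose2[OF K(3) that] by auto
 have "lint mu (%s. lint mu (%t. ph (s + t) * F (- t))) = lint mu (%t. lint mu (%s. ph (s + t) * F (- t)))"
 proof (rule fubini_cc[OF _ S compact_uminus[OF K(1)]])
  show "cts (%(s, t). ph (s + t) * F (- t))" unfolding case_prod_beta' by (intro continuous_intros c)
  fix s t assume st: "s ~: S | t ~: uminus ` K"
  show "ph (s + t) * F (- t) = 0"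
  proof (rule ccontr)
   assume nz: "ph (s + t) * F (- t) ~= 0"
   hence "s + t : L" "- t : K" using L(2) K(2) by auto
   moreover have "s = (s + t) + (- t)" by simp
   ultimately have "s : S" "t : uminus ` K" unfolding S_def by (blast, force)
   thus False using st by blast
  qed
 qed
 also have "... = lint mu (%t. lint mu ph * F (- t))"
 proof -
  have "lint mu (%s. ph (s + t)) = lint mu ph" for t
   using integral_translate[OF measurable_mu[OF L(3)], of t] by (simp add: add.commute)
  thus ?thesis by simp
 qed
 finally have 1: "lint mu (%s. lint mu (%t. ph (s + t) * F (- t))) = lint mu ph * lint mu (%t. F (- t))" by simp
 \<comment> \<open>Replacing \<open>t\<close> by \<open>t - s\<close> turns the same double integral
   into one whose inner integral over \<open>s\<close> is that of \<open>F\<close> itself.\<close>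
 have "lint mu (%t. ph (s + t) * F (- t)) = lint mu (%t. ph t * F (s - t))" for s
 proof -
  have "cts (%t. ph (s + t) * F (- t))"
   by (intro continuous_intros continuous_on_compose2[OF L(3)] continuous_on_compose2[OF K(3)]) auto
  from integral_translate[OF measurable_mu[OF this], of "- s"] show ?thesis by simp
 qed
 hence "lint mu (%s. lint mu (%t. ph (s + t) * F (- t))) = lint mu (%s. lint mu (%t. ph t * F (s - t)))" by simp
 also have "... = lint mu (%t. lint mu (%s. ph t * F (s - t)))"
 proof (rule fubini_cc[OF _ S L(1)])
  show "cts (%(s, t). ph t * F (s - t))" unfolding case_prod_beta' by (intro continuous_intros c)
  fix s t assume st: "s ~: S | t ~: L"
  show "ph t * F (s - t) = 0"
  proof (rule ccontr)
   assume nz: "ph t * F (s - t) ~= 0"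
   hence "t : L" "s - t : K" using L(2) K(2) by auto
   moreover have "s = t + (s - t)" by simp
   ultimately have "s : S" "t : L" unfolding S_def by blast+
   thus False using st by blast
  qed
 qed
 also have "... = lint mu (%t. ph t * lint mu F)"
 proof -
  have "lint mu (%s. F (s - t)) = lint mu F" for t using integral_translate[OF measurable_mu[OF K(3)], of "- t"] by simp
  thus ?thesis by simp
 qed
 finally have "lint mu ph * lint mu (%t. F (- t)) = lint mu ph * lint mu F" unfolding 1 by simp
 thus ?thesis using ph0 by simp
qed

end

section \<open>Integrals of algebra-valued functions\<close>

context haar
begin

lemma weak_integral_exists: assumes A: "cstar_algebra A" and k: "cmap A k"
  and K: "compact K" and k0: "!!t. t ~: K ==> k t = \<zero>\<^bsub>A\<^esub>"
 shows "EX x:carrier A. ALL ph. bounded_functional A ph --> lint mu (%s. ph (k s)) = ph x"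
proof -
 interpret cstar_algebra A by fact
 have kc: "k t : carrier A" for t by (rule cmapD(1)[OF k])
 have ccf: "cc (%s. ph (k s))" if "bounded_functional A ph" for ph
  unfolding cc_def using K k0 continuous_functional_comp[OF that k] bounded_functional_zero[OF that]
  by (intro conjI exI[of _ K]) auto
 have comb: "EX x:carrier A. ALL ph. bounded_functional A ph --> ph x = (\<Sum>i<m. of_real (c i) * ph (k (p i)))"
  for m :: nat and c and p
 proof (induction m)
  case 0
  thus ?case using bounded_functional_zero by (intro bexI[of _ "\<zero>\<^bsub>A\<^esub>"]) auto
 next
  case (Suc m)
  then obtain x where x: "x : carrier A" "!!ph. bounded_functional A ph ==> ph x = (\<Sum>i<m. of_real (c i) * ph (k (p i)))"
   by blast
  have "ph (x \<oplus>\<^bsub>A\<^esub> of_real (c m) \<odot>\<^bsub>A\<^esub> k (p m)) = ph x + of_real (c m) * ph (k (p m))"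
   if "bounded_functional A ph" for ph using that x(1) kc by (simp add: bounded_functional_def)
  thus ?case
   using x kc by (intro bexI[of _ "x \<oplus>\<^bsub>A\<^esub> of_real (c m) \<odot>\<^bsub>A\<^esub> k (p m)"]) auto
 qed
 define M where "M = measure mu K"
 have M0: "0 <= M" by (simp add: M_def)
 \<comment> \<open>An approximate integral whose error is uniform over all functionals with a given
   Lipschitz constant \<open>c\<close>. This uniformity makes the Riemann sums a Cauchy sequence in
   norm, through the norming functionals.\<close>
 define P where "P ep x \<longleftrightarrow> x : carrier A & (ALL ph c. bounded_functional A ph -->
   (ALL y:carrier A. ALL z:carrier A. cmod (ph y - ph z) <= c * nrm A (y \<ominus>\<^bsub>A\<^esub> z)) --> 0 <= c -->
   cmod (lint mu (%s. ph (k s)) - ph x) <= c * ep * M)" for ep x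
 have "EX x. P ep x" if e: "0 < ep" for ep
 proof -
  have "ALL s. EX U. open U & s : U & (ALL r:U. nrm A (k s \<ominus>\<^bsub>A\<^esub> k r) < ep)"
   using k e unfolding continuous_iff by blast
  then obtain U where U: "!!s. open (U s) & s : U s" "!!s0 s. s : U s0 ==> nrm A (k s0 \<ominus>\<^bsub>A\<^esub> k s) < ep"
   by metis
  obtain m p E where mpE: "!!i. i < (m :: nat) ==> p i : K & E i \<subseteq> U (p i) \<inter> K & E i : sets borel"
   "disjoint_family_on E {..<m}" "(\<Union>i<m. E i) = K" using compact_partition[OF K, of U] U by metis
  have "EX x:carrier A. ALL ph. bounded_functional A ph -->
    ph x = (\<Sum>i<m. of_real (measure mu (E i)) * ph (k (p i)))" by (rule comb)
  then obtain x where x: "x : carrier A" "!!ph. bounded_functional A ph ==>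
    ph x = (\<Sum>i<m. of_real (measure mu (E i)) * ph (k (p i)))" by blast
  have "cmod (lint mu (%s. ph (k s)) - ph x) <= c * ep * M"
   if ph: "bounded_functional A ph" and c: "0 <= c"
    "!!y z. y : carrier A ==> z : carrier A ==> cmod (ph y - ph z) <= c * nrm A (y \<ominus>\<^bsub>A\<^esub> z)" for ph c
   unfolding x(2)[OF ph] M_def
  proof (rule riemann_sum[OF integrable_cc[OF ccf[OF ph]] K _ _ mpE(2,3)])
   fix i s assume i: "i < m" "s : E i"
   hence s: "s : U (p i)" using mpE(1) by blast
   have "cmod (ph (k s) - ph (k (p i))) <= c * nrm A (k (p i) \<ominus>\<^bsub>A\<^esub> k s)"
    using c(2)[OF kc kc, of "p i" s] by (simp add: norm_minus_commute)
   also have "... <= c * ep" using U(2)[OF s] c(1) by (intro mult_left_mono) auto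
   finally show "cmod (ph (k s) - ph (k (p i))) <= c * ep" .
  qed (use k0 bounded_functional_zero[OF ph] mpE(1) c e in auto)
  thus ?thesis using x(1) unfolding P_def by blast
 qed
 hence "ALL n :: nat. EX x. P (inverse (real (Suc n))) x" by simp
 then obtain x where "!!n :: nat. P (inverse (real (Suc n))) (x n)" by metis
 hence x: "!!n. x n : carrier A" and xb: "!!n ph c. bounded_functional A ph ==>
   (!!y z. y : carrier A ==> z : carrier A ==> cmod (ph y - ph z) <= c * nrm A (y \<ominus>\<^bsub>A\<^esub> z)) ==> 0 <= c ==>
   cmod (lint mu (%s. ph (k s)) - ph (x n)) <= c * inverse (real (Suc n)) * M" unfolding P_def by blast+
 have dist: "nrm A (x m \<ominus>\<^bsub>A\<^esub> x n) <= (inverse (real (Suc m)) + inverse (real (Suc n))) * M" for m n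
 proof -
  obtain ph where ph: "bounded_functional A ph" "!!y. y : carrier A ==> cmod (ph y) <= nrm A y"
   "Re (ph (x m \<ominus>\<^bsub>A\<^esub> x n)) = nrm A (x m \<ominus>\<^bsub>A\<^esub> x n)"
   using norming_functional[of "x m \<ominus>\<^bsub>A\<^esub> x n"] x by auto
  note lin = bounded_functional_diff[OF ph(1)]
  have b: "cmod (lint mu (%s. ph (k s)) - ph (x n)) <= 1 * inverse (real (Suc n)) * M" for n
   by (rule xb[OF ph(1)]) (use ph(2) in \<open>auto simp: lin[symmetric]\<close>)
  have "nrm A (x m \<ominus>\<^bsub>A\<^esub> x n) = Re (ph (x m) - ph (x n))" using ph(3) lin x by simp
  also have "... <= cmod (ph (x m) - ph (x n))" by (rule complex_Re_le_cmod)
  also have "... <= inverse (real (Suc m)) * M + inverse (real (Suc n)) * M"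
   by (rule norm_diff_triangle_le[of _ "lint mu (%s. ph (k s))"])
    (use b[of m] b[of n] in \<open>auto simp: norm_minus_commute\<close>)
  finally show ?thesis by (simp add: distrib_right)
 qed
 have "EX y:carrier A. (%n. nrm A (x n \<ominus>\<^bsub>A\<^esub> y)) ~~> 0"
 proof (rule Cauchy_limit[OF x])
  fix ep :: real assume e: "0 < ep"
  have "(%n. inverse (real (Suc n)) * M) ~~> 0" by (rule tendsto_mult_left_zero[OF LIMSEQ_inverse_real_of_nat])
  hence "\<forall>\<^sub>F n in sequentially. inverse (real (Suc n)) * M < ep / 2" by (rule order_tendstoD) (use e in simp)
  then obtain N where N: "!!n. n >= N ==> inverse (real (Suc n)) * M < ep / 2" by (auto simp: eventually_sequentially)
  have "nrm A (x m \<ominus>\<^bsub>A\<^esub> x n) < ep" if "m >= N" "n >= N" for m n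
   using dist[of m n] N[OF that(1)] N[OF that(2)] by (simp add: distrib_right)
  thus "EX N. ALL m>=N. ALL n>=N. nrm A (x m \<ominus>\<^bsub>A\<^esub> x n) < ep" by blast
 qed
 then obtain y where y: "y : carrier A" and lim: "(%n. nrm A (x n \<ominus>\<^bsub>A\<^esub> y)) ~~> 0" by blast
 have "lint mu (%s. ph (k s)) = ph y" if ph: "bounded_functional A ph" for ph
 proof -
  obtain c where c: "c > 0" "!!x y. x : carrier A ==> y : carrier A ==> cmod (ph x - ph y) <= c * nrm A (x \<ominus>\<^bsub>A\<^esub> y)"
   using bounded_functional_bound[OF ph] by metis
  have b: "cmod (lint mu (%s. ph (k s)) - ph y) <= c * inverse (real (Suc n)) * M + c * nrm A (x n \<ominus>\<^bsub>A\<^esub> y)" for n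
   by (rule norm_diff_triangle_le[of _ "ph (x n)"]) (use xb[OF ph c(2)] c x y in auto)
  have "(%n. c * inverse (real (Suc n)) * M + c * nrm A (x n \<ominus>\<^bsub>A\<^esub> y)) ~~> c * 0 * M + c * 0"
   by (intro tendsto_intros lim LIMSEQ_inverse_real_of_nat)
  hence "cmod (lint mu (%s. ph (k s)) - ph y) <= c * 0 * M + c * 0" by (rule LIMSEQ_le_const) (use b in auto)
  thus ?thesis by simp
 qed
 thus ?thesis using y by blast
qed

theorem assumes A: "cstar_algebra A" and k: "cmap A k"
  and K: "compact K" and k0: "!!t. t ~: K ==> k t = \<zero>\<^bsub>A\<^esub>"
 shows weak_integral_closed: "weak_integral A mu k : carrier A"
  and weak_integral_eq: "!!ph. bounded_functional A ph ==> lint mu (%s. ph (k s)) = ph (weak_integral A mu k)"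
  and weak_integral_bound: "!!C. (!!t. nrm A (k t) <= C) ==> nrm A (weak_integral A mu k) <= C * measure mu K"
proof -
 interpret cstar_algebra A by fact
 have ccf: "cc (%s. ph (k s))" if "bounded_functional A ph" for ph
  unfolding cc_def using K k0 continuous_functional_comp[OF that k] bounded_functional_zero[OF that]
  by (intro conjI exI[of _ K]) auto
 obtain x where x: "x : carrier A" "!!ph. bounded_functional A ph ==> lint mu (%s. ph (k s)) = ph x"
  using weak_integral_exists[OF assms] by blast
 have "weak_integral A mu k = x" unfolding weak_integral_def
 proof (rule the_equality)
  show "x : carrier A & (ALL ph. bounded_functional A ph -->
   integrable mu (%s. ph (k s)) & lint mu (%s. ph (k s)) = ph x)" using x integrable_cc[OF ccf] by blast
  show "y = x" if "y : carrier A & (ALL ph. bounded_functional A ph -->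
   integrable mu (%s. ph (k s)) & lint mu (%s. ph (k s)) = ph y)" for y using that x functional_separates[of y x] by metis
 qed
 thus w: "weak_integral A mu k : carrier A"
  "!!ph. bounded_functional A ph ==> lint mu (%s. ph (k s)) = ph (weak_integral A mu k)" using x by auto
 fix C assume C: "!!t. nrm A (k t) <= C"
 have kc: "k t : carrier A" for t by (rule cmapD(1)[OF k])
 obtain ph where ph: "bounded_functional A ph" "!!y. y : carrier A ==> cmod (ph y) <= nrm A y"
   "Re (ph (weak_integral A mu k)) = nrm A (weak_integral A mu k)" using norming_functional[OF w(1)] by auto
 have "nrm A (weak_integral A mu k) <= cmod (lint mu (%s. ph (k s)))"
  unfolding w(2)[OF ph(1)] ph(3)[symmetric] by (rule complex_Re_le_cmod)
 also have "... <= C * measure mu K"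
 proof (rule integral_bound_supp[OF integrable_cc[OF ccf[OF ph(1)]] K])
  show "cmod (ph (k t)) <= C" for t using ph(2)[OF kc[of t]] C[of t] by (rule order_trans)
 qed (use k0 bounded_functional_zero[OF ph(1)] in auto)
 finally show "nrm A (weak_integral A mu k) <= C * measure mu K" .
qed

end

section \<open>Representations on the sequence space\<close>

lemma op_of_fun: assumes add: "!!x y. t (x + y) = t x + t y" and scale: "!!c x. t (escale c x) = escale c (t x)"
  and bound: "!!x. norm (t x) <= C * norm x" and C: "0 <= C" shows "EX T. (ALL x. app T x = t x) & norm T <= C"
proof -
 have "EX T. (ALL x y. ip (app T x) y = ip (t x) y) & norm T <= C"
 proof (rule form_op)
  show "cmod (ip (t x) y) <= C * norm x * norm y" for x y
   by (meson ip_Cauchy_Schwarz mult_right_mono bound norm_ge_zero order_trans)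
 qed (simp_all add: add scale ip_add_left ip_add_right ip_scale_left ip_scale_right C)
 then obtain T where T: "!!x y. ip (app T x) y = ip (t x) y" "norm T <= C" by blast
 have "app T x = t x" for x by (rule ip_ext) (rule T)
 thus ?thesis using T(2) by blast
qed

text \<open>The matrix determines the columns of the adjoint, and every coordinate of
  \<open>app S x\<close> is an inner product of \<open>x\<close> with such a column, which bypasses
  a density argument.\<close>

lemma op_matrix_eqI: assumes "!!k m. coord (app S (delta k)) m = coord (app T (delta k)) m" shows "S = T"
proof -
 have "app (adj S) (delta m) = app (adj T) (delta m)" for m
 proof (rule ell2_eqI)
  fix k
  have "coord (app (adj W) (delta m)) k = cnj (coord (app W (delta k)) m)" for W
   by (simp only: ip_delta_right[symmetric] adj) (metis ip_commute)
  thus "coord (app (adj S) (delta m)) k = coord (app (adj T) (delta m)) k" by (simp add: assms)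
 qed
 hence "coord (app S x) m = coord (app T x) m" for x m by (simp only: ip_delta_right[symmetric] adj'[symmetric])
 thus ?thesis by (intro op_eqI ell2_eqI)
qed

text \<open>An injection of \<open>op\<close> into the functions over which
  \<open>AF_embeddable\<close> and \<open>cuntz_algebra\<close> quantify: column \<open>k\<close> is
  stored at the indicator of \<open>io k\<close>, from which \<open>THE\<close> recovers
  \<open>k\<close>. Every infinite \<open>'x\<close> admits such an \<open>io\<close>.\<close>

definition matrix_embed :: "(nat => 'x) => op => 'x l2op"
 where "matrix_embed io T = (%ph b. coord (app T (delta (THE k. ph (io k) = 1))) (inv_into UNIV io b))"

lemma inj_matrix_embed: assumes "inj io" shows "inj (matrix_embed io)"
proof (rule injI)
 fix S T assume eq: "matrix_embed io S = matrix_embed io T"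
 show "S = T"
 proof (rule op_matrix_eqI)
  fix k m
  define ph where "ph z = (if z = io k then 1 else (0 :: complex))" for z
  have "(THE k'. ph (io k') = 1) = k" using assms by (intro the_equality) (auto simp: ph_def inj_eq split: if_splits)
  moreover have "matrix_embed io S ph (io m) = matrix_embed io T ph (io m)" by (simp add: eq)
  ultimately show "coord (app S (delta k)) m = coord (app T (delta k)) m" by (simp add: matrix_embed_def assms)
 qed
qed

definition op_hom :: "('a, 'm) cstar_scheme => ('a => op) => bool"
 where "op_hom A rp \<longleftrightarrow> (ALL x:carrier A. ALL y:carrier A. rp (x \<oplus>\<^bsub>A\<^esub> y) = rp x + rp y) &
  (ALL c. ALL x:carrier A. rp (c \<odot>\<^bsub>A\<^esub> x) = opsc c (rp x)) &
  (ALL x:carrier A. ALL y:carrier A. rp (x \<otimes>\<^bsub>A\<^esub> y) = rp x * rp y) &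
  (ALL x:carrier A. rp (star A x) = adj (rp x))"

lemma op_homD: assumes "op_hom A rp"
 shows "[|x : carrier A; y : carrier A|] ==> rp (x \<oplus>\<^bsub>A\<^esub> y) = rp x + rp y"
  "x : carrier A ==> rp (c \<odot>\<^bsub>A\<^esub> x) = opsc c (rp x)"
  "[|x : carrier A; y : carrier A|] ==> rp (x \<otimes>\<^bsub>A\<^esub> y) = rp x * rp y"
  "x : carrier A ==> rp (star A x) = adj (rp x)" using assms by (auto simp: op_hom_def)

lemma op_hom_diff: assumes "cstar_algebra A" "op_hom A rp" "x : carrier A" "y : carrier A"
 shows "rp (x \<ominus>\<^bsub>A\<^esub> y) = rp x - rp y"
proof -
 interpret cstar_algebra A by fact
 show ?thesis using assms(3,4) by (simp add: minus_smult op_homD[OF assms(2)] opsc_simps)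
qed

lemma inj_id_op: "inj (id :: op => op)" by simp

lemma cstar_opalg_UNIV: "inj e ==> cstar_algebra (opalg e UNIV)" by (rule opalg_cstar) auto

lemma op_hom_star_hom: "op_hom A rp ==> star_hom A (opalg id UNIV) rp" unfolding op_hom_def star_hom_def
 using opalg_sel[OF inj_id_op star_sub_UNIV] by simp

lemma op_hom_contractive: assumes "cstar_algebra A" "op_hom A rp" "x : carrier A" shows "norm (rp x) <= nrm A x"
 using star_hom_contractive[OF assms(1) cstar_opalg_UNIV[OF inj_id_op] op_hom_star_hom[OF assms(2)] assms(3)]
  opalg_sel(8)[OF inj_id_op star_sub_UNIV] by simp

lemma op_hom_isometric: assumes "cstar_algebra A" "op_hom A rp" "x : carrier A"
  and "!!x. x : carrier A ==> rp x = 0 ==> x = \<zero>\<^bsub>A\<^esub>" shows "norm (rp x) = nrm A x"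
 using injective_star_hom_isometric[OF assms(1) cstar_opalg_UNIV[OF inj_id_op] op_hom_star_hom[OF assms(2)] _ assms(3)]
  opalg_sel(2,8)[OF inj_id_op star_sub_UNIV] assms(4) by simp

text \<open>The universal property speaks of algebras on \<open>nat l2op\<close>, so all bounded
  operators are copied there, and the resulting homomorphism is read back as one into
  \<open>op\<close>.\<close>

lemma cuntz_representation: assumes A: "cuntz_algebra n A S"
  and T: "!!i. i : {1..n} ==> adj (T i) * T i = 1" "(\<Sum>i\<in>{1..n}. T i * adj (T i)) = 1"
 shows "EX rp. op_hom A rp & (ALL i:{1..n}. rp (S i) = T i)"
proof -
 define e :: "op => nat l2op" where "e = matrix_embed id"
 have e: "inj e" unfolding e_def by (rule inj_matrix_embed) simp
 let ?C = "opalg e UNIV"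
 note sel = opalg_sel[OF e star_sub_UNIV]
 interpret C: cstar_algebra ?C by (rule cstar_opalg_UNIV[OF e])
 have fs: "finsum ?C (%i. e (F i)) I = e (sum F I)" if "finite I" for F and I :: "nat set" using that
 proof (induction I rule: finite_induct)
  case empty
  thus ?case by (simp add: sel)
 next
  case (insert i I)
  have "(%i. e (F i)) : I \<rightarrow> carrier ?C" "e (F i) : carrier ?C" by (simp_all add: sel)
  thus ?case using insert by (simp add: sel)
 qed
 have "cuntz_family ?C n (%i. e (T i))" unfolding cuntz_family_def using T by (simp add: sel fs)
 then obtain ph where ph: "star_hom A ?C ph" "!!i. i : {1..n} ==> ph (S i) = e (T i)"
  using A C.cstar_algebra_axioms opalg_ring[OF e] unfolding cuntz_algebra_def by metis
 note h = star_homD[OF ph(1)]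
 define rp where "rp a = inv_into UNIV e (ph a)" for a
 have erp: "e (rp a) = ph a" if "a : carrier A" for a using h(1)[OF that] by (auto simp: rp_def sel f_inv_into_f)
 have rpe: "rp a = W" if "ph a = e W" for a W by (simp add: rp_def that e)
 interpret A: cstar_algebra A using A by (simp add: cuntz_algebra_def)
 have "rp (x \<oplus>\<^bsub>A\<^esub> y) = rp x + rp y" "rp (x \<otimes>\<^bsub>A\<^esub> y) = rp x * rp y"
  if xy: "x : carrier A" "y : carrier A" for x y
 proof -
  have "ph (x \<oplus>\<^bsub>A\<^esub> y) = e (rp x) \<oplus>\<^bsub>?C\<^esub> e (rp y)" by (simp only: erp xy h(2))
  thus "rp (x \<oplus>\<^bsub>A\<^esub> y) = rp x + rp y" by (intro rpe) (simp only: sel)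
  have "ph (x \<otimes>\<^bsub>A\<^esub> y) = e (rp x) \<otimes>\<^bsub>?C\<^esub> e (rp y)" by (simp only: erp xy h(4))
  thus "rp (x \<otimes>\<^bsub>A\<^esub> y) = rp x * rp y" by (intro rpe) (simp only: sel)
 qed
 moreover have "rp (c \<odot>\<^bsub>A\<^esub> x) = opsc c (rp x)" "rp (star A x) = adj (rp x)"
  if x: "x : carrier A" for c x
 proof -
  have "ph (c \<odot>\<^bsub>A\<^esub> x) = c \<odot>\<^bsub>?C\<^esub> e (rp x)" by (simp only: erp x h(3))
  thus "rp (c \<odot>\<^bsub>A\<^esub> x) = opsc c (rp x)" by (intro rpe) (simp only: sel)
  have "ph (star A x) = star ?C (e (rp x))" by (simp only: erp x h(5))
  thus "rp (star A x) = adj (rp x)" by (intro rpe) (simp only: sel)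
 qed
 ultimately have "op_hom A rp" unfolding op_hom_def by blast
 thus ?thesis using rpe[OF ph(2)] by blast
qed

section \<open>Permutative representations\<close>

text \<open>The maps \<open>s i\<close> are the branches of the inverse of the shift
  \<open>tln\<close>, and \<open>hdn x\<close> names the branch through which \<open>x\<close> is
  reached; together they are a bijection of \<open>{1..n} \<times> nat\<close> with
  \<open>nat\<close>.\<close>

locale perm_sys =
 fixes n :: nat and s :: "nat => nat => nat" and hdn tln :: "nat => nat"
 assumes hdn: "hdn x : {1..n}" and s_hdn: "s (hdn x) (tln x) = x"
  and hdn_s: "i : {1..n} ==> hdn (s i x) = i" and tln_s: "i : {1..n} ==> tln (s i x) = x"
begin

lemma inj_s: "i : {1..n} ==> inj (s i)" by (metis injI tln_s)

definition pull :: "nat => ell2 => ell2" where "pull i xi = Abs_ell2 (%x. coord xi (s i x))"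

lemma pull_part: assumes i: "i : {1..n}" shows "(\<Sum>x<N. (cmod (coord xi (s i x)))^2) <= (norm xi)^2"
proof -
 have "(\<Sum>x<N. (cmod (coord xi (s i x)))^2) = (\<Sum>y\<in>s i ` {..<N}. (cmod (coord xi y))^2)"
  by (rule sum.reindex_cong[symmetric, of "s i"]) (use inj_s[OF i] in \<open>auto intro: inj_on_subset\<close>)
 thus ?thesis using finite_part_le_norm[of "s i ` {..<N}" xi] by simp
qed

lemma coord_pull: assumes i: "i : {1..n}" shows "coord (pull i xi) x = coord xi (s i x)"
proof -
 have "summable (%x. (cmod (coord xi (s i x)))^2)"
  by (rule bounded_imp_summable[OF _ pull_part[OF i, of xi "Suc _", unfolded lessThan_Suc_atMost]]) simp
 thus ?thesis by (simp add: pull_def Abs_ell2_inverse)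
qed

lemma norm_pull: assumes i: "i : {1..n}" shows "norm (pull i xi) <= norm xi"
proof -
 have "(norm (pull i xi))^2 <= (norm xi)^2" unfolding norm_ell2_sq[of "pull i xi"]
  by (rule suminf_le_const[OF summable_coord]) (simp add: coord_pull[OF i] pull_part[OF i])
 thus ?thesis by (rule power2_le_imp_le) simp
qed

text \<open>\<open>Rop i\<close> sends \<open>delta (s i x)\<close> to \<open>delta x\<close> and
  kills the other basis vectors. The isometry is defined as its adjoint, since pulling back along an
  injection is the direction in which the norm bound is immediate.\<close>

definition Rop :: "nat => op" where "Rop i = (SOME T. ALL xi. app T xi = pull i xi)"
definition Sop :: "nat => op" where "Sop i = adj (Rop i)"

lemma app_Rop: assumes i: "i : {1..n}" shows "app (Rop i) xi = pull i xi"
proof -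
 have "EX T. (ALL xi. app T xi = pull i xi) & norm T <= 1"
  by (rule op_of_fun) (auto intro!: ell2_eqI simp: coord_pull[OF i] norm_pull[OF i])
 hence "EX T. ALL xi. app T xi = pull i xi" by blast
 hence "ALL xi. app (Rop i) xi = pull i xi" unfolding Rop_def by (rule someI_ex)
 thus ?thesis by simp
qed

lemma coord_Sop: assumes i: "i : {1..n}" shows "coord (app (Sop i) xi) y = (if hdn y = i then coord xi (tln y) else 0)"
proof -
 have "app (Rop i) (delta y) = (if hdn y = i then delta (tln y) else 0)" unfolding app_Rop[OF i]
  by (rule ell2_eqI) (use hdn_s[OF i, of "tln y"] tln_s[OF i] s_hdn[of y] in \<open>auto simp: coord_pull[OF i]\<close>)
 thus ?thesis unfolding Sop_def ip_delta_right[symmetric] adj by simp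
qed

lemma adj_Sop [simp]: "adj (Sop i) = Rop i" by (simp add: Sop_def)

lemma Rop_Sop: "i : {1..n} ==> j : {1..n} ==> Rop i * Sop j = (if i = j then 1 else 0)"
 by (intro op_eqI ell2_eqI) (auto simp: app_Rop coord_pull coord_Sop hdn_s tln_s)

lemma sum_Sop_Rop: "(\<Sum>i\<in>{1..n}. Sop i * Rop i) = 1"
proof (intro op_eqI ell2_eqI)
 fix xi y
 have app_sum: "app (sum f I) xi = (\<Sum>i\<in>I. app (f i) xi)" for f and I :: "nat set"
  by (induction I rule: infinite_finite_induct) auto
 have "coord (app (\<Sum>i\<in>{1..n}. Sop i * Rop i) xi) y
   = (\<Sum>i\<in>{1..n}. if hdn y = i then coord xi (s i (tln y)) else 0)" unfolding app_sum coord_sum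
  by (rule sum.cong) (auto simp: coord_Sop app_Rop coord_pull)
 also have "... = coord xi y" using hdn[of y] s_hdn[of y] by (simp add: sum.delta')
 finally show "coord (app (\<Sum>i\<in>{1..n}. Sop i * Rop i) xi) y = coord (app 1 xi) y" by simp
qed

lemma diag_Sop: assumes "ALL k. cmod (d k) <= C" "i : {1..n}" shows "diag d * Sop i = Sop i * diag (%x. d (s i x))"
proof (intro op_eqI ell2_eqI)
 fix xi y
 have d': "ALL k. cmod (d (s i k)) <= C" using assms by blast
 show "coord (app (diag d * Sop i) xi) y = coord (app (Sop i * diag (%x. d (s i x))) xi) y"
  using s_hdn[of y] by (auto simp: coord_diag[OF assms(1)] coord_Sop[OF assms(2)] coord_diag[OF d'])
qed

lemma Sop_delta: "i : {1..n} ==> app (Sop i) (delta x) = delta (s i x)"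
 by (rule ell2_eqI) (use s_hdn hdn_s tln_s in \<open>auto simp: coord_Sop\<close>)

end

text \<open>Permutative systems with a prescribed itinerary. The index \<open>(mu, m)\<close> stands for the infinite word
 \<open>mu\<close> followed by the \<open>m\<close>-fold shift of \<open>x0\<close>, together with the lag \<open>m\<close>; the lag makes the
 grading well defined also for periodic \<open>x0\<close>.\<close>

definition tail_set :: "nat => (nat => nat) => (nat list \<times> nat) set"
 where "tail_set n x0 = {(mu, m). set mu \<subseteq> {1..n} & (mu = [] | m = 0 | last mu ~= x0 (m - 1))}"

definition tail_s :: "(nat => nat) => nat => nat list \<times> nat => nat list \<times> nat"
 where "tail_s x0 j = (%(mu, m). if mu = [] & m > 0 & j = x0 (m - 1) then ([], m - 1) else (j # mu, m))"

definition tail_hd :: "(nat => nat) => nat list \<times> nat => nat"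
 where "tail_hd x0 = (%(mu, m). if mu = [] then x0 m else hd mu)"

definition tail_tl :: "nat list \<times> nat => nat list \<times> nat"
 where "tail_tl = (%(mu, m). if mu = [] then ([], Suc m) else (tl mu, m))"

context
 fixes n :: nat and x0 :: "nat => nat" assumes x0: "!!k. x0 k : {1..n}"
begin

lemma tail_closed:
 "x : tail_set n x0 ==> j : {1..n} ==> tail_s x0 j x : tail_set n x0"
 "x : tail_set n x0 ==> tail_tl x : tail_set n x0"
 "x : tail_set n x0 ==> tail_hd x0 x : {1..n}"
proof -
 obtain mu m where xm: "x = (mu, m)" by (cases x)
 show "x : tail_set n x0 ==> j : {1..n} ==> tail_s x0 j x : tail_set n x0"
  by (cases mu) (auto simp: xm tail_set_def tail_s_def)
 show "x : tail_set n x0 ==> tail_tl x : tail_set n x0" by (cases mu) (auto simp: xm tail_set_def tail_tl_def)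
 show "x : tail_set n x0 ==> tail_hd x0 x : {1..n}" using x0[of m] by (cases mu) (auto simp: xm tail_set_def tail_hd_def)
qed

lemma tail_inverse:
 "x : tail_set n x0 ==> tail_s x0 (tail_hd x0 x) (tail_tl x) = x"
 "x : tail_set n x0 ==> tail_hd x0 (tail_s x0 j x) = j"
 "x : tail_set n x0 ==> tail_tl (tail_s x0 j x) = x"
proof -
 show "x : tail_set n x0 ==> tail_s x0 (tail_hd x0 x) (tail_tl x) = x"
 proof -
  assume x: "x : tail_set n x0"
  obtain mu m where xm: "x = (mu, m)" by (cases x)
  show ?thesis
  proof (cases mu)
   case (Cons a nu)
   thus ?thesis using x xm by (auto simp: tail_set_def tail_s_def tail_hd_def tail_tl_def)
  qed (use xm in \<open>auto simp: tail_s_def tail_hd_def tail_tl_def\<close>)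
 qed
 show "x : tail_set n x0 ==> tail_hd x0 (tail_s x0 j x) = j"
  "x : tail_set n x0 ==> tail_tl (tail_s x0 j x) = x"
  by (auto simp: tail_set_def tail_s_def tail_hd_def tail_tl_def split: prod.splits)
qed

definition tail_enum :: "nat => nat list \<times> nat" where "tail_enum = from_nat_into (tail_set n x0)"

lemma tail_enum_bij: "bij_betw tail_enum UNIV (tail_set n x0)"
proof -
 have "inj (%m :: nat. ([] :: nat list, m))" by (auto simp: inj_def)
 moreover have "range (%m :: nat. ([] :: nat list, m)) \<subseteq> tail_set n x0" by (auto simp: tail_set_def)
 ultimately have "infinite (tail_set n x0)" by (meson finite_subset infinite_UNIV_nat finite_imageD)
 thus ?thesis unfolding tail_enum_def by (intro bij_betw_from_nat_into) auto
qed

definition "tidx x = inv_into UNIV tail_enum x"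

lemma tail_enum_idx: "x : tail_set n x0 ==> tail_enum (tidx x) = x"
 using tail_enum_bij by (simp add: tidx_def bij_betw_def f_inv_into_f)

lemma tidx_enum: "tidx (tail_enum k) = k" using tail_enum_bij by (simp add: tidx_def bij_betw_def)

lemma tail_enum_in: "tail_enum k : tail_set n x0" using tail_enum_bij by (auto simp: bij_betw_def)

lemma tail_perm_sys:
 "perm_sys n (%i k. tidx (tail_s x0 i (tail_enum k))) (%k. tail_hd x0 (tail_enum k)) (%k. tidx (tail_tl (tail_enum k)))"
proof
 fix k i
 show "tail_hd x0 (tail_enum k) : {1..n}" by (rule tail_closed(3)[OF tail_enum_in])
 show "tidx (tail_s x0 (tail_hd x0 (tail_enum k)) (tail_enum (tidx (tail_tl (tail_enum k))))) = k"
  by (simp add: tail_enum_idx tail_closed tail_enum_in tail_inverse tidx_enum)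
 assume i: "i : {1..n}"
 show "tail_hd x0 (tail_enum (tidx (tail_s x0 i (tail_enum k)))) = i"
  by (subst tail_enum_idx[OF tail_closed(1)[OF tail_enum_in i]]) (rule tail_inverse(2)[OF tail_enum_in])
 show "tidx (tail_tl (tail_enum (tidx (tail_s x0 i (tail_enum k))))) = k"
  by (subst tail_enum_idx[OF tail_closed(1)[OF tail_enum_in i]])
   (simp add: tail_inverse(3)[OF tail_enum_in] tidx_enum)
qed

end

section \<open>Continuity of algebra-valued and operator-valued functions\<close>

context cstar_algebra
begin

lemma cmap_const: "a : carrier A ==> cmap A (%_. a)" by (rule cmapI[where b="%_ _. 0"]) auto

lemma cmap_comp: assumes f: "cmap A f" and g: "cts g" shows "cmap A (%t. f (g t))"
proof (rule cmapI[OF cmapD(1)[OF f] _ order_refl])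
 fix t
 have "filterlim g (nhds (g t)) (nhds t)" using g unfolding cts_nhds by blast
 from filterlim_compose[OF cmapD(2)[OF f, of "g t"] this]
 show "((%s. nrm A (f (g t) \<ominus> f (g s))) \<longlongrightarrow> 0) (nhds t)" .
qed

lemma cmap_add: "cmap A f ==> cmap A g ==> cmap A (%t. f t \<oplus> g t)" by (simp add: cmap_iff lim_add)

lemma cmap_mult: "cmap A f ==> cmap A g ==> cmap A (%t. f t \<otimes> g t)" by (simp add: cmap_iff lim_mult cl)

lemma cmap_scale: "cmap A f ==> cts h ==> cmap A (%t. h t \<odot> f t)" by (simp add: cmap_iff cts_nhds lim_scale)

lemma cmap_star: "cmap A f ==> cmap A (%t. star A (f t))" by (simp add: cmap_iff lim_star cl)

lemma cmap_minus: assumes f: "cmap A f" and g: "cmap A g" shows "cmap A (%t. f t \<ominus> g t)"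
proof -
 have "(%t. f t \<ominus> g t) = (%t. f t \<oplus> (-1) \<odot> g t)"
  using cmapD(1)[OF f] cmapD(1)[OF g] by (simp add: minus_smult)
 thus ?thesis using cmap_add[OF f cmap_scale[OF g, of "%_. -1"]] by simp
qed

lemma cmap_nrm: assumes f: "cmap A f" shows "cts (%t. nrm A (f t))"
proof -
 note c = cmapD(1)[OF f]
 have "((%s. nrm A (f s) - nrm A (f t)) \<longlongrightarrow> 0) (nhds t)" for t by (rule Lim_null[OF _ cmapD(2)[OF f]])
   (use nrm_rev_triangle[OF c c, of t] in \<open>simp add: abs_minus_commute\<close>)
 thus ?thesis unfolding cts_nhds by (auto intro: LIM_zero_cancel)
qed

lemma cmap_op_hom: assumes f: "cmap A f" and rp: "op_hom A rp" shows "cts (%t. rp (f t))"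
proof -
 note c = cmapD(1)[OF f]
 have "((%s. rp (f s) - rp (f t)) \<longlongrightarrow> 0) (nhds t)" for t
 proof (rule Lim_null[OF _ cmapD(2)[OF f, of t]], rule allI)
  fix s
  have "norm (rp (f s) - rp (f t)) = norm (rp (f t \<ominus> f s))"
   using op_hom_diff[OF cstar_algebra_axioms rp c c] by (simp add: norm_minus_commute)
  also have "... <= nrm A (f t \<ominus> f s)" by (rule op_hom_contractive[OF cstar_algebra_axioms rp]) (use c in simp)
  finally show "norm (rp (f s) - rp (f t)) <= nrm A (f t \<ominus> f s)" .
 qed
 thus ?thesis unfolding cts_nhds by (auto intro: LIM_zero_cancel)
qed

end

lemma bounded_bilinear_app: "bounded_bilinear app"
proof
 show "app (r *\<^sub>R S) x = r *\<^sub>R app S x" "app S (r *\<^sub>R x) = r *\<^sub>R app S x" for r S x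
  using app_scale[of S "of_real r" x] by (simp_all add: escale_simps)
 show "EX K. ALL S x. norm (app S x) <= norm S * norm x * K" by (rule exI[of _ 1]) (simp add: norm_app)
qed auto

lemma bounded_bilinear_ip: "bounded_bilinear ip"
proof
 show "ip (r *\<^sub>R x) y = r *\<^sub>R ip x y" "ip x (r *\<^sub>R y) = r *\<^sub>R ip x y" for r x y
  using ip_scale_left[of "of_real r" x y] ip_scale_right[of x "of_real r" y]
  by (simp_all add: escale_simps scaleR_conv_of_real)
 show "EX K. ALL x y. norm (ip x y) <= norm x * norm y * K" by (rule exI[of _ 1]) (simp add: ip_Cauchy_Schwarz)
qed (auto simp: ip_add_left ip_add_right)

lemmas cont_app = bounded_bilinear.continuous_on[OF bounded_bilinear_app]
lemmas cont_ip = bounded_bilinear.continuous_on[OF bounded_bilinear_ip]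

text \<open>Only strong continuity can be expected, as the entries need not converge uniformly in
  the index. Vectors with finitely many coordinates are handled entrywise, the remainder by the
  uniform bound 1.\<close>

lemma diag_strong_continuous:
 fixes d :: "'t :: topological_space => nat => complex"
 assumes bd: "!!t. ALL x. cmod (d t x) <= 1" and cont: "!!x. cts (%t. d t x)" shows "cts (%t. app (diag (d t)) xi)"
proof -
 have "((%t. app (diag (d t)) xi) \<longlongrightarrow> app (diag (d t0)) xi) (nhds t0)" for t0 unfolding tendsto_iff
 proof (intro allI impI)
  fix ep :: real assume e: "0 < ep"
  obtain N where N: "norm (xi - (\<Sum>n<N. escale (coord xi n) (delta n))) < ep / 3"
   using order_tendstoD(2)[OF ell2_truncate[of xi], of "ep / 3"] e by (auto simp: eventually_sequentially)
  define ze where "ze = (\<Sum>n<N. escale (coord xi n) (delta n))"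
  define g where "g t = (\<Sum>n<N. cmod (d t n - d t0 n) * cmod (coord xi n))" for t
  have z: "app (diag (d t)) ze - app (diag (d t0)) ze = (\<Sum>n<N. escale ((d t n - d t0 n) * coord xi n) (delta n))" for t
  proof (rule ell2_eqI)
   fix k
   have ct: "coord ze k = (if k < N then coord xi k else 0)" by (simp add: ze_def if_distrib cong: if_cong)
   have cs: "coord (\<Sum>n<N. escale ((d t n - d t0 n) * coord xi n) (delta n)) k
    = (if k < N then (d t k - d t0 k) * coord xi k else 0)" by (simp add: if_distrib cong: if_cong)
   show "coord (app (diag (d t)) ze - app (diag (d t0)) ze) k
    = coord (\<Sum>n<N. escale ((d t n - d t0 n) * coord xi n) (delta n)) k"
    unfolding cs by (simp add: coord_diag[OF bd] ct algebra_simps)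
  qed
  have gz: "norm (app (diag (d t)) ze - app (diag (d t0)) ze) <= g t" for t
   unfolding z g_def by (rule order_trans[OF norm_sum]) (simp add: norm_escale norm_mult)
  have "((%t. d t n) \<longlongrightarrow> d t0 n) (nhds t0)" for n using cont[of n] unfolding cts_nhds by blast
  hence "(g \<longlongrightarrow> (\<Sum>n<N. cmod (d t0 n - d t0 n) * cmod (coord xi n))) (nhds t0)"
   unfolding g_def by (intro tendsto_intros)
  hence "(g \<longlongrightarrow> 0) (nhds t0)" by simp
  hence "\<forall>\<^sub>F t in nhds t0. g t < ep / 3" by (rule order_tendstoD(2)) (use e in simp)
  thus "\<forall>\<^sub>F t in nhds t0. dist (app (diag (d t)) xi) (app (diag (d t0)) xi) < ep"
  proof (rule eventually_mono)
   fix t assume g: "g t < ep / 3"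
   have small: "norm (app (diag (d t)) (xi - ze)) < ep / 3" for t
   proof -
    have "norm (app (diag (d t)) (xi - ze)) <= 1 * norm (xi - ze)"
     by (rule order_trans[OF norm_app mult_right_mono[OF norm_diag[OF bd]]]) simp
    thus ?thesis using N by (simp add: ze_def)
   qed
   have "app (diag (d t)) xi - app (diag (d t0)) xi = app (diag (d t)) (xi - ze) - app (diag (d t0)) (xi - ze)
     + (app (diag (d t)) ze - app (diag (d t0)) ze)" by simp
   hence "norm (app (diag (d t)) xi - app (diag (d t0)) xi)
    <= norm (app (diag (d t)) (xi - ze)) + norm (app (diag (d t0)) (xi - ze)) + g t"
    using gz[of t] norm_triangle_ineq4[of "app (diag (d t)) (xi - ze)" "app (diag (d t0)) (xi - ze)"]
     norm_triangle_ineq[of "app (diag (d t)) (xi - ze) - app (diag (d t0)) (xi - ze)"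
      "app (diag (d t)) ze - app (diag (d t0)) ze"] by simp
   also have "... < ep" using small[of t] small[of t0] g by linarith
   finally show "dist (app (diag (d t)) xi) (app (diag (d t0)) xi) < ep" by (simp add: dist_norm)
  qed
 qed
 thus ?thesis unfolding cts_nhds by blast
qed

section \<open>The covariant representation of the crossed product\<close>

lemma dualD: assumes "ga : dual"
 shows "cts ga" "cmod (ga t) = 1" "ga (s + t) = ga s * ga t" "ga 0 = 1" "ga (- t) = cnj (ga t)"
proof -
 show a: "cts ga" "cmod (ga t) = 1" "ga (s + t) = ga s * ga t" for s t using assms by (auto simp: dual_group_def)
 have nz: "ga t ~= 0" for t using a(2)[of t] by auto
 have "ga 0 * ga 0 = ga 0 * 1" using a(3)[of 0 0] by simp
 thus z: "ga 0 = 1" using nz[of 0] by simp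
 have "ga t * ga (- t) = ga t * cnj (ga t)" using a(3)[of t "- t"] a(2)[of t] z by (simp add: complex_norm_square[symmetric])
 thus "ga (- t) = cnj (ga t)" using nz[of t] by simp
qed

lemma dual_cancel: "ga : dual ==> ga t * cnj (ga t) = 1" "ga : dual ==> cnj (ga t) * ga t = 1"
 using complex_norm_square[of "ga t"] dualD(2)[of ga t] by (simp_all add: mult.commute)

lemma dual_mult: "ga : dual ==> de : dual ==> (%t. ga t * de t) : dual"
 by (auto simp: dual_group_def norm_mult intro!: continuous_intros)

lemma dual_cnj: "ga : dual ==> (%t. cnj (ga t)) : dual" by (auto simp: dual_group_def intro!: continuous_intros)

lemma dual_one: "(%t. 1) : dual" by (auto simp: dual_group_def)

locale quasi_free = lc_haar mu for mu :: "'g :: {topological_ab_group_add, t2_space} measure" +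
 fixes n :: nat and og :: "nat => 'g => complex"
  and A :: "'a cstar" (structure) and S :: "nat => 'a" and al :: "'g => 'a => 'a"
 assumes n2: "n >= 2" and dual: "!!i. i : {1..n} ==> og i : dual"
  and cuntz: "cuntz_algebra n A S" and action: "cstar_action al A"
  and gauge: "!!t i. i : {1..n} ==> al t (S i) = og i t \<odot> S i"
begin

lemma cstar_A: "cstar_algebra A" using cuntz by (simp add: cuntz_algebra_def)

sublocale A: cstar_algebra A by (rule cstar_A)

lemma S_closed: "i : {1..n} ==> S i : carrier A" and S_isometry: "i : {1..n} ==> star A (S i) \<otimes> S i = \<one>"
 using cuntz by (auto simp: cuntz_algebra_def cuntz_family_def)

lemma S_generate: "cstar_subalgebra H A ==> (!!i. i : {1..n} ==> S i : H) ==> H = carrier A"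
 using cuntz unfolding cuntz_algebra_def by blast

lemma one_closed: "\<one> : carrier A"
 using S_isometry[of 1] S_closed[of 1] n2 A.cl by (metis atLeastAtMost_iff le_numeral_extra(4) one_le_numeral order_trans)

lemma al_hom: "star_hom A A (al t)" and al_zero: "x : carrier A ==> al 0 x = x"
 and al_cont: "x : carrier A ==> cmap A (%t. al t x)"
 using action by (auto simp: cstar_action_def)

lemmas al_simps = star_homD[OF al_hom]

lemma al_diff: "x : carrier A ==> y : carrier A ==> al t (x \<ominus> y) = al t x \<ominus> al t y"
 by (simp add: A.minus_smult al_simps)

lemma al_nrm: "x : carrier A ==> nrm A (al t x) <= nrm A x" by (rule star_hom_contractive[OF cstar_A cstar_A al_hom])

text \<open>The action is continuous only pointwise; contractivity of each \<open>al t\<close>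
  upgrades this to joint continuity.\<close>

lemma cmap_action: assumes h: "cts h" and k: "cmap A k" shows "cmap A (%t. al (h t) (k t))"
proof (rule A.cmapI)
 fix t s
 note c = A.cmapD(1)[OF k]
 show "al (h t) (k t) : carrier A" using c by (simp add: al_simps)
 have 1: "cmap A (%s. al (h s) (k t))" by (rule A.cmap_comp[OF al_cont[OF c] h])
 show "((%s. nrm A (al (h t) (k t) \<ominus> al (h s) (k t)) + nrm A (k t \<ominus> k s)) \<longlongrightarrow> 0) (nhds t)"
  using tendsto_add[OF A.cmapD(2)[OF 1, of t] A.cmapD(2)[OF k, of t]] by simp
 have "nrm A (al (h t) (k t) \<ominus> al (h s) (k s)) <= nrm A (al (h t) (k t) \<ominus> al (h s) (k t))
   + nrm A (al (h s) (k t) \<ominus> al (h s) (k s))" using c by (intro A.nrm_minus_trans) (auto simp: al_simps)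
 also have "nrm A (al (h s) (k t) \<ominus> al (h s) (k s)) <= nrm A (k t \<ominus> k s)"
  using al_nrm[of "k t \<ominus> k s" "h s"] c by (simp add: al_diff)
 finally show "nrm A (al (h t) (k t) \<ominus> al (h s) (k s))
   <= nrm A (al (h t) (k t) \<ominus> al (h s) (k t)) + nrm A (k t \<ominus> k s)" by simp
qed

definition E :: "('g => 'a) cstar" where "E = Cc_algebra mu al A"

lemma E_sel:
 "f \<otimes>\<^bsub>E\<^esub> g = (%t. weak_integral A mu (%s. f s \<otimes> al s (g (t - s))))"
 "f \<oplus>\<^bsub>E\<^esub> g = (%t. f t \<oplus> g t)" "c \<odot>\<^bsub>E\<^esub> f = (%t. c \<odot> f t)"
 "star E f = (%t. al t (star A (f (- t))))" "nrm E f = lint mu (%s. nrm A (f s))" by (simp_all add: E_def Cc_algebra_def)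

lemma E_carrier: "f : carrier E \<longleftrightarrow> cmap A f &
  (EX K. compact K & (ALL t. t ~: K --> f t = \<zero>))" by (simp add: E_def Cc_algebra_def)

lemma E_cmap: "f : carrier E ==> cmap A f" by (simp add: E_carrier)

lemma E_val: "f : carrier E ==> f t : carrier A" by (rule A.cmapD(1)[OF E_cmap])

lemma E_supp: assumes "f : carrier E" obtains K where "compact K" "!!t. t ~: K ==> f t = \<zero>"
 using assms by (auto simp: E_carrier)

lemma E_add: "f : carrier E ==> g : carrier E ==> f \<oplus>\<^bsub>E\<^esub> g : carrier E"
proof -
 assume f: "f : carrier E" and g: "g : carrier E"
 obtain K where K: "compact K" "!!t. t ~: K ==> f t = \<zero>" by (rule E_supp[OF f]) (rule that)
 obtain L where L: "compact L" "!!t. t ~: L ==> g t = \<zero>" by (rule E_supp[OF g]) (rule that)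
 show ?thesis unfolding E_carrier E_sel by (intro conjI A.cmap_add E_cmap f g exI[of _ "K \<union> L"]) (use K L in auto)
qed

lemma E_smult: "f : carrier E ==> c \<odot>\<^bsub>E\<^esub> f : carrier E"
proof -
 assume f: "f : carrier E"
 obtain K where K: "compact K" "!!t. t ~: K ==> f t = \<zero>" by (rule E_supp[OF f]) (rule that)
 show ?thesis unfolding E_carrier E_sel by (intro conjI A.cmap_scale E_cmap f exI[of _ "K"]) (use K in auto)
qed

lemma E_star: "f : carrier E ==> star E f : carrier E"
proof -
 assume f: "f : carrier E"
 obtain K where K: "compact K" "!!t. t ~: K ==> f t = \<zero>" by (rule E_supp[OF f]) (rule that)
 have z: "al t \<zero> = \<zero>" for t using al_simps(3)[of "\<zero>" t 0] al_simps(1)[of "\<zero>" t] by simp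
 have "f (- t) = \<zero>" if "t ~: uminus ` K" for t using that by (intro K(2)) (metis add.inverse_inverse imageI)
 thus ?thesis unfolding E_carrier E_sel
  by (intro conjI cmap_action A.cmap_star A.cmap_comp[OF E_cmap[OF f]] continuous_intros
    exI[of _ "uminus ` K"] compact_uminus K(1)) (auto simp: z)
qed

text \<open>The integrand of the twisted convolution. It is kept apart from the product of
  \<open>E\<close> because its joint continuity in \<open>t\<close> and \<open>s\<close> and its
  support have to be known before the integral is.\<close>

definition conv :: "('g => 'a) => ('g => 'a) => 'g => 'g => 'a" where "conv f g t s = f s \<otimes> al s (g (t - s))"

lemma conv_cmap: assumes "f : carrier E" "g : carrier E" "cts u" "cts v" shows "cmap A (%x. conv f g (u x) (v x))"
 unfolding conv_def by (intro A.cmap_mult cmap_action A.cmap_comp[OF E_cmap] continuous_on_diff assms)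

lemma conv_zero: assumes f: "f : carrier E" and g: "g : carrier E"
 obtains K L where "compact K" "compact L" "!!t s. s ~: K | t ~: L ==> conv f g t s = \<zero>"
proof -
 obtain K where K: "compact K" "!!t. t ~: K ==> f t = \<zero>" by (rule E_supp[OF f]) (rule that)
 obtain L where L: "compact L" "!!t. t ~: L ==> g t = \<zero>" by (rule E_supp[OF g]) (rule that)
 have z: "al t \<zero> = \<zero>" for t using al_simps(3)[of "\<zero>" t 0] al_simps(1)[of "\<zero>" t] by simp
 have "conv f g t s = \<zero>" if "s ~: K | t ~: {a + b |a b. a : K & b : L}" for t s
 proof (cases "s : K")
  case True
  have "t - s ~: L"
  proof
   assume "t - s : L"
   moreover have "t = s + (t - s)" by simp
   ultimately show False using that True by blast
  qed
  thus ?thesis using L(2) E_val[OF f] by (simp add: conv_def z)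
 qed (use K(2) E_val[OF g] in \<open>simp add: conv_def al_simps\<close>)
 thus ?thesis using that[OF K(1) compact_sum[OF K(1) L(1)]] by blast
qed

lemma conv_slice: "f : carrier E ==> g : carrier E ==> cmap A (conv f g t)" using conv_cmap[of f g "%_. t" "%s. s"] by simp

lemma E_mult_eq: "f \<otimes>\<^bsub>E\<^esub> g = (%t. weak_integral A mu (conv f g t))"
proof -
 have "conv f g t = (%s. f s \<otimes> al s (g (t - s)))" for t by (simp add: conv_def fun_eq_iff)
 thus ?thesis by (simp add: E_sel)
qed

lemma E_mult_functional: assumes "f : carrier E" "g : carrier E" "bounded_functional A ph"
 shows "ph ((f \<otimes>\<^bsub>E\<^esub> g) t) = lint mu (%s. ph (conv f g t s))"
proof -
 obtain K L where KL: "compact K" "!!t s. s ~: K | t ~: L ==> conv f g t s = \<zero>" using conv_zero[OF assms(1,2)] by metis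
 show ?thesis
  using weak_integral_eq[OF cstar_A conv_slice[OF assms(1,2)] KL(1) KL(2) assms(3), of t] by (simp add: E_mult_eq)
qed

text \<open>The weak integral is bounded in norm by the supremum of the integrand times the measure
  of \<open>K\<close>, so continuity of the product reduces to the tube lemma for the norm of a
  difference of integrands.\<close>

lemma E_mult: assumes f: "f : carrier E" and g: "g : carrier E" shows "f \<otimes>\<^bsub>E\<^esub> g : carrier E"
proof -
 obtain K L where K: "compact K" and L: "compact L" and KL: "!!t s. s ~: K | t ~: L ==> conv f g t s = \<zero>"
  by (rule conv_zero[OF f g]) (rule that)
 note sl = conv_slice[OF f g]
 have wc: "weak_integral A mu (conv f g t) : carrier A" for t
  by (rule weak_integral_closed[OF cstar_A sl K]) (use KL in blast)
 have diff: "nrm A (weak_integral A mu (conv f g t0) \<ominus> weak_integral A mu (conv f g t)) <= C * measure mu K"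
  if C: "!!s. nrm A (conv f g t0 s \<ominus> conv f g t s) <= C" for t0 t C
 proof -
  have d: "cmap A (%s. conv f g t0 s \<ominus> conv f g t s)" by (rule A.cmap_minus[OF sl sl])
  have dz: "conv f g t0 s \<ominus> conv f g t s = \<zero>" if "s ~: K" for s using KL[of s] that by simp
  have "weak_integral A mu (%s. conv f g t0 s \<ominus> conv f g t s)
    = weak_integral A mu (conv f g t0) \<ominus> weak_integral A mu (conv f g t)"
  proof (rule A.functional_separates)
   show "weak_integral A mu (%s. conv f g t0 s \<ominus> conv f g t s) : carrier A"
    by (rule weak_integral_closed[OF cstar_A d K dz])
   fix ph assume ph: "bounded_functional A ph"
   note lin = A.bounded_functional_diff[OF ph]
   have ccf: "cc (%s. ph (conv f g t s))" for t
    unfolding cc_def using K KL A.continuous_functional_comp[OF ph sl] A.bounded_functional_zero[OF ph]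
    by (intro conjI exI[of _ K]) auto
   have "ph (weak_integral A mu (%s. conv f g t0 s \<ominus> conv f g t s))
     = lint mu (%s. ph (conv f g t0 s) - ph (conv f g t s))"
    using weak_integral_eq[OF cstar_A d K dz ph] by (simp add: lin A.cmapD(1)[OF sl])
   also have "... = ph (weak_integral A mu (conv f g t0)) - ph (weak_integral A mu (conv f g t))"
    using integrable_cc[OF ccf] weak_integral_eq[OF cstar_A sl K _ ph] KL by simp
   finally show "ph (weak_integral A mu (%s. conv f g t0 s \<ominus> conv f g t s))
    = ph (weak_integral A mu (conv f g t0) \<ominus> weak_integral A mu (conv f g t))" by (simp add: lin wc)
  qed (use wc in simp)
  thus ?thesis using weak_integral_bound[OF cstar_A d K dz C] by simp
 qed
 have "cmap A (%t. weak_integral A mu (conv f g t))" unfolding A.continuous_iff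
 proof (intro conjI allI impI wc)
  fix t0 and ep :: real assume e: "0 < ep"
  obtain de where d0: "0 < de" and d1: "de * measure mu K < ep" by (rule small_factor[OF e measure_nonneg])
  define F where "F t s = cre (nrm A (conv f g t0 s \<ominus> conv f g t s))" for t s
  have "cts (%(t, s). F t s)" unfolding F_def case_prod_beta'
   by (intro continuous_on_of_real A.cmap_nrm A.cmap_minus conv_cmap f g continuous_intros)
  then obtain U where U: "open U" "t0 : U" "!!t s. t : U ==> s : K ==> cmod (F t s - F t0 s) < de"
   using tube_uniform[OF _ K d0, of F t0] by blast
  have "nrm A (weak_integral A mu (conv f g t0) \<ominus> weak_integral A mu (conv f g t)) < ep" if t: "t : U" for t
  proof -
   have "nrm A (conv f g t0 s \<ominus> conv f g t s) <= de" for s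
   proof (cases "s : K")
    case True
    thus ?thesis using U(3)[OF t True] A.nrm_ge0 A.cmapD(1)[OF sl] by (simp add: F_def)
   qed (use KL d0 in simp)
   hence "nrm A (weak_integral A mu (conv f g t0) \<ominus> weak_integral A mu (conv f g t)) <= de * measure mu K"
    by (rule diff)
   also note d1
   finally show ?thesis .
  qed
  thus "EX U. open U & t0 : U & (ALL s:U. nrm A (weak_integral A mu (conv f g t0) \<ominus> weak_integral A mu (conv f g s)) < ep)"
   using U by blast
 qed
 moreover have "weak_integral A mu (conv f g t) = \<zero>" if "t ~: L" for t
 proof -
  have "nrm A (weak_integral A mu (conv f g t)) <= 0 * measure mu K"
   by (rule weak_integral_bound[OF cstar_A sl K]) (use KL that in auto)
  thus ?thesis using A.nrm_ge0[OF wc] by (intro A.nrm_eq_zero[OF wc]) (simp add: order_antisym)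
 qed
 ultimately show ?thesis using L unfolding E_carrier E_mult_eq by blast
qed

end

text \<open>\<open>c x\<close> is the character through which \<open>G\<close> acts on the basis
  vector \<open>x\<close>; \<open>c_s\<close> is what lets these diagonal unitaries implement the
  action on the generators.\<close>

locale covariant = quasi_free mu n og A S al + perm_sys n s hdn tln
 for mu :: "'g :: {topological_ab_group_add, t2_space} measure" and n og and A :: "'a cstar" (structure) and S al s hdn tln +
 fixes c :: "nat => 'g => complex" assumes c_dual: "c x : dual" and c_s: "i : {1..n} ==> c (s i x) t = og i t * c x t"
begin

definition rp :: "'a => op" where "rp = (SOME rp. op_hom A rp & (ALL i:{1..n}. rp (S i) = Sop i))"

lemma rp_hom: "op_hom A rp" and rp_S: "i : {1..n} ==> rp (S i) = Sop i"
proof -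
 have "EX rp. op_hom A rp & (ALL i:{1..n}. rp (S i) = Sop i)"
  by (rule cuntz_representation[OF cuntz]) (use sum_Sop_Rop in \<open>simp_all add: Rop_Sop\<close>)
 from someI_ex[OF this] show "op_hom A rp" "i : {1..n} ==> rp (S i) = Sop i" unfolding rp_def[symmetric] by blast+
qed

lemmas rp_simps = op_homD[OF rp_hom]
lemmas rp_nrm = op_hom_contractive[OF cstar_A rp_hom]

lemma rp_zero: "rp \<zero> = 0" using rp_simps(2)[of "\<zero>" 0] by (simp add: opsc_simps)

lemma rp_one: "rp \<one> = 1"
proof -
 have 1: "1 : {1..n}" using n2 by simp
 have "rp (star A (S 1) \<otimes> S 1) = Rop 1 * Sop 1"
  using S_closed[OF 1] by (simp only: rp_simps A.star_closed rp_S[OF 1] adj_Sop)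
 thus ?thesis using Rop_Sop[OF 1 1] S_isometry[OF 1] by simp
qed

definition U :: "'g => op" where "U t = diag (%x. c x t)"

lemma c_bound: "ALL x. cmod (c x t) <= 1" by (simp add: dualD(2)[OF c_dual])

lemma coord_U: "coord (app (U t) xi) x = c x t * coord xi x" unfolding U_def by (rule coord_diag[OF c_bound])

lemma norm_U: "norm (U t) <= 1" unfolding U_def by (rule norm_diag[OF c_bound])

lemma U_add: "U (t + r) = U t * U r" by (intro op_eqI ell2_eqI) (simp add: coord_U dualD(3)[OF c_dual])

lemma U_zero: "U 0 = 1" by (intro op_eqI ell2_eqI) (simp add: coord_U dualD(4)[OF c_dual])

lemma U_adj: "adj (U t) = U (- t)"
proof (rule op_matrix_eqI)
 fix k m
 have "coord (app (adj (U t)) (delta k)) m = cnj (coord (app (U t) (delta m)) k)"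
  by (simp only: ip_delta_right[symmetric] adj) (metis ip_commute)
 thus "coord (app (adj (U t)) (delta k)) m = coord (app (U (- t)) (delta k)) m" by (simp add: coord_U dualD(5)[OF c_dual])
qed

lemma U_Sop: "i : {1..n} ==> U t * Sop i = opsc (og i t) (Sop i) * U t" unfolding U_def
 by (simp only: diag_Sop[OF c_bound] c_s)
  (intro op_eqI ell2_eqI, simp add: coord_Sop coord_diag[OF c_bound] coord_diag[of _ 1]
   norm_mult dualD(2)[OF c_dual] dualD(2)[OF dual])

text \<open>The elements that satisfy the equation for all \<open>t\<close> form a C*-subalgebra,
  and it contains the generators. Closure under adjoints uses that the adjoint of \<open>U t\<close>
  is its inverse \<open>U (- t)\<close>.\<close>

lemma covariance: assumes a: "a : carrier A" shows "U t * rp a = rp (al t a) * U t"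
proof -
 define H where "H = {a : carrier A. ALL t. U t * rp a = rp (al t a) * U t}"
 have HA: "H \<subseteq> carrier A" by (auto simp: H_def)
 have Hz: "\<zero> : H" using al_simps(3)[of "\<zero>" _ 0] al_simps(1)[of "\<zero>"] by (simp add: H_def rp_zero)
 have Hs: "w \<odot> a : H" if "a : H" for w a using that by (simp add: H_def rp_simps al_simps opsc_simps)
 have Hm: "\<ominus> a : H" if "a : H" for a using Hs[OF that, of "-1"] A.smult_m1[of a] that HA by auto
 have "submodule H complex_ring A"
  by (rule A.submoduleI) (use HA Hz Hs Hm in \<open>auto simp: H_def rp_simps al_simps algebra_simps\<close>)
 moreover have "ALL x:H. ALL y:H. x \<otimes> y : H"
 proof (intro ballI)
  fix x y assume x: "x : H" and y: "y : H"
  have "U t * (rp x * rp y) = rp (al t x) * rp (al t y) * U t" for t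
  proof -
   have "U t * (rp x * rp y) = (U t * rp x) * rp y" by (simp add: mult.assoc)
   also have "... = rp (al t x) * (U t * rp y)" using x by (simp add: H_def mult.assoc)
   also have "... = rp (al t x) * rp (al t y) * U t" using y by (simp add: H_def mult.assoc)
   finally show ?thesis .
  qed
  thus "x \<otimes> y : H" using x y by (simp add: H_def rp_simps al_simps A.cl)
 qed
 moreover have "ALL x:H. star A x : H"
 proof
  fix x assume x: "x : H"
  have "U t * adj (rp x) = adj (rp (al t x)) * U t" for t
  proof -
   have "adj (U t * rp x) = adj (rp (al t x) * U t)" using x by (simp add: H_def)
   hence "adj (rp x) * U (- t) = U (- t) * adj (rp (al t x))" by (simp add: U_adj)
   hence "U t * (adj (rp x) * U (- t)) * U t = U t * (U (- t) * adj (rp (al t x))) * U t" by simp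
   moreover have "U t * (adj (rp x) * U (- t)) * U t = U t * adj (rp x)"
    using U_add[of "- t" t] U_zero by (simp add: mult.assoc)
   moreover have "U t * (U (- t) * adj (rp (al t x))) * U t = adj (rp (al t x)) * U t"
    using U_add[of t "- t"] U_zero by (simp flip: mult.assoc)
   ultimately show ?thesis by simp
  qed
  thus "star A x : H" using x by (simp add: H_def rp_simps al_simps A.cl)
 qed
 moreover have "closedin (cs_topology A) H" unfolding A.closedin_iff
 proof (intro conjI HA ballI impI)
  fix x assume x: "x : carrier A" and l: "ALL ep>0. EX y:H. nrm A (x \<ominus> y) < ep"
  have "norm (U t * rp x - rp (al t x) * U t) <= 0" for t
  proof (rule field_le_epsilon)
   fix e :: real assume "0 < e"
   then obtain y where y: "y : H" "nrm A (x \<ominus> y) < e / 2" using l half_gt_zero by blast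
   have yc: "y : carrier A" using y HA by blast
   have "U t * rp x - rp (al t x) * U t = U t * rp (x \<ominus> y) - rp (al t (x \<ominus> y)) * U t"
    using y x yc by (simp add: H_def op_hom_diff[OF cstar_A rp_hom] al_diff al_simps algebra_simps)
   also have "norm ... <= norm (U t) * norm (rp (x \<ominus> y)) + norm (rp (al t (x \<ominus> y))) * norm (U t)"
    by (intro order_trans[OF norm_triangle_ineq4] add_mono norm_mult_ineq)
   also have "... <= 1 * nrm A (x \<ominus> y) + nrm A (x \<ominus> y) * 1"
    using x yc by (intro add_mono mult_mono norm_U rp_nrm order_trans[OF rp_nrm al_nrm])
     (auto simp: al_simps A.nrm_ge0)
   finally show "norm (U t * rp x - rp (al t x) * U t) <= 0 + e" using y(2) by simp
  qed
  thus "x : H" using x by (simp add: H_def)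
 qed
 ultimately have "cstar_subalgebra H A" by (simp add: cstar_subalgebra_def)
 moreover have "S i : H" if "i : {1..n}" for i using that S_closed[OF that] by (simp add: H_def gauge rp_S rp_simps U_Sop)
 ultimately have "H = carrier A" by (rule S_generate)
 thus ?thesis using a by (auto simp: H_def)
qed

end

text \<open>The image of \<open>j\<close> is only dense. The bound makes \<open>Ph f\<close> depend
  on \<open>j f\<close> alone and continuously, so limits along approximating sequences define the
  extension; \<open>key\<close> frees it of the chosen sequence, so that all operations can be
  carried out on approximants.\<close>

lemma op_hom_extension:
 fixes E :: "('e, 'm) cstar_scheme" and B :: "('b, 'k) cstar_scheme" (structure)
 assumes B: "cstar_algebra B" and j: "star_hom E B j" and dense: "cs_topology B closure_of (j ` carrier E) = carrier B"
  and clE: "!!f g. f : carrier E ==> g : carrier E ==> f \<oplus>\<^bsub>E\<^esub> g : carrier E"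
   "!!c f. f : carrier E ==> c \<odot>\<^bsub>E\<^esub> f : carrier E"
   "!!f g. f : carrier E ==> g : carrier E ==> f \<otimes>\<^bsub>E\<^esub> g : carrier E"
   "!!f. f : carrier E ==> star E f : carrier E"
  and Ph: "op_hom E Ph" and bound: "!!f. f : carrier E ==> norm (Ph f) <= nrm B (j f)"
 shows "EX Ps. op_hom B Ps & (ALL f:carrier E. Ps (j f) = Ph f)"
proof -
 interpret B: cstar_algebra B by fact
 note jh = star_homD[OF j] and Phh = op_homD[OF Ph]
 have jE: "j ` carrier E \<subseteq> carrier B" using jh(1) by auto
 have diff: "norm (Ph f - Ph g) <= nrm B (j f \<ominus> j g)" if f: "f : carrier E" and g: "g : carrier E" for f g
 proof -
  have "Ph f - Ph g = Ph (f \<oplus>\<^bsub>E\<^esub> (-1) \<odot>\<^bsub>E\<^esub> g)" using f g clE by (simp add: Phh opsc_simps)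
  moreover have "j (f \<oplus>\<^bsub>E\<^esub> (-1) \<odot>\<^bsub>E\<^esub> g) = j f \<ominus> j g"
   using f g clE jh(1)[OF f] jh(1)[OF g] by (simp add: jh B.minus_smult)
  ultimately show ?thesis using bound[of "f \<oplus>\<^bsub>E\<^esub> (-1) \<odot>\<^bsub>E\<^esub> g"] f g clE by simp
 qed
 have "EX F. ALL k :: nat. F k : carrier E & nrm B (b \<ominus> j (F k)) < inverse (real (Suc k))"
  if b: "b : carrier B" for b
 proof -
  have "ALL ep>0. EX y:j ` carrier E. nrm B (b \<ominus> y) < ep"
   using B.closure_of_iff[OF jE, of b] b unfolding dense by blast
  hence "ALL k :: nat. EX f. f : carrier E & nrm B (b \<ominus> j f) < inverse (real (Suc k))"
   by (metis imageE inverse_positive_iff_positive of_nat_0_less_iff zero_less_Suc)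
  thus ?thesis by metis
 qed
 then obtain F where F: "!!b k. b : carrier B ==> F b k : carrier E"
  and Fb: "!!b (k :: nat). b : carrier B ==> nrm B (b \<ominus> j (F b k)) < inverse (real (Suc k))" by metis
 have Flim: "(%k. nrm B (b \<ominus> j (F b k))) ~~> 0" if b: "b : carrier B" for b
 proof (rule Lim_null[OF _ LIMSEQ_inverse_real_of_nat], rule allI)
  fix k
  have "0 <= nrm B (b \<ominus> j (F b k))" using b jh(1)[OF F[OF b]] by (intro B.nrm_ge0) simp
  thus "norm (nrm B (b \<ominus> j (F b k))) <= inverse (real (Suc k))" using Fb[OF b, of k] by simp
 qed
 have conv: "convergent (%k. Ph (f k))"
  if b: "b : carrier B" and f: "!!k. f k : carrier E" and l: "(%k. nrm B (b \<ominus> j (f k))) ~~> 0" for b f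
 proof -
  have "Cauchy (%k. Ph (f k))"
  proof (rule CauchyI)
   fix e :: real assume "0 < e"
   hence "\<forall>\<^sub>F k in sequentially. nrm B (b \<ominus> j (f k)) < e / 2" by (intro order_tendstoD(2)[OF l]) simp
   then obtain N where N: "!!k. k >= N ==> nrm B (b \<ominus> j (f k)) < e / 2" by (auto simp: eventually_sequentially)
   have "norm (Ph (f m) - Ph (f k)) < e" if "m >= N" "k >= N" for m k
    using diff[OF f f, of m k] B.nrm_minus_trans[OF jh(1)[OF f] b jh(1)[OF f], of m k]
     B.nrm_commute[OF b jh(1)[OF f], of m] N[OF that(1)] N[OF that(2)] by linarith
   thus "EX M. ALL m>=M. ALL n>=M. norm (Ph (f m) - Ph (f n)) < e" by blast
  qed
  thus ?thesis by (rule Cauchy_convergent)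
 qed
 define Ps where "Ps b = lim (%k. Ph (F b k))" for b
 have Pslim: "(%k. Ph (F b k)) ~~> Ps b" if "b : carrier B" for b
  using conv[OF that F[OF that] Flim[OF that]] by (simp add: Ps_def convergent_LIMSEQ_iff)
 have key: "(%k. Ph (f k)) ~~> Ps b"
  if b: "b : carrier B" and f: "!!k. f k : carrier E" and l: "(%k. nrm B (b \<ominus> j (f k))) ~~> 0" for b f
 proof -
  have "(%k. Ph (f k) - Ph (F b k)) ~~> 0"
  proof (rule Lim_null)
   show "(%k. nrm B (b \<ominus> j (f k)) + nrm B (b \<ominus> j (F b k))) ~~> 0" using tendsto_add[OF l Flim[OF b]] by simp
   show "ALL k. norm (Ph (f k) - Ph (F b k)) <= nrm B (b \<ominus> j (f k)) + nrm B (b \<ominus> j (F b k))"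
   proof
    fix k
    show "norm (Ph (f k) - Ph (F b k)) <= nrm B (b \<ominus> j (f k)) + nrm B (b \<ominus> j (F b k))"
     using diff[OF f F[OF b], of k k] B.nrm_minus_trans[OF jh(1)[OF f] b jh(1)[OF F[OF b]], of k k]
      B.nrm_commute[OF b jh(1)[OF f], of k] by linarith
   qed
  qed
  from tendsto_add[OF this Pslim[OF b]] show ?thesis by simp
 qed
 have ext: "Ps (j f) = Ph f" if "f : carrier E" for f
  using key[of "j f" "%_. f"] that jh(1) LIMSEQ_unique[OF tendsto_const] by fastforce
 have "op_hom B Ps" unfolding op_hom_def
 proof (intro conjI ballI allI)
  fix b b' assume b: "b : carrier B" and b': "b' : carrier B"
  note jc = jh(1)[OF F[OF b]] jh(1)[OF F[OF b']]
  note l = Flim[OF b] Flim[OF b']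
  have "(%k. Ph (F b k \<oplus>\<^bsub>E\<^esub> F b' k)) ~~> Ps (b \<oplus> b')"
   by (rule key) (use b b' F clE B.lim_add[OF l b b' jc] in \<open>simp_all add: jh(2)\<close>)
  moreover have "(%k. Ph (F b k \<oplus>\<^bsub>E\<^esub> F b' k)) ~~> Ps b + Ps b'"
   using tendsto_add[OF Pslim[OF b] Pslim[OF b']] F b b' by (simp add: Phh)
  ultimately show "Ps (b \<oplus> b') = Ps b + Ps b'" by (rule LIMSEQ_unique)
  have "(%k. Ph (F b k \<otimes>\<^bsub>E\<^esub> F b' k)) ~~> Ps (b \<otimes> b')"
   by (rule key) (use b b' F clE B.lim_mult[OF l b b' jc] in \<open>simp_all add: jh(4) B.cl\<close>)
  moreover have "(%k. Ph (F b k \<otimes>\<^bsub>E\<^esub> F b' k)) ~~> Ps b * Ps b'"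
   using tendsto_mult[OF Pslim[OF b] Pslim[OF b']] F b b' by (simp add: Phh)
  ultimately show "Ps (b \<otimes> b') = Ps b * Ps b'" by (rule LIMSEQ_unique)
 next
  fix b c assume b: "b : carrier B"
  note jc = jh(1)[OF F[OF b]]
  have "(%k. Ph (c \<odot>\<^bsub>E\<^esub> F b k)) ~~> Ps (c \<odot> b)"
   by (rule key) (use b F clE B.lim_scale[OF tendsto_const[of c] Flim[OF b] b jc] in \<open>simp_all add: jh(3)\<close>)
  moreover have "(%k. Ph (c \<odot>\<^bsub>E\<^esub> F b k)) ~~> opsc c (Ps b)"
   using bounded_linear.tendsto[OF bounded_linear_opscale Pslim[OF b]] F[OF b] by (simp add: Phh)
  ultimately show "Ps (c \<odot> b) = opsc c (Ps b)" by (rule LIMSEQ_unique)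
 next
  fix b assume b: "b : carrier B"
  note jc = jh(1)[OF F[OF b]]
  have "(%k. Ph (star E (F b k))) ~~> Ps (star B b)"
   by (rule key) (use b F clE B.lim_star[OF Flim[OF b] b jc] in \<open>simp_all add: jh(5) B.cl\<close>)
  moreover have "(%k. Ph (star E (F b k))) ~~> adj (Ps b)"
   using bounded_linear.tendsto[OF bounded_linear_adj Pslim[OF b]] F[OF b] by (simp add: Phh)
  ultimately show "Ps (star B b) = adj (Ps b)" by (rule LIMSEQ_unique)
 qed
 thus ?thesis using ext by blast
qed

text \<open>The kernel is a closed ideal; a single element outside it forces it to be zero, and
  injective homomorphisms are isometric.\<close>

lemma simple_op_hom_isometric: assumes B: "cstar_algebra B" and simple: "simple_cstar B" and Ps: "op_hom B Ps"
  and nz: "b0 : carrier B" "Ps b0 ~= 0" and b: "b : carrier B" shows "norm (Ps b) = nrm B b"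
proof -
 interpret B: cstar_algebra B by fact
 note h = op_homD[OF Ps]
 define I where "I = {x : carrier B. Ps x = 0}"
 have z: "\<zero>\<^bsub>B\<^esub> : I" using h(2)[of "\<zero>\<^bsub>B\<^esub>" 0] by (simp add: I_def opsc_simps)
 have sc: "c \<odot>\<^bsub>B\<^esub> x : I" if "x : I" for c x using that by (simp add: I_def h opsc_simps)
 have sm: "\<ominus>\<^bsub>B\<^esub> x : I" if "x : I" for x
  using sc[OF that, of "-1"] B.smult_m1[of x] that by (simp add: I_def)
 have "submodule I complex_ring B" by (rule B.submoduleI) (use z sc sm in \<open>auto simp: I_def h\<close>)
 moreover have "closedin (cs_topology B) I" unfolding B.closedin_iff
 proof (intro conjI ballI impI)
  fix x assume x: "x : carrier B" and l: "ALL ep>0. EX y:I. nrm B (x \<ominus>\<^bsub>B\<^esub> y) < ep"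
  have "norm (Ps x) <= 0"
  proof (rule field_le_epsilon)
   fix e :: real assume "0 < e"
   then obtain y where y: "y : I" "nrm B (x \<ominus>\<^bsub>B\<^esub> y) < e" using l by blast
   hence yc: "y : carrier B" by (simp add: I_def)
   have "Ps x = Ps (x \<ominus>\<^bsub>B\<^esub> y)" using y(1) op_hom_diff[OF B Ps x yc] by (simp add: I_def)
   also have "norm ... <= nrm B (x \<ominus>\<^bsub>B\<^esub> y)" by (rule op_hom_contractive[OF B Ps]) (use x yc in simp)
   finally show "norm (Ps x) <= 0 + e" using y by simp
  qed
  thus "x : I" using x by (simp add: I_def)
 qed (auto simp: I_def)
 ultimately have "closed_ideal I B" unfolding closed_ideal_def by (auto simp: I_def h B.cl)
 hence "I = {\<zero>\<^bsub>B\<^esub>} | I = carrier B" using simple by (simp add: simple_cstar_def)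
 moreover have "I ~= carrier B" using nz by (auto simp: I_def)
 ultimately have "I = {\<zero>\<^bsub>B\<^esub>}" by blast
 thus ?thesis by (intro op_hom_isometric[OF B Ps b]) (auto simp: I_def)
qed

section \<open>The integrated form\<close>

context covariant
begin

definition kern :: "('g => 'a) => ell2 => ell2 => 'g => complex"
 where "kern f xi et t = ip (app (rp (f t)) (app (U t) xi)) et"

lemma U_cont: "cts (%t. app (U t) xi)" unfolding U_def by (rule diag_strong_continuous[OF c_bound dualD(1)[OF c_dual]])

lemma kern_cc: assumes f: "f : carrier E" shows "cc (kern f xi et)"
proof -
 obtain K where K: "compact K" "!!t. t ~: K ==> f t = \<zero>" by (rule E_supp[OF f]) (rule that)
 have "cts (%t. kern f xi et t)"
  unfolding kern_def by (intro cont_ip cont_app A.cmap_op_hom[OF E_cmap[OF f] rp_hom] U_cont continuous_intros)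
 thus ?thesis unfolding cc_def using K by (intro conjI exI[of _ K]) (auto simp: kern_def rp_zero)
qed

lemma E_nrm_cc: assumes f: "f : carrier E" shows "cc (%t. nrm A (f t))"
proof -
 obtain K where K: "compact K" "!!t. t ~: K ==> f t = \<zero>" by (rule E_supp[OF f]) (rule that)
 thus ?thesis unfolding cc_def using A.cmap_nrm[OF E_cmap[OF f]] by (intro conjI exI[of _ K]) auto
qed

lemma norm_app_U: "norm (app (U t) xi) <= norm xi" using order_trans[OF norm_app mult_right_mono[OF norm_U]] by simp

lemma kern_bound: assumes f: "f : carrier E" shows "cmod (kern f xi et t) <= nrm A (f t) * (norm xi * norm et)"
proof -
 have "cmod (kern f xi et t) <= norm (rp (f t)) * norm (app (U t) xi) * norm et" unfolding kern_def by (rule ip_app_bound)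
 also have "... <= nrm A (f t) * norm xi * norm et"
  by (intro mult_right_mono mult_mono rp_nrm E_val[OF f] norm_app_U) (auto simp: A.nrm_ge0 E_val[OF f])
 finally show ?thesis by (simp add: mult.assoc)
qed

text \<open>The integral of \<open>rp (f t) * U t\<close> is taken weakly, as \<open>U\<close> is
  continuous only in the strong sense; the sesquilinear form is bounded by the norm of
  \<open>E\<close>.\<close>

lemma Ph_exists: assumes f: "f : carrier E"
 shows "EX T. (ALL xi et. ip (app T xi) et = lint mu (kern f xi et)) & norm T <= nrm E f"
proof (rule form_op)
 note i = integrable_cc[OF kern_cc[OF f]]
 show "lint mu (kern f (xi + xi') et) = lint mu (kern f xi et) + lint mu (kern f xi' et)" for xi xi' et
  by (subst Bochner_Integration.integral_add[OF i i, symmetric]) (simp add: kern_def[abs_def] ip_add_left)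
 show "lint mu (kern f xi (et + et')) = lint mu (kern f xi et) + lint mu (kern f xi et')" for xi et et'
  by (subst Bochner_Integration.integral_add[OF i i, symmetric]) (simp add: kern_def[abs_def] ip_add_right)
 show "lint mu (kern f (escale c xi) et) = c * lint mu (kern f xi et)" for c xi et
  by (simp add: kern_def[abs_def] ip_scale_left)
 show "lint mu (kern f xi (escale c et)) = cnj c * lint mu (kern f xi et)" for c xi et
  by (simp add: kern_def[abs_def] ip_scale_right)
 show "cmod (lint mu (kern f xi et)) <= nrm E f * norm xi * norm et" for xi et
 proof -
  have "cmod (lint mu (kern f xi et)) <= lint mu (%t. cmod (kern f xi et t))" by (rule integral_norm_bound)
  also have "... <= lint mu (%t. nrm A (f t) * (norm xi * norm et))"
   by (rule integral_mono) (use i integrable_cc[OF E_nrm_cc[OF f]] kern_bound[OF f] in auto)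
  finally show ?thesis by (simp add: E_sel mult.assoc)
 qed
 show "0 <= nrm E f" unfolding E_sel by (rule Bochner_Integration.integral_nonneg) (simp add: A.nrm_ge0 E_val[OF f])
qed

definition Ph :: "('g => 'a) => op"
 where "Ph f = (SOME T. (ALL xi et. ip (app T xi) et = lint mu (kern f xi et)) & norm T <= nrm E f)"

lemma ip_Ph: "f : carrier E ==> ip (app (Ph f) xi) et = lint mu (kern f xi et)"
 and norm_Ph: "f : carrier E ==> norm (Ph f) <= nrm E f"
 using someI_ex[OF Ph_exists, of f] unfolding Ph_def[symmetric] by blast+

lemma Ph_mult: assumes f: "f : carrier E" and g: "g : carrier E" shows "Ph (f \<otimes>\<^bsub>E\<^esub> g) = Ph f * Ph g"
proof (rule op_ext_ip)
 fix xi et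
 obtain K L where K: "compact K" and L: "compact L" and KL: "!!t s. s ~: K | t ~: L ==> conv f g t s = \<zero>"
  by (rule conv_zero[OF f g]) (rule that)
 define F where "F t s = ip (app (rp (conv f g t s)) (app (U t) xi)) et" for t s
 have bf: "bounded_functional A (%a. ip (app (rp a) (app (U t) xi)) et)" for t unfolding bounded_functional_def
 proof (intro conjI ballI allI exI)
  fix x assume x: "x : carrier A"
  show "cmod (ip (app (rp x) (app (U t) xi)) et) <= norm (app (U t) xi) * norm et * nrm A x"
  proof -
   have "cmod (ip (app (rp x) (app (U t) xi)) et) <= norm (rp x) * norm (app (U t) xi) * norm et" by (rule ip_app_bound)
   also have "... <= nrm A x * norm (app (U t) xi) * norm et" by (intro mult_right_mono rp_nrm x) auto
   finally show ?thesis by (simp add: mult_ac)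
  qed
 qed (auto simp: rp_simps ip_add_left ip_scale_left)
 have uc: "cts (%x. app (U (v x)) xi)" if "cts v" for v :: "'g \<times> 'g => 'g" and xi
  by (rule continuous_on_compose2[OF U_cont that]) auto
 have Fc: "cts (%(t, s). F t s)" unfolding F_def case_prod_beta'
  by (intro cont_ip cont_app A.cmap_op_hom[OF _ rp_hom] conv_cmap f g uc continuous_intros)
 have F0: "F t s = 0" if "t ~: L | s ~: K" for t s using KL[of s t] that by (auto simp: F_def rp_zero)
 \<comment> \<open>Covariance moves \<open>U s\<close> across \<open>rp (g (t - s))\<close>, which
   separates the part that depends on \<open>t - s\<close> from the part that depends on
   \<open>s\<close>; translation invariance then produces the product.\<close>
 have Feq: "F t s = ip (app (rp (g (t - s))) (app (U (t - s)) xi)) (app (adj (rp (f s) * U s)) et)" for t s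
 proof -
  have "rp (conv f g t s) * U t = rp (f s) * (rp (al s (g (t - s))) * U s) * U (t - s)"
   using E_val[OF f] E_val[OF g] by (simp add: conv_def rp_simps al_simps mult.assoc flip: U_add)
  also have "... = rp (f s) * U s * (rp (g (t - s)) * U (t - s))"
   by (simp only: covariance[OF E_val[OF g], symmetric] mult.assoc)
  finally have "app (rp (conv f g t s)) (app (U t) xi) = app (rp (f s) * U s) (app (rp (g (t - s))) (app (U (t - s)) xi))"
   by (simp only: app_simps(6)[symmetric] mult.assoc)
  thus ?thesis by (simp only: F_def adj')
 qed
 have "ip (app (Ph (f \<otimes>\<^bsub>E\<^esub> g)) xi) et = lint mu (%t. lint mu (F t))"
  unfolding ip_Ph[OF E_mult[OF f g]] kern_def E_mult_functional[OF f g bf] F_def ..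
 also have "... = lint mu (%s. lint mu (%t. F t s))" by (rule fubini_cc[OF Fc L K F0])
 also have "... = lint mu (%s. kern f (app (Ph g) xi) et s)"
 proof -
  have "lint mu (%t. F t s) = kern f (app (Ph g) xi) et s" for s
  proof -
   define ze where "ze = app (adj (rp (f s) * U s)) et"
   have "lint mu (%t. F t s) = lint mu (%t. kern g xi ze (- s + t))" by (simp add: Feq kern_def ze_def)
   also have "... = lint mu (kern g xi ze)"
    by (rule integral_translate) (use kern_cc[OF g] in \<open>auto simp: cc_def intro!: measurable_mu\<close>)
   also have "... = ip (app (Ph g) xi) ze" by (simp add: ip_Ph[OF g])
   also have "... = kern f (app (Ph g) xi) et s" unfolding ze_def kern_def adj' by simp
   finally show ?thesis .
  qed
  thus ?thesis by simp
 qed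
 also have "... = ip (app (Ph f * Ph g) xi) et" by (simp add: ip_Ph[OF f])
 finally show "ip (app (Ph (f \<otimes>\<^bsub>E\<^esub> g)) xi) et = ip (app (Ph f * Ph g) xi) et" .
qed

lemma Ph_star: assumes f: "f : carrier E" shows "Ph (star E f) = adj (Ph f)"
proof (rule op_ext_ip)
 fix xi et
 have eq: "kern (star E f) xi et t = cnj (kern f et xi (- t))" for t
 proof -
  have ft: "star A (f (- t)) : carrier A" using E_val[OF f] by (simp add: A.cl)
  have "rp (al t (star A (f (- t)))) * U t = U t * adj (rp (f (- t)))"
   using covariance[OF ft, of t] E_val[OF f] by (simp add: rp_simps)
  hence "kern (star E f) xi et t = ip (app (U t * adj (rp (f (- t)))) xi) et"
   unfolding kern_def E_sel by (simp only: app_simps(6)[symmetric])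
  also have "... = ip (app (adj (rp (f (- t)) * U (- t))) xi) et" by (simp add: U_adj)
  also have "... = cnj (kern f et xi (- t))" unfolding adj kern_def by (subst ip_commute) simp
  finally show ?thesis .
 qed
 have "cc (%t. cnj (kern f et xi t))" using kern_cc[OF f, of et xi] by (auto simp: cc_def intro!: continuous_intros)
 \<comment> \<open>Taking adjoints reverses the sign of \<open>t\<close>, so the inversion
   invariance of \<open>mu\<close> enters here.\<close>
 from integral_uminus[OF this]
 have "lint mu (kern (star E f) xi et) = lint mu (%t. cnj (kern f et xi t))" by (simp only: eq[abs_def])
 also have "... = cnj (lint mu (kern f et xi))" by simp
 also have "... = ip (app (adj (Ph f)) xi) et" unfolding adj by (subst ip_commute) (simp add: ip_Ph[OF f])
 finally show "ip (app (Ph (star E f)) xi) et = ip (app (adj (Ph f)) xi) et" by (simp add: ip_Ph[OF E_star[OF f]])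
qed

lemma Ph_hom: "op_hom E Ph" unfolding op_hom_def
proof (intro conjI ballI allI)
 fix f g assume f: "f : carrier E" and g: "g : carrier E"
 show "Ph (f \<otimes>\<^bsub>E\<^esub> g) = Ph f * Ph g" by (rule Ph_mult[OF f g])
 show "Ph (f \<oplus>\<^bsub>E\<^esub> g) = Ph f + Ph g"
 proof (rule op_ext_ip)
  fix xi et
  have "kern (f \<oplus>\<^bsub>E\<^esub> g) xi et = (%t. kern f xi et t + kern g xi et t)"
   using E_val[OF f] E_val[OF g] by (simp add: fun_eq_iff kern_def E_sel rp_simps ip_add_left)
  thus "ip (app (Ph (f \<oplus>\<^bsub>E\<^esub> g)) xi) et = ip (app (Ph f + Ph g) xi) et"
   using integrable_cc[OF kern_cc[OF f]] integrable_cc[OF kern_cc[OF g]] by (simp add: ip_Ph f g E_add ip_add_left)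
 qed
next
 fix f c assume f: "f : carrier E"
 show "Ph (c \<odot>\<^bsub>E\<^esub> f) = opsc c (Ph f)"
 proof (rule op_ext_ip)
  fix xi et
  have "kern (c \<odot>\<^bsub>E\<^esub> f) xi et = (%t. c * kern f xi et t)"
   using E_val[OF f] by (simp add: fun_eq_iff kern_def E_sel rp_simps ip_scale_left)
  thus "ip (app (Ph (c \<odot>\<^bsub>E\<^esub> f)) xi) et = ip (app (opsc c (Ph f)) xi) et"
   by (simp add: ip_Ph f E_smult ip_scale_left)
 qed
qed (rule Ph_star)

lemma Ph_seminorm: "cstar_seminorm E (%f. norm (Ph f))" unfolding cstar_seminorm_def
 using E_star by (auto simp: op_homD[OF Ph_hom] norm_opscale norm_triangle_ineq norm_mult_ineq op_cstar)

text \<open>The norm of \<open>Ph f\<close> is one of the C*-seminorms over which the enveloping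
  norm is a supremum.\<close>

lemma Ph_extends:
 fixes B :: "('b, 'k) cstar_scheme" assumes env: "enveloping_cstar_algebra E B j"
 shows "EX Ps. op_hom B Ps & (ALL f:carrier E. Ps (j f) = Ph f)"
proof (rule op_hom_extension[OF _ _ _ E_add E_smult E_mult E_star Ph_hom])
 fix f assume f: "f : carrier E"
 have "norm (Ph f) <= Sup {p f |p. cstar_seminorm E p & (ALL y:carrier E. p y <= nrm E y)}"
 proof (rule cSup_upper)
  show "norm (Ph f) : {p f |p. cstar_seminorm E p & (ALL y:carrier E. p y <= nrm E y)}"
   using Ph_seminorm norm_Ph by (intro CollectI exI[of _ "%f. norm (Ph f)"]) simp
  show "bdd_above {p f |p. cstar_seminorm E p & (ALL y:carrier E. p y <= nrm E y)}"
   using f by (intro bdd_aboveI[where M="nrm E f"]) auto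
 qed
 thus "norm (Ph f) <= nrm B (j f)" using env f by (simp add: enveloping_cstar_algebra_def)
qed (use env in \<open>auto simp: enveloping_cstar_algebra_def\<close>)

end

section \<open>Multipliers on the dual group\<close>

abbreviation char_mult :: "('g => complex) => ('g => complex) => 'g => complex" (infixr "\<diamond>" 70)
 where "ta \<diamond> ga \<equiv> (%t. ta t * ga t)"

text \<open>In the topology of the dual group, these are the relatively compact sets.\<close>

definition equi :: "('g :: topological_ab_group_add => complex) set => bool"
 where "equi Y \<longleftrightarrow> Y \<subseteq> dual &
  (ALL ep>0. EX V. open V & 0 : V & (ALL ga:Y. ALL t:V. cmod (ga t - 1) < ep))"

lemma equiD: "equi Y ==> 0 < ep ==> EX V. open V & 0 : V & (ALL ga:Y. ALL t:V. cmod (ga t - 1) < ep)" by (simp add: equi_def)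

text \<open>Total boundedness as in the Arzela-Ascoli theorem, stated as a finite colouring. A
  colour records the values at finitely many points of \<open>K\<close>, rounded to a grid;
  equicontinuity at 0 carries closeness at those points to all of \<open>K\<close>, since
  \<open>ga t = ga p * ga (t - p)\<close>.\<close>

lemma equi_cover: assumes Y: "equi Y" and K: "compact K" and d: "0 < de"
 shows "EX col :: ('g :: topological_ab_group_add => complex) => 'g => int \<times> int. finite (col ` Y) &
  (ALL ga:Y. ALL ga':Y. col ga = col ga' --> (ALL t:K. cmod (ga t - ga' t) < de))"
proof -
 have YD: "Y \<subseteq> dual" using Y by (simp add: equi_def)
 obtain V where V: "open V" "0 : V" "!!ga t. ga : Y ==> t : V ==> cmod (ga t - 1) < de / 4"
  using equiD[OF Y, of "de / 4"] d by auto
 define T where "T p = (%t. t - p) -` V" for p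
 have "open (T p)" for p unfolding T_def by (intro open_vimage V continuous_intros)
 moreover have "K \<subseteq> (\<Union>p\<in>K. T p)" using V by (auto simp: T_def)
 ultimately obtain P where P: "P \<subseteq> K" "finite P" "K \<subseteq> (\<Union>p\<in>P. T p)"
  using compactE_image[OF K, of K T] by metis
 \<comment> \<open>Real and imaginary parts within \<open>de / 8\<close> give values within
   \<open>de / 4\<close>; two further errors of \<open>de / 4\<close> come from moving between
   \<open>p\<close> and \<open>t\<close>.\<close>
 define et where "et = de / 8"
 have et: "0 < et" using d by (simp add: et_def)
 define col where "col ga p = (if p : P then (\<lfloor>Re (ga p) / et\<rfloor>, \<lfloor>Im (ga p) / et\<rfloor>) else (0, 0))" for ga p
 define I where "I = {\<lfloor>- 1 / et\<rfloor>..\<lfloor>1 / et\<rfloor>}"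
 have fl: "\<lfloor>r / et\<rfloor> : I" if "\<bar>r\<bar> <= 1" for r
  using that et divide_right_mono[of "- 1" r et] divide_right_mono[of r 1 et] unfolding I_def by (auto intro!: floor_mono)
 have "col ` Y \<subseteq> {f. ALL p. (p : P --> f p : I \<times> I) & (p ~: P --> f p = (0, 0))}"
 proof safe
  fix ga p assume g: "ga : Y" and p: "p : P"
  have "cmod (ga p) = 1" using dualD(2) g YD by blast
  hence "\<bar>Re (ga p)\<bar> <= 1" "\<bar>Im (ga p)\<bar> <= 1"
   using abs_Re_le_cmod[of "ga p"] abs_Im_le_cmod[of "ga p"] by simp_all
  thus "col ga p : I \<times> I" using p fl by (simp add: col_def)
 qed (simp add: col_def)
 hence fin: "finite (col ` Y)" by (rule finite_subset) (intro finite_set_of_finite_funs P, simp add: I_def)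
 have fl2: "\<bar>r - r'\<bar> < et" if "\<lfloor>r / et\<rfloor> = \<lfloor>r' / et\<rfloor>" for r r'
 proof -
  have "\<bar>r / et - r' / et\<bar> < 1" using that by linarith
  thus ?thesis using et by (simp add: divide_simps abs_less_iff flip: diff_divide_distrib)
 qed
 have "cmod (ga t - ga' t) < de" if g: "ga : Y" "ga' : Y" and eq: "col ga = col ga'" and t: "t : K" for ga ga' t
 proof -
  obtain p where p: "p : P" "t - p : V" using t P(3) by (auto simp: T_def)
  have "col ga p = col ga' p" using eq by simp
  hence "\<bar>Re (ga p) - Re (ga' p)\<bar> < et" "\<bar>Im (ga p) - Im (ga' p)\<bar> < et"
   using p fl2 by (auto simp: col_def)
  hence d1: "cmod (ga p - ga' p) < de / 4" using cmod_le[of "ga p - ga' p"] by (simp add: et_def)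
  have D: "ga : dual" "ga' : dual" using g YD by auto
  have t: "rh t = rh p * rh (t - p)" if "rh : dual" for rh using dualD(3)[OF that, of p "t - p"] by simp
  have "ga t - ga' t = ga p * (ga (t - p) - 1) + (ga p - ga' p) + ga' p * (1 - ga' (t - p))"
   by (simp add: t[OF D(1)] t[OF D(2)] algebra_simps)
  also have "cmod ... <= cmod (ga p * (ga (t - p) - 1)) + cmod (ga p - ga' p) + cmod (ga' p * (1 - ga' (t - p)))"
   by (intro norm_triangle_mono order_refl)
  also have "... < de" using V(3)[OF g(1) p(2)] V(3)[OF g(2) p(2)] d1 d
   by (simp add: norm_mult dualD(2)[OF D(1)] dualD(2)[OF D(2)] norm_minus_commute)
  finally show ?thesis .
 qed
 with fin show ?thesis by blast
qed

lemma equi_subset: "equi Y ==> Z \<subseteq> Y ==> equi Z" unfolding equi_def by (meson subset_iff subset_trans)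

lemma equi_empty: "equi {}" by (auto simp: equi_def)

lemma equi_Un: assumes "equi Y" "equi Z" shows "equi (Y \<union> Z)" unfolding equi_def
proof (intro conjI allI impI)
 fix ep :: real assume e: "0 < ep"
 obtain V where V: "open V" "0 : V" "ALL ga:Y. ALL t:V. cmod (ga t - 1) < ep" using equiD[OF assms(1) e] by blast
 obtain V' where V': "open V'" "0 : V'" "ALL ga:Z. ALL t:V'. cmod (ga t - 1) < ep" using equiD[OF assms(2) e] by blast
 show "EX V. open V & 0 : V & (ALL ga:Y \<union> Z. ALL t:V. cmod (ga t - 1) < ep)"
  by (rule exI[of _ "V \<inter> V'"]) (use V V' in auto)
qed (use assms in \<open>auto simp: equi_def\<close>)

text \<open>These are the translations that move some point of \<open>Y\<close> into
  \<open>Z\<close>; in the AF case this leaves only finitely many relevant words.\<close>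

lemma equi_quotient: assumes "equi Y" "equi Z" shows "equi {ta : dual. EX ga:Y. ta \<diamond> ga : Z}" unfolding equi_def
proof (intro conjI allI impI)
 fix ep :: real assume e: "0 < ep"
 obtain V where V: "open V" "0 : V" "ALL ga:Y. ALL t:V. cmod (ga t - 1) < ep / 2"
  using equiD[OF assms(1) half_gt_zero[OF e]] by blast
 obtain V' where V': "open V'" "0 : V'" "ALL ga:Z. ALL t:V'. cmod (ga t - 1) < ep / 2"
  using equiD[OF assms(2) half_gt_zero[OF e]] by blast
 have "cmod (ta t - 1) < ep" if "ga : Y" "ta \<diamond> ga : Z" "t : V \<inter> V'" for ta ga t
 proof -
  have "cmod (ga t) = 1" using that(1) assms(1) by (auto simp: equi_def dest: dualD(2))
  hence "cmod (ta t - 1) = cmod ((ta t - 1) * ga t)" by (simp add: norm_mult)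
  also have "... = cmod ((ta t * ga t - 1) - (ga t - 1))" by (simp add: algebra_simps)
  also have "... <= cmod (ta t * ga t - 1) + cmod (ga t - 1)" by (rule norm_triangle_ineq4)
  also have "... < ep / 2 + ep / 2" using V V' that by (intro add_strict_mono) auto
  finally show ?thesis by simp
 qed
 thus "EX W. open W & 0 : W & (ALL ta:{ta : dual. EX ga:Y. ta \<diamond> ga : Z}. ALL t:W. cmod (ta t - 1) < ep)"
  using V V' by (intro exI[of _ "V \<inter> V'"]) blast
qed auto

context lc_haar
begin

definition hat :: "('g => complex) => ('g => complex) => complex" where "hat h ga = lint mu (%t. h t * ga t)"

lemma hat_cc: "cc h ==> ga : dual ==> cc (%t. h t * ga t)" using cc_mult[of ga h] dualD(1)[of ga] by (simp add: mult.commute)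

lemmas hat_integrable = integrable_cc[OF hat_cc]

lemma cc_norm: "cc h ==> cc (%t. cmod (h t))" unfolding cc_def by (auto intro: continuous_on_norm)

lemma hat_nonzero: assumes g: "ga : dual" obtains h where "cc h" "hat h ga ~= 0"
proof -
 obtain b :: "'g => real" where b: "cc b" "0 < lint mu b" using positive_cc by blast
 define k where "k t = cnj (ga t) * cre (b t)" for t
 have k: "cc k" unfolding k_def[abs_def] by (rule cc_mult[OF dualD(1)[OF dual_cnj[OF g]] cc_of_real[OF b(1)]])
 have "k t * ga t = cre (b t)" for t using dual_cancel(2)[OF g, of t] by (simp add: k_def mult_ac)
 hence "hat k ga = cre (lint mu b)" by (simp add: hat_def)
 thus ?thesis using that[OF k] b(2) by simp
qed

lemma hat_bound: assumes h: "cc h" and g: "ga : dual" shows "cmod (hat h ga) <= lint mu (%t. cmod (h t))"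
 using integral_norm_bound[of mu "%t. h t * ga t"] by (simp add: hat_def norm_mult dualD(2)[OF g])

lemma hat_add: "cc h ==> cc k ==> ga : dual ==> hat (%t. h t + k t) ga = hat h ga + hat k ga"
 by (simp add: hat_def distrib_right hat_integrable)

lemma hat_scale: "hat (%t. c * h t) ga = c * hat h ga" by (simp add: hat_def mult.assoc)

lemma cc_scale: "cc h ==> cc (%t. (c :: complex) * h t)" by (rule cc_mult) auto

lemma hat_translate: "hat (ta \<diamond> h) ga = hat h (ta \<diamond> ga)" by (simp add: hat_def mult_ac)

lemma cc_cnj: "cc h ==> cc (%t. cnj (h t))" unfolding cc_def by (elim conjE, intro conjI continuous_on_cnj) simp_all

lemma hat_cnj: assumes h: "cc h" and g: "ga : dual" shows "hat (%t. cnj (h (- t))) ga = cnj (hat h ga)"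
proof -
 have "cc (%t. cnj (h t * ga t))" by (rule cc_cnj[OF hat_cc[OF h g]])
 note eq = integral_uminus[OF this]
 have "cnj (h (- t)) * ga t = cnj (h (- t) * ga (- t))" for t by (subst dualD(5)[OF g]) simp
 hence "hat (%t. cnj (h (- t))) ga = lint mu (%t. cnj (h t * ga t))" unfolding hat_def by (simp only: eq)
 also have "... = cnj (hat h ga)" unfolding hat_def by (rule Bochner_Integration.integral_cnj)
 finally show ?thesis .
qed

text \<open>The convolution theorem; \<open>l\<close> is the convolution of \<open>h\<close> and
  \<open>k\<close>.\<close>

lemma hat_mult: assumes h: "cc h" and k: "cc k" shows "EX l. cc l & (ALL ga:dual. hat l ga = hat h ga * hat k ga)"
proof -
 obtain K where K: "compact K" "!!t. t ~: K ==> h t = 0" "cts h" by (rule ccE[OF h]) (rule that)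
 obtain L where L: "compact L" "!!t. t ~: L ==> k t = 0" "cts k" by (rule ccE[OF k]) (rule that)
 define M where "M = {s + t |s t. s : K & t : L}"
 have M: "compact M" unfolding M_def by (rule compact_sum[OF K(1) L(1)])
 have z: "h s * k (t - s) = 0" if "t ~: M | s ~: K" for t s
 proof (cases "s : K")
  case True
  have "t - s ~: L"
  proof
   assume "t - s : L"
   moreover have "t = s + (t - s)" by simp
   ultimately show False using that True unfolding M_def by blast
  qed
  thus ?thesis by (simp add: L(2))
 qed (simp add: K(2))
 have c1: "cts (%x. h (snd x))" "cts (%x. k (fst x - snd x))"
  by (rule continuous_on_compose2[OF K(3) continuous_on_snd[OF continuous_on_id] subset_UNIV]
   continuous_on_compose2[OF L(3) continuous_on_diff[OF continuous_on_fst continuous_on_snd] subset_UNIV]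
   continuous_on_id)+
 define l where "l t = lint mu (%s. h s * k (t - s))" for t
 have "cc l" unfolding l_def by (rule cc_partial_integral[OF _ M K(1), of "%t s. h s * k (t - s)"])
   (use z in \<open>auto simp: case_prod_beta' intro!: continuous_on_mult c1\<close>)
 moreover have "hat l ga = hat h ga * hat k ga" if g: "ga : dual" for ga
 proof -
  have gc: "cts (%x. ga (fst x))"
   by (rule continuous_on_compose2[OF dualD(1)[OF g] continuous_on_fst[OF continuous_on_id] subset_UNIV])
  have "hat l ga = lint mu (%t. lint mu (%s. h s * k (t - s) * ga t))" by (simp add: hat_def l_def)
  also have "... = lint mu (%s. lint mu (%t. h s * k (t - s) * ga t))"
   by (rule fubini_cc[OF _ M K(1)]) (use z in \<open>auto simp: case_prod_beta' intro!: continuous_on_mult c1 gc\<close>)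
  also have "... = lint mu (%s. (h s * ga s) * hat k ga)"
  proof (rule Bochner_Integration.integral_cong[OF refl])
   fix s
   have "h s * k (t - s) * ga t = (h s * ga s) * (k (- s + t) * ga (- s + t))" for t
   proof -
    have "ga t = ga s * ga (t - s)" using dualD(3)[OF g, of s "t - s"] by simp
    thus ?thesis by simp
   qed
   hence "lint mu (%t. h s * k (t - s) * ga t) = lint mu (%t. (h s * ga s) * (k (- s + t) * ga (- s + t)))" by (simp only:)
   also have "... = (h s * ga s) * lint mu (%t. k (- s + t) * ga (- s + t))" by simp
   also have "lint mu (%t. k (- s + t) * ga (- s + t)) = hat k ga" unfolding hat_def
    by (rule integral_translate) (use hat_cc[OF k g] in \<open>auto simp: cc_def intro!: measurable_mu\<close>)
   finally show "lint mu (%t. h s * k (t - s) * ga t) = h s * ga s * hat k ga" .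
  qed
  also have "... = hat h ga * hat k ga" by (simp add: hat_def)
  finally show ?thesis .
 qed
 ultimately show ?thesis by blast
qed

text \<open>By the Riemann--Lebesgue lemma, on the dual group this is \<open>C\<^sub>0\<close>.\<close>

definition FC :: "(('g => complex) => complex) set"
 where "FC = {w. ALL ep>0. EX h. cc h & (ALL ga:dual. cmod (w ga - hat h ga) <= ep)}"

lemma FCD: "w : FC ==> 0 < ep ==> EX h. cc h & (ALL ga:dual. cmod (w ga - hat h ga) <= ep)" by (simp add: FC_def)

lemma FC_hat: "cc h ==> hat h : FC" unfolding FC_def by (auto intro!: exI[of _ h])

lemma FC_limit: assumes "!!ep. 0 < ep ==> EX v:FC. ALL ga:dual. cmod (w ga - v ga) <= ep" shows "w : FC" unfolding FC_def
proof (intro CollectI allI impI)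
 fix ep :: real assume "0 < ep"
 hence e: "0 < ep / 2" by simp
 obtain v where v: "v : FC" "ALL ga:dual. cmod (w ga - v ga) <= ep / 2" using assms[OF e] by blast
 obtain h where h: "cc h" "ALL ga:dual. cmod (v ga - hat h ga) <= ep / 2" using FCD[OF v(1) e] by blast
 have "cmod (w ga - hat h ga) <= ep" if "ga : dual" for ga
  using norm_triangle_ineq[of "w ga - v ga" "v ga - hat h ga"] v(2) h(2) that by fastforce
 thus "EX h. cc h & (ALL ga:dual. cmod (w ga - hat h ga) <= ep)" using h by blast
qed

lemma FC_bounded: "w : FC ==> EX C>0. ALL ga:dual. cmod (w ga) <= C"
proof -
 assume "w : FC"
 then obtain h where h: "cc h" "ALL ga:dual. cmod (w ga - hat h ga) <= 1" using FCD[of w 1] by auto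
 define I where "I = lint mu (%t. cmod (h t))"
 have "0 <= I" unfolding I_def by (rule Bochner_Integration.integral_nonneg) simp
 moreover have "cmod (w ga) <= 1 + I" if g: "ga : dual" for ga
  using norm_triangle_ineq[of "w ga - hat h ga" "hat h ga"] h(2) hat_bound[OF h(1) g] g by (fastforce simp: I_def)
 ultimately show ?thesis by (intro exI[of _ "1 + I"]) auto
qed

lemma FC_add: assumes "w : FC" "v : FC" shows "(%ga. w ga + v ga) : FC"
proof (rule FC_limit)
 fix ep :: real assume "0 < ep"
 hence e: "0 < ep / 2" by simp
 obtain h where h: "cc h" "ALL ga:dual. cmod (w ga - hat h ga) <= ep / 2" using FCD[OF assms(1) e] by blast
 obtain k where k: "cc k" "ALL ga:dual. cmod (v ga - hat k ga) <= ep / 2" using FCD[OF assms(2) e] by blast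
 have "cmod (w ga + v ga - hat (%t. h t + k t) ga) <= ep" if g: "ga : dual" for ga
 proof -
  have "w ga + v ga - hat (%t. h t + k t) ga = (w ga - hat h ga) + (v ga - hat k ga)" by (simp add: hat_add[OF h(1) k(1) g])
  also have "cmod ... <= ep / 2 + ep / 2" using h(2) k(2) g by (intro norm_triangle_mono) auto
  finally show ?thesis by simp
 qed
 thus "EX u:FC. ALL ga:dual. cmod (w ga + v ga - u ga) <= ep" using FC_hat[OF cc_add[OF h(1) k(1)]] by blast
qed

lemma FC_mult: assumes "w : FC" "v : FC" shows "(%ga. w ga * v ga) : FC"
proof (rule FC_limit)
 fix ep :: real assume e: "0 < ep"
 obtain C where C: "C > 0" "ALL ga:dual. cmod (w ga) <= C" using FC_bounded[OF assms(1)] by blast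
 obtain k where k: "cc k" "ALL ga:dual. cmod (v ga - hat k ga) <= ep / (2 * C)"
  using FCD[OF assms(2), of "ep / (2 * C)"] C e by auto
 obtain D where D: "D > 0" "ALL ga:dual. cmod (hat k ga) <= D" using FC_bounded[OF FC_hat[OF k(1)]] by blast
 obtain h where h: "cc h" "ALL ga:dual. cmod (w ga - hat h ga) <= ep / (2 * D)"
  using FCD[OF assms(1), of "ep / (2 * D)"] D e by auto
 obtain l where l: "cc l" "ALL ga:dual. hat l ga = hat h ga * hat k ga" using hat_mult[OF h(1) k(1)] by blast
 have "cmod (w ga * v ga - hat l ga) <= ep" if g: "ga : dual" for ga
 proof -
  have "w ga * v ga - hat l ga = w ga * (v ga - hat k ga) + (w ga - hat h ga) * hat k ga"
   using l(2) g by (simp add: algebra_simps)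
  also have "cmod ... <= C * (ep / (2 * C)) + ep / (2 * D) * D"
  proof (rule norm_triangle_mono)
   show "cmod (w ga * (v ga - hat k ga)) <= C * (ep / (2 * C))" unfolding norm_mult using C k(2) g by (intro mult_mono) auto
   show "cmod ((w ga - hat h ga) * hat k ga) <= ep / (2 * D) * D"
    unfolding norm_mult using D h(2) g e by (intro mult_mono) auto
  qed
  also have "... = ep" using C D by simp
  finally show ?thesis .
 qed
 thus "EX u:FC. ALL ga:dual. cmod (w ga * v ga - u ga) <= ep" using FC_hat[OF l(1)] by blast
qed

lemma FC_zero: "(%_. 0) : FC"
proof -
 have "cc (%_ :: 'g. 0 :: complex)" unfolding cc_def using compact_empty by auto
 from FC_hat[OF this] show ?thesis by (simp add: hat_def[abs_def])
qed

lemma FC_scale: "w : FC ==> (%ga. c * w ga) : FC"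
proof (rule FC_limit)
 fix ep :: real assume w: "w : FC" and e: "0 < ep"
 obtain d where d: "0 < d" "d * cmod c < ep" by (rule small_factor[OF e norm_ge_zero])
 obtain h where h: "cc h" "ALL ga:dual. cmod (w ga - hat h ga) <= d" using FCD[OF w d(1)] by blast
 have "cmod (c * w ga - hat (%t. c * h t) ga) <= ep" if g: "ga : dual" for ga
 proof -
  have "cmod (c * w ga - hat (%t. c * h t) ga) = cmod c * cmod (w ga - hat h ga)"
   by (simp add: hat_scale norm_mult flip: right_diff_distrib)
  also have "... <= cmod c * d" using h(2) g by (intro mult_left_mono) auto
  finally show ?thesis using d(2) by (simp add: mult.commute)
 qed
 thus "EX u:FC. ALL ga:dual. cmod (c * w ga - u ga) <= ep" using FC_hat[OF cc_scale[OF h(1)]] by blast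
qed

lemma FC_cnj: "w : FC ==> (%ga. cnj (w ga)) : FC"
proof (rule FC_limit)
 fix ep :: real assume w: "w : FC" and e: "0 < ep"
 obtain h where h: "cc h" "ALL ga:dual. cmod (w ga - hat h ga) <= ep" using FCD[OF w e] by blast
 have "cc (%t. cnj (h (- t)))" by (rule cc_cnj[OF cc_uminus[OF h(1)]])
 moreover have "cmod (cnj (w ga) - hat (%t. cnj (h (- t))) ga) <= ep" if g: "ga : dual" for ga
  using h(2) g by (simp add: hat_cnj[OF h(1) g] flip: complex_cnj_diff)
 ultimately show "EX u:FC. ALL ga:dual. cmod (cnj (w ga) - u ga) <= ep" using FC_hat by blast
qed

lemma FC_translate: assumes w: "w : FC" and x: "ta : dual" shows "(%ga. w (ta \<diamond> ga)) : FC"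
proof (rule FC_limit)
 fix ep :: real assume e: "0 < ep"
 obtain h where h: "cc h" "ALL ga:dual. cmod (w ga - hat h ga) <= ep" using FCD[OF w e] by blast
 have "cmod (w (ta \<diamond> ga) - hat (ta \<diamond> h) ga) <= ep" if g: "ga : dual" for ga
  using h(2) dual_mult[OF x g] by (simp add: hat_translate)
 thus "EX u:FC. ALL ga:dual. cmod (w (ta \<diamond> ga) - u ga) <= ep"
  using FC_hat[OF cc_mult[OF dualD(1)[OF x] h(1)]] by blast
qed

lemma FC_poly: "w : FC ==> (%ga. poly (px * r) (w ga)) : FC"
proof (induction r)
 case (pCons a r)
 have "(%ga. poly (px * pCons a r) (w ga)) = (%ga. a * w ga + w ga * poly (px * r) (w ga))"
  by (simp add: fun_eq_iff algebra_simps)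
 thus ?case using FC_add[OF FC_scale FC_mult] pCons by simp
qed (simp add: FC_zero)

text \<open>\<open>FC\<close> need not contain the constants, so \<open>f\<close> must vanish at 0
  and is approximated by polynomials without constant term.\<close>

lemma FC_calculus: assumes w: "w : FC" and f: "cts f" "f 0 = 0" shows "(%ga. cre (f (Re (w ga)))) : FC"
proof (rule FC_limit)
 fix ep :: real assume e: "0 < ep"
 obtain C where C: "C > 0" "ALL ga:dual. cmod (w ga) <= C" using FC_bounded[OF w] by blast
 obtain r :: "complex poly" where r: "ALL t. \<bar>t\<bar> <= C --> cmod (poly (px * r) (of_real t) - of_real (f t)) < ep"
  using weierstrass_poly[of C f ep] continuous_on_subset[OF f(1)] f(2) e C by auto
 have "(%ga. (1 / 2) * (w ga + cnj (w ga))) : FC" by (intro FC_scale FC_add FC_cnj w)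
 moreover have "(1 / 2) * (z + cnj z) = of_real (Re z)" for z by (simp add: complex_add_cnj)
 ultimately have "(%ga. poly (px * r) (of_real (Re (w ga)))) : FC" using FC_poly by simp
 moreover have "cmod (of_real (f (Re (w ga))) - poly (px * r) (of_real (Re (w ga)))) <= ep" if "ga : dual" for ga
 proof -
  have "\<bar>Re (w ga)\<bar> <= C" using C(2) that abs_Re_le_cmod[of "w ga"] by (meson order_trans)
  thus ?thesis using r by (simp only: norm_minus_commute[of "of_real (f _)"] less_imp_le)
 qed
 ultimately show "EX v:FC. ALL ga:dual. cmod (cre (f (Re (w ga))) - v ga) <= ep"
  by (intro bexI[of _ "%ga. poly (px * r) (of_real (Re (w ga)))"]) blast+
qed

text \<open>Uniform continuity for the topology of uniform convergence on compact sets;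
  \<open>K\<close> is a support of an approximating \<open>h\<close>, outside which the characters
  do not affect \<open>hat h\<close>.\<close>

lemma FC_uniform: assumes w: "w : FC" and e: "0 < ep" shows "EX K de. compact K & 0 < de & (ALL ga:dual. ALL ga':dual.
  (ALL t:K. cmod (ga t - ga' t) < de) --> cmod (w ga - w ga') < ep)"
proof -
 obtain h where h: "cc h" "ALL ga:dual. cmod (w ga - hat h ga) <= ep / 4" using FCD[OF w, of "ep / 4"] e by auto
 obtain K where K: "compact K" "!!t. t ~: K ==> h t = 0" using ccE[OF h(1)] by metis
 define I where "I = lint mu (%t. cmod (h t))"
 have I: "0 <= I" unfolding I_def by (rule Bochner_Integration.integral_nonneg) simp
 obtain de where d: "0 < de" and dI: "de * I < ep / 4" by (rule small_factor[of "ep / 4" I]) (use e I in auto)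
 have "cmod (w ga - w ga') < ep"
  if g: "ga : dual" "ga' : dual" and l: "ALL t:K. cmod (ga t - ga' t) < de" for ga ga'
 proof -
  have "hat h ga - hat h ga' = lint mu (%t. h t * (ga t - ga' t))"
   by (simp add: hat_def right_diff_distrib hat_integrable[OF h(1)] g)
  also have "cmod ... <= lint mu (%t. cmod (h t * (ga t - ga' t)))" by (rule integral_norm_bound)
  also have "... <= lint mu (%t. de * cmod (h t))"
  proof (rule integral_mono)
   show "integrable mu (%t. cmod (h t * (ga t - ga' t)))" by (simp add: right_diff_distrib hat_integrable[OF h(1)] g)
   show "integrable mu (%t. de * cmod (h t))" using integrable_cc[OF cc_norm[OF h(1)]] by simp
   show "cmod (h t * (ga t - ga' t)) <= de * cmod (h t)" for t
   proof (cases "t : K")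
    case True
    hence "cmod (h t) * cmod (ga t - ga' t) <= cmod (h t) * de" using l by (intro mult_left_mono) (auto intro: less_imp_le)
    thus ?thesis by (simp add: norm_mult mult.commute)
   qed (simp add: K(2))
  qed
  also have "... <= ep / 4" using dI by (simp add: I_def)
  finally have "cmod (hat h ga - hat h ga') <= ep / 4" .
  moreover have "cmod (w ga - hat h ga) <= ep / 4" "cmod (w ga' - hat h ga') <= ep / 4" using h(2) g by auto
  ultimately have "cmod ((w ga - hat h ga) + (hat h ga - hat h ga') - (w ga' - hat h ga')) <= 3 * (ep / 4)"
   using norm_triangle_ineq4[of "(w ga - hat h ga) + (hat h ga - hat h ga')" "w ga' - hat h ga'"]
    norm_triangle_ineq[of "w ga - hat h ga" "hat h ga - hat h ga'"] by linarith
  thus ?thesis using e by simp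
 qed
 thus ?thesis using K(1) d by blast
qed

lemma translation_continuous: assumes h: "cc h" and e: "0 < ep"
 shows "EX V. open V & 0 : V & (ALL t:V. lint mu (%s. cmod (h (s - t) - h s)) < ep)"
proof -
 obtain K where K: "compact K" "!!t. t ~: K ==> h t = 0" "cts h" by (rule ccE[OF h]) (rule that)
 \<comment> \<open>The support of a bump function at 0 confines the translations to a compact set,
   so all translates of \<open>h\<close> in question live on the one compact set
   \<open>M\<close>.\<close>
 obtain b :: "'g => real" where b: "cc b" "b 0 = 1" using bump[OF lc, of UNIV 0] by auto
 obtain L where L: "compact L" "!!t. t ~: L ==> b t = 0" "cts b" by (rule ccE[OF b(1)]) (rule that)
 define V0 where "V0 = b -` {0<..}"
 have "V0 \<subseteq> L" using L(2) by (force simp: V0_def)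
 moreover have "open V0" unfolding V0_def by (rule open_vimage[OF open_greaterThan L(3)])
 ultimately have V0: "open V0" "0 : V0" "V0 \<subseteq> L" using b by (auto simp: V0_def)
 define M where "M = {s + t |s t. s : K & t : L} \<union> K"
 have M: "compact M" unfolding M_def by (intro compact_Un compact_sum K L)
 have z: "h (s - t) - h s = 0" if "t : L" "s ~: M" for s t
 proof -
  have "s - t ~: K"
  proof
   assume "s - t : K"
   moreover have "s = (s - t) + t" by simp
   ultimately show False using that unfolding M_def by blast
  qed
  thus ?thesis using that by (simp add: M_def K(2))
 qed
 obtain de where d0: "0 < de" and d1: "de * measure mu M < ep" by (rule small_factor[OF e measure_nonneg])
 have c: "cts (%(t, s). h (s - t))"
  unfolding case_prod_beta' by (rule continuous_on_compose2[OF K(3)]) (auto intro!: continuous_intros)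
 obtain V1 where V1: "open V1" "0 : V1" "ALL t:V1. ALL s:M. cmod (h (s - t) - h (s - 0)) < de"
  using tube_uniform[OF c M d0, of 0] by blast
 have "lint mu (%s. cmod (h (s - t) - h s)) < ep" if t: "t : V0 \<inter> V1" for t
 proof -
  have tL: "t : L" using t V0(3) by blast
  have "cts (%s. h (s - t) - h s)" by (intro continuous_intros continuous_on_compose2[OF K(3)] K(3)) auto
  hence "cc (%s. h (s - t) - h s)" unfolding cc_def using M z[OF tL] by blast
  hence i: "integrable mu (%s. cre (cmod (h (s - t) - h s)))" by (intro integrable_cc cc_of_real cc_norm)
  have bd: "cmod (h (s - t) - h s) <= de" for s using V1(3) t z[OF tL, of s] d0 by (cases "s : M") (auto simp: less_imp_le)
  have "cmod (lint mu (%s. cre (cmod (h (s - t) - h s)))) <= de * measure mu M"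
   by (rule integral_bound_supp[OF i M]) (use z[OF tL] bd in auto)
  moreover have "0 <= lint mu (%s. cmod (h (s - t) - h s))" by (rule Bochner_Integration.integral_nonneg) simp
  ultimately have "lint mu (%s. cmod (h (s - t) - h s)) <= de * measure mu M" by simp
  also note d1
  finally show ?thesis .
 qed
 thus ?thesis using V0 V1 by (intro exI[of _ "V0 \<inter> V1"]) auto
qed

text \<open>A quantitative Riemann-Lebesgue lemma. Translating \<open>h\<close> by \<open>t\<close>
  multiplies \<open>hat h ga\<close> by \<open>ga t\<close>, so \<open>(ga t - 1) * hat h ga\<close>
  is bounded by the \<open>L^1\<close> distance of \<open>h\<close> from its translate; where
  \<open>hat h\<close> is not small, \<open>ga t\<close> must be near 1.\<close>

lemma FC_support: assumes w: "w : FC" and e: "0 < ep" shows "equi {ga : dual. ep < cmod (w ga)}" unfolding equi_def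
proof (intro conjI allI impI)
 fix de :: real assume d: "0 < de"
 obtain h where h: "cc h" "ALL ga:dual. cmod (w ga - hat h ga) <= ep / 2" using FCD[OF w, of "ep / 2"] e by auto
 obtain V where V: "open V" "0 : V" "!!t. t : V ==> lint mu (%s. cmod (h (s - t) - h s)) < de * (ep / 2)"
  using translation_continuous[OF h(1), of "de * (ep / 2)"] d e by auto
 have "cmod (ga t - 1) < de" if g: "ga : dual" "ep < cmod (w ga)" and t: "t : V" for ga t
 proof -
  have hg: "ep / 2 < cmod (hat h ga)" using norm_triangle_ineq[of "w ga - hat h ga" "hat h ga"] h(2) g by fastforce
  define ht where "ht s = h (s - t)" for s
  have ht: "cc ht"
  proof -
   obtain K where K: "compact K" "!!t. t ~: K ==> h t = 0" "cts h" by (rule ccE[OF h(1)]) (rule that)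
   have "cts ht" unfolding ht_def by (intro continuous_on_compose2[OF K(3)] continuous_intros) auto
   moreover have "ht s = 0" if "s ~: {a + b |a b. a : K & b : {t}}" for s
   proof -
    have "s - t ~: K" using that by (metis (mono_tags, lifting) diff_add_cancel mem_Collect_eq singletonI)
    thus ?thesis by (simp add: ht_def K(2))
   qed
   moreover have "compact {a + b |a b. a : K & b : {t}}" by (rule compact_sum[OF K(1)]) simp
   ultimately show ?thesis unfolding cc_def by (intro conjI exI[of _ "{a + b |a b. a : K & b : {t}}"]) auto
  qed
  have "hat ht ga = lint mu (%s. ht (t + s) * ga (t + s))" unfolding hat_def
   by (rule integral_translate[symmetric]) (use hat_cc[OF ht g(1)] in \<open>auto simp: cc_def intro!: measurable_mu\<close>)
  also have "... = lint mu (%s. ga t * (h s * ga s))" by (simp add: ht_def dualD(3)[OF g(1)] mult.left_commute)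
  also have "... = ga t * hat h ga" by (simp add: hat_def)
  finally have "(ga t - 1) * hat h ga = lint mu (%s. (ht s - h s) * ga s)"
   using hat_integrable[OF ht g(1)] hat_integrable[OF h(1) g(1)] by (simp add: hat_def left_diff_distrib)
  also have "cmod ... <= lint mu (%s. cmod ((ht s - h s) * ga s))" by (rule integral_norm_bound)
  also have "... < de * (ep / 2)" using V(3)[OF t] by (simp add: norm_mult dualD(2)[OF g(1)] ht_def)
  finally have 1: "cmod (ga t - 1) * cmod (hat h ga) < de * (ep / 2)" by (simp add: norm_mult)
  show ?thesis
  proof (rule ccontr)
   assume "~ ?thesis"
   hence "de * (ep / 2) <= cmod (ga t - 1) * cmod (hat h ga)" using hg d e by (intro mult_mono) auto
   with 1 show False by simp
  qed
 qed
 thus "EX V. open V & 0 : V & (ALL ga:{ga : dual. ep < cmod (w ga)}. ALL t:V. cmod (ga t - 1) < de)" using V by blast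
qed auto

end

lemma op_norm_ip: assumes "!!xi et. cmod (ip (app T xi) et) <= C * norm xi * norm et" "0 <= C" shows "norm T <= C"
 by (rule op_norm_bound[OF assms(2)], rule norm_le_ip) (use assms in auto)

lemma star_sub_closure: assumes D: "star_sub D" shows "star_sub (closure D)" unfolding star_sub_def
proof (intro conjI ballI allI)
 note d = star_subD[OF D]
 show "0 : closure D" using d(1) closure_subset by blast
 fix x assume "x : closure D"
 then obtain f where f: "!!k :: nat. f k : D" "f ~~> x" unfolding closure_sequential by blast
 show "opsc k x : closure D" for k unfolding closure_sequential
  by (rule exI[of _ "%i. opsc k (f i)"]) (simp add: f d bounded_linear.tendsto[OF bounded_linear_opscale])
 show "adj x : closure D" unfolding closure_sequential
  by (rule exI[of _ "%i. adj (f i)"]) (simp add: f d bounded_linear.tendsto[OF bounded_linear_adj])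
 fix y assume "y : closure D"
 then obtain g where g: "!!k :: nat. g k : D" "g ~~> y" unfolding closure_sequential by blast
 show "x + y : closure D" unfolding closure_sequential by (rule exI[of _ "%i. f i + g i"]) (simp add: f g d tendsto_add)
 show "x * y : closure D" unfolding closure_sequential by (rule exI[of _ "%i. f i * g i"]) (simp add: f g d tendsto_mult)
qed

section \<open>Words and the spanning operators\<close>

context quasi_free
begin

definition "wd = lists {1..n}"

lemma wd_simps [simp]: "[] : wd" "i # u : wd \<longleftrightarrow> i : {1..n} & u : wd" "u @ v : wd \<longleftrightarrow> u : wd & v : wd"
 by (auto simp: wd_def)

definition om :: "nat list => 'g => complex" where "om u t = prod_list (map (%i. og i t) u)"

lemma om_append: "om (u @ v) t = om u t * om v t" by (simp add: om_def)

lemma om_simps [simp]: "om [] t = 1" "om (i # u) t = og i t * om u t" by (simp_all add: om_def)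

lemma om_dual: "u : wd ==> om u : dual"
proof (induction u)
 case (Cons i u)
 hence "og i \<diamond> om u : dual" by (intro dual_mult dual) auto
 thus ?case by (simp add: om_def fun_eq_iff)
qed (use dual_one in \<open>simp add: om_def[abs_def]\<close>)

lemma om_translate: "u : wd ==> ga : dual ==> om u \<diamond> ga : dual" by (rule dual_mult[OF om_dual])

text \<open>Symbols are functions of arbitrary maps from \<open>'g\<close> to the complex numbers;
  only their values on the dual group matter, hence boundedness there.\<close>

definition bw :: "(('g => complex) => complex) => bool"
 where "bw w \<longleftrightarrow> (EX C. ALL ga:dual. cmod (w ga) <= C)"

lemma bw_FC: "w : FC ==> bw w" using FC_bounded unfolding bw_def by blast

lemma bw_const: "bw (%_. k)" unfolding bw_def by blast

lemma bw_add: "bw w ==> bw v ==> bw (%ga. w ga + v ga)" unfolding bw_def by (elim exE) (meson norm_triangle_mono)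

lemma bw_mult: "bw w ==> bw v ==> bw (%ga. w ga * v ga)"
proof -
 assume "bw w" "bw v"
 then obtain C D where "ALL ga:dual. cmod (w ga) <= C" "ALL ga:dual. cmod (v ga) <= D" by (auto simp: bw_def)
 hence "ALL ga:dual. cmod (w ga * v ga) <= \<bar>C\<bar> * \<bar>D\<bar>"
  unfolding norm_mult by (intro ballI mult_mono) (auto intro: order_trans[OF _ abs_ge_self])
 thus ?thesis unfolding bw_def by blast
qed

lemma bw_cnj: "bw w ==> bw (%ga. cnj (w ga))" by (simp add: bw_def)

lemma bw_translate: "bw w ==> u : wd ==> bw (%ga. w (om u \<diamond> ga))" unfolding bw_def using om_translate by blast

definition el :: "('g => complex) => 'a => 'g => 'a" where "el h a t = h t \<odot> a"

lemma el_closed: assumes h: "cc h" and a: "a : carrier A" shows "el h a : carrier E"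
proof -
 have k: "cmap A (el h a)" unfolding el_def[abs_def] using h by (intro A.cmap_scale A.cmap_const a) (simp add: cc_def)
 obtain K where "compact K" "!!t. t ~: K ==> h t = 0" using ccE[OF h] by metis
 thus ?thesis unfolding E_carrier using k a by (intro conjI exI[of _ K]) (auto simp: el_def)
qed

end

context covariant
begin

definition Sw :: "nat list => op" where "Sw u = foldr (%i T. Sop i * T) u 1"
definition sw :: "nat list => nat => nat" where "sw u x = foldr s u x"

lemma Sw_simps [simp]: "Sw [] = 1" "Sw (i # u) = Sop i * Sw u" by (simp_all add: Sw_def)

lemma Sw_append: "Sw (u @ v) = Sw u * Sw v" by (induction u) (simp_all add: mult.assoc)

lemma adj_Sw_Sw: "u : wd ==> adj (Sw u) * Sw u = 1"
proof (induction u)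
 case (Cons i u)
 have "adj (Sw (i # u)) * Sw (i # u) = adj (Sw u) * (Rop i * Sop i) * Sw u" by (simp add: mult.assoc)
 thus ?case using Cons by (simp add: Rop_Sop)
qed simp

lemma adj_Sw_Sw': "u : wd ==> adj (Sw u) * (Sw u * T) = T" by (simp add: adj_Sw_Sw flip: mult.assoc)

lemma Sw_orth: "[|u : wd; v : wd; \<nexists>k. v = u @ k; \<nexists>k. u = v @ k|] ==> adj (Sw u) * Sw v = 0"
proof (induction u arbitrary: v)
 case (Cons i u)
 obtain j v' where v: "v = j # v'" using Cons.prems(4) by (cases v) auto
 have ij: "i : {1..n}" "j : {1..n}" using Cons.prems v by auto
 have "adj (Sw (i # u)) * Sw v = adj (Sw u) * (Rop i * Sop j) * Sw v'" by (simp add: v mult.assoc)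
 also have "... = 0"
 proof (cases "i = j")
  case True
  have "adj (Sw u) * Sw v' = 0" by (rule Cons.IH) (use Cons.prems v True in auto)
  thus ?thesis using Rop_Sop[OF ij] True by simp
 qed (simp add: Rop_Sop[OF ij])
 finally show ?case .
qed simp

lemma norm_Sw: "u : wd ==> norm (Sw u) <= 1"
 using op_cstar[of "Sw u"] norm_ge_zero[of "Sw u"] by (auto simp: adj_Sw_Sw power2_eq_1_iff)

lemma Sw_delta: "u : wd ==> app (Sw u) (delta x) = delta (sw u x)" by (induction u) (auto simp: sw_def Sop_delta)

definition Dg :: "(('g => complex) => complex) => op" where "Dg w = diag (%x. w (c x))"

lemma coord_Dg: "bw w ==> coord (app (Dg w) xi) x = w (c x) * coord xi x"
 unfolding Dg_def bw_def using coord_diag c_dual by (metis (no_types, lifting))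

lemma norm_Dg: "(!!ga. ga : dual ==> cmod (w ga) <= C) ==> norm (Dg w) <= C"
 unfolding Dg_def by (rule norm_diag) (simp add: c_dual)

lemma norm_Dg_ge: "bw w ==> cmod (w (c x)) <= norm (Dg w)"
 unfolding Dg_def bw_def by (elim exE, rule norm_diag_ge) (auto simp: c_dual)

lemma Dg_delta: "bw w ==> app (Dg w) (delta x) = escale (w (c x)) (delta x)" by (rule ell2_eqI) (simp add: coord_Dg)

lemma Dg_cong: "(!!ga. ga : dual ==> w ga = v ga) ==> Dg w = Dg v" by (simp add: Dg_def c_dual)

lemma Dg_add: "bw w ==> bw v ==> Dg (%ga. w ga + v ga) = Dg w + Dg v"
 by (intro op_eqI ell2_eqI) (simp add: coord_Dg bw_add distrib_right)

lemma Dg_mult: "bw w ==> bw v ==> Dg (%ga. w ga * v ga) = Dg w * Dg v"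
 by (intro op_eqI ell2_eqI) (simp add: coord_Dg bw_mult mult.assoc)

lemma Dg_scale: "bw w ==> Dg (%ga. k * w ga) = opsc k (Dg w)"
 by (intro op_eqI ell2_eqI) (simp add: coord_Dg bw_mult[OF bw_const] mult.assoc)

lemma Dg_const: "Dg (%ga. k) = opsc k 1" by (intro op_eqI ell2_eqI) (simp add: coord_Dg bw_const)

lemma Dg_diff: "bw w ==> bw v ==> Dg (%ga. w ga - v ga) = Dg w - Dg v"
 using Dg_add[of w "%ga. (-1) * v ga"] Dg_scale[of v "-1"] bw_mult[OF bw_const[of "-1"], of v] by (simp add: opsc_simps)

lemma adj_Dg: "bw w ==> adj (Dg w) = Dg (%ga. cnj (w ga))"
proof (rule op_matrix_eqI)
 fix k m assume w: "bw w"
 have "coord (app (adj (Dg w)) (delta k)) m = cnj (coord (app (Dg w) (delta m)) k)"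
  by (simp only: ip_delta_right[symmetric] adj) (metis ip_commute)
 thus "coord (app (adj (Dg w)) (delta k)) m = coord (app (Dg (%ga. cnj (w ga))) (delta k)) m"
  by (simp add: coord_Dg w bw_cnj)
qed

lemma Dg_Sop: assumes w: "bw w" and i: "i : {1..n}" shows "Dg w * Sop i = Sop i * Dg (%ga. w (og i \<diamond> ga))"
proof -
 have "c (s i x) = og i \<diamond> c x" for x using c_s[OF i] by (simp add: fun_eq_iff)
 moreover obtain C where "ALL x. cmod (w (c x)) <= C" using w c_dual unfolding bw_def by blast
 ultimately show ?thesis using diag_Sop[of "%x. w (c x)" C i] i by (simp add: Dg_def)
qed

text \<open>Moving a multiplier past an isometry translates its symbol by the character of the word.
  This relation governs all products in \<open>alg0\<close>.\<close>

lemma Dg_Sw: "bw w ==> u : wd ==> Dg w * Sw u = Sw u * Dg (%ga. w (om u \<diamond> ga))"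
proof (induction u arbitrary: w)
 case (Cons i u)
 have i: "[i] : wd" and u: "u : wd" using Cons.prems by auto
 have b: "bw (%ga. w (og i \<diamond> ga))" using bw_translate[OF Cons.prems(1) i] by simp
 have "Dg w * Sw (i # u) = Sop i * (Dg (%ga. w (og i \<diamond> ga)) * Sw u)"
  using Dg_Sop[OF Cons.prems(1), of i] i by (simp flip: mult.assoc)
 also have "... = Sw (i # u) * Dg (%ga. w (og i \<diamond> om u \<diamond> ga))" by (simp add: Cons.IH[OF b u] mult.assoc)
 finally show ?case by (simp add: mult.assoc)
qed simp

lemma adj_Sw_Dg: assumes w: "bw w" and u: "u : wd" shows "adj (Sw u) * Dg w = Dg (%ga. w (om u \<diamond> ga)) * adj (Sw u)"
proof -
 have "adj (Dg (%ga. cnj (w ga)) * Sw u) = adj (Sw u * Dg (%ga. cnj (w (om u \<diamond> ga))))"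
  by (simp only: Dg_Sw[OF bw_cnj[OF w] u])
 thus ?thesis using adj_Dg[OF bw_cnj[OF w]] adj_Dg[OF bw_cnj[OF bw_translate[OF w u]]] by simp
qed

abbreviation gen :: "nat list => (('g => complex) => complex) => nat list => op"
 where "gen u w v \<equiv> Sw u * Dg w * adj (Sw v)"

lemma adj_gen: "bw w ==> adj (gen u w v) = gen v (%ga. cnj (w ga)) u" by (simp add: adj_Dg mult.assoc)

text \<open>Two words are either comparable, and then the shorter one cancels and the rest
  translates a symbol, or their isometries have orthogonal ranges. The three lemmas on products
  correspond to the three cases.\<close>

lemma gen_mult1: assumes "bw w" "bw w'" "v : wd" "k : wd"
 shows "gen u w v * gen (v @ k) w' v' = gen (u @ k) (%ga. w (om k \<diamond> ga) * w' ga) v'"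
proof -
 have "gen u w v * gen (v @ k) w' v' = Sw u * (Dg w * Sw k) * Dg w' * adj (Sw v')"
  by (simp add: Sw_append mult.assoc adj_Sw_Sw' assms)
 also have "... = gen (u @ k) (%ga. w (om k \<diamond> ga) * w' ga) v'"
  by (simp only: Dg_Sw[OF assms(1,4)] Dg_mult[OF bw_translate[OF assms(1,4)] assms(2)] Sw_append mult.assoc)
 finally show ?thesis .
qed

lemma gen_mult2: assumes "bw w" "bw w'" "v : wd" "k : wd"
 shows "gen u w (v @ k) * gen v w' v' = gen u (%ga. w ga * w' (om k \<diamond> ga)) (v' @ k)"
proof -
 have "gen u w (v @ k) * gen v w' v' = Sw u * Dg w * (adj (Sw k) * Dg w') * adj (Sw v')"
  by (simp add: Sw_append mult.assoc adj_Sw_Sw' assms)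
 also have "... = gen u (%ga. w ga * w' (om k \<diamond> ga)) (v' @ k)"
  by (simp only: adj_Sw_Dg[OF assms(2,4)] Dg_mult[OF assms(1) bw_translate[OF assms(2,4)]] Sw_append adj_simps mult.assoc)
 finally show ?thesis .
qed

lemma gen_mult0: assumes "v : wd" "u' : wd" "\<nexists>k. u' = v @ k" "\<nexists>k. v = u' @ k"
 shows "gen u w v * gen u' w' v' = 0"
proof -
 have "gen u w v * gen u' w' v' = Sw u * Dg w * (adj (Sw v) * Sw u') * Dg w' * adj (Sw v')" by (simp only: mult.assoc)
 thus ?thesis by (simp add: Sw_orth[OF assms])
qed

text \<open>The linear span of the operators \<open>gen u w v\<close>; scalars are absorbed by the
  symbols, since the classes \<open>W\<close> in use are closed under scaling.\<close>

inductive_set alg0 :: "(('g => complex) => complex) set => op set" for W where zero: "0 : alg0 W"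
 | step: "[|T : alg0 W; w : W; u : wd; v : wd|] ==> gen u w v + T : alg0 W"

lemma alg0_gen: "w : W ==> u : wd ==> v : wd ==> gen u w v : alg0 W" using alg0.step[OF alg0.zero, of w W u v] by simp

lemma alg0_add: "x : alg0 W ==> y : alg0 W ==> x + y : alg0 W"
 by (induction rule: alg0.induct) (simp_all add: add.assoc alg0.step)

text \<open>Three symbol classes are distinguished because the Cuntz algebra has constant symbols,
  and a constant symbol times one in \<open>FC\<close> must land in \<open>FC\<close>.\<close>

lemma alg0_mult: assumes "x : alg0 W" "y : alg0 V" "!!w. w : W ==> bw w" "!!w. w : V ==> bw w"
  and 1: "!!w v k. w : W ==> v : V ==> k : wd ==> (%ga. w (om k \<diamond> ga) * v ga) : Z"
  and 2: "!!w v k. w : W ==> v : V ==> k : wd ==> (%ga. w ga * v (om k \<diamond> ga)) : Z" shows "x * y : alg0 Z"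
proof -
 have g: "gen u w v * gen u' w' v' : alg0 Z"
  if h: "w : W" "w' : V" "u : wd" "v : wd" "u' : wd" "v' : wd" for u v w u' v' w'
 proof -
  consider k where "u' = v @ k" | k where "v = u' @ k" | "\<nexists>k. u' = v @ k" "\<nexists>k. v = u' @ k" by blast
  thus ?thesis
  proof cases
   case 1
   hence "k : wd" using h by simp
   thus ?thesis unfolding 1 using h assms by (subst gen_mult1) (auto intro!: alg0_gen)
  next
   case 2
   hence "k : wd" using h by simp
   thus ?thesis unfolding 2 using h assms 2 by (subst gen_mult2) (auto intro!: alg0_gen)
  next
   case 3
   show ?thesis using gen_mult0[OF h(4,5) 3] by (simp add: alg0.zero)
  qed
 qed
 have "gen u w v * y : alg0 Z" if "w : W" "u : wd" "v : wd" for u w v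
  using assms(2) that by (induction rule: alg0.induct) (simp_all add: alg0.zero distrib_left alg0_add g)
 with assms(1) show ?thesis by (induction rule: alg0.induct) (simp_all add: alg0.zero distrib_right alg0_add)
qed

lemma alg0_star_sub: assumes "!!w. w : W ==> bw w" "!!w v. w : W ==> v : W ==> (%ga. w ga * v ga) : W"
  "!!w k. w : W ==> (%ga. k * w ga) : W" "!!w. w : W ==> (%ga. cnj (w ga)) : W"
  "!!w k. w : W ==> k : wd ==> (%ga. w (om k \<diamond> ga)) : W" shows "star_sub (alg0 W)" unfolding star_sub_def
proof (intro conjI ballI allI alg0.zero alg0_add)
 fix x assume x: "x : alg0 W"
 show "x * y : alg0 W" if "y : alg0 W" for y by (rule alg0_mult[OF x that]) (simp_all add: assms)
 show "adj x : alg0 W" using x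
 proof (induction rule: alg0.induct)
  case (step T w u v)
  have "adj (gen u w v + T) = gen v (%ga. cnj (w ga)) u + adj T"
   by (simp only: adj_simps(1) adj_gen[OF assms(1)[OF step(2)]])
  thus ?case using step assms by (simp add: alg0.step)
 qed (simp add: alg0.zero)
 show "opsc k x : alg0 W" for k using x
 proof (induction rule: alg0.induct)
  case (step T w u v)
  have "opsc k (gen u w v + T) = gen u (%ga. k * w ga) v + opsc k T"
   by (simp add: opsc_simps Dg_scale[OF assms(1)[OF step(2)]])
  thus ?case using step assms by (simp add: alg0.step)
 qed (simp add: opsc_simps alg0.zero)
qed

lemma alg0_FC: "star_sub (alg0 FC)" by (rule alg0_star_sub) (auto intro: bw_FC FC_mult FC_scale FC_cnj FC_translate om_dual)

lemma alg0_const: "star_sub (alg0 (range (%k _. k)))" by (rule alg0_star_sub) (auto intro: bw_const)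

lemma alg0_approx: assumes "x : alg0 W" and W: "!!w. w : W ==> bw w" and V: "!!w. w : V ==> bw w"
  and app: "!!w ep. w : W ==> 0 < ep ==> EX v:V. ALL ga:dual. cmod (w ga - v ga) <= ep" shows "x : closure (alg0 V)"
 unfolding closure_approachable
proof (intro allI impI)
 fix ep :: real assume "0 < ep"
 with assms(1) show "EX y:alg0 V. dist y x < ep"
 proof (induction arbitrary: ep rule: alg0.induct)
  case (step T w u v)
  obtain y where y: "y : alg0 V" "dist y T < ep / 2" using step.IH[of "ep / 2"] step.prems by auto
  obtain w' where w': "w' : V" "ALL ga:dual. cmod (w ga - w' ga) <= ep / 2"
   using app[OF step(2), of "ep / 2"] step.prems by auto
  have "gen u w v - gen u w' v = Sw u * Dg (%ga. w ga - w' ga) * adj (Sw v)"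
   by (simp add: Dg_diff W[OF step(2)] V[OF w'(1)] algebra_simps)
  also have "norm ... <= norm (Sw u) * norm (Dg (%ga. w ga - w' ga)) * norm (adj (Sw v))"
   by (intro order_trans[OF norm_mult_ineq] mult_right_mono norm_mult_ineq) simp
  also have "... <= 1 * (ep / 2) * 1" by (intro mult_mono norm_Dg) (use norm_Sw step w' in auto)
  finally have "norm (gen u w v - gen u w' v) <= ep / 2" by simp
  hence "dist (gen u w' v + y) (gen u w v + T) < ep"
   using dist_triangle_add[of "gen u w' v" y "gen u w v" T] y(2) by (simp add: dist_norm norm_minus_commute)
  thus ?case using alg0.step[OF y(1) w'(1) step(3,4)] by blast
 qed (use alg0.zero in force)
qed

text \<open>The closed span with constant symbols is a selfadjoint algebra that contains all
  \<open>Sop i\<close>, and \<open>A\<close> is generated by the \<open>S i\<close>.\<close>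

lemma rp_in_closure: assumes a: "a : carrier A" shows "rp a : closure (alg0 (range (%k _. k)))"
proof -
 let ?C = "closure (alg0 (range (%k _. k)))"
 note C = star_subD[OF star_sub_closure[OF alg0_const]]
 define H where "H = {a : carrier A. rp a : ?C}"
 have HA: "H \<subseteq> carrier A" by (auto simp: H_def)
 have Hs: "w \<odot> a : H" if "a : H" for w a using that by (simp add: H_def rp_simps C)
 have Hm: "\<ominus> a : H" if "a : H" for a using Hs[OF that, of "-1"] A.smult_m1[of a] that HA by auto
 have "submodule H complex_ring A"
  by (rule A.submoduleI) (use HA Hs Hm C(1) in \<open>auto simp: H_def rp_simps rp_zero C\<close>)
 moreover have "closedin (cs_topology A) H" unfolding A.closedin_iff
 proof (intro conjI HA ballI impI)
  fix x assume x: "x : carrier A" and l: "ALL ep>0. EX y:H. nrm A (x \<ominus> y) < ep"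
  have "rp x : closure ?C" unfolding closure_approachable
  proof (intro allI impI)
   fix ep :: real assume "0 < ep"
   then obtain y where y: "y : H" "nrm A (x \<ominus> y) < ep" using l by blast
   hence yc: "y : carrier A" using HA by blast
   have "dist (rp y) (rp x) = norm (rp (x \<ominus> y))"
    by (simp add: op_hom_diff[OF cstar_A rp_hom x yc] dist_norm norm_minus_commute)
   also have "... <= nrm A (x \<ominus> y)" using x yc by (intro rp_nrm) simp
   finally show "EX z:?C. dist z (rp x) < ep" using y by (intro bexI[of _ "rp y"]) (auto simp: H_def)
  qed
  thus "x : H" using x by (simp add: H_def)
 qed
 ultimately have "cstar_subalgebra H A" unfolding cstar_subalgebra_def by (auto simp: H_def rp_simps C A.cl)
 moreover have "S i : H" if "i : {1..n}" for i
 proof -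
  have "Sop i = gen [i] (%_. 1) []" by (simp add: Dg_const opsc_simps)
  also have "... : ?C" using that by (intro subsetD[OF closure_subset] alg0_gen) auto
  finally show ?thesis using that S_closed[OF that] by (simp add: H_def rp_S)
 qed
 ultimately have "H = carrier A" by (rule S_generate)
 thus ?thesis using a by (auto simp: H_def)
qed

lemma Sw_in_range: assumes "u : wd" shows "EX a:carrier A. rp a = Sw u" using assms
proof (induction u)
 case Nil
 show ?case using rp_one one_closed by (intro bexI[of _ "\<one>"]) simp_all
next
 case (Cons i u)
 then obtain a where "a : carrier A" "rp a = Sw u" by auto
 thus ?case using Cons.prems S_closed by (intro bexI[of _ "S i \<otimes> a"]) (simp_all add: rp_simps rp_S A.cl)
qed

lemma Ph_el: assumes h: "cc h" and a: "a : carrier A" shows "Ph (el h a) = rp a * Dg (hat h)"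
proof (rule op_matrix_eqI)
 fix k m
 have "app (U t) (delta k) = escale (c k t) (delta k)" for t by (rule ell2_eqI) (simp add: coord_U)
 hence "kern (el h a) (delta k) (delta m) = (%t. h t * c k t * coord (app (rp a) (delta k)) m)"
  by (simp add: fun_eq_iff kern_def el_def rp_simps a)
 hence "coord (app (Ph (el h a)) (delta k)) m = hat h (c k) * coord (app (rp a) (delta k)) m"
  using ip_Ph[OF el_closed[OF h a], of "delta k" "delta m"] by (simp add: hat_def)
 thus "coord (app (Ph (el h a)) (delta k)) m = coord (app (rp a * Dg (hat h)) (delta k)) m"
  by (simp add: Dg_delta bw_FC FC_hat h)
qed

text \<open>A partition of unity replaces \<open>f\<close> by finitely many elementary functions
  \<open>el (h p) (f p)\<close>, on which \<open>Ph\<close> is the product of an element of the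
  Cuntz algebra and a multiplier.\<close>

lemma Ph_approx: assumes f: "f : carrier E" and e: "0 < ep"
 shows "EX P h a. finite P & (ALL p:P. cc (h p) & a p : carrier A) &
  norm (Ph f - (\<Sum>p\<in>(P :: 'g set). rp (a p) * Dg (hat (h p)))) < ep"
proof -
 obtain K where K: "compact K" "!!t. t ~: K ==> f t = \<zero>" by (rule E_supp[OF f]) (rule that)
 obtain g :: "'g => real" where g: "cc g" "ALL t. 0 <= g t" "ALL t:K. 1 <= g t" using bump_compact[OF lc K(1)] by blast
 obtain L where L: "compact L" "!!t. t ~: L ==> g t = 0" using ccE[OF g(1)] by metis
 obtain de where d0: "0 < de" and d1: "de * measure mu L < ep" by (rule small_factor[OF e measure_nonneg])
 have pc: "cts (%t. rp (f t))" by (rule A.cmap_op_hom[OF E_cmap[OF f] rp_hom])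
 \<comment> \<open>Intersecting with the set where \<open>g > 0\<close> keeps the supports of all
   bump functions in the fixed compact set \<open>L\<close>, so that \<open>de\<close> can be chosen
   before them.\<close>
 define N where "N t = (%r. norm (rp (f r) - rp (f t))) -` {..<de} \<inter> g -` {0<..}" for t
 have "open (N t)" for t
  unfolding N_def using g(1) pc by (intro open_Int open_vimage continuous_intros) (simp_all add: cc_def)
 moreover have "t : N t" if "t : K" for t using g(3) that d0 by (force simp: N_def)
 ultimately have "ALL t:K. EX b :: 'g => real. cc b & (ALL r. 0 <= b r & b r <= 1) & b t = 1 & (ALL r. r ~: N t --> b r = 0)"
  using bump[OF lc] by simp
 then obtain b :: "'g => 'g => real" where b: "!!t. t : K ==> cc (b t)"
  "!!t r. t : K ==> 0 <= b t r" "!!t. t : K ==> b t t = 1" "!!t r. t : K ==> r ~: N t ==> b t r = 0" by metis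
 have bc: "cts (b t)" if "t : K" for t using b(1)[OF that] by (simp add: cc_def)
 have "open (b t -` {1/2<..})" if "t : K" for t by (rule open_vimage[OF open_greaterThan bc[OF that]])
 moreover have "K \<subseteq> (\<Union>t\<in>K. b t -` {1/2<..})" using b(3) by force
 ultimately obtain P where P: "P \<subseteq> K" "finite P" "K \<subseteq> (\<Union>t\<in>P. b t -` {1/2<..})"
  by (rule compactE_image[OF K(1)])
 \<comment> \<open>The lower bound \<open>1/2\<close> keeps the denominator away from 0 everywhere
   without changing it on \<open>K\<close>, where some bump function exceeds
   \<open>1/2\<close>.\<close>
 define den where "den r = max (1/2) (\<Sum>p\<in>P. b p r)" for r
 have den0: "0 < den r" for r by (simp add: den_def less_max_iff_disj)
 have denc: "cts den" unfolding den_def by (intro continuous_intros bc) (use P in auto)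
 define ph where "ph p r = inverse (den r) * b p r" for p r
 have phcc: "cc (ph p)" if "p : P" for p unfolding ph_def[abs_def]
  using that P(1) den0 by (intro cc_mult continuous_on_inverse denc b) (auto simp: less_imp_neq[THEN not_sym])
 have ph0: "0 <= ph p r" if "p : P" for p r using b(2) P(1) that den0[of r] by (auto simp: ph_def intro!: mult_nonneg_nonneg)
 define si where "si r = (\<Sum>p\<in>P. ph p r)" for r
 have si_eq: "si r = (\<Sum>p\<in>P. b p r) / den r" for r by (simp add: si_def ph_def sum_distrib_left[symmetric] divide_inverse mult.commute)
 have si1: "si r <= 1" for r unfolding si_eq using den0[of r] by (simp add: den_def)
 have siK: "si r = 1" if rK: "r : K" for r
 proof -
  obtain p where p: "p : P" "1/2 < b p r" using subsetD[OF P(3) rK] by auto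
  have "b p r <= (\<Sum>p\<in>P. b p r)" using p P b(2) by (intro member_le_sum) auto
  hence "den r = (\<Sum>p\<in>P. b p r)" using p by (simp add: den_def)
  thus ?thesis using den0[of r] by (simp add: si_eq)
 qed
 define h where "h p t = cre (ph p t)" for p t
 have h: "cc (h p)" if "p : P" for p unfolding h_def[abs_def] by (rule cc_of_real[OF phcc[OF that]])
 have fs: "opsc (of_real (si r)) (rp (f r)) = rp (f r)" for r
  using siK K(2) by (cases "r : K") (simp_all add: opsc_simps rp_zero)
 have opsum: "opsc (\<Sum>p\<in>P. k p) T = (\<Sum>p\<in>P. opsc (k p) T)" for k T
  using P(2) by (induction P rule: finite_induct) (simp_all add: opsc_simps)
 have close: "norm (rp (f r) - (\<Sum>p\<in>P. opsc (h p r) (rp (f p)))) <= de" for r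
 proof -
  have "rp (f r) - (\<Sum>p\<in>P. opsc (h p r) (rp (f p))) = (\<Sum>p\<in>P. opsc (h p r) (rp (f r) - rp (f p)))"
   by (subst fs[symmetric])
    (simp add: si_def h_def opsum opsc_simps flip: sum_subtractf)
  also have "norm ... <= (\<Sum>p\<in>P. ph p r * de)"
  proof (rule sum_norm_le)
   fix p assume p: "p : P"
   show "norm (opsc (h p r) (rp (f r) - rp (f p))) <= ph p r * de"
   proof (cases "r : N p")
    case True
    thus ?thesis using ph0[OF p, of r] by (simp add: norm_opscale h_def N_def mult_left_mono less_imp_le)
   next
    case False
    have "b p r = 0" by (rule b(4)[OF _ False]) (use p P in blast)
    thus ?thesis by (simp add: norm_opscale h_def ph_def)
   qed
  qed
  also have "... = si r * de" by (simp add: si_def sum_distrib_right)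
  also have "... <= de" using si1[of r] d0 by simp
  finally show ?thesis .
 qed
 have out: "f r = \<zero>" "p : P ==> h p r = 0" if "r ~: L" for r p
 proof -
  have gr: "g r = 0" by (rule L(2)[OF that])
  hence "r ~: K" using g(3) by force
  thus "f r = \<zero>" by (rule K(2))
  assume p: "p : P"
  have "b p r = 0" by (rule b(4)) (use p P gr in \<open>auto simp: N_def\<close>)
  thus "h p r = 0" by (simp add: h_def ph_def)
 qed
 have fp: "f p : carrier A" for p by (rule E_val[OF f])
 note elc = el_closed[OF h fp]
 have "norm (Ph f - (\<Sum>p\<in>P. Ph (el (h p) (f p)))) <= de * measure mu L"
 proof (rule op_norm_ip)
  fix xi et
  define F where "F t = kern f xi et t - (\<Sum>p\<in>P. kern (el (h p) (f p)) xi et t)" for t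
  have Fi: "integrable mu F" unfolding F_def
   by (intro Bochner_Integration.integrable_diff Bochner_Integration.integrable_sum integrable_cc kern_cc f elc)
  have Fe: "F t = ip (app (rp (f t) - (\<Sum>p\<in>P. opsc (h p t) (rp (f p)))) (app (U t) xi)) et" for t
  proof -
   have "app (\<Sum>p\<in>P. opsc (h p t) (rp (f p))) x = (\<Sum>p\<in>P. app (opsc (h p t) (rp (f p))) x)" for x
    using P(2) by (induction P rule: finite_induct) simp_all
   thus ?thesis by (simp add: F_def kern_def el_def rp_simps fp ip_diff_left ip_sum_left)
  qed
  have "cmod (F t) <= norm (rp (f t) - (\<Sum>p\<in>P. opsc (h p t) (rp (f p)))) * norm (app (U t) xi) * norm et" for t
   unfolding Fe by (rule ip_app_bound)
  also have "... t <= de * norm xi * norm et" for t by (intro mult_right_mono mult_mono close norm_app_U) (use d0 in auto)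
  finally have Fb: "cmod (F t) <= de * norm xi * norm et" for t .
  have "ip (app (Ph f - (\<Sum>p\<in>P. Ph (el (h p) (f p)))) xi) et = lint mu F"
  proof -
   have "app (\<Sum>p\<in>P. Ph (el (h p) (f p))) x = (\<Sum>p\<in>P. app (Ph (el (h p) (f p))) x)" for x
    using P(2) by (induction P rule: finite_induct) simp_all
   thus ?thesis unfolding F_def
    by (simp add: ip_diff_left ip_sum_left ip_Ph f elc integrable_cc kern_cc Bochner_Integration.integral_sum)
  qed
  also have "cmod ... <= de * norm xi * norm et * measure mu L"
   by (rule integral_bound_supp[OF Fi L(1) _ Fb]) (simp add: Fe out rp_zero opsc_simps)
  finally show "cmod (ip (app (Ph f - (\<Sum>p\<in>P. Ph (el (h p) (f p)))) xi) et) <= de * measure mu L * norm xi * norm et"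
   by (simp add: mult_ac)
 qed (use d0 in simp)
 also note d1
 finally have "norm (Ph f - (\<Sum>p\<in>P. rp (f p) * Dg (hat (h p)))) < ep" by (simp add: Ph_el h fp cong: sum.cong)
 thus ?thesis using P(2) h fp by blast
qed

lemma Ph_in_closure: assumes f: "f : carrier E" shows "Ph f : closure (alg0 FC)"
proof -
 note C = star_subD[OF star_sub_closure[OF alg0_FC]]
 have left: "x * T : closure (alg0 FC)" if x: "x : closure (alg0 (range (%k _. k)))" and T: "T : alg0 FC" for x T
 proof -
  obtain g where g: "!!k :: nat. g k : alg0 (range (%k _. k))" "g ~~> x" using x unfolding closure_sequential by blast
  have "g k * T : alg0 FC" for k by (rule alg0_mult[OF g(1) T]) (auto intro: bw_const bw_FC FC_scale FC_translate om_dual)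
  thus ?thesis unfolding closure_sequential
   by (intro exI[of _ "%k. g k * T"]) (simp add: tendsto_mult[OF g(2) tendsto_const])
 qed
 have "Ph f : closure (closure (alg0 FC))" unfolding closure_approachable
 proof (intro allI impI)
  fix ep :: real assume "0 < ep"
  from Ph_approx[OF f this] obtain P h a where P: "finite (P :: 'g set)" "ALL p:P. cc (h p) & a p : carrier A"
   "norm (Ph f - (\<Sum>p\<in>P. rp (a p) * Dg (hat (h p)))) < ep" by (elim exE conjE)
  have 1: "rp (a p) * Dg (hat (h p)) : closure (alg0 FC)" if "p : P" for p
   using alg0_gen[of "hat (h p)" FC "[]" "[]"] P(2) that by (intro left rp_in_closure) (auto simp: FC_hat)
  have "(\<Sum>p\<in>P. rp (a p) * Dg (hat (h p))) : closure (alg0 FC)"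
   using P(1) 1 by (induction P rule: finite_induct) (simp_all add: C)
  thus "EX y:closure (alg0 FC). dist y (Ph f) < ep"
   by (rule rev_bexI) (use P(3) in \<open>simp add: dist_norm norm_minus_commute\<close>)
 qed
 thus ?thesis by simp
qed

lemma om_cancel: "u : wd ==> (%t. cnj (om u t)) \<diamond> om u \<diamond> ga = ga"
proof (rule ext)
 fix t assume u: "u : wd"
 have "cnj (om u t) * (om u t * ga t) = (om u t * cnj (om u t)) * ga t" by (simp only: mult_ac)
 also have "om u t * cnj (om u t) = 1" by (rule dual_cancel(1)[OF om_dual[OF u]])
 finally show "cnj (om u t) * (om u t * ga t) = ga t" by simp
qed

text \<open>Moving the multiplier to the right of \<open>adj (Sw v)\<close> translates its symbol by
  the inverse of \<open>om v\<close> and leaves an element of the Cuntz algebra times a multiplier,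
  which elementary functions approximate.\<close>

lemma gen_in_range: assumes R: "closed R" "!!f. f : carrier E ==> Ph f : R" and w: "w : FC" and u: "u : wd" and v: "v : wd"
 shows "gen u w v : R"
proof -
 obtain a where a: "a : carrier A" "rp a = Sw u" using Sw_in_range[OF u] by blast
 obtain b where b: "b : carrier A" "rp b = Sw v" using Sw_in_range[OF v] by blast
 define w' where "w' ga = w ((%t. cnj (om v t)) \<diamond> ga)" for ga
 have w': "w' : FC" unfolding w'_def[abs_def] by (rule FC_translate[OF w dual_cnj[OF om_dual[OF v]]])
 have "w' (om v \<diamond> ga) = w ga" for ga by (simp only: w'_def om_cancel[OF v])
 hence "adj (Sw v) * Dg w' = Dg w * adj (Sw v)" using adj_Sw_Dg[OF bw_FC[OF w'] v] by simp
 hence eq: "gen u w v = rp (a \<otimes> star A b) * Dg w'" by (simp add: rp_simps a b A.cl mult.assoc)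
 have "gen u w v : closure R" unfolding closure_approachable eq
 proof (intro allI impI)
  fix ep :: real assume e: "0 < ep"
  define M where "M = norm (rp (a \<otimes> star A b)) + 1"
  have M: "0 < M" by (simp add: M_def add_nonneg_pos)
  obtain h where h: "cc h" "ALL ga:dual. cmod (w' ga - hat h ga) <= ep / (2 * M)"
   using FCD[OF w', of "ep / (2 * M)"] e M by auto
  have "Ph (el h (a \<otimes> star A b)) - rp (a \<otimes> star A b) * Dg w'
    = - (rp (a \<otimes> star A b) * Dg (%ga. w' ga - hat h ga))"
   by (simp add: Ph_el h(1) a b A.cl Dg_diff bw_FC w' FC_hat algebra_simps)
  also have "norm ... <= norm (rp (a \<otimes> star A b)) * norm (Dg (%ga. w' ga - hat h ga))" by (simp add: norm_mult_ineq)
  also have "... <= M * (ep / (2 * M))" using M h(2) by (intro mult_mono norm_Dg) (auto simp: M_def)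
  also have "... < ep" using M e by simp
  finally show "EX y:R. dist y (rp (a \<otimes> star A b) * Dg w') < ep"
   using R(2)[OF el_closed[OF h(1), of "a \<otimes> star A b"]] a b A.cl by (auto simp: dist_norm)
 qed
 thus ?thesis using R(1) by simp
qed

end

section \<open>The AF case\<close>

definition fspan :: "op set => op set" where "fspan Z = {x. EX k. x = (\<Sum>z\<in>Z. opsc (k z) z)}"

lemma opsc_sum: "opsc k (\<Sum>z\<in>Z. f z) = (\<Sum>z\<in>Z. opsc k (f z))"
 by (induction Z rule: infinite_finite_induct) (simp_all add: opsc_simps)

lemma fspan_add: "x : fspan Z ==> y : fspan Z ==> x + y : fspan Z"
proof -
 assume "x : fspan Z" "y : fspan Z"
 then obtain k l where "x = (\<Sum>z\<in>Z. opsc (k z) z)" "y = (\<Sum>z\<in>Z. opsc (l z) z)" by (auto simp: fspan_def)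
 hence "x + y = (\<Sum>z\<in>Z. opsc (k z + l z) z)" by (simp add: opsc_simps sum.distrib)
 thus ?thesis by (auto simp: fspan_def)
qed

lemma fspan_scale: "x : fspan Z ==> opsc a x : fspan Z"
proof -
 assume "x : fspan Z"
 then obtain k where "x = (\<Sum>z\<in>Z. opsc (k z) z)" by (auto simp: fspan_def)
 hence "opsc a x = (\<Sum>z\<in>Z. opsc (a * k z) z)" by (simp add: opsc_sum opsc_simps)
 thus ?thesis by (auto simp: fspan_def)
qed

lemma fspan_zero: "0 : fspan Z" unfolding fspan_def by (auto simp: opsc_simps intro!: exI[of _ "%_. 0"])

lemma fspan_sum: "(!!i. i : I ==> f i : fspan Z) ==> (\<Sum>i\<in>I. f i) : fspan Z"
 by (induction I rule: infinite_finite_induct) (simp_all add: fspan_zero fspan_add)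

lemma fspan_base: assumes "finite Z" "z : Z" shows "z : fspan Z"
proof -
 have "(\<Sum>x\<in>Z. opsc (if x = z then 1 else 0) x) = (\<Sum>x\<in>Z. if x = z then x else 0)"
  by (rule sum.cong) (auto simp: opsc_simps)
 also have "... = z" using assms by simp
 finally have "z = (\<Sum>x\<in>Z. opsc (if x = z then 1 else 0) x)" ..
 thus ?thesis unfolding fspan_def by (intro CollectI exI)
qed

lemma opsc_diff: "opsc (a - b) z = opsc a z - opsc b z" using opsc_simps(2)[of "a - b" b z] by simp

lemma fspan_insert: assumes "finite Z" "z ~: Z"
 shows "x : fspan (insert z Z) \<longleftrightarrow> (EX a. x - opsc a z : fspan Z)"
proof
 assume "x : fspan (insert z Z)"
 then obtain k where "x = (\<Sum>y\<in>insert z Z. opsc (k y) y)" by (auto simp: fspan_def)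
 hence "x - opsc (k z) z = (\<Sum>y\<in>Z. opsc (k y) y)" using assms by simp
 thus "EX a. x - opsc a z : fspan Z" by (auto simp: fspan_def)
next
 assume "EX a. x - opsc a z : fspan Z"
 then obtain a k where "x - opsc a z = (\<Sum>y\<in>Z. opsc (k y) y)" by (auto simp: fspan_def)
 hence "x = opsc a z + (\<Sum>y\<in>Z. opsc (k y) y)" by (simp add: algebra_simps)
 also have "... = (\<Sum>y\<in>insert z Z. opsc (if y = z then a else k y) y)"
  using assms by (simp add: sum.insert_if) (intro sum.cong, auto)
 finally show "x : fspan (insert z Z)" by (auto simp: fspan_def)
qed

text \<open>Induction on the spanning set: if \<open>z\<close> has distance at least
  \<open>d > 0\<close> from the closed span of the others, its coefficient is bounded by
  \<open>1 / d\<close> times the norm and so converges along with the sequence.\<close>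

lemma fspan_closed: "finite Z ==> closed (fspan Z)"
proof (induction rule: finite_induct)
 case empty
 show ?case by (simp add: fspan_def)
next
 case (insert z Z)
 note ins = fspan_insert[OF insert.hyps]
 show ?case
 proof (cases "z : fspan Z")
  case True
  have "fspan (insert z Z) = fspan Z"
  proof (rule Set.set_eqI)
   fix x
   have "x : fspan Z" if "x - opsc a z : fspan Z" for a using fspan_add[OF that fspan_scale[OF True, of a]] by simp
   moreover have "x - opsc 0 z : fspan Z" if "x : fspan Z" using that by (simp add: opsc_simps)
   ultimately show "x : fspan (insert z Z) \<longleftrightarrow> x : fspan Z" unfolding ins by blast
  qed
  thus ?thesis using insert.IH by simp
 next
  case False
  hence "z ~: closure (fspan Z)" using insert.IH by simp
  then obtain d where d: "d > 0" "!!v. v : fspan Z ==> d <= dist v z" unfolding closure_approachable by (meson not_le)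
  have low: "cmod a * d <= norm (opsc a z + v)" if v: "v : fspan Z" for a v
  proof (cases "a = 0")
   case False
   have eq: "opsc a z + v = opsc a (z - opsc (- inverse a) v)" using False by (simp add: opsc_simps)
   have "d <= norm (z - opsc (- inverse a) v)"
    using d(2)[OF fspan_scale[OF v, of "- inverse a"]] by (simp add: dist_norm norm_minus_commute)
   thus ?thesis unfolding eq norm_opscale by (intro mult_left_mono) auto
  qed simp
  show ?thesis unfolding closed_sequential_limits
  proof (intro allI impI, elim conjE)
   fix f x assume "ALL i. f i : fspan (insert z Z)" and l: "f ~~> x"
   hence "ALL i. EX a. f i - opsc a z : fspan Z" unfolding ins by blast
   then obtain a where a: "!!i. f i - opsc (a i) z : fspan Z" by metis
   have diff: "cmod (a i - a j) * d <= norm (f i - f j)" for i j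
   proof -
    have "f i - opsc (a i) z + opsc (-1) (f j - opsc (a j) z) : fspan Z" by (intro fspan_add fspan_scale a)
    from low[OF this, of "a i - a j"] show ?thesis by (simp add: opsc_simps opsc_diff algebra_simps)
   qed
   have "Cauchy a"
   proof (rule CauchyI)
    fix e :: real assume "0 < e"
    hence "0 < e * d" using d by simp
    then obtain N where N: "ALL i>=N. ALL j>=N. norm (f i - f j) < e * d" using CauchyD[OF LIMSEQ_imp_Cauchy[OF l]] by blast
    have "norm (a i - a j) < e" if "i >= N" "j >= N" for i j using le_less_trans[OF diff, of i j "e * d"] N that d by simp
    thus "EX M. ALL m>=M. ALL n>=M. norm (a m - a n) < e" by blast
   qed
   then obtain b where b: "a ~~> b" using Cauchy_convergent convergent_def by blast
   have "(%i. opsc (a i) z - opsc b z) ~~> 0"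
   proof (rule Lim_null)
    have "opsc (a i) z - opsc b z = opsc (a i - b) z" for i by (simp add: opsc_diff)
    thus "ALL i. norm (opsc (a i) z - opsc b z) <= cmod (a i - b) * norm z" by (simp add: norm_opscale)
    have "(%i. a i - b) ~~> 0" using tendsto_diff[OF b tendsto_const[of b]] by simp
    from tendsto_mult_left_zero[OF tendsto_norm_zero[OF this]] show "(%i. cmod (a i - b) * norm z) ~~> 0" .
   qed
   hence "(%i. f i - opsc (a i) z) ~~> x - opsc b z" by (intro tendsto_diff l) (rule LIM_zero_cancel)
   hence "x - opsc b z : fspan Z" by (rule closed_sequentially[OF insert.IH a])
   thus "x : fspan (insert z Z)" unfolding ins by blast
  qed
 qed
qed

text \<open>The conditions on \<open>Z\<close> are those of matrix units: adjoints stay in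
  \<open>Z\<close>, products stay in \<open>Z\<close> or vanish.\<close>

lemma fspan_star_sub: assumes Z: "finite Z" and mult: "!!x y. x : Z ==> y : Z ==> x * y : insert 0 Z"
  and adj: "!!x. x : Z ==> adj x : Z" shows "star_sub (fspan Z)" unfolding star_sub_def
proof (intro conjI ballI allI fspan_zero fspan_add fspan_scale)
 have b: "x : fspan Z" if "x : insert 0 Z" for x using that fspan_base[OF Z] fspan_zero by auto
 fix x assume "x : fspan Z"
 then obtain k where k: "x = (\<Sum>z\<in>Z. opsc (k z) z)" by (auto simp: fspan_def)
 have "adj x = (\<Sum>z\<in>Z. opsc (cnj (k z)) (adj z))" unfolding k by (induction Z rule: infinite_finite_induct) simp_all
 thus "adj x : fspan Z" using adj b by (auto intro!: fspan_sum fspan_scale)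
 fix y assume "y : fspan Z"
 then obtain l where l: "y = (\<Sum>z\<in>Z. opsc (l z) z)" by (auto simp: fspan_def)
 have "x * y = (\<Sum>z\<in>Z. \<Sum>z'\<in>Z. opsc (k z * l z') (z * z'))"
  unfolding k l sum_product by (intro sum.cong refl) (simp add: opsc_simps mult.commute)
 thus "x * y : fspan Z" using mult b by (auto intro!: fspan_sum fspan_scale simp del: insert_iff)
qed

lemma opalg_finsum: assumes e: "inj e" and D: "star_sub D" and Z: "finite Z" "Z \<subseteq> D"
 shows "finsum (opalg e D) (%x. k x \<odot>\<^bsub>opalg e D\<^esub> x) (e ` Z) = e (\<Sum>z\<in>Z. opsc (k (e z)) z)"
proof -
 interpret O: star_algebra "opalg e D" by (rule opalg_star_algebra[OF e D])
 note sel = opalg_sel[OF e D]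
 show ?thesis using Z
 proof (induction Z rule: finite_induct)
  case (insert z Z)
  have n: "e z ~: e ` Z" using insert(2) e by (auto simp: inj_def)
  have "finsum (opalg e D) (%x. k x \<odot>\<^bsub>opalg e D\<^esub> x) (insert (e z) (e ` Z))
    = (k (e z) \<odot>\<^bsub>opalg e D\<^esub> e z) \<oplus>\<^bsub>opalg e D\<^esub> finsum (opalg e D) (%x. k x \<odot>\<^bsub>opalg e D\<^esub> x) (e ` Z)"
   by (rule O.M.finsum_insert) (use insert n in \<open>auto simp: sel star_subD[OF D]\<close>)
  thus ?case using insert by (simp add: sel)
 qed (simp add: sel)
qed

lemma opalg_AF: assumes e: "inj e" and D: "star_sub D" "closed D"
  and dense: "!!x ep. x : D ==> 0 < ep ==> EX y:D0. norm (x - y) < ep" and D0: "D0 \<subseteq> D"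
  and fd: "!!F. finite F ==> F \<subseteq> D0 ==> EX Z. finite Z & Z \<subseteq> D & star_sub (fspan Z) & F \<subseteq> fspan Z"
 shows "AF_algebra (opalg e D)" unfolding AF_algebra_def
proof (intro conjI allI impI, goal_cases)
 case 1
 show ?case by (rule opalg_cstar[OF e D])
next
 case (2 F ep)
 note sel = opalg_sel[OF e D(1)]
 have "ALL x:F. EX T. T : D & x = e T" using 2 by (auto simp: sel)
 then obtain T where T: "!!x. x : F ==> T x : D & x = e (T x)" by metis
 have "ALL x:F. EX y. y : D0 & norm (T x - y) < ep" using dense T 2 by blast
 then obtain y where y: "!!x. x : F ==> y x : D0 & norm (T x - y x) < ep" by metis
 obtain Z where Z: "finite Z" "Z \<subseteq> D" "star_sub (fspan Z)" "y ` F \<subseteq> fspan Z"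
  using fd[of "y ` F"] y 2 by blast
 have ZD: "fspan Z \<subseteq> D"
 proof
  fix x assume "x : fspan Z"
  then obtain k where "x = (\<Sum>z\<in>Z. opsc (k z) z)" by (auto simp: fspan_def)
  moreover have "(\<Sum>z\<in>Z. opsc (k z) z) : D"
   using Z(1,2) by (induction Z rule: finite_induct) (simp_all add: star_subD[OF D(1)])
  ultimately show "x : D" by simp
 qed
 have "finite_dimensional_subalgebra (e ` fspan Z) (opalg e D)" unfolding finite_dimensional_subalgebra_def
 proof (intro conjI exI[of _ "e ` Z"] ballI)
  show "cstar_subalgebra (e ` fspan Z) (opalg e D)" by (rule opalg_closed_sub[OF e D fspan_closed[OF Z(1)] ZD Z(3)])
  show "finite (e ` Z)" "e ` Z \<subseteq> e ` fspan Z" using Z(1) fspan_base by auto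
  fix x assume "x : e ` fspan Z"
  then obtain k where k: "x = e (\<Sum>z\<in>Z. opsc (k z) z)" by (auto simp: fspan_def)
  have "x = finsum (opalg e D) (%x. k (inv_into UNIV e x) \<odot>\<^bsub>opalg e D\<^esub> x) (e ` Z)"
   unfolding opalg_finsum[OF e D(1) Z(1,2)] k by (simp add: inv_into_f_f[OF e])
  thus "EX c. x = finsum (opalg e D) (%x. c x \<odot>\<^bsub>opalg e D\<^esub> x) (e ` Z)" by (rule exI[where x="%x. k (inv_into UNIV e x)"])
 qed
 moreover have "EX z:e ` fspan Z. nrm (opalg e D) (x \<ominus>\<^bsub>opalg e D\<^esub> z) < ep" if x: "x : F" for x
 proof (rule bexI)
  show "e (y x) : e ` fspan Z" using Z(4) x by blast
  have "nrm (opalg e D) (e (T x) \<ominus>\<^bsub>opalg e D\<^esub> e (y x)) = norm (T x - y x)"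
   using T[OF x] y[OF x] D0 by (subst opalg_minus[OF e D(1)]) (auto simp: sel)
  thus "nrm (opalg e D) (x \<ominus>\<^bsub>opalg e D\<^esub> e (y x)) < ep" using T[OF x] y[OF x] by simp
 qed
 ultimately show ?case by blast
qed

lemma opalg_AF_embeddable:
 fixes B :: "('b, 'k) cstar_scheme" and e :: "op => 'b l2op"
 assumes e: "inj e" and D: "star_sub D" "closed D" and AF: "AF_algebra (opalg e D)"
  and B: "cstar_algebra B" and Ps: "op_hom B Ps" and iso: "!!b. b : carrier B ==> norm (Ps b) = nrm B b"
  and R: "Ps ` carrier B \<subseteq> D" "closed (Ps ` carrier B)" "star_sub (Ps ` carrier B)" shows "AF_embeddable B"
 unfolding AF_embeddable_def
proof (intro exI conjI)
 interpret B: cstar_algebra B by fact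
 note sel = opalg_sel[OF e D(1)] and h = op_homD[OF Ps]
 show "AF_algebra (opalg e D)" by fact
 show "cstar_subalgebra (e ` Ps ` carrier B) (opalg e D)" by (rule opalg_closed_sub[OF e D R(2,1,3)])
 show "star_hom B (opalg e D) (%b. e (Ps b))" unfolding star_hom_def using R(1) by (auto simp: sel h)
 have "inj_on (%b. e (Ps b)) (carrier B)"
 proof (rule inj_onI)
  fix x y assume x: "x : carrier B" and y: "y : carrier B" and "e (Ps x) = e (Ps y)"
  hence "Ps (x \<ominus>\<^bsub>B\<^esub> y) = 0" using e by (simp add: op_hom_diff[OF B Ps x y] inj_eq)
  hence "nrm B (x \<ominus>\<^bsub>B\<^esub> y) = 0" using iso[of "x \<ominus>\<^bsub>B\<^esub> y"] x y by simp
  thus "x = y" using x y by (intro B.minus_eq_zero[OF x y] B.nrm_eq_zero) simp_all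
 qed
 thus "bij_betw (%b. e (Ps b)) (carrier B) (e ` Ps ` carrier B)" by (simp add: bij_betw_def image_image)
qed

lemma equi_singleton: assumes "ga : dual" shows "equi {ga}" unfolding equi_def
proof (intro conjI allI impI)
 fix ep :: real assume e: "0 < ep"
 have "open ((%t. cmod (ga t - 1)) -` {..<ep})" by (intro open_vimage open_lessThan continuous_intros dualD(1)[OF assms])
 thus "EX V. open V & 0 : V & (ALL ga:{ga}. ALL t:V. cmod (ga t - 1) < ep)"
  using e dualD(4)[OF assms] by (intro exI[of _ "(%t. cmod (ga t - 1)) -` {..<ep}"]) auto
qed (use assms in simp)

context quasi_free
begin

text \<open>Simple functions in place of continuous ones. The resulting closed algebra is in general
  larger than the image of the crossed product, which is why the conclusion is
  embeddability.\<close>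

definition FS :: "(('g => complex) => complex) set" where "FS = {w. finite (w ` dual) & equi {ga : dual. w ga ~= 0}}"

lemma FS_bw: "w : FS ==> bw w"
proof -
 assume "w : FS"
 hence "bounded (w ` dual)" by (simp add: FS_def finite_imp_bounded)
 thus ?thesis unfolding bw_def bounded_iff by blast
qed

lemma FS_sub: assumes "w : FS" "finite (v ` dual)" "!!ga. ga : dual ==> w ga = 0 ==> v ga = 0" shows "v : FS"
 using assms equi_subset[of "{ga : dual. w ga ~= 0}" "{ga : dual. v ga ~= 0}"] by (auto simp: FS_def)

lemma FS_translate: assumes w: "w : FS" and k: "k : wd" shows "(%ga. w (om k \<diamond> ga)) : FS"
proof -
 have "(%ga. w (om k \<diamond> ga)) ` dual \<subseteq> w ` dual" using om_translate[OF k] by blast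
 hence "finite ((%ga. w (om k \<diamond> ga)) ` dual)" using w by (auto simp: FS_def intro: finite_subset)
 moreover have "equi {ta : dual. EX ga:{om k}. ta \<diamond> ga : {ga : dual. w ga ~= 0}}"
  using w by (intro equi_quotient equi_singleton om_dual k) (simp add: FS_def)
 hence "equi {ga : dual. w (om k \<diamond> ga) ~= 0}"
  by (rule equi_subset) (auto simp: mult.commute[of "om k _"] intro!: dual_mult om_dual k)
 ultimately show ?thesis by (simp add: FS_def)
qed

lemma FC_FS: assumes w: "w : FC" and e: "0 < ep" shows "EX v:FS. ALL ga:dual. cmod (w ga - v ga) <= ep"
proof -
 define et where "et = ep / 2"
 have et: "0 < et" using e by (simp add: et_def)
 \<comment> \<open>Rounding to a grid of mesh \<open>ep / 2\<close> moves a value by at most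
   \<open>ep\<close>, and cutting off values of modulus at most \<open>ep\<close> makes the support
   relatively compact.\<close>
 define rd where "rd z = Complex (et * \<lfloor>Re z / et\<rfloor>) (et * \<lfloor>Im z / et\<rfloor>)" for z
 have fl: "\<bar>r - et * \<lfloor>r / et\<rfloor>\<bar> <= et" for r
 proof -
  have "\<bar>r / et - \<lfloor>r / et\<rfloor>\<bar> <= 1" by linarith
  hence "\<bar>et\<bar> * \<bar>r / et - \<lfloor>r / et\<rfloor>\<bar> <= et * 1" using et by (intro mult_mono) auto
  thus ?thesis using et unfolding abs_mult[symmetric] by (simp add: right_diff_distrib)
 qed
 have rd: "cmod (z - rd z) <= ep" for z using cmod_le[of "z - rd z"] fl[of "Re z"] fl[of "Im z"] by (simp add: rd_def et_def)
 define v where "v ga = (if ep < cmod (w ga) then rd (w ga) else 0)" for ga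
 obtain C where C: "ALL ga:dual. cmod (w ga) <= C" using FC_bounded[OF w] by blast
 define I where "I = {\<lfloor>- C / et\<rfloor>..\<lfloor>C / et\<rfloor>}"
 have "v ` dual \<subseteq> insert 0 ((%(p, q). Complex (et * of_int p) (et * of_int q)) ` (I \<times> I))"
 proof
  fix z assume "z : v ` dual"
  then obtain ga where g: "ga : dual" "z = v ga" by blast
  have "cmod (w ga) <= C" using C g by blast
  hence "\<bar>Re (w ga)\<bar> <= C" "\<bar>Im (w ga)\<bar> <= C"
   using abs_Re_le_cmod[of "w ga"] abs_Im_le_cmod[of "w ga"] by linarith+
  moreover have "\<lfloor>r / et\<rfloor> : I" if "\<bar>r\<bar> <= C" for r
   using that et divide_right_mono[of "- C" r et] divide_right_mono[of r C et] unfolding I_def by (auto intro!: floor_mono)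
  ultimately have "\<lfloor>Re (w ga) / et\<rfloor> : I" "\<lfloor>Im (w ga) / et\<rfloor> : I" by blast+
  hence "rd (w ga) : (%(p, q). Complex (et * of_int p) (et * of_int q)) ` (I \<times> I)"
   by (intro image_eqI[of _ _ "(\<lfloor>Re (w ga) / et\<rfloor>, \<lfloor>Im (w ga) / et\<rfloor>)"]) (simp_all add: rd_def)
  thus "z : insert 0 ((%(p, q). Complex (et * of_int p) (et * of_int q)) ` (I \<times> I))" by (simp add: g v_def)
 qed
 hence "finite (v ` dual)" by (rule finite_subset) (simp add: I_def)
 moreover have "equi {ga : dual. v ga ~= 0}" by (rule equi_subset[OF FC_support[OF w e]]) (auto simp: v_def split: if_splits)
 ultimately have "v : FS" by (simp add: FS_def)
 moreover have "cmod (w ga - v ga) <= ep" for ga using rd by (simp add: v_def)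
 ultimately show ?thesis by blast
qed

end

context covariant
begin

lemma alg0_FS: "star_sub (alg0 FS)"
proof (rule alg0_star_sub)
 fix w v k assume w: "w : FS"
 have f: "finite (w ` dual)" using w by (simp add: FS_def)
 have "finite ((%z. k * z) ` w ` dual)" "finite (cnj ` w ` dual)" using f by blast+
 thus "(%ga. k * w ga) : FS" "(%ga. cnj (w ga)) : FS" by (auto intro!: FS_sub[OF w] simp: image_image)
 assume v: "v : FS"
 have "finite ((%(y, z). y * z) ` (w ` dual \<times> v ` dual))" using w v by (simp add: FS_def)
 hence "finite ((%ga. w ga * v ga) ` dual)" by (rule rev_finite_subset) auto
 thus "(%ga. w ga * v ga) : FS" by (rule FS_sub[OF w]) simp
qed (auto intro: FS_bw FS_translate)

lemma alg0_generated: assumes "x : alg0 W"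
 shows "EX G. finite G & G \<subseteq> wd \<times> W \<times> wd & (ALL Z. (ALL (u, w, v):G. gen u w v : fspan Z) --> x : fspan Z)"
 using assms
proof (induction rule: alg0.induct)
 case zero
 show ?case by (rule exI[of _ "{}"]) (simp add: fspan_zero)
next
 case (step T w u v)
 then obtain G where "finite G" "G \<subseteq> wd \<times> W \<times> wd"
  "ALL Z. (ALL (u, w, v):G. gen u w v : fspan Z) --> T : fspan Z" by blast
 thus ?case using step by (intro exI[of _ "insert (u, w, v) G"]) (auto intro: fspan_add)
qed

text \<open>The symbols are refined to atoms that translations by words respect.
  \<open>Sg ga\<close> records the values of all symbols at all translates
  \<open>om k \<diamond> ga\<close>; for \<open>ga\<close> in \<open>Y\<close> only the words in the
  finite set \<open>R\<close> contribute nonzero values, so finitely many atoms meet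
  \<open>Y\<close>. The generators over atoms multiply like matrix units.\<close>

lemma finite_dim:
 assumes af: "!!Y. equi Y ==> finite {u : wd. om u : Y}" and G: "finite G" "G \<subseteq> wd \<times> FS \<times> wd"
 shows "EX Z. finite Z & Z \<subseteq> alg0 FS & star_sub (fspan Z) & (ALL (u, w, v):G. gen u w v : fspan Z)"
proof -
 define Ws where "Ws = (%(u, w, v). w) ` G"
 define W0 where "W0 = (%(u, w, v). u) ` G \<union> (%(u, w, v). v) ` G"
 have fin: "finite Ws" "finite W0" using G by (simp_all add: Ws_def W0_def)
 have WF: "w : FS" if "w : Ws" for w using that G by (auto simp: Ws_def)
 have W0: "a : wd" if "a : W0" for a using that G by (auto simp: W0_def)
 define Sg where "Sg ga = (%(k, w). if k : wd & w : Ws then w (om k \<diamond> ga) else 0)" for ga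
 define Y where "Y = {ga : dual. EX w:Ws. w ga ~= 0}"
 \<comment> \<open>The words that move some point of \<open>Y\<close> into \<open>Y\<close>. This
   set is finite by \<open>af\<close>, as the characters of its words lie in a quotient of
   relatively compact sets.\<close>
 define R where "R = {k : wd. EX ga:Y. om k \<diamond> ga : Y}"
 have YD: "Y \<subseteq> dual" by (auto simp: Y_def)
 have "equi (\<Union>w\<in>Ws. {ga : dual. w ga ~= 0})"
  using fin(1) WF by (induction Ws rule: finite_induct) (auto simp: equi_empty FS_def intro: equi_Un)
 hence Yq: "equi Y" by (rule equi_subset) (auto simp: Y_def)
 have "finite {k : wd. om k : {ta : dual. EX ga:Y. ta \<diamond> ga : Y}}" by (rule af[OF equi_quotient[OF Yq Yq]])
 hence Rfin: "finite R" by (rule rev_finite_subset) (auto simp: R_def om_dual)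
 \<comment> \<open>The entry of the translate at \<open>l\<close> is the original entry at
   \<open>l @ k\<close>. Equal signatures thus stay equal, because \<open>Sg\<close> ranges over all
   words and not only over those in \<open>R\<close>.\<close>
 have Sg_tr: "Sg (om k \<diamond> ga) = Sg (om k \<diamond> ga')" if eq: "Sg ga = Sg ga'" and k: "k : wd" for k ga ga'
 proof (rule ext, clarify)
  fix l w
  have "om l \<diamond> om k \<diamond> rh = om (l @ k) \<diamond> rh" for rh :: "'g => complex" by (simp add: om_append mult.assoc)
  thus "Sg (om k \<diamond> ga) (l, w) = Sg (om k \<diamond> ga') (l, w)"
   using fun_cong[OF eq, of "(l @ k, w)"] k by (auto simp: Sg_def split: if_splits)
 qed
 have Sg_Y: "ga : Y \<longleftrightarrow> ga' : Y" if eq: "Sg ga = Sg ga'" and D: "ga : dual" "ga' : dual" for ga ga'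
 proof -
  have "w ga ~= 0 \<longleftrightarrow> w ga' ~= 0" if "w : Ws" for w using fun_cong[OF eq, of "([], w)"] that by (simp add: Sg_def)
  hence "(EX w:Ws. w ga ~= 0) \<longleftrightarrow> (EX w:Ws. w ga' ~= 0)" by (rule bex_cong[OF refl])
  thus ?thesis using D by (simp add: Y_def)
 qed
 have sgfin: "finite (Sg ` Y)"
 proof (rule finite_subset)
  show "finite {f. ALL p. (p : R \<times> Ws --> f p : (\<Union>w\<in>Ws. w ` dual)) & (p ~: R \<times> Ws --> f p = 0)}"
   using Rfin fin WF by (intro finite_set_of_finite_funs) (auto simp: FS_def)
  show "Sg ` Y \<subseteq> {f. ALL p. (p : R \<times> Ws --> f p : (\<Union>w\<in>Ws. w ` dual)) & (p ~: R \<times> Ws --> f p = 0)}"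
  proof (intro image_subsetI CollectI allI conjI impI)
   fix ga p assume g: "ga : Y" and "p : R \<times> Ws"
   then obtain k w where p: "p = (k, w)" and k: "k : R" and w: "w : Ws" by blast
   have "om k \<diamond> ga : dual" using g k YD by (auto simp: R_def intro: om_translate)
   thus "Sg ga p : (\<Union>w\<in>Ws. w ` dual)" using k w by (auto simp: Sg_def R_def p)
  next
   fix ga p assume g: "ga : Y" and n: "p ~: R \<times> Ws"
   obtain k w where p: "p = (k, w)" by (cases p)
   show "Sg ga p = 0"
   proof (rule ccontr)
    assume "Sg ga p ~= 0"
    hence h: "k : wd" "w : Ws" "w (om k \<diamond> ga) ~= 0" by (auto simp: Sg_def p split: if_splits)
    hence "om k \<diamond> ga : Y" using g YD by (auto simp: Y_def intro!: bexI[of _ w] dual_mult om_dual)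
    thus False using n h g by (auto simp: R_def p)
   qed
  qed
 qed
 define ind where "ind si ga = (if Sg ga = si then 1 else 0 :: complex)" for si ga
 have bind: "bw (ind si)" for si by (auto simp: bw_def ind_def intro!: exI[of _ 1])
 have indFS: "ind (Sg ga0) : FS" if g0: "ga0 : Y" for ga0
 proof -
  have "ind (Sg ga0) ` dual \<subseteq> {0, 1}" by (auto simp: ind_def)
  hence "finite (ind (Sg ga0) ` dual)" by (rule finite_subset) simp
  moreover have "equi {ga : dual. ind (Sg ga0) ga ~= 0}"
   using g0 YD Sg_Y by (intro equi_subset[OF Yq]) (auto simp: ind_def split: if_splits)
  ultimately show ?thesis by (simp add: FS_def)
 qed
 define ok where "ok k ga \<longleftrightarrow> k : wd & om k \<diamond> ga : Y" for k ga
 define Z where "Z = {gen (a @ k) (ind (Sg ga)) (b @ l) |a b k l ga. a : W0 & b : W0 & ga : Y & ok k ga & ok l ga}"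
 have ZI: "gen (a @ k) (ind (Sg ga)) (b @ l) : Z" if "a : W0" "b : W0" "ga : Y" "ok k ga" "ok l ga" for a b k l ga
  using that unfolding Z_def by blast
 have "Z \<subseteq> (%(a, b, k, l, si). gen (a @ k) (ind si) (b @ l)) ` (W0 \<times> W0 \<times> R \<times> R \<times> Sg ` Y)"
 proof
  fix x assume "x : Z"
  then obtain a b k l ga where x: "x = gen (a @ k) (ind (Sg ga)) (b @ l)" "a : W0" "b : W0" "ga : Y" "ok k ga" "ok l ga"
   unfolding Z_def by blast
  hence "k : R" "l : R" by (auto simp: R_def ok_def)
  thus "x : (%(a, b, k, l, si). gen (a @ k) (ind si) (b @ l)) ` (W0 \<times> W0 \<times> R \<times> R \<times> Sg ` Y)"
   using x by (intro image_eqI[of _ _ "(a, b, k, l, Sg ga)"]) auto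
 qed
 hence Zfin: "finite Z" by (rule finite_subset) (use fin Rfin sgfin in simp)
 have Zalg: "Z \<subseteq> alg0 FS" unfolding Z_def ok_def using W0 indFS by (auto intro!: alg0_gen)
 have Zadj: "adj x : Z" if xZ: "x : Z" for x
 proof -
  obtain a b k l ga where x: "x = gen (a @ k) (ind (Sg ga)) (b @ l)" "a : W0" "b : W0" "ga : Y" "ok k ga" "ok l ga"
   using xZ unfolding Z_def by blast
  have "(%rh. cnj (ind (Sg ga) rh)) = ind (Sg ga)" by (simp add: ind_def fun_eq_iff)
  hence "adj x = gen (b @ l) (ind (Sg ga)) (a @ k)" unfolding x(1) by (simp only: adj_gen[OF bind])
  thus ?thesis using ZI x by simp
 qed
 have main: "gen (a @ k) (ind (Sg ga)) (b @ l) * gen (a' @ k') (ind (Sg ga')) (b' @ l') : insert 0 Z"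
  if h: "a : W0" "b : W0" "ga : Y" "ok k ga" "ok l ga" "a' : W0" "b' : W0" "ga' : Y" "ok k' ga'" "ok l' ga'"
   and eq: "a' @ k' = (b @ l) @ q" for a b k l ga a' b' k' l' ga' q
 proof -
  have "a' @ k' : wd" using h W0 by (auto simp: ok_def)
  hence q: "q : wd" and bl: "b @ l : wd" unfolding eq by simp_all
  have g': "ga' : dual" using h YD by blast
  have m: "gen (a @ k) (ind (Sg ga)) (b @ l) * gen (a' @ k') (ind (Sg ga')) (b' @ l')
    = gen ((a @ k) @ q) (%rh. ind (Sg ga) (om q \<diamond> rh) * ind (Sg ga') rh) (b' @ l')"
   unfolding eq by (rule gen_mult1[OF bind bind bl q])
  have t: "Sg (om q \<diamond> rh) = Sg (om q \<diamond> ga')" if "Sg rh = Sg ga'" for rh by (rule Sg_tr[OF that q])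
  show ?thesis
  proof (cases "Sg (om q \<diamond> ga') = Sg ga")
   case True
   have "(%rh. ind (Sg ga) (om q \<diamond> rh) * ind (Sg ga') rh) = ind (Sg ga')"
   proof (rule ext)
    fix rh
    show "ind (Sg ga) (om q \<diamond> rh) * ind (Sg ga') rh = ind (Sg ga') rh"
     using t[of rh] True by (cases "Sg rh = Sg ga'") (simp_all add: ind_def)
   qed
   moreover have "ok (k @ q) ga'"
   proof -
    have k: "k : wd" using h by (simp add: ok_def)
    have "om k \<diamond> om q \<diamond> ga' : Y" by (rule Sg_Y[OF Sg_tr[OF True k], THEN iffD2])
      (use h YD g' q k in \<open>auto simp: ok_def intro!: dual_mult om_dual\<close>)
    thus ?thesis using q k by (simp add: ok_def om_append mult.assoc)
   qed
   ultimately show ?thesis unfolding m using ZI[of a b' ga' "k @ q" l'] h by simp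
  next
   case False
   have "(%rh. ind (Sg ga) (om q \<diamond> rh) * ind (Sg ga') rh) = (%_. 0)"
   proof (rule ext)
    fix rh
    show "ind (Sg ga) (om q \<diamond> rh) * ind (Sg ga') rh = 0"
     using t[of rh] False by (cases "Sg rh = Sg ga'") (simp_all add: ind_def)
   qed
   thus ?thesis unfolding m by (simp add: Dg_const opsc_simps)
  qed
 qed
 have Zmult: "x * y : insert 0 Z" if x: "x : Z" and y: "y : Z" for x y
 proof -
  obtain a b k l ga where x': "x = gen (a @ k) (ind (Sg ga)) (b @ l)" "a : W0" "b : W0" "ga : Y" "ok k ga" "ok l ga"
   using x unfolding Z_def by blast
  obtain a' b' k' l' ga' where y': "y = gen (a' @ k') (ind (Sg ga')) (b' @ l')" "a' : W0" "b' : W0" "ga' : Y" "ok k' ga'" "ok l' ga'"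
   using y unfolding Z_def by blast
  consider q where "a' @ k' = (b @ l) @ q" | q where "b @ l = (a' @ k') @ q"
   | "\<nexists>q. a' @ k' = (b @ l) @ q" "\<nexists>q. b @ l = (a' @ k') @ q" by blast
  thus ?thesis
  proof cases
   case 1
   thus ?thesis unfolding x'(1) y'(1) using main x' y' by blast
  next
   case 2
   \<comment> \<open>The case of a longer left word follows from \<open>main\<close> by taking
     adjoints.\<close>
   have r: "(%rh. cnj (ind si rh)) = ind si" for si by (simp add: ind_def fun_eq_iff)
   have "adj y * adj x : insert 0 Z" unfolding x'(1) y'(1) adj_gen[OF bind] r using main 2 x' y' by blast
   moreover have "adj z : insert 0 Z" if "z : insert 0 Z" for z using that Zadj by auto
   ultimately have "adj (adj y * adj x) : insert 0 Z" by blast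
   thus ?thesis by (simp only: adj_simps adj_adj)
  next
   case 3
   have "b @ l : wd" "a' @ k' : wd" using x' y' W0 by (auto simp: ok_def)
   from gen_mult0[OF this 3] show ?thesis unfolding x'(1) y'(1) by simp
  qed
 qed
 have "gen u w v : fspan Z" if g: "(u, w, v) : G" for u w v
 proof -
  have h: "u : W0" "v : W0" "w : Ws" using g by (force simp: W0_def Ws_def)+
  \<comment> \<open>On each atom \<open>w\<close> is constant, its value being the entry of the
    signature at the empty word.\<close>
  define d where "d si = (%ga. si ([], w) * ind si ga)" for si
  have bd: "bw (d si)" for si unfolding d_def by (rule bw_mult[OF bw_const bind])
  have sumD: "bw (%ga. \<Sum>si\<in>T. d si ga) & Dg (%ga. \<Sum>si\<in>T. d si ga) = (\<Sum>si\<in>T. Dg (d si))" if "finite T" for T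
   using that by (induction T rule: finite_induct) (simp_all add: bw_const Dg_const opsc_simps bw_add bd Dg_add)
  have "w ga = (\<Sum>si\<in>Sg ` Y. d si ga)" if g: "ga : dual" for ga
  proof -
   have "(\<Sum>si\<in>Sg ` Y. d si ga) = (\<Sum>si\<in>Sg ` Y. if si = Sg ga then w ga else 0)"
    using h by (intro sum.cong) (auto simp: d_def ind_def Sg_def)
   also have "... = (if Sg ga : Sg ` Y then w ga else 0)" using sgfin by simp
   also have "... = w ga" using h g by (auto simp: Y_def)
   finally show ?thesis by simp
  qed
  hence "Dg w = (\<Sum>si\<in>Sg ` Y. Dg (d si))" using Dg_cong[of w "%ga. \<Sum>si\<in>Sg ` Y. d si ga"] sumD[OF sgfin] by simp
  hence "gen u w v = (\<Sum>si\<in>Sg ` Y. gen u (d si) v)" by (simp add: sum_distrib_left sum_distrib_right)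
  also have "... : fspan Z"
  proof (rule fspan_sum)
   fix si assume "si : Sg ` Y"
   then obtain ga where s: "si = Sg ga" "ga : Y" by blast
   have "gen (u @ []) (ind si) (v @ []) : Z" unfolding s(1) by (rule ZI) (use h s in \<open>auto simp: ok_def\<close>)
   moreover have "gen u (d si) v = opsc (si ([], w)) (gen (u @ []) (ind si) (v @ []))"
    unfolding d_def by (simp add: Dg_scale[OF bind] opsc_simps)
   ultimately show "gen u (d si) v : fspan Z" using fspan_scale fspan_base[OF Zfin] by simp
  qed
  finally show ?thesis .
 qed
 thus ?thesis using Zfin Zalg fspan_star_sub[OF Zfin Zmult Zadj] by blast
qed

text \<open>Symbols in \<open>FC\<close> are uniform limits of symbols in \<open>FS\<close>, so the
  closed algebra over \<open>FS\<close> contains the image of \<open>B\<close>; and finitely many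
  elements of \<open>alg0 FS\<close> involve only finitely many generators, to which
  \<open>finite_dim\<close> applies.\<close>

lemma AF_case:
 fixes B :: "('b, 'k) cstar_scheme" assumes af: "!!Y. equi Y ==> finite {u : wd. om u : Y}"
  and B: "cstar_algebra B" "op_hom B Ps" "!!b. b : carrier B ==> norm (Ps b) = nrm B b"
  and R: "Ps ` carrier B = closure (alg0 FC)" and inf: "infinite (UNIV :: 'b set)" shows "AF_embeddable B"
proof -
 obtain io :: "nat => 'b" where "inj io" using infinite_countable_subset[OF inf] by blast
 hence e: "inj (matrix_embed io)" by (rule inj_matrix_embed)
 let ?D = "closure (alg0 FS)"
 have D: "star_sub ?D" "closed ?D" by (simp_all add: star_sub_closure alg0_FS)
 have "alg0 FC \<subseteq> ?D" by (rule subsetI, rule alg0_approx) (auto intro: bw_FC FS_bw FC_FS)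
 hence sub: "closure (alg0 FC) \<subseteq> ?D" by (rule closure_minimal) simp
 have "AF_algebra (opalg (matrix_embed io) ?D)"
 proof (rule opalg_AF[OF e D])
  show "EX y:alg0 FS. norm (x - y) < ep" if "x : ?D" "0 < ep" for x ep
   using that unfolding closure_approachable by (auto simp: dist_norm norm_minus_commute)
  show "alg0 FS \<subseteq> ?D" by (rule closure_subset)
  fix F assume F: "finite F" "F \<subseteq> alg0 FS"
  hence "ALL x:F. EX G. finite G & G \<subseteq> wd \<times> FS \<times> wd & (ALL Z. (ALL (u, w, v):G. gen u w v : fspan Z) --> x : fspan Z)"
   using alg0_generated by blast
  then obtain G where G: "!!x. x : F ==> finite (G x)" "!!x. x : F ==> G x \<subseteq> wd \<times> FS \<times> wd"
   "!!x Z. x : F ==> ALL (u, w, v):G x. gen u w v : fspan Z ==> x : fspan Z" by metis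
  obtain Z where Z: "finite Z" "Z \<subseteq> alg0 FS" "star_sub (fspan Z)" "ALL (u, w, v):\<Union> (G ` F). gen u w v : fspan Z"
   using finite_dim[OF af, of "\<Union> (G ` F)"] F G(1,2) by blast
  have "x : fspan Z" if "x : F" for x by (rule G(3)[OF that]) (use Z(4) that in blast)
  thus "EX Z. finite Z & Z \<subseteq> ?D & star_sub (fspan Z) & F \<subseteq> fspan Z"
   using Z closure_subset[of "alg0 FS"] by (intro exI[of _ Z]) auto
 qed
 from opalg_AF_embeddable[OF e D this B] show ?thesis using sub by (simp add: R star_sub_closure alg0_FC)
qed

end

section \<open>Consequences of simplicity\<close>

locale simple_crossed_product = quasi_free mu n og A S al
 for mu :: "'g :: {topological_ab_group_add, t2_space} measure" and n og and A :: "'a cstar" and S al +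
 fixes B :: "('b, 'k) cstar_scheme" (structure) and j :: "('g => 'a) => 'b"
 assumes env: "enveloping_cstar_algebra E B j" and simple: "simple_cstar B"
begin

lemma cstar_B: "cstar_algebra B" using env by (simp add: enveloping_cstar_algebra_def)

sublocale B: cstar_algebra B by (rule cstar_B)

lemma j_closed: "f : carrier E ==> j f : carrier B"
 using env star_homD(1)[of E B j f] by (simp add: enveloping_cstar_algebra_def)

lemma j_dense: "b : carrier B ==> 0 < ep ==> EX f:carrier E. nrm B (b \<ominus> j f) < ep"
proof -
 assume b: "b : carrier B" and e: "0 < ep"
 have "b : cs_topology B closure_of (j ` carrier E)" using env b by (simp add: enveloping_cstar_algebra_def)
 thus ?thesis using B.closure_of_iff[of "j ` carrier E" b] j_closed e by auto
qed

end

locale simple_rep = simple_crossed_product mu n og A S al B j + covariant mu n og A S al s hdn tln c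
 for mu :: "'g :: {topological_ab_group_add, t2_space} measure" and n og
  and A :: "'a cstar" and S al and B :: "('b, 'k) cstar_scheme" (structure) and j s hdn tln c
begin

text \<open>Isometry makes the range of \<open>Ps\<close> closed, so the range and the closure of
  \<open>alg0 FC\<close> have to be compared only on dense subsets.\<close>

lemma isometric_hom:
 "EX Ps. op_hom B Ps & (ALL f:carrier E. Ps (j f) = Ph f) & (ALL b:carrier B. norm (Ps b) = nrm B b) &
  Ps ` carrier B = closure (alg0 FC)"
proof -
 obtain Ps where h: "op_hom B Ps" and Psj: "ALL f:carrier E. Ps (j f) = Ph f" using Ph_extends[OF env] by blast
 \<comment> \<open>Some multiplier is nonzero on the basis vector 0, so the representation is
   nonzero, as the argument with the kernel requires.\<close>
 obtain k where k: "cc k" "hat k (c 0) ~= 0" using hat_nonzero[OF c_dual] by blast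
 have "0 < norm (Dg (hat k))"
  using k(2) norm_Dg_ge[OF bw_FC[OF FC_hat[OF k(1)]], of 0] by (metis less_le_trans zero_less_norm_iff)
 moreover have ek: "el k \<one>\<^bsub>A\<^esub> : carrier E" by (rule el_closed[OF k(1) one_closed])
 moreover have "Ph (el k \<one>\<^bsub>A\<^esub>) = Dg (hat k)" by (simp add: Ph_el[OF k(1) one_closed] rp_one)
 ultimately have nz: "Ps (j (el k \<one>\<^bsub>A\<^esub>)) ~= 0" using Psj by auto
 have iso: "norm (Ps b) = nrm B b" if "b : carrier B" for b
  by (rule simple_op_hom_isometric[OF cstar_B simple h j_closed[OF ek] nz that])
 have diff: "norm (Ps x - Ps y) = nrm B (x \<ominus> y)" if "x : carrier B" "y : carrier B" for x y
  using iso[of "x \<ominus> y"] that by (simp add: op_hom_diff[OF cstar_B h])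
 have cl: "closed (Ps ` carrier B)" unfolding closed_sequential_limits
 proof (intro allI impI, elim conjE)
  fix f l assume f: "ALL i. f i : Ps ` carrier B" and l: "f ~~> l"
  from f have "ALL i. EX x. x : carrier B & f i = Ps x" by blast
  then obtain x where x: "!!i. x i : carrier B" "!!i. f i = Ps (x i)" by metis
  have "EX N. ALL m>=N. ALL n>=N. nrm B (x m \<ominus> x n) < ep" if "0 < ep" for ep
   using CauchyD[OF LIMSEQ_imp_Cauchy[OF l] that] by (simp add: x diff)
  then obtain y where y: "y : carrier B" "(%k. nrm B (x k \<ominus> y)) ~~> 0" using B.Cauchy_limit[of x] x by blast
  have "(%k. f k - Ps y) ~~> 0" by (rule tendsto_norm_zero_cancel) (use y in \<open>simp add: x diff\<close>)
  hence "f ~~> Ps y" by (rule LIM_zero_cancel)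
  hence "l = Ps y" by (rule LIMSEQ_unique[OF l])
  thus "l : Ps ` carrier B" using y(1) by blast
 qed
 have "Ps b : closure (closure (alg0 FC))" if b: "b : carrier B" for b unfolding closure_approachable
 proof (intro allI impI)
  fix ep :: real assume "0 < ep"
  then obtain f where f: "f : carrier E" "nrm B (b \<ominus> j f) < ep" using j_dense[OF b] by blast
  hence "dist (Ph f) (Ps b) < ep" using diff[OF b j_closed[OF f(1)]] Psj by (simp add: dist_norm norm_minus_commute)
  thus "EX y:closure (alg0 FC). dist y (Ps b) < ep" using Ph_in_closure[OF f(1)] by (rule bexI)
 qed
 hence 1: "Ps ` carrier B \<subseteq> closure (alg0 FC)" by auto
 have "T : Ps ` carrier B" if "T : alg0 FC" for T using that
 proof (induction rule: alg0.induct)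
  case zero
  have "Ps \<zero> = 0" using op_homD(2)[OF h, of "\<zero>" 0] by (simp add: opsc_simps)
  thus ?case by (intro image_eqI[of _ _ "\<zero>"]) simp_all
 next
  case (step T w u v)
  have R: "Ph f : Ps ` carrier B" if f: "f : carrier E" for f using Psj f j_closed[OF f] by (metis imageI)
  have "gen u w v : Ps ` carrier B" by (rule gen_in_range[OF cl R step(2-4)])
  then obtain x y where "x : carrier B" "y : carrier B" "gen u w v = Ps x" "T = Ps y" using step by blast
  thus ?case by (intro image_eqI[of _ _ "x \<oplus> y"]) (simp_all add: op_homD[OF h])
 qed
 hence "closure (alg0 FC) \<subseteq> Ps ` carrier B" by (intro closure_minimal cl) blast
 with 1 have "Ps ` carrier B = closure (alg0 FC)" by blast
 thus ?thesis using h Psj iso by blast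
qed

lemma norm_Dg_eq: "cc h ==> norm (Dg (hat h)) = nrm B (j (el h \<one>\<^bsub>A\<^esub>))"
proof -
 assume h: "cc h"
 obtain Ps where Ps: "ALL f:carrier E. Ps (j f) = Ph f" "ALL b:carrier B. norm (Ps b) = nrm B b" using isometric_hom by blast
 have e: "el h \<one>\<^bsub>A\<^esub> : carrier E" by (rule el_closed[OF h one_closed])
 show ?thesis using bspec[OF Ps(2) j_closed[OF e]] bspec[OF Ps(1) e] Ph_el[OF h one_closed] rp_one by simp
qed

end

context simple_crossed_product
begin

text \<open>The norm of a multiplier is the supremum of its symbol over the characters that occur,
  and by isometry it is a norm in \<open>B\<close>, the same for both representations. Hence
  functions in \<open>FC\<close> cannot tell apart the sets of characters of the two.\<close>

lemma spectrum_eq: assumes C: "covariant mu n og A S al s hdn tln c" and C': "covariant mu n og A S al s' hdn' tln' c'"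
  and w: "w : FC" and e: "0 < ep" shows "EX x. cmod (w (c' y)) - ep < cmod (w (c x))"
proof (rule ccontr)
 interpret C: simple_rep mu n og A S al B j s hdn tln c by (intro simple_rep.intro C simple_crossed_product_axioms)
 interpret C': simple_rep mu n og A S al B j s' hdn' tln' c' by (intro simple_rep.intro C' simple_crossed_product_axioms)
 assume "~ ?thesis"
 hence le: "cmod (w (c x)) <= cmod (w (c' y)) - ep" for x by (simp add: not_less)
 obtain h where h: "cc h" "ALL ga:dual. cmod (w ga - hat h ga) <= ep / 3" using FCD[OF w, of "ep / 3"] e by auto
 have "cmod (hat h (c x)) <= cmod (w (c' y)) - ep + ep / 3" for x
  using norm_triangle_ineq2[of "hat h (c x)" "w (c x)"] le[of x] bspec[OF h(2) C.c_dual, of x]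
  by (simp add: norm_minus_commute)
 hence "norm (C.Dg (hat h)) <= cmod (w (c' y)) - ep + ep / 3" unfolding C.Dg_def by (intro norm_diag allI)
 moreover have "cmod (hat h (c' y)) <= norm (C'.Dg (hat h))" by (rule C'.norm_Dg_ge[OF bw_FC[OF FC_hat[OF h(1)]]])
 moreover have "cmod (w (c' y)) - ep / 3 <= cmod (hat h (c' y))"
  using norm_triangle_ineq2[of "w (c' y)" "hat h (c' y)"] bspec[OF h(2) C'.c_dual, of y] by simp
 ultimately show False using C.norm_Dg_eq[OF h(1)] C'.norm_Dg_eq[OF h(1)] e by linarith
qed

end

context quasi_free
begin

text \<open>The lag \<open>m\<close> is compensated by the inverse of the character of the first
  \<open>m\<close> letters, so prepending the letters \<open>x0 0, ..., x0 (m - 1)\<close> leads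
  back to the base character \<open>ga\<close>.\<close>

definition tail_c :: "(nat => nat) => ('g => complex) => nat => 'g => complex"
 where "tail_c x0 ga k t = (case tail_enum n x0 k of (u, m) => om u t * cnj (om (map x0 [0..<m]) t) * ga t)"

lemma tail_covariant: assumes x0: "!!k. x0 k : {1..n}" and g: "ga : dual"
 shows "covariant mu n og A S al (%i k. tidx n x0 (tail_s x0 i (tail_enum n x0 k)))
  (%k. tail_hd x0 (tail_enum n x0 k)) (%k. tidx n x0 (tail_tl (tail_enum n x0 k))) (tail_c x0 ga)"
proof -
 have W: "map x0 [0..<m] : wd" for m using x0 by (auto simp: wd_def)
 interpret perm_sys n "%i k. tidx n x0 (tail_s x0 i (tail_enum n x0 k))" "%k. tail_hd x0 (tail_enum n x0 k)"
  "%k. tidx n x0 (tail_tl (tail_enum n x0 k))" by (rule tail_perm_sys[OF x0])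
 show ?thesis
 proof unfold_locales
  fix k
  obtain u m where um: "tail_enum n x0 k = (u, m)" by (cases "tail_enum n x0 k")
  have "u : wd" using tail_enum_in[of x0 n k, OF x0] um by (auto simp: tail_set_def wd_def)
  hence "om u \<diamond> (%t. cnj (om (map x0 [0..<m]) t)) \<diamond> ga : dual" by (intro dual_mult om_dual dual_cnj W g)
  moreover have "tail_c x0 ga k = om u \<diamond> (%t. cnj (om (map x0 [0..<m]) t)) \<diamond> ga"
   by (simp add: tail_c_def um fun_eq_iff mult.assoc)
  ultimately show "tail_c x0 ga k : dual" by simp
 next
  fix i k t assume i: "i : {1..n}"
  obtain u m where um: "tail_enum n x0 k = (u, m)" by (cases "tail_enum n x0 k")
  have "tail_s x0 i (u, m) : tail_set n x0" using tail_closed(1)[of x0 n, OF x0 tail_enum_in[of x0 n k, OF x0] i] um by simp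
  hence idx: "tail_enum n x0 (tidx n x0 (tail_s x0 i (tail_enum n x0 k))) = tail_s x0 i (u, m)"
   unfolding um by (rule tail_enum_idx[of x0 n, OF x0])
  show "tail_c x0 ga (tidx n x0 (tail_s x0 i (tail_enum n x0 k))) t = og i t * tail_c x0 ga k t"
  proof (cases "u = [] & m > 0 & i = x0 (m - 1)")
   case True
   then obtain m' where m': "m = Suc m'" "i = x0 m'" by (cases m) auto
   have "og i t * cnj (og i t) = 1" by (rule dual_cancel(1)[OF dual[OF i]])
   hence "cnj (om (map x0 [0..<m']) t) = og i t * cnj (om (map x0 [0..<m]) t)"
    by (simp add: m'(1) om_append m'(2)[symmetric] mult_ac)
   thus ?thesis using True unfolding tail_c_def idx unfolding um by (simp add: tail_s_def m'(1) mult.assoc)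
  next
   case False
   thus ?thesis unfolding tail_c_def idx unfolding um by (auto simp: tail_s_def mult.assoc)
  qed
 qed
qed

lemma tail_c_base: assumes x0: "!!k. x0 k : {1..n}" shows "tail_c x0 ga (tidx n x0 ([], 0)) = ga"
proof -
 have "([], 0) : tail_set n x0" by (simp add: tail_set_def)
 thus ?thesis by (simp add: tail_c_def tail_enum_idx[of x0 n, OF x0] fun_eq_iff)
qed

end

context simple_crossed_product
begin

lemma one_le_n: "1 : {1..n}" using n2 by simp

text \<open>Every \<open>ga\<close> in the dual group occurs in some representation, namely as the
  base character of an itinerary, and \<open>spectrum_eq\<close> transfers this to the given
  one.\<close>

lemma FC_sup: assumes C: "covariant mu n og A S al s hdn tln c" and w: "w : FC" and e: "0 < ep" and g: "ga : dual"
 shows "EX x. cmod (w ga) - ep < cmod (w (c x))"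
 using spectrum_eq[OF C tail_covariant[of "%_. 1", OF one_le_n g] w e, of "tidx n (%_. 1) ([], 0)"]
 by (simp only: tail_c_base[of "%_. 1", OF one_le_n])

text \<open>Comparison of the constant itinerary \<open>i\<close> started at \<open>ga'\<close> with
  a representation in which \<open>ga\<close> occurs. Words together with inverse powers of
  \<open>og i\<close> reach every character approximately; recurrence later removes the inverse
  powers.\<close>

lemma FC_orbit: assumes i: "i : {1..n}" and w: "w : FC" and e: "0 < ep" and g: "ga : dual" "ga' : dual"
 shows "EX u:wd. EX m. cmod (w ga) - ep < cmod (w (om u \<diamond> (%t. cnj (og i t) ^ m * ga' t)))"
proof -
 obtain x where x: "cmod (w ga) - ep < cmod (w (tail_c (%_. i) ga' x))"
  using FC_sup[OF tail_covariant[of "%_. i", OF i g(2)] w e g(1)] by blast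
 obtain u m where um: "tail_enum n (%_. i) x = (u, m)" by (cases "tail_enum n (%_. i) x")
 have "u : wd" using tail_enum_in[of "%_. i" n x, OF i] um by (auto simp: tail_set_def wd_def)
 moreover have "om (map (%_. i) [0..<m]) t = og i t ^ m" for t by (induction m) (simp_all add: om_append)
 hence "tail_c (%_. i) ga' x = om u \<diamond> (%t. cnj (og i t) ^ m * ga' t)"
  by (simp add: tail_c_def um fun_eq_iff mult.assoc)
 ultimately show ?thesis using x by auto
qed

end

section \<open>Dickson's lemma and the dichotomy\<close>

lemma nat_subseq_mono:
 fixes s :: "nat => nat" shows "EX r :: nat => nat. strict_mono r & (ALL p q. p <= q --> s (r p) <= s (r q))"
proof -
 \<comment> \<open>A minimum of \<open>s\<close> beyond \<open>x\<close> is attained, and no later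
   value is smaller; iterating this gives a nondecreasing subsequence.\<close>
 have ex: "EX y>x. ALL z>=y. s y <= s z" for x
 proof -
  define y where "y = arg_min s (%y. x < y)"
  have "x < y" "!!z. x < z ==> s y <= s z" using arg_min_nat_lemma[of "%y. x < y" "Suc x" s] by (simp_all add: y_def)
  thus ?thesis by (meson less_le_trans)
 qed
 have "EX r. ALL k. (ALL z>=r k. s (r k) <= s z) & r k < r (Suc k)" by (rule dependent_nat_choice) (use ex in blast)+
 then obtain r where r: "!!k z. r k <= z ==> s (r k) <= s z" "!!k. r k < r (Suc k)" by blast
 have "strict_mono r" using r(2) by (simp add: strict_mono_Suc_iff)
 thus ?thesis using r(1) by (intro exI[of _ r]) (simp add: strict_mono_less_eq)
qed

lemma Dickson:
 fixes f :: "nat => 'l => nat" assumes "finite L"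
 shows "EX r :: nat => nat. strict_mono r & (ALL l:L. ALL p q. p <= q --> f (r p) l <= f (r q) l)" using assms
proof (induction L rule: finite_induct)
 case empty
 show ?case by (rule exI[of _ id]) (simp add: strict_mono_def)
next
 case (insert l L)
 then obtain r :: "nat => nat" where r: "strict_mono r" "!!l p q. l : L ==> p <= q ==> f (r p) l <= f (r q) l" by blast
 obtain r' :: "nat => nat" where r': "strict_mono r'" "!!p q. p <= q ==> f (r (r' p)) l <= f (r (r' q)) l"
  using nat_subseq_mono[of "%k. f (r k) l"] by blast
 show ?case
 proof (intro exI[of _ "%k. r (r' k)"] conjI ballI allI impI)
  show "strict_mono (%k. r (r' k))" using r(1) r'(1) by (simp add: strict_mono_def)
  fix l' p q assume "l' : insert l L" and pq: "(p :: nat) <= q"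
  then consider "l' = l" | "l' : L" by blast
  thus "f (r (r' p)) l' <= f (r (r' q)) l'" by cases (use r'(2)[OF pq] r(2) strict_mono_less_eq[OF r'(1)] pq in auto)
 qed
qed

lemma replicate_marker_neq: assumes "i ~= i'" "j ~= k" shows "replicate j i @ i' # x ~= replicate k i @ i' # y"
proof -
 have "replicate j i @ i' # x ~= replicate k i @ i' # y" if "j < k" for j k x y
 proof
  assume "replicate j i @ i' # x = replicate k i @ i' # y"
  hence "(replicate j i @ i' # x) ! j = (replicate k i @ i' # y) ! j" by simp
  thus False using that assms(1) by (simp add: nth_append)
 qed
 from this[of j k x y] this[of k j y x] show ?thesis using assms(2) by (metis linorder_neqE_nat)
qed

context quasi_free
begin

text \<open>The inverse of \<open>og i\<close> is a limit of characters of words, uniformly on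
  compact sets: the effect of the letter \<open>i\<close> can be undone by further letters.\<close>

definition recurrent :: "nat => bool"
 where "recurrent i \<longleftrightarrow> (ALL K de. compact K & 0 < de --> (EX rh:wd. ALL t:K. cmod (og i t * om rh t - 1) < de))"

lemma om_mset: "om u t = prod_mset (image_mset (%i. og i t) (mset u))"
 by (simp add: om_def prod_mset_prod_list flip: mset_map)

text \<open>Infinitely many words share a colour, so their characters are close on \<open>K\<close>,
  and their lengths are unbounded. Dickson's lemma on the letter counts yields two of them with one
  multiset of letters strictly inside the other. The character depends only on the multiset, so the
  nonempty difference is a word \<open>i # rh\<close> with character close to 1.\<close>

lemma close_words: assumes Y: "equi Y" and inf: "infinite {u : wd. om u : Y}" and K: "compact K" and d: "0 < de"
 shows "EX i:{1..n}. EX rh:wd. ALL t:K. cmod (og i t * om rh t - 1) < de"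
proof -
 obtain col :: "('g => complex) => 'g => int \<times> int" where fin: "finite (col ` Y)"
  and col: "ALL ga:Y. ALL ga':Y. col ga = col ga' --> (ALL t:K. cmod (ga t - ga' t) < de)"
  using equi_cover[OF Y K d] by blast
 have "finite ((%u. col (om u)) ` {u : wd. om u : Y})" by (rule finite_subset[OF _ fin]) auto
 from pigeonhole_infinite[OF inf this] obtain u0 where
  u0: "infinite {a : {u : wd. om u : Y}. col (om a) = col (om u0)}" by blast
 let ?X = "{a : {u : wd. om u : Y}. col (om a) = col (om u0)}"
 have long: "EX v:?X. N < length v" for N
 proof (rule ccontr)
  assume "~ ?thesis"
  hence "?X \<subseteq> {u. set u \<subseteq> {1..n} & length u <= N}" by (auto simp: wd_def not_less)
  thus False using u0 finite_lists_length_le[of "{1..n}" N] finite_subset by auto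
 qed
 have "EX U. ALL k. U k : ?X & length (U k) < length (U (Suc k))"
  by (rule dependent_nat_choice) (use long[of 0] long in blast)+
 then obtain U where U: "!!k. U k : ?X" "!!k. length (U k) < length (U (Suc k))" by blast
 obtain r :: "nat => nat" where r: "strict_mono r" "!!l p q. l : {1..n} ==> p <= q ==> count (mset (U (r p))) l <= count (mset (U (r q))) l"
  using Dickson[of "{1..n}" "%k. count (mset (U k))"] by auto
 define u v where "u = U (r 0)" and "v = U (r 1)"
 have sm: "strict_mono (%k. length (U k))" using U(2) by (simp add: strict_mono_Suc_iff)
 have len: "length u < length v"
  unfolding u_def v_def using strict_monoD[OF sm, of "r 0" "r 1"] strict_monoD[OF r(1), of 0 1] by simp
 have w: "u : wd" "v : wd" "om u : Y" "om v : Y" "col (om v) = col (om u)"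
  using U(1)[of "r 0"] U(1)[of "r 1"] by (auto simp: u_def v_def)
 have sub: "mset u \<subseteq># mset v"
 proof (rule mset_subset_eqI)
  fix l
  show "count (mset u) l <= count (mset v) l"
  proof (cases "l : {1..n}")
   case True
   thus ?thesis unfolding u_def v_def by (intro r(2)) simp_all
  next
   case False
   hence "l ~: set u" using w(1) by (auto simp: wd_def)
   thus ?thesis by (simp add: count_mset count_list_0_iff)
  qed
 qed
 obtain k where k: "mset k = mset v - mset u" using ex_mset by blast
 have mv: "mset v = mset u + mset k" using sub k by simp
 have "length v = length u + length k" using arg_cong[OF mv, of size] by simp
 then obtain i rh where irh: "k = i # rh" using len by (cases k) auto
 have "set k \<subseteq> set v" using arg_cong[OF mv, of set_mset] by auto
 hence kw: "i : {1..n}" "rh : wd" using w(2) by (auto simp: wd_def irh)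
 have "cmod (og i t * om rh t - 1) < de" if t: "t : K" for t
 proof -
  have "om v t = om u t * (og i t * om rh t)" unfolding om_mset mv irh by (simp add: om_mset)
  hence "cmod (om v t - om u t) = cmod (om u t * (og i t * om rh t - 1))" by (simp add: right_diff_distrib)
  also have "... = cmod (og i t * om rh t - 1)" by (simp add: norm_mult dualD(2)[OF om_dual[OF w(1)]])
  finally show ?thesis using col w t by fastforce
 qed
 thus ?thesis using kw by blast
qed

lemma dichotomy: assumes Y: "equi Y" and inf: "infinite {u : wd. om u : Y}" shows "EX i:{1..n}. recurrent i"
proof (rule ccontr)
 assume "~ ?thesis"
 hence "ALL i:{1..n}. EX K de. compact K & 0 < de & ~ (EX rh:wd. ALL t:K. cmod (og i t * om rh t - 1) < de)"
  unfolding recurrent_def by blast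
 then obtain K de where K: "!!i. i : {1..n} ==> compact (K i)" "!!i. i : {1..n} ==> 0 < de i"
  "!!i. i : {1..n} ==> ~ (EX rh:wd. ALL t:K i. cmod (og i t * om rh t - 1) < de i)" by metis
 \<comment> \<open>The letter found by \<open>close_words\<close> depends on \<open>K\<close> and
   \<open>de\<close>. Failing pairs for the single letters are therefore merged, by a union of
   compact sets and a minimum, so that one application contradicts them all.\<close>
 define d where "d = Min (de ` {1..n})"
 have ne: "{1..n} ~= {}" using n2 by auto
 have d: "0 < d" "!!i. i : {1..n} ==> d <= de i" using K(2) ne by (auto simp: d_def)
 have "compact (\<Union>i\<in>{1..n}. K i)" using K(1) by (intro compact_UN) auto
 from close_words[OF Y inf this d(1)] obtain i rh where i: "i : {1..n}" and rh: "rh : wd"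
  and cl: "ALL t:(\<Union>i\<in>{1..n}. K i). cmod (og i t * om rh t - 1) < d" by blast
 have "cmod (og i t * om rh t - 1) < de i" if "t : K i" for t using cl that i d(2)[OF i] by (meson UN_I less_le_trans)
 thus False using K(3)[OF i] rh by blast
qed

lemma om_replicate: "om (replicate m i) t = og i t ^ m" by (induction m) simp_all

lemma om_concat_replicate: "om (concat (replicate m rh)) t = om rh t ^ m" by (induction m) (simp_all add: om_append)

lemma wd_replicate: "i : {1..n} ==> replicate m i : wd" "rh : wd ==> concat (replicate m rh) : wd" by (induction m) simp_all

end

definition incomparable :: "'l list => 'l list => bool"
 where "incomparable u v \<longleftrightarrow> (\<nexists>k. v = u @ k) & (\<nexists>k. u = v @ k)"

section \<open>Words that move characters to given places\<close>

context simple_crossed_product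
begin

lemma power_close: assumes i: "i : {1..n}" and rh: "rh : wd"
  and cl: "cmod (og i t * om rh t - 1) < de / (real N + 1)" and m: "m <= N" shows "cmod ((og i t * om rh t) ^ m - 1) < de"
proof -
 have n1: "cmod (og i t * om rh t) = 1" by (simp add: norm_mult dualD(2)[OF om_dual[OF rh]] dualD(2)[OF dual[OF i]])
 have "cmod ((og i t * om rh t) ^ m - 1 ^ m) <= m * cmod (og i t * om rh t - 1)" by (rule norm_power_diff) (simp_all add: n1)
 also have "... <= N * cmod (og i t * om rh t - 1)" using m by (intro mult_right_mono) auto
 also have "... <= (real N + 1) * cmod (og i t * om rh t - 1)" by (intro mult_right_mono) auto
 also have "... < (real N + 1) * (de / (real N + 1))" using cl by (intro mult_strict_left_mono) auto
 finally show ?thesis by simp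
qed

text \<open>\<open>FC_orbit\<close> reaches \<open>r ga1\<close> up to a quarter with
  \<open>m\<close> inverse letters; each of these is replaced by the word \<open>rh\<close>, which
  costs another quarter in total. Since \<open>m\<close> is known before \<open>rh\<close> is
  chosen, the error of the \<open>m\<close>-th power is under control.\<close>

lemma hit_word: assumes i: "i : {1..n}" "recurrent i" and r: "(%ga. cre (r ga)) : FC" "!!ga. 0 <= r ga"
  and g1: "ga1 : dual" "0 < r ga1" and g: "ga : dual" shows "EX u:wd. r ga1 / 2 < r (om u \<diamond> ga)"
proof -
 let ?M = "r ga1"
 have e: "0 < ?M / 4" using g1 by simp
 obtain K de where K: "compact K" "0 < de" and un: "ALL ga:dual. ALL ga':dual.
  (ALL t:K. cmod (ga t - ga' t) < de) --> cmod (cre (r ga) - cre (r ga')) < ?M / 4" using FC_uniform[OF r(1) e] by blast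
 obtain u m where u: "u : wd" and um: "?M - ?M / 4 < r (om u \<diamond> (%t. cnj (og i t) ^ m * ga t))"
  using FC_orbit[OF i(1) r(1) e g1(1) g] r(2) by auto
 obtain rh where rh: "rh : wd" "ALL t:K. cmod (og i t * om rh t - 1) < de / (real m + 1)"
  using i(2) K unfolding recurrent_def by (meson divide_pos_pos of_nat_0_le_iff add_nonneg_pos zero_less_one)
 define v where "v = u @ concat (replicate m rh)"
 have v: "v : wd" using u rh by (simp add: v_def wd_replicate)
 have cm: "(%t. cnj (og i t) ^ m) : dual" by (induction m) (simp_all add: dual_one dual_mult dual_cnj dual[OF i(1)])
 have "cmod ((om v \<diamond> ga) t - (om u \<diamond> (%t. cnj (og i t) ^ m * ga t)) t) < de" if t: "t : K" for t
 proof -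
  have "cnj (og i t) * og i t = 1" by (rule dual_cancel(2)[OF dual[OF i(1)]])
  hence "om rh t ^ m = cnj (og i t) ^ m * (og i t * om rh t) ^ m" by (simp flip: power_mult_distrib mult.assoc)
  hence "(om v \<diamond> ga) t - (om u \<diamond> (%t. cnj (og i t) ^ m * ga t)) t
    = (om u t * ga t * cnj (og i t) ^ m) * ((og i t * om rh t) ^ m - 1)"
   by (simp add: v_def om_append om_concat_replicate algebra_simps)
  hence "cmod ((om v \<diamond> ga) t - (om u \<diamond> (%t. cnj (og i t) ^ m * ga t)) t)
    = cmod ((og i t * om rh t) ^ m - 1)"
   by (simp add: norm_mult norm_power dualD(2)[OF om_dual[OF u]] dualD(2)[OF dual[OF i(1)]] dualD(2)[OF g])
  thus ?thesis using power_close[OF i(1) rh(1) bspec[OF rh(2) t] order_refl] by simp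
 qed
 hence "cmod (cre (r (om v \<diamond> ga)) - cre (r (om u \<diamond> (%t. cnj (og i t) ^ m * ga t)))) < ?M / 4"
  by (rule un[rule_format, OF om_translate[OF v g] om_translate[OF u dual_mult[OF cm g]]])
 hence "\<bar>r (om v \<diamond> ga) - r (om u \<diamond> (%t. cnj (og i t) ^ m * ga t))\<bar> < ?M / 4"
  by (simp flip: of_real_diff)
 thus ?thesis using um v by (intro bexI[of _ v]) linarith+
qed

text \<open>The prefixes \<open>i\<^sup>ji'\<close> make the words incomparable, and the suffixes \<open>rh\<^sup>j\<close> undo the effect of \<open>i\<^sup>j\<close>.\<close>

lemma hit_words: assumes i: "i : {1..n}" "recurrent i" and r: "(%ga. cre (r ga)) : FC" "!!ga. 0 <= r ga"
  and g1: "ga1 : dual" "0 < r ga1" and Y: "equi Y"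
 shows "EX (J :: nat) lam ze et. 0 < et & ze : wd & (ALL j<J. lam j : wd & incomparable (lam j) ze) &
  (ALL j<J. ALL k<J. j ~= k --> incomparable (lam j) (lam k)) & (ALL ga:Y. EX j<J. et <= r (om (lam j) \<diamond> ga))"
proof -
 let ?M = "r ga1"
 have e: "0 < ?M / 8" using g1 by simp
 obtain K de where K: "compact K" "0 < de" and un0: "ALL ga:dual. ALL ga':dual.
  (ALL t:K. cmod (ga t - ga' t) < de) --> cmod (cre (r ga) - cre (r ga')) < ?M / 8" using FC_uniform[OF r(1) e] by blast
 have un: "\<bar>r ga - r ga'\<bar> < ?M / 8"
  if "ga : dual" "ga' : dual" "!!t. t : K ==> cmod (ga t - ga' t) < de" for ga ga'
 proof -
  have "cmod (cre (r ga) - cre (r ga')) < ?M / 8" using un0 that by blast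
  thus ?thesis by (simp flip: of_real_diff)
 qed
 have YD: "ga : dual" if "ga : Y" for ga using that Y by (auto simp: equi_def)
 \<comment> \<open>A second letter exists as \<open>n >= 2\<close>; it ends the run of
   \<open>i\<close> and thus marks its length.\<close>
 obtain i' where i': "i' : {1..n}" "i' ~= i"
  using n2 by (metis atLeastAtMost_iff le_numeral_extra(4) one_le_numeral order_trans numeral_eq_one_iff semiring_norm(85))
 have d': "og i' \<diamond> ga : dual" if "ga : dual" for ga by (rule dual_mult[OF dual[OF i'(1)] that])
 obtain col :: "('g => complex) => 'g => int \<times> int" where fin: "finite (col ` Y)"
  and col: "ALL ga:Y. ALL ga':Y. col ga = col ga' --> (ALL t:K. cmod (ga t - ga' t) < de)" using equi_cover[OF Y K] by blast
 obtain f and J :: nat where f: "col ` Y = f ` {i. i < J}" using finite_imp_nat_seg_image_inj_on[OF fin] by blast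
 have "ALL j. j < J --> (EX ga. ga : Y & col ga = f j)" using f by (metis (mono_tags, lifting) imageE image_eqI mem_Collect_eq)
 then obtain gar where gar: "!!j. j < J ==> gar j : Y" "!!j. j < J ==> col (gar j) = f j" by metis
 \<comment> \<open>One word per colour suffices: it is chosen for the representative
   \<open>gar j\<close>, already moved by the marker letter \<open>i'\<close>, and serves all
   characters of that colour up to \<open>?M / 8\<close>.\<close>
 have "ALL j. j < J --> (EX u. u : wd & ?M / 2 < r (om u \<diamond> og i' \<diamond> gar j))"
  using hit_word[OF i r g1 d'] YD gar(1) by blast
 then obtain u where u: "!!j. j < J ==> u j : wd" "!!j. j < J ==> ?M / 2 < r (om (u j) \<diamond> og i' \<diamond> gar j)" by metis
 have "0 < de / (real J + 1)" using K by simp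
 then obtain rh where rh: "rh : wd" "ALL t:K. cmod (og i t * om rh t - 1) < de / (real J + 1)"
  using i(2) K(1) unfolding recurrent_def by blast
 define lam where "lam j = replicate j i @ i' # u j @ concat (replicate j rh)" for j
 \<comment> \<open>One more word, with a run of length \<open>J\<close>, so that it is incomparable
   with all \<open>lam j\<close>. It later provides the part of the space that an isometry
   misses.\<close>
 define ze where "ze = replicate J i @ i' # []"
 have lw: "lam j : wd" if "j < J" for j using u(1)[OF that] rh i i' by (simp add: lam_def wd_replicate)
 have inc: "incomparable (replicate j i @ i' # x) (replicate k i @ i' # y)" if "j ~= k" for j k x y
  using replicate_marker_neq[OF i'(2)[symmetric] that] replicate_marker_neq[OF i'(2)[symmetric] that[symmetric]]
  by (auto simp: incomparable_def)
 have "EX j<J. ?M / 4 <= r (om (lam j) \<diamond> ga)" if g: "ga : Y" for ga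
 proof -
  obtain j where j: "j < J" "col ga = f j" using f g by (metis (mono_tags, lifting) imageE image_eqI mem_Collect_eq)
  have uD: "om (u j) \<diamond> og i' \<diamond> ga' : dual" if "ga' : Y" for ga'
   by (rule om_translate[OF u(1)[OF j(1)] d'[OF YD[OF that]]])
  have 1: "\<bar>r (om (u j) \<diamond> og i' \<diamond> ga) - r (om (u j) \<diamond> og i' \<diamond> gar j)\<bar> < ?M / 8"
  proof (rule un[OF uD[OF g] uD[OF gar(1)[OF j(1)]]])
   fix t assume t: "t : K"
   have "(om (u j) \<diamond> og i' \<diamond> ga) t - (om (u j) \<diamond> og i' \<diamond> gar j) t = om (u j) t * og i' t * (ga t - gar j t)"
    by (simp add: algebra_simps)
   hence "cmod ((om (u j) \<diamond> og i' \<diamond> ga) t - (om (u j) \<diamond> og i' \<diamond> gar j) t) = cmod (ga t - gar j t)"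
    by (simp add: norm_mult dualD(2)[OF om_dual[OF u(1)[OF j(1)]]] dualD(2)[OF dual[OF i'(1)]])
   thus "cmod ((om (u j) \<diamond> og i' \<diamond> ga) t - (om (u j) \<diamond> og i' \<diamond> gar j) t) < de"
    using col g gar(1)[OF j(1)] gar(2)[OF j(1)] j(2) t by metis
  qed
  have 2: "\<bar>r (om (lam j) \<diamond> ga) - r (om (u j) \<diamond> og i' \<diamond> ga)\<bar> < ?M / 8"
  proof (rule un[OF om_translate[OF lw[OF j(1)] YD[OF g]] uD[OF g]])
   fix t assume t: "t : K"
   have "(om (lam j) \<diamond> ga) t - (om (u j) \<diamond> og i' \<diamond> ga) t
     = om (u j) t * og i' t * ga t * ((og i t * om rh t) ^ j - 1)"
    by (simp add: lam_def om_append om_replicate om_concat_replicate power_mult_distrib algebra_simps)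
   hence "cmod ((om (lam j) \<diamond> ga) t - (om (u j) \<diamond> og i' \<diamond> ga) t) = cmod ((og i t * om rh t) ^ j - 1)"
    by (simp add: norm_mult dualD(2)[OF om_dual[OF u(1)[OF j(1)]]] dualD(2)[OF dual[OF i'(1)]]
      dualD(2)[OF YD[OF g]])
   thus "cmod ((om (lam j) \<diamond> ga) t - (om (u j) \<diamond> og i' \<diamond> ga) t) < de"
    using power_close[OF i(1) rh(1) bspec[OF rh(2) t], of j] j(1) by simp
  qed
  show ?thesis using 1 2 u(2)[OF j(1)] by (intro exI[of _ j] conjI j(1)) linarith
 qed
 moreover have "ze : wd" using i i' by (simp add: ze_def wd_replicate)
 moreover have "incomparable (lam j) ze" if "j < J" for j unfolding lam_def ze_def using that by (intro inc) simp
 moreover have "incomparable (lam j) (lam k)" if "j ~= k" for j k unfolding lam_def using that by (rule inc)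
 ultimately show ?thesis using lw g1(2) by (intro exI[of _ J] exI[of _ lam] exI[of _ ze] exI[of _ "?M / 4"]) simp
qed

end

text \<open>With \<open>s\<close> in the role of \<open>1 - sqrt (1 - d)\<close>, from
  \<open>root_exists\<close>, \<open>p - d\<close> equals \<open>(1 - s) p (1 - s)\<close>, and
  \<open>1 - s\<close> is inverted by a Neumann series. The inverse \<open>I\<close> may lie outside
  \<open>C\<close> when \<open>C\<close> has no unit, so only products \<open>x * I\<close> are
  claimed to be in \<open>C\<close>.\<close>

lemma polar_correction: assumes C: "star_sub C" "closed C" and d: "d : C" "adj d = d" "norm d <= 1/2"
  and p: "p : C" "p * d = d" "d * p = d" shows "EX I. adj I * (p - d) * I = p & (ALL x:C. x * I : C)"
proof -
 interpret O: cstar_algebra "opalg id C" by (rule opalg_cstar[OF inj_id_op C])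
 note sel0 = opalg_sel[OF inj_id_op C(1)] and cs = star_subD[OF C(1)]
 have sel: "carrier (opalg id C) = C" "x \<otimes>\<^bsub>opalg id C\<^esub> y = x * y" "x \<oplus>\<^bsub>opalg id C\<^esub> y = x + y"
  "a \<odot>\<^bsub>opalg id C\<^esub> x = opsc a x" "star (opalg id C) x = adj x" "nrm (opalg id C) x = norm x" for a x y
  using sel0(1) sel0(4,5)[of x y] sel0(6)[of a x] sel0(7,8)[of x] by simp_all
 have "EX s:carrier (opalg id C). star (opalg id C) s = s & nrm (opalg id C) s <= 1/2 &
  2 \<odot>\<^bsub>opalg id C\<^esub> s = d \<oplus>\<^bsub>opalg id C\<^esub> s \<otimes>\<^bsub>opalg id C\<^esub> s &
  (ALL a:carrier (opalg id C). a \<otimes>\<^bsub>opalg id C\<^esub> d = d \<otimes>\<^bsub>opalg id C\<^esub> a --> a \<otimes>\<^bsub>opalg id C\<^esub> s = s \<otimes>\<^bsub>opalg id C\<^esub> a)"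
  by (rule O.root_exists) (unfold sel, use d in simp_all)
 then obtain s where s: "s : C" "adj s = s" "norm s <= 1/2" "opsc 2 s = d + s * s"
  and com: "ALL a:C. a * d = d * a --> a * s = s * a" unfolding sel by blast
 have ps: "p * s = s * p" using com p by simp
 have two: "opsc 2 s = s + s" using opsc_simps(2)[of 1 1 s] by (simp add: opsc_simps)
 have sq: "(1 - s) * (1 - s) = 1 - d" using s(4) unfolding two by (simp add: algebra_simps eq_diff_eq)
 have np: "norm (s ^ k) <= (1/2) ^ k" for k using order_trans[OF norm_power_ineq power_mono[OF s(3)]] by simp
 have sm: "summable (%k. s ^ k)"
  by (rule summable_comparison_test'[OF summable_geometric[of "1/2 :: real"]]) (use np in auto)
 define I where "I = (\<Sum>k. s ^ k)"
 have "I = 1 + s * I" unfolding I_def using suminf_split_head[OF sm] suminf_mult[OF sm, of s] by (simp add: algebra_simps)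
 hence 1: "(1 - s) * I = 1" by (simp add: algebra_simps)
 hence "adj ((1 - s) * I) = adj 1" by (simp only:)
 hence 2: "adj I * (1 - s) = 1" by (simp add: s(2))
 have "p - d = p * (1 - d)" using p by (simp add: algebra_simps)
 also have "... = (1 - s) * p * (1 - s)" proof -
  have "p * (1 - s) = (1 - s) * p" using ps by (simp add: algebra_simps)
  thus ?thesis unfolding sq[symmetric] by (simp flip: mult.assoc)
 qed
 finally have "adj I * (p - d) * I = (adj I * (1 - s)) * p * ((1 - s) * I)" by (simp only: mult.assoc)
 hence "adj I * (p - d) * I = p" using 1 2 by simp
 moreover have "x * I : C" if x: "x : C" for x
 proof -
  have "x * s ^ k : C" for k
  proof (induction k)
   case (Suc k)
   have "x * s ^ Suc k = x * s ^ k * s" by (simp add: power_commutes mult.assoc)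
   thus ?case using Suc cs(4) s(1) by simp
  qed (simp add: x)
  hence "x * (\<Sum>k<N. s ^ k) : C" for N by (induction N) (simp_all add: cs distrib_left)
  moreover have "(%N. x * (\<Sum>k<N. s ^ k)) ~~> x * I"
   unfolding I_def by (intro tendsto_mult tendsto_const summable_LIMSEQ sm)
  ultimately show ?thesis by (rule closed_sequentially[OF C(2)])
 qed
 ultimately show ?thesis by blast
qed

lemma norm_projection: "adj p = p ==> p * p = p ==> norm p <= 1"
proof -
 assume "adj p = p" "p * p = p"
 hence "norm p = (norm p)^2" using op_cstar[of p] by simp
 hence "norm p = 0 | norm p = 1" by (simp add: power2_eq_square)
 thus ?thesis by auto
qed

lemma norm_mult3: "norm a <= x ==> norm b <= y ==> norm c <= z ==> norm (a * b * (c :: op)) <= x * y * z"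
proof -
 assume h: "norm a <= x" "norm b <= y" "norm c <= z"
 hence nn: "0 <= x" "0 <= y" by (auto intro: order_trans[OF norm_ge_zero])
 have "norm (a * b * c) <= norm a * norm b * norm c"
  by (intro order_trans[OF norm_mult_ineq] mult_right_mono norm_mult_ineq) simp
 also have "... <= x * y * z" using h nn by (intro mult_mono) auto
 finally show ?thesis .
qed

section \<open>Local units and compression to multipliers\<close>

context quasi_free
begin

abbreviation "rFC r \<equiv> (%ga. cre (r ga)) : FC"

lemma rFC_calculus: assumes "rFC r" "cts f" "f 0 = 0" shows "rFC (%ga. f (r ga))" using FC_calculus[OF assms] by simp

lemma rFC_mult: "rFC r ==> rFC q ==> rFC (%ga. r ga * q ga)" using FC_mult by simp

lemma rFC_add: "rFC r ==> rFC q ==> rFC (%ga. r ga + q ga)" using FC_add by simp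

lemma rFC_scale: "rFC r ==> rFC (%ga. a * r ga)" using FC_scale by simp

lemma rFC_sum: "finite I ==> (!!i. i : I ==> rFC (r i)) ==> rFC (%ga. \<Sum>i\<in>I. r i ga)"
 by (induction I rule: finite_induct) (simp_all add: FC_zero FC_add)

lemma rFC_norm: "w : FC ==> rFC (%ga. (cmod (w ga))^2)"
 using FC_mult[OF _ FC_cnj, of w w] by (simp flip: complex_norm_square)

lemma rFC_support: "rFC r ==> 0 < ep ==> equi {ga : dual. ep < r ga}" by (rule equi_subset[OF FC_support]) auto

end

context covariant
begin

abbreviation "Dr r \<equiv> Dg (%ga. cre (r ga))"
abbreviation "BB \<equiv> closure (alg0 FC)"

lemmas BB = star_subD[OF star_sub_closure[OF alg0_FC]]

lemma alg0_BB: "x : alg0 FC ==> x : BB" using closure_subset by blast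

lemma gen_BB: "w : FC ==> u : wd ==> v : wd ==> gen u w v : BB" by (rule alg0_BB[OF alg0_gen])

lemma adj_Dr: "bw (%ga. cre (r ga)) ==> adj (Dr r) = Dr r" by (simp add: adj_Dg)

text \<open>\<open>V\<close> collects the squared moduli of the symbols, each moved by the inverse
  of \<open>om u\<close> to the left end of its generator. Where \<open>V <= de\<close>, all these
  symbols are at most \<open>sqrt de\<close>, so a multiplier living there almost kills
  \<open>T\<close>.\<close>

lemma local_unit0: assumes "T : alg0 FC" shows "EX V N. rFC V & (ALL ga. 0 <= V ga) & 0 <= N & (ALL h de. bw h & 0 <= de &
  (ALL ga:dual. cmod (h ga) <= 1 & (de < V ga --> h ga = 0)) --> norm (Dg h * T) <= N * sqrt de)" using assms
proof (induction rule: alg0.induct)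
 case zero
 show ?case by (rule exI[of _ "%_. 0"], rule exI[of _ 0]) (simp add: FC_zero)
next
 case (step T w u v)
 from step.IH obtain V N where V0: "rFC V" "ALL ga. 0 <= V ga" "0 <= N" and N0: "ALL h de. bw h & 0 <= de &
  (ALL ga:dual. cmod (h ga) <= 1 & (de < V ga --> h ga = 0)) --> norm (Dg h * T) <= N * sqrt de" by (elim exE conjE)
 note V = V0(1) V0(2)[rule_format] V0(3)
 have N: "norm (Dg h * T) <= N * sqrt de" if "bw h" "0 <= de"
  "!!ga. ga : dual ==> cmod (h ga) <= 1 & (de < V ga --> h ga = 0)" for h de
  by (rule N0[rule_format]) (intro conjI ballI that)
 define w' where "w' ga = w ((%t. cnj (om u t)) \<diamond> ga)" for ga
 have w': "w' : FC" unfolding w'_def[abs_def] by (rule FC_translate[OF step(2) dual_cnj[OF om_dual[OF step(3)]]])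
 have w'u: "w' (om u \<diamond> ga) = w ga" for ga unfolding w'_def using om_cancel[OF step(3)] by simp
 define V' where "V' ga = (cmod (w' ga))^2 + V ga" for ga
 have "norm (Dg h * (gen u w v + T)) <= (1 + N) * sqrt de"
  if h: "bw h" "0 <= de" "!!ga. ga : dual ==> cmod (h ga) <= 1 & (de < V' ga --> h ga = 0)" for h de
 proof -
  have b: "bw w" by (rule bw_FC[OF step(2)])
  have "Dg h * gen u w v = Sw u * Dg (%ga. h (om u \<diamond> ga) * w ga) * adj (Sw v)"
   using Dg_Sw[OF h(1) step(3)] Dg_mult[OF bw_translate[OF h(1) step(3)] b] by (simp flip: mult.assoc)
  moreover have "norm (Sw u * Dg (%ga. h (om u \<diamond> ga) * w ga) * adj (Sw v)) <= 1 * sqrt de * 1"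
  proof (rule norm_mult3)
   show "norm (Dg (%ga. h (om u \<diamond> ga) * w ga)) <= sqrt de"
   proof (rule norm_Dg)
    fix ga :: "'g => complex" assume "ga : dual"
    hence hg: "cmod (h (om u \<diamond> ga)) <= 1" "de < V' (om u \<diamond> ga) --> h (om u \<diamond> ga) = 0"
     using h(3)[OF om_translate[OF step(3)]] by blast+
    show "cmod (h (om u \<diamond> ga) * w ga) <= sqrt de"
    proof (cases "de < V' (om u \<diamond> ga)")
     case False
     hence "(cmod (w ga))^2 <= de" using V(2)[of "om u \<diamond> ga"] by (simp add: V'_def w'u)
     hence "cmod (w ga) <= sqrt de" by (rule real_le_rsqrt)
     hence "cmod (h (om u \<diamond> ga)) * cmod (w ga) <= 1 * sqrt de" using hg(1) by (intro mult_mono) auto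
     thus ?thesis by (simp add: norm_mult)
    qed (use hg h(2) in simp)
   qed
  qed (simp_all add: norm_Sw step)
  moreover have "norm (Dg h * T) <= N * sqrt de"
  proof (rule N[OF h(1,2)])
   fix ga :: "'g => complex" assume g: "ga : dual"
   have "V ga <= V' ga" by (simp add: V'_def)
   thus "cmod (h ga) <= 1 & (de < V ga --> h ga = 0)" using h(3)[OF g] by auto
  qed
  ultimately have "norm (Dg h * gen u w v) + norm (Dg h * T) <= (1 + N) * sqrt de" by (simp add: distrib_right)
  thus ?thesis unfolding distrib_left by (rule order_trans[OF norm_triangle_ineq])
 qed
 moreover have "rFC V'" unfolding V'_def[abs_def] by (intro rFC_add rFC_norm w' V)
 ultimately show ?case using V by (intro exI[of _ V'] exI[of _ "1 + N"]) (auto simp: V'_def)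
qed

lemma local_unit: assumes T: "T : BB" and e: "0 < ep"
 shows "EX f. rFC f & (ALL ga. 0 <= f ga & f ga <= 1) & equi {ga : dual. f ga ~= 0} & norm (Dr f * T - T) < ep"
proof -
 obtain T0 where T0: "T0 : alg0 FC" "dist T0 T < ep / 4" using T e unfolding closure_approachable
  by (meson zero_less_divide_iff zero_less_numeral)
 from local_unit0[OF T0(1)] obtain V N where V0: "rFC V" "ALL ga. 0 <= V ga" "0 <= N" and N0: "ALL h de. bw h & 0 <= de &
  (ALL ga:dual. cmod (h ga) <= 1 & (de < V ga --> h ga = 0)) --> norm (Dg h * T0) <= N * sqrt de" by (elim exE conjE)
 note V = V0(1) V0(2)[rule_format] V0(3)
 have N: "norm (Dg h * T0) <= N * sqrt de" if "bw h" "0 <= de"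
  "!!ga. ga : dual ==> cmod (h ga) <= 1 & (de < V ga --> h ga = 0)" for h de
  by (rule N0[rule_format]) (intro conjI ballI that)
 \<comment> \<open>\<open>h = 1 - f\<close> vanishes where \<open>V > 2 * de\<close>, so the error
   on \<open>T0\<close> is at most \<open>N * sqrt (2 * de)\<close>; \<open>de\<close> is chosen to
   make this at most \<open>ep / 4\<close>.\<close>
 define de where "de = (ep / (4 * (N + 1)))^2 / 2"
 have d: "0 < de" using e V(3) by (simp add: de_def)
 have Nd: "N * sqrt (2 * de) <= ep / 4" using e V(3) by (simp add: de_def field_simps real_sqrt_divide)
 define f where "f ga = min 1 (max 0 (V ga / de - 1))" for ga
 have f01: "0 <= f ga" "f ga <= 1" for ga by (auto simp: f_def)
 have fF: "rFC f"
  unfolding f_def[abs_def] by (rule rFC_calculus[OF V(1), of "%t. min 1 (max 0 (t / de - 1))"]) (use d in \<open>auto intro!: continuous_intros\<close>)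
 have "equi {ga : dual. f ga ~= 0}"
  by (rule equi_subset[OF rFC_support[OF V(1) d]]) (use d in \<open>auto simp: f_def min_def max_def divide_simps split: if_splits\<close>)
 moreover have "norm (Dr f * T - T) < ep"
 proof -
  define h where "h ga = 1 - cre (f ga)" for ga
  have Dh: "Dg h = 1 - Dr f" unfolding h_def[abs_def] by (simp add: Dg_diff bw_const bw_FC fF Dg_const opsc_simps)
  have hb: "cmod (h ga) <= 1" for ga
  proof -
   have "h ga = cre (1 - f ga)" by (simp add: h_def)
   thus ?thesis using f01[of ga] by (simp only: norm_of_real)
  qed
  have "norm (Dg h * T0) <= N * sqrt (2 * de)"
  proof (rule N)
   show "bw h" unfolding bw_def using hb by blast
   show "cmod (h ga) <= 1 & (2 * de < V ga --> h ga = 0)" for ga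
   proof (intro conjI impI hb)
    assume "2 * de < V ga"
    hence "1 <= V ga / de - 1" using d by (simp add: field_simps)
    thus "h ga = 0" by (simp add: h_def f_def)
   qed
  qed (use d in simp)
  moreover have "norm (Dg h * (T - T0)) <= 1 * norm (T - T0)"
   by (intro order_trans[OF norm_mult_ineq] mult_right_mono norm_Dg hb) simp
  moreover have "Dr f * T - T = - (Dg h * T0 + Dg h * (T - T0))" by (simp add: Dh algebra_simps)
  hence "norm (Dr f * T - T) <= norm (Dg h * T0) + norm (Dg h * (T - T0))"
   by (simp only: norm_minus_cancel norm_triangle_ineq)
  ultimately show ?thesis using Nd T0(2) e by (simp add: dist_norm norm_minus_commute)
 qed
 ultimately show ?thesis using fF f01 by blast
qed

text \<open>Aperiodicity up to length \<open>L\<close>: different tails of \<open>xi\<close> have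
  orthogonal isometries, so compression by \<open>xi\<close> kills generators whose two words differ
  in length.\<close>

definition good :: "nat => nat list => bool" where "good L xi \<longleftrightarrow> xi : wd & L <= length xi &
  (ALL p<=L. ALL q<=L. p ~= q --> incomparable (drop p xi) (drop q xi))"

lemma good_mono: "good L xi ==> M <= L ==> good M xi" unfolding good_def by (meson le_trans)

lemma incomparable_orth: "u : wd ==> v : wd ==> incomparable u v ==> adj (Sw u) * Sw v = 0"
 unfolding incomparable_def by (rule Sw_orth) auto

lemma compress_Sw: assumes xi: "xi : wd" and u: "u : wd" "length u <= length xi"
 shows "adj (Sw xi) * Sw u = (if take (length u) xi = u then adj (Sw (drop (length u) xi)) else 0)"
proof (cases "take (length u) xi = u")
 case True
 hence "xi = u @ drop (length u) xi" by (metis append_take_drop_id)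
 hence "adj (Sw xi) = adj (Sw (drop (length u) xi)) * adj (Sw u)" using Sw_append[of u "drop (length u) xi"] by simp
 thus ?thesis using True by (simp add: adj_Sw_Sw[OF u(1)] mult.assoc)
next
 case False
 have "adj (Sw xi) * Sw u = 0"
 proof (rule Sw_orth[OF xi u(1)])
  show "\<nexists>k. u = xi @ k"
  proof
   assume "EX k. u = xi @ k"
   then obtain k where "u = xi @ k" by blast
   thus False using u(2) False by simp
  qed
  show "\<nexists>k. xi = u @ k" using False by auto
 qed
 thus ?thesis using False by simp
qed

lemma wd_drop: "xi : wd ==> drop k xi : wd" unfolding wd_def by (auto dest: in_set_dropD)

text \<open>Compression by \<open>xi\<close> reduces \<open>gen u w v\<close> to the tails of
  \<open>xi\<close> after \<open>u\<close> and after \<open>v\<close>. If the lengths agree, the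
  tails coincide and a multiplier remains; if not, the tails are orthogonal by aperiodicity. A
  conditional expectation onto multipliers is thus realized by an isometry.\<close>

lemma compress_alg0: assumes "T : alg0 FC" shows "EX L. ALL xi. good L xi --> (EX w:FC. adj (Sw xi) * T * Sw xi = Dg w)"
 using assms
proof (induction rule: alg0.induct)
 case zero
 have "Dg (%_. 0) = 0" by (simp add: Dg_const opsc_simps)
 thus ?case using FC_zero by force
next
 case (step T w u v)
 then obtain L where L: "!!xi. good L xi ==> EX w:FC. adj (Sw xi) * T * Sw xi = Dg w" by blast
 define M where "M = max L (max (length u) (length v))"
 have "EX w':FC. adj (Sw xi) * (gen u w v + T) * Sw xi = Dg w'" if g: "good M xi" for xi
 proof -
  have xi: "xi : wd" "length u <= length xi" "length v <= length xi" using g by (auto simp: good_def M_def)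
  obtain w1 where w1: "w1 : FC" "adj (Sw xi) * T * Sw xi = Dg w1" using L[OF good_mono[OF g]] by (auto simp: M_def)
  have "EX w2:FC. adj (Sw xi) * gen u w v * Sw xi = Dg w2"
  proof -
   have "adj (Sw v) * Sw xi = adj (adj (Sw xi) * Sw v)" by simp
   hence e: "adj (Sw xi) * gen u w v * Sw xi = (adj (Sw xi) * Sw u) * Dg w * adj (adj (Sw xi) * Sw v)"
    by (simp only: mult.assoc)
   have z: "EX w2:FC. (0 :: op) = Dg w2" using FC_zero by (intro bexI[of _ "%_. 0"]) (simp_all add: Dg_const opsc_simps)
   show ?thesis
   proof (cases "take (length u) xi = u & take (length v) xi = v")
    case False
    hence "adj (Sw xi) * gen u w v * Sw xi = 0"
     unfolding e using compress_Sw[OF xi(1) step(3) xi(2)] compress_Sw[OF xi(1) step(4) xi(3)] by auto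
    thus ?thesis using z by simp
   next
    case True
    define x y where "x = drop (length u) xi" and "y = drop (length v) xi"
    have xy: "x : wd" "y : wd" using xi by (auto simp: x_def y_def wd_drop)
    have "adj (Sw xi) * gen u w v * Sw xi = adj (Sw x) * (Dg w * Sw y)"
     unfolding e using True compress_Sw[OF xi(1) step(3) xi(2)] compress_Sw[OF xi(1) step(4) xi(3)]
     by (simp add: x_def y_def mult.assoc)
    also have "... = (adj (Sw x) * Sw y) * Dg (%ga. w (om y \<diamond> ga))"
     by (simp only: Dg_Sw[OF bw_FC[OF step(2)] xy(2)] mult.assoc)
    finally have f: "adj (Sw xi) * gen u w v * Sw xi = (adj (Sw x) * Sw y) * Dg (%ga. w (om y \<diamond> ga))" .
    show ?thesis
    proof (cases "length u = length v")
     case True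
     hence "x = y" by (simp add: x_def y_def)
     thus ?thesis unfolding f using FC_translate[OF step(2) om_dual[OF xy(2)]] adj_Sw_Sw[OF xy(2)] by auto
    next
     case False
     hence "incomparable x y" using g unfolding x_def y_def good_def M_def by simp
     thus ?thesis unfolding f using incomparable_orth[OF xy] z by simp
    qed
   qed
  qed
  then obtain w2 where w2: "w2 : FC" "adj (Sw xi) * gen u w v * Sw xi = Dg w2" by blast
  have "adj (Sw xi) * (gen u w v + T) * Sw xi = adj (Sw xi) * gen u w v * Sw xi + adj (Sw xi) * T * Sw xi"
   by (simp only: distrib_left distrib_right)
  also have "... = Dg (%ga. w2 ga + w1 ga)" by (simp only: w1 w2 Dg_add[OF bw_FC[OF w2(1)] bw_FC[OF w1(1)]])
  finally show ?thesis by (rule bexI[OF _ FC_add[OF w2(1) w1(1)]])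
 qed
 thus ?case by (intro exI[of _ M] allI impI)
qed

end

context covariant
begin

text \<open>The word \<open>xi\<close> is taken along the itinerary of \<open>x\<close>, so the
  diagonal entry of \<open>a\<close> at \<open>x\<close> reappears as a value of the resulting
  symbol and is not lost in the compression.\<close>

lemma compress: assumes a: "a : BB" and e: "0 < ep" and aper: "!!L x. EX xi x'. good L xi & x = sw xi x'"
 shows "EX xi:wd. EX w:FC. EX x'. norm (adj (Sw xi) * a * Sw xi - Dg w) <= ep &
  cmod (w (c x') - ip (app a (delta x)) (delta x)) <= ep"
proof -
 obtain T where T: "T : alg0 FC" "dist T a < ep" using a e unfolding closure_approachable by blast
 obtain L where L: "!!xi. good L xi ==> EX w:FC. adj (Sw xi) * T * Sw xi = Dg w" using compress_alg0[OF T(1)] by blast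
 obtain xi x' where xi: "good L xi" "x = sw xi x'" using aper by blast
 obtain w where w: "w : FC" "adj (Sw xi) * T * Sw xi = Dg w" using L[OF xi(1)] by blast
 have xw: "xi : wd" using xi by (simp add: good_def)
 have "norm (adj (Sw xi) * (a - T) * Sw xi) <= 1 * ep * 1"
  using T(2) norm_Sw[OF xw] by (intro norm_mult3) (simp_all add: dist_norm norm_minus_commute)
 hence 1: "norm (adj (Sw xi) * a * Sw xi - Dg w) <= ep" unfolding w(2)[symmetric] by (simp add: algebra_simps)
 have "w (c x') = ip (app (Dg w) (delta x')) (delta x')" by (simp add: coord_Dg bw_FC w(1))
 also have "... = ip (app T (delta x)) (delta x)"
  unfolding w(2)[symmetric] using Sw_delta[OF xw, of x'] by (simp only: app_simps adj xi(2))
 finally have "w (c x') - ip (app a (delta x)) (delta x) = - ip (app (a - T) (delta x)) (delta x)"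
  by (simp add: ip_diff_left)
 also have "cmod ... <= norm (a - T) * norm (delta x) * norm (delta x)" unfolding norm_minus_cancel by (rule ip_app_bound)
 finally have "cmod (w (c x') - ip (app a (delta x)) (delta x)) <= ep" using T(2) by (simp add: dist_norm norm_minus_commute)
 thus ?thesis using 1 xw w(1) by blast
qed

end

section \<open>Comparison of positive elements\<close>

context simple_rep
begin

text \<open>\<open>z\<close> is the sum of the \<open>Sw (lam j)\<close> times the multiplier
  \<open>sqrt k\<close>. The words are incomparable, so no cross terms arise, and
  \<open>adj z * Dr r * z\<close> has the symbol \<open>k\<close> times the sum of the translates of
  \<open>r\<close>. That sum is at least \<open>et\<close> where \<open>f\<close> is nonzero, so
  \<open>k\<close> can be taken as the quotient.\<close>

lemma transport: assumes i: "i : {1..n}" "recurrent i" and r: "rFC r" "!!ga. 0 <= r ga" and g1: "ga1 : dual" "0 < r ga1"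
  and f: "rFC f" "!!ga. 0 <= f ga" "equi {ga : dual. f ga ~= 0}" shows "EX z:alg0 FC. EX k (J :: nat) lam. EX ze:wd.
  (ALL w. bw w --> adj z * Dg w * z = Dg (%ga. cre (k ga) * (\<Sum>j<J. w (om (lam j) \<diamond> ga)))) &
  (ALL j<J. lam j : wd) & (ALL ga:dual. 0 <= k ga & k ga * (\<Sum>j<J. r (om (lam j) \<diamond> ga)) = f ga) &
  adj z * Sw ze = 0"
proof -
 obtain J :: nat and lam ze et where h: "0 < et" "ze : wd" "!!j. j < J ==> lam j : wd" "!!j. j < J ==> incomparable (lam j) ze"
  "!!j k. j < J ==> k < J ==> j ~= k ==> incomparable (lam j) (lam k)"
  and low: "!!ga. ga : dual ==> f ga ~= 0 ==> EX j<J. et <= r (om (lam j) \<diamond> ga)"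
  using hit_words[OF i r g1 f(3)] by (elim exE conjE) blast
 define H where "H ga = (\<Sum>j<J. r (om (lam j) \<diamond> ga))" for ga
 have HF: "rFC H" unfolding H_def[abs_def] by (rule rFC_sum) (use FC_translate[OF r(1) om_dual[OF h(3)]] in auto)
 have Hlow: "et <= H ga" if g: "ga : dual" "f ga ~= 0" for ga
 proof -
  obtain j where "j < J" "et <= r (om (lam j) \<diamond> ga)" using low[OF g] by blast
  moreover have "r (om (lam j) \<diamond> ga) <= H ga" unfolding H_def using calculation(1) r(2) by (intro member_le_sum) auto
  ultimately show ?thesis by simp
 qed
 \<comment> \<open>The reciprocal \<open>1 / max t et\<close> does not vanish at 0; its constant
   \<open>1 / et\<close> is split off and attached to \<open>f\<close>, so that \<open>k\<close>
   remains in \<open>FC\<close>.\<close>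
 define ph where "ph t = 1 / max t et - 1 / et" for t
 have "cts ph" unfolding ph_def using h(1) by (intro continuous_intros) (auto simp: max_def)
 moreover have "ph 0 = 0" using h(1) by (simp add: ph_def max_def)
 ultimately have phF: "rFC (%ga. ph (H ga))" by (rule rFC_calculus[OF HF])
 define k where "k ga = f ga * (1 / max (H ga) et)" for ga
 have k0: "0 <= k ga" for ga unfolding k_def using f(2)[of ga] h(1) by (intro mult_nonneg_nonneg) auto
 have "k ga = f ga * ph (H ga) + (1 / et) * f ga" for ga by (simp add: k_def ph_def algebra_simps)
 hence "rFC k" using rFC_add[OF rFC_mult[OF f(1) phF] rFC_scale[OF f(1), of "1 / et"]] by (simp only:)
 hence qF: "rFC (%ga. sqrt (k ga))" by (rule rFC_calculus) (auto intro!: continuous_intros)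
 have qb: "bw (%ga. cre (sqrt (k ga)))" by (rule bw_FC[OF qF])
 let ?D = "Dr (%ga. sqrt (k ga))"
 define z where "z = (\<Sum>j<J. Sw (lam j) * ?D)"
 have adz: "adj z = (\<Sum>j<J. ?D * adj (Sw (lam j)))"
 proof -
  have "adj (\<Sum>j\<in>I. Sw (lam j) * ?D) = (\<Sum>j\<in>I. ?D * adj (Sw (lam j)))" for I
   by (induction I rule: infinite_finite_induct) (simp_all add: adj_Dr[OF qb])
  thus ?thesis by (simp add: z_def)
 qed
 have "gen (lam j) (%ga. cre (sqrt (k ga))) [] : alg0 FC" if "j < J" for j by (rule alg0_gen[OF qF h(3)[OF that]]) simp
 hence "Sw (lam j) * ?D : alg0 FC" if "j < J" for j using that by simp
 hence zA: "z : alg0 FC" unfolding z_def by (induction J) (simp_all add: star_subD[OF alg0_FC])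
 have "adj z * Dg w * z = Dg (%ga. cre (k ga) * (\<Sum>j<J. w (om (lam j) \<diamond> ga)))" if w: "bw w" for w
 proof -
  have t: "?D * adj (Sw (lam j)) * Dg w * (Sw (lam l) * ?D)
    = (if l = j then Dg (%ga. cre (k ga) * w (om (lam j) \<diamond> ga)) else 0)" if "j < J" "l < J" for j l
  proof -
   note tr = bw_translate[OF w h(3)[OF that(2)]]
   have "?D * adj (Sw (lam j)) * Dg w * (Sw (lam l) * ?D)
     = ?D * (adj (Sw (lam j)) * Sw (lam l)) * Dg (%ga. w (om (lam l) \<diamond> ga)) * ?D"
    using Dg_Sw[OF w h(3)[OF that(2)]] by (simp add: mult.assoc) (simp flip: mult.assoc)
   also have "... = (if l = j then ?D * Dg (%ga. w (om (lam l) \<diamond> ga)) * ?D else 0)"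
    using incomparable_orth[OF h(3)[OF that(1)] h(3)[OF that(2)]] h(5)[OF that] adj_Sw_Sw[OF h(3)[OF that(1)]] by auto
   also have "?D * Dg (%ga. w (om (lam l) \<diamond> ga)) * ?D = Dg (%ga. cre (k ga) * w (om (lam l) \<diamond> ga))"
    unfolding Dg_mult[OF qb tr, symmetric] Dg_mult[OF bw_mult[OF qb tr] qb, symmetric]
   proof (rule Dg_cong)
    fix ga :: "'g => complex"
    have "cre (sqrt (k ga)) * cre (sqrt (k ga)) = cre (k ga)" using k0[of ga] by (simp flip: of_real_mult)
    thus "cre (sqrt (k ga)) * w (om (lam l) \<diamond> ga) * cre (sqrt (k ga))
      = cre (k ga) * w (om (lam l) \<diamond> ga)" by (metis mult.assoc mult.commute)
   qed
   finally show ?thesis by (cases "l = j") simp_all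
  qed
  have "adj z * Dg w * z = (\<Sum>j<J. \<Sum>l<J. ?D * adj (Sw (lam j)) * Dg w * (Sw (lam l) * ?D))"
   unfolding adz sum_distrib_right unfolding z_def sum_distrib_left ..
  also have "... = (\<Sum>j<J. Dg (%ga. cre (k ga) * w (om (lam j) \<diamond> ga)))" by (intro sum.cong refl) (simp add: t)
  also have "... = Dg (%ga. \<Sum>j<J. cre (k ga) * w (om (lam j) \<diamond> ga))"
  proof -
   have kb: "bw (%ga. cre (k ga))" by (rule bw_FC) fact
   have "N <= J ==> bw (%ga. \<Sum>j<N. cre (k ga) * w (om (lam j) \<diamond> ga)) &
    (\<Sum>j<N. Dg (%ga. cre (k ga) * w (om (lam j) \<diamond> ga)))
    = Dg (%ga. \<Sum>j<N. cre (k ga) * w (om (lam j) \<diamond> ga))" for N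
   proof (induction N)
    case (Suc N)
    hence "bw (%ga. cre (k ga) * w (om (lam N) \<diamond> ga))" by (intro bw_mult kb bw_translate[OF w] h) simp
    thus ?case using Suc by (simp add: bw_add Dg_add)
   qed (simp add: bw_const Dg_const opsc_simps)
   thus ?thesis by blast
  qed
  finally show ?thesis by (simp add: sum_distrib_left)
 qed
 moreover have "k ga * H ga = f ga" if "ga : dual" for ga
  using Hlow[OF that] h(1) by (cases "f ga = 0") (simp_all add: k_def max_def)
 moreover have "adj z * Sw ze = 0" unfolding adz sum_distrib_right
  by (rule sum.neutral) (simp add: mult.assoc incomparable_orth h)
 ultimately show ?thesis using zA k0 h(2,3) unfolding H_def by blast
qed

text \<open>\<open>adj b * b\<close> is compressed to nearly a multiplier with a positive peak,
  which \<open>transport\<close> turns into a local unit for \<open>p\<close>. Cutting down by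
  \<open>p\<close> gives an element near \<open>p\<close>, and \<open>polar_correction\<close> makes
  it equal to \<open>p\<close>.\<close>

lemma embed_projection: assumes i: "i : {1..n}" "recurrent i" and aper: "!!L x. EX xi x'. good L xi & x = sw xi x'"
  and p: "p : BB" "adj p = p" "p * p = p" and b: "b : BB" "b ~= 0" shows "EX r:BB. adj (b * r) * (b * r) = p"
proof -
 obtain x where x: "app b (delta x) ~= 0" using b(2) op_matrix_eqI[of b 0] by force
 define be where "be = (norm (app b (delta x)))^2"
 have be: "0 < be" using x by (simp add: be_def)
 define a where "a = adj b * b"
 have a: "a : BB" "adj a = a" using b by (simp_all add: a_def BB)
 have ax: "ip (app a (delta x)) (delta x) = cre be" unfolding a_def app_simps adj ip_norm be_def ..
 obtain xi w x' where xi: "xi : wd" and w: "w : FC" "norm (adj (Sw xi) * a * Sw xi - Dg w) <= be / 16"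
  and wx: "cmod (w (c x') - cre be) <= be / 16" using compress[OF a(1) _ aper, of "be / 16" x] be unfolding ax by auto
 define Q where "Q = adj (Sw xi) * a * Sw xi"
 define G where "G ga = Re (w ga)" for ga
 have GF: "rFC G" unfolding G_def by (rule FC_calculus[OF w(1), of "%t. t"]) auto
 \<comment> \<open>\<open>Q\<close> is selfadjoint, so passing to the real part of the symbol does
   not increase the error.\<close>
 have XG: "norm (Q - Dr G) <= be / 16"
 proof -
  have "Dr G = Dg (%ga. (1 / 2) * (w ga + cnj (w ga)))" by (rule Dg_cong) (simp add: G_def complex_add_cnj)
  also have "... = opsc (1 / 2) (Dg w + adj (Dg w))"
   by (simp only: Dg_scale[OF bw_add[OF bw_FC[OF w(1)] bw_cnj[OF bw_FC[OF w(1)]]]]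
    Dg_add[OF bw_FC[OF w(1)] bw_cnj[OF bw_FC[OF w(1)]]] adj_Dg[OF bw_FC[OF w(1)]])
  finally have "Q - Dr G = opsc (1 / 2) (Q + Q) - opsc (1 / 2) (Dg w + adj (Dg w))"
   using opsc_simps(2)[of "1 / 2" "1 / 2" Q] by (simp add: opsc_simps)
  also have "... = opsc (1 / 2) ((Q - Dg w) + adj (Q - Dg w))"
   using a(2) by (simp add: Q_def opsc_simps(1,11)[symmetric] mult.assoc del: opsc_simps(11)) (simp add: algebra_simps)
  also have "norm ... <= (1 / 2) * (be / 16 + be / 16)"
   unfolding norm_opscale using w(2) by (intro mult_mono norm_triangle_mono) (simp_all only: norm_adj Q_def norm_ge_zero, simp_all)
  finally show ?thesis by simp
 qed
 define r where "r ga = max 0 (G ga - be / 2)" for ga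
 have r0: "0 <= r ga" for ga by (simp add: r_def)
 have rF: "rFC r"
  unfolding r_def[abs_def] by (rule rFC_calculus[OF GF, of "%t. max 0 (t - be / 2)"]) (use be in \<open>auto intro!: continuous_intros\<close>)
 have "\<bar>Re (w (c x') - cre be)\<bar> <= be / 16" using abs_Re_le_cmod wx by (rule order_trans)
 hence "- (be / 16) <= G (c x') - be" using abs_ge_minus_self[of "Re (w (c x') - cre be)"] by (simp add: G_def)
 hence "be / 2 < G (c x')" using be by linarith
 hence rx: "0 < r (c x')" by (simp add: r_def)
 obtain f where f: "rFC f" "!!ga. 0 <= f ga" "!!ga. f ga <= 1" "equi {ga : dual. f ga ~= 0}" "norm (Dr f * p - p) < 1 / 8"
  using local_unit[OF p(1), of "1 / 8"] by auto
 obtain z k lam and J :: nat where z: "z : alg0 FC"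
  and zw: "!!w. bw w ==> adj z * Dg w * z = Dg (%ga. cre (k ga) * (\<Sum>j<J. w (om (lam j) \<diamond> ga)))"
  and lam: "!!j. j < J ==> lam j : wd"
  and k: "!!ga. ga : dual ==> 0 <= k ga" "!!ga. ga : dual ==> k ga * (\<Sum>j<J. r (om (lam j) \<diamond> ga)) = f ga"
  using transport[OF i rF r0 c_dual rx f(1,2,4)] by (elim bexE exE conjE) blast
 \<comment> \<open>With \<open>q = ps G\<close>, the product \<open>q^2 * G\<close> is the excess
   \<open>r\<close> of \<open>G\<close> over \<open>be / 2\<close>, while
   \<open>q^2 <= (2 / be) * r\<close>. The cut-off at half the peak thus bounds the norm of
   \<open>adj y * y\<close> by \<open>2 / be\<close>, which keeps the error \<open>be / 16\<close>
   of \<open>Q\<close> harmless.\<close>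
 define ps where "ps t = sqrt (max 0 (t - be / 2) / max t (be / 2))" for t
 have "cts ps" unfolding ps_def using be by (intro continuous_intros) (auto simp: max_def)
 moreover have "ps 0 = 0" using be by (simp add: ps_def)
 ultimately have qF: "rFC (%ga. ps (G ga))" by (rule rFC_calculus[OF GF])
 define q where "q ga = ps (G ga)" for ga
 have q: "rFC q" using qF by (simp add: q_def)
 have q2: "(q ga)^2 = max 0 (G ga - be / 2) / max (G ga) (be / 2)" for ga
  unfolding q_def ps_def using be by (intro real_sqrt_pow2 divide_nonneg_nonneg) (auto simp: le_max_iff_disj)
 have qG: "q ga * G ga * q ga = r ga" for ga
 proof -
  have "q ga * G ga * q ga = (q ga)^2 * G ga" by (simp add: power2_eq_square)
  thus ?thesis using be by (auto simp: q2 r_def max_def)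
 qed
 have qr: "(q ga)^2 <= (2 / be) * r ga" for ga
 proof -
  have "max 0 (G ga - be / 2) / max (G ga) (be / 2) <= max 0 (G ga - be / 2) / (be / 2)"
   using be by (intro divide_left_mono) (auto simp: max_def)
  thus ?thesis by (simp add: q2 r_def mult.commute)
 qed
 have qb: "bw (%ga. cre (q ga))" and Gb: "bw (%ga. cre (G ga))" and rb: "bw (%ga. cre (r ga))" by (intro bw_FC q GF rF)+
 define y where "y = Dr q * z"
 have yG: "adj y * Dr G * y = Dr f"
 proof -
  have "adj y * Dr G * y = adj z * (Dr q * Dr G * Dr q) * z" by (simp add: y_def adj_Dr[OF qb] mult.assoc)
  also have "Dr q * Dr G * Dr q = Dr r" unfolding Dg_mult[OF qb Gb, symmetric] Dg_mult[OF bw_mult[OF qb Gb] qb, symmetric]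
   by (rule Dg_cong) (simp flip: of_real_mult add: qG)
  also have "adj z * Dr r * z = Dr f" unfolding zw[OF rb] by (rule Dg_cong) (simp flip: of_real_mult of_real_sum add: k)
  finally show ?thesis .
 qed
 have "norm (adj y * y) <= 2 / be"
 proof -
  have "adj y * y = adj z * Dg (%ga. cre (q ga) * cre (q ga)) * z"
   by (simp add: y_def adj_Dr[OF qb] Dg_mult[OF qb qb] mult.assoc)
  also have "... = Dg (%ga. cre (k ga) * (\<Sum>j<J. cre (q (om (lam j) \<diamond> ga)) * cre (q (om (lam j) \<diamond> ga))))"
   by (rule zw[OF bw_mult[OF qb qb]])
  also have "... = Dr (%ga. k ga * (\<Sum>j<J. (q (om (lam j) \<diamond> ga))^2))"
   by (rule Dg_cong) (simp add: power2_eq_square)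
  also have "norm ... <= 2 / be"
  proof (rule norm_Dg)
   fix ga :: "'g => complex" assume g: "ga : dual"
   have "k ga * (\<Sum>j<J. (q (om (lam j) \<diamond> ga))^2) <= k ga * (\<Sum>j<J. (2 / be) * r (om (lam j) \<diamond> ga))"
    by (intro mult_left_mono sum_mono qr k(1) g)
   also have "... = (2 / be) * (k ga * (\<Sum>j<J. r (om (lam j) \<diamond> ga)))" by (simp add: sum_distrib_left mult.left_commute)
   also have "... <= (2 / be) * 1" unfolding k(2)[OF g] using f(3) be by (intro mult_left_mono) auto
   finally have "k ga * (\<Sum>j<J. (q (om (lam j) \<diamond> ga))^2) <= 2 / be" by simp
   moreover have "0 <= k ga * (\<Sum>j<J. (q (om (lam j) \<diamond> ga))^2)" using k(1)[OF g] by (intro mult_nonneg_nonneg sum_nonneg) auto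
   ultimately show "cmod (cre (k ga * (\<Sum>j<J. (q (om (lam j) \<diamond> ga))^2))) <= 2 / be"
    by (simp only: norm_of_real abs_of_nonneg)
  qed
  finally show ?thesis .
 qed
 hence ny: "(norm y)^2 <= 2 / be" by (simp add: op_cstar)
 have "norm (adj y * (Q - Dr G) * y) <= norm (adj y) * (be / 16) * norm y" by (rule norm_mult3[OF order_refl XG order_refl])
 also have "... = (norm y)^2 * (be / 16)" by (simp add: power2_eq_square)
 also have "... <= (2 / be) * (be / 16)" using ny be by (intro mult_right_mono) auto
 also have "... = 1 / 8" using be by simp
 finally have n1: "norm (adj y * Q * y - Dr f) <= 1 / 8" unfolding yG[symmetric] by (simp add: algebra_simps)
 define r1 where "r1 = Sw xi * y * p"
 have "gen xi (%ga. cre (q ga)) [] * z * p : BB" by (intro BB gen_BB q xi alg0_BB z p) simp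
 hence r1: "r1 : BB" by (simp add: r1_def y_def mult.assoc)
 define d where "d = p - adj (b * r1) * (b * r1)"
 have bb: "adj (b * r1) * (b * r1) = p * (adj y * Q * y) * p" by (simp add: r1_def Q_def a_def p(2) mult.assoc)
 have pp: "p * (p * T) = p * T" for T using p(3) by (simp flip: mult.assoc)
 \<comment> \<open>Two errors of \<open>1 / 8\<close>, one from the local unit and one from
   replacing \<open>Q\<close> by the multiplier, stay within the bound that
   \<open>polar_correction\<close> demands.\<close>
 have "norm d <= 1 / 2"
 proof -
  have "d = p * (p - Dr f * p) - p * (adj y * Q * y - Dr f) * p"
   unfolding d_def bb using p(3) by (simp add: algebra_simps pp)
  also have "norm ... <= norm (p * (p - Dr f * p)) + norm (p * (adj y * Q * y - Dr f) * p)" by (rule norm_triangle_ineq4)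
  also have "norm (p * (p - Dr f * p)) <= 1 * (1 / 8)" using norm_projection[OF p(2,3)] f(5)
   by (intro order_trans[OF norm_mult_ineq] mult_mono) (auto simp: norm_minus_commute)
  also have "norm (p * (adj y * Q * y - Dr f) * p) <= 1 * (1 / 8) * 1"
   using norm_projection[OF p(2,3)] n1 by (intro norm_mult3)
  finally show ?thesis by simp
 qed
 moreover have "d : BB" "adj d = d" using p b(1) r1 by (simp_all add: d_def BB)
 moreover have "p * d = d" "d * p = d" unfolding d_def bb using p(3) by (simp_all add: algebra_simps pp)
 ultimately obtain I where I: "adj I * (p - d) * I = p" "ALL x:BB. x * I : BB"
  using polar_correction[OF star_sub_closure[OF alg0_FC] closed_closure _ _ _ p(1)] by blast
 have "adj (b * (r1 * I)) * (b * (r1 * I)) = adj I * (adj (b * r1) * (b * r1)) * I" by (simp add: mult.assoc)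
 also have "... = p" using I(1) by (simp add: d_def)
 finally show ?thesis using I(2) r1 by blast
qed

end

section \<open>Projections and pure infiniteness\<close>

context simple_rep
begin

text \<open>A proper isometry \<open>v\<close> in the unitization gives the projection
  \<open>1 - v * adj v\<close>. Here \<open>v = x + H\<close>, where \<open>adj x * x\<close> is the
  multiplier with symbol \<open>g^2\<close> and \<open>H\<close> the one with symbol
  \<open>sqrt (1 - g^2)\<close>; the cross terms vanish since \<open>x\<close> begins with a
  multiplier supported where \<open>g = 1\<close>. The range of \<open>v\<close> misses nonzero
  vectors in the range of \<open>Dr q * Sw ze\<close>.\<close>

lemma projection_exists: assumes i: "i : {1..n}" "recurrent i" shows "EX p:BB. adj p = p & p * p = p & p ~= 0"
proof -
 obtain h where h: "cc h" "hat h (c 0) ~= 0" using hat_nonzero[OF c_dual] by blast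
 define V where "V ga = (cmod (hat h ga))^2" for ga
 have VF: "rFC V" unfolding V_def[abs_def] by (rule rFC_norm[OF FC_hat[OF h(1)]])
 define ka where "ka = V (c 0)"
 have ka: "0 < ka" using h(2) by (simp add: ka_def V_def)
 define r where "r ga = max 0 (V ga - ka / 2)" for ga
 define g where "g ga = min 1 (max 0 (4 / ka * V ga - 1))" for ga
 have rF: "rFC r" unfolding r_def[abs_def]
  by (rule rFC_calculus[OF VF, of "%t. max 0 (t - ka / 2)"]) (use ka in \<open>auto intro!: continuous_intros\<close>)
 have gF: "rFC g" unfolding g_def[abs_def]
  by (rule rFC_calculus[OF VF, of "%t. min 1 (max 0 (4 / ka * t - 1))"]) (use ka in \<open>auto intro!: continuous_intros\<close>)
 have r0: "0 <= r ga" and g01: "0 <= g ga" "g ga <= 1" for ga by (auto simp: r_def g_def)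
 have rx: "0 < r (c 0)" using ka by (simp add: r_def ka_def[symmetric])
 have g1: "g ga = 1" if "r ga ~= 0" for ga
 proof -
  have "ka / 2 < V ga" using that by (simp add: r_def max_def split: if_splits)
  hence "2 <= 4 / ka * V ga" using ka by (simp add: field_simps)
  thus ?thesis by (simp add: g_def)
 qed
 have "ka / 4 < V ga" if "g ga * g ga ~= 0" for ga
 proof -
  have "0 < 4 / ka * V ga - 1"
  proof (rule ccontr)
   assume "~ ?thesis"
   hence "max 0 (4 / ka * V ga - 1) = 0" by (intro max_absorb1) simp
   thus False using that by (simp add: g_def)
  qed
  thus ?thesis using ka by (simp add: field_simps)
 qed
 hence gq: "equi {ga : dual. g ga * g ga ~= 0}" using ka by (intro equi_subset[OF rFC_support[OF VF, of "ka / 4"]]) auto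
 obtain z k lam ze and J :: nat where z: "z : alg0 FC" "ze : wd" "adj z * Sw ze = 0"
  and zw: "!!w. bw w ==> adj z * Dg w * z = Dg (%ga. cre (k ga) * (\<Sum>j<J. w (om (lam j) \<diamond> ga)))"
  and k: "!!ga. ga : dual ==> k ga * (\<Sum>j<J. r (om (lam j) \<diamond> ga)) = g ga * g ga"
  using transport[OF i rF r0 c_dual rx rFC_mult[OF gF gF] mult_nonneg_nonneg[OF g01(1) g01(1)] gq]
  by (elim bexE exE conjE) blast
 define q where "q ga = sqrt (r ga)" for ga
 have qF: "rFC q" unfolding q_def[abs_def] by (rule rFC_calculus[OF rF]) (auto intro!: continuous_intros)
 \<comment> \<open>The symbol of \<open>H\<close> need not lie in \<open>FC\<close>, but that of
   \<open>H - 1\<close> does; so \<open>v - 1\<close> and hence the projection belong to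
   \<open>BB\<close>.\<close>
 define e where "e ga = sqrt (max 0 (1 - (g ga)\<^sup>2)) - 1" for ga
 have eF: "rFC e" unfolding e_def[abs_def]
  by (rule rFC_calculus[OF gF, of "%t. sqrt (max 0 (1 - t\<^sup>2)) - 1"]) (auto intro!: continuous_intros)
 have qb: "bw (%ga. cre (q ga))" and eb: "bw (%ga. cre (e ga))" and rb: "bw (%ga. cre (r ga))" by (intro bw_FC qF eF rF)+
 define x H where "x = Dr q * z" and "H = Dr (%ga. 1 + e ga)"
 have hb: "bw (%ga. cre (1 + e ga))" using bw_add[OF bw_const[of 1] eb] by simp
 have HH: "adj H = H" by (simp only: H_def adj_Dr[OF hb])
 have qq: "Dr q * Dr q = Dr r"
  unfolding Dg_mult[OF qb qb, symmetric] by (rule Dg_cong) (simp add: q_def r0 flip: of_real_mult)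
 have Hq: "H * Dr q = 0"
 proof -
  have "(1 + e ga) * q ga = 0" for ga using g1[of ga] by (cases "r ga = 0") (simp_all add: q_def e_def)
  hence "H * Dr q = Dg (%_. 0)"
   unfolding H_def Dg_mult[OF hb qb, symmetric] by (intro Dg_cong) (simp only: of_real_mult[symmetric] of_real_0)
  thus ?thesis by (simp add: Dg_const opsc_simps)
 qed
 hence Hx: "H * x = 0" by (simp add: x_def flip: mult.assoc)
 hence "adj (H * x) = adj 0" by (simp only:)
 hence xH: "adj x * H = 0" by (simp add: HH)
 define v where "v = x + H"
 have xx: "adj x * x = Dr (%ga. g ga * g ga)"
 proof -
  have "adj x * x = adj z * (Dr q * Dr q) * z" by (simp add: x_def adj_Dr[OF qb] mult.assoc)
  also have "... = Dr (%ga. g ga * g ga)"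
   unfolding qq zw[OF rb] by (rule Dg_cong) (simp flip: of_real_mult of_real_sum add: k)
  finally show ?thesis .
 qed
 have vv: "adj v * v = 1"
 proof -
  have "adj v * v = adj x * x + H * H" by (simp add: v_def HH Hx xH algebra_simps)
  also have "H * H = Dr (%ga. (1 + e ga) * (1 + e ga))" unfolding H_def Dg_mult[OF hb hb, symmetric] by (rule Dg_cong) simp
  also have "adj x * x + ... = Dg (%ga. cre (g ga * g ga) + cre ((1 + e ga) * (1 + e ga)))"
   unfolding xx using Dg_add[OF bw_FC[OF rFC_mult[OF gF gF]] bw_mult[OF hb hb]] by simp
  also have "... = Dg (%_. 1)"
  proof (rule Dg_cong)
   fix ga :: "'g => complex"
   have "(g ga)^2 <= 1" using g01[of ga] by (simp add: power_le_one)
   hence "g ga * g ga + (1 + e ga) * (1 + e ga) = 1" by (simp add: e_def power2_eq_square)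
   thus "cre (g ga * g ga) + cre ((1 + e ga) * (1 + e ga)) = 1" by (simp only: of_real_add[symmetric] of_real_1)
  qed
  finally show ?thesis by (simp add: Dg_const opsc_simps)
 qed
 define p where "p = 1 - v * adj v"
 have vvT: "adj v * (v * T) = T" for T using vv by (simp flip: mult.assoc)
 have "adj p = p" "p * p = p" by (simp_all add: p_def algebra_simps vvT)
 moreover have "p : BB"
 proof -
  define y where "y = x + Dr e"
  have "gen [] (%ga. cre (q ga)) [] * z : BB" "gen [] (%ga. cre (e ga)) [] : BB" by (intro BB gen_BB qF eF alg0_BB z; simp)+
  hence y: "y : BB" by (simp add: y_def x_def BB)
  have "H = 1 + Dr e" using Dg_add[OF bw_const[of 1] eb] by (simp add: H_def Dg_const opsc_simps)
  hence "p = - (y + adj y + y * adj y)" by (simp add: p_def v_def y_def algebra_simps)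
  thus ?thesis using y by (simp add: BB)
 qed
 moreover have "p ~= 0"
 proof
  assume "p = 0"
  hence 1: "v * adj v = 1" by (simp add: p_def)
  have "adj x * (Dr q * Sw ze) = adj z * (Dr r * Sw ze)"
   unfolding qq[symmetric] by (simp add: x_def adj_Dr[OF qb] mult.assoc)
  also have "... = (adj z * Sw ze) * Dg (%ga. cre (r (om ze \<diamond> ga)))" by (simp only: Dg_Sw[OF rb z(2)] mult.assoc)
  finally have "adj v * (Dr q * Sw ze) = 0" using Hq by (simp add: v_def z(3) HH distrib_right flip: mult.assoc)
  hence "(v * adj v) * (Dr q * Sw ze) = 0" by (simp add: mult.assoc)
  hence "Sw ze * Dg (%ga. cre (q (om ze \<diamond> ga))) = 0" using 1 Dg_Sw[OF qb z(2)] by simp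
  hence "adj (Sw ze) * (Sw ze * Dg (%ga. cre (q (om ze \<diamond> ga)))) = 0" by simp
  hence D0: "Dg (%ga. cre (q (om ze \<diamond> ga))) = 0" by (simp add: adj_Sw_Sw' z(2))
  \<comment> \<open>Since \<open>om ze\<close> moves \<open>ga1\<close> to \<open>c 0\<close>, the
    translated symbol is positive at \<open>ga1\<close>. That character need not occur in the
    representation, so \<open>FC_sup\<close> transfers nonvanishing to one that does.\<close>
  define ga1 where "ga1 = (%t. cnj (om ze t)) \<diamond> c 0"
  have ga1: "ga1 : dual" unfolding ga1_def by (intro dual_mult dual_cnj om_dual z(2) c_dual)
  have "om ze \<diamond> ga1 = c 0" unfolding ga1_def using om_cancel[OF z(2), of "c 0"] by (simp add: mult.left_commute)
  hence "0 < q (om ze \<diamond> ga1)" using rx by (simp add: q_def)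
  moreover note qT = FC_translate[OF qF om_dual[OF z(2)]]
  ultimately obtain y where "0 < cmod (cre (q (om ze \<diamond> c y)))"
   using FC_sup[OF covariant_axioms qT, of "q (om ze \<diamond> ga1)" ga1] ga1 by auto
  thus False using norm_Dg_ge[OF bw_FC[OF qT], of y] by (simp add: D0)
 qed
 ultimately show ?thesis by blast
qed

lemma conj_BB: assumes i: "i : {1..n}" and x: "x : BB" shows "Sop i * x * Rop i : BB"
proof -
 have a: "Sop i * T * Rop i : alg0 FC" if "T : alg0 FC" for T using that
 proof (induction rule: alg0.induct)
  case (step T w u v)
  have "Sop i * (gen u w v + T) * Rop i = gen (i # u) w (i # v) + Sop i * T * Rop i" by (simp add: algebra_simps)
  thus ?case using alg0.step[OF step.IH step(2), of "i # u" "i # v"] step i by simp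
 qed (simp add: alg0.zero)
 obtain f where f: "!!k :: nat. f k : alg0 FC" "f ~~> x" using x unfolding closure_sequential by blast
 show ?thesis unfolding closure_sequential
  by (rule exI[of _ "%k. Sop i * f k * Rop i"]) (intro conjI allI a f tendsto_mult tendsto_const)
qed

lemma partial_isometry: assumes "adj v * v = p" "adj p = p" "p * p = p" shows "v * p = v"
proof -
 have pp: "adj v * (v * T) = p * T" "p * (p * T) = p * T" for T using assms by (simp_all flip: mult.assoc)
 have "adj (v * p - v) * (v * p - v) = 0" using assms by (simp add: algebra_simps pp)
 hence "norm (v * p - v) = 0" using op_cstar[of "v * p - v"] by simp
 thus ?thesis by simp
qed

end

context simple_rep
begin

text \<open>A projection that embeds into a proper corner of itself is infinite; here the corner comes from
 two orthogonal copies of a nonzero projection.\<close>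

lemma infinite_element: assumes i: "i : {1..n}" "recurrent i" and aper: "!!L x. EX xi x'. good L xi & x = sw xi x'"
  and h: "h : BB" "h ~= 0"
 shows "EX r:BB. EX u:BB. EX Q Q'. Q = (h * r) * adj (h * r) & Q * Q = Q & adj u * u = Q & u * adj u = Q' &
  Q' * Q' = Q' & Q * Q' = Q' & Q' * Q = Q' & Q ~= Q'"
proof -
 obtain p where p: "p : BB" "adj p = p" "p * p = p" "p ~= 0" using projection_exists[OF i] by blast
 note emb = embed_projection[OF i aper]
 \<comment> \<open>The first letters 1 and 2 give \<open>b 1\<close> and \<open>b 2\<close>
   orthogonal ranges; embedding \<open>p\<close> into each of them provides the two orthogonal
   copies \<open>q1\<close> and \<open>q2\<close>.\<close>
 define b where "b l = Sop l * p * Rop l" for l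
 have l12: "1 : {1..n}" "2 : {1..n}" using n2 by auto
 have b: "b l : BB" "b l ~= 0" if l: "l : {1..n}" for l
 proof -
  have "Rop l * b l * Sop l = (Rop l * Sop l) * p * (Rop l * Sop l)" by (simp only: b_def mult.assoc)
  hence "Rop l * b l * Sop l = p" by (simp add: Rop_Sop[OF l l])
  thus "b l ~= 0" using p(4) by fastforce
  show "b l : BB" unfolding b_def by (rule conj_BB[OF l p(1)])
 qed
 obtain r1 where r1: "r1 : BB" "adj (b 1 * r1) * (b 1 * r1) = p" using emb[OF p(1-3) b[OF l12(1)]] by blast
 obtain r2 where r2: "r2 : BB" "adj (b 2 * r2) * (b 2 * r2) = p" using emb[OF p(1-3) b[OF l12(2)]] by blast
 define v1 v2 where "v1 = b 1 * r1" and "v2 = b 2 * r2"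
 have adjS: "adj (Rop l) = Sop l" for l by (simp add: Sop_def)
 have v: "adj v1 * v1 = p" "adj v2 * v2 = p" unfolding v1_def v2_def by (rule r1(2), rule r2(2))
 have vB: "v1 : BB" "v2 : BB" unfolding v1_def v2_def by (intro BB r1 r2 b l12)+
 have "adj v1 * v2 = adj r1 * Sop 1 * p * (Rop 1 * Sop 2) * p * Rop 2 * r2"
  by (simp add: v1_def v2_def b_def adjS p(2) mult.assoc)
 hence o12: "adj v1 * v2 = 0" unfolding Rop_Sop[OF l12] by simp
 hence "adj (adj v1 * v2) = adj 0" by (simp only:)
 hence o21: "adj v2 * v1 = 0" by simp
 define q1 q2 where "q1 = v1 * adj v1" and "q2 = v2 * adj v2"
 have vp: "v1 * p = v1" "v2 * p = v2" by (rule partial_isometry[OF v(1) p(2,3)], rule partial_isometry[OF v(2) p(2,3)])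
 have vT: "adj v1 * (v1 * T) = p * T" "adj v2 * (v2 * T) = p * T" "adj v1 * (v2 * T) = 0" "adj v2 * (v1 * T) = 0"
  "v1 * (p * T) = v1 * T" "v2 * (p * T) = v2 * T" for T using v o12 o21 vp by (simp_all flip: mult.assoc)
 have pT: "p * adj v1 = adj v1" "p * adj v2 = adj v2"
  using arg_cong[OF vp(1), of adj] arg_cong[OF vp(2), of adj] by (simp_all add: p(2))
 have q: "q1 * q1 = q1" "q2 * q2 = q2" "q1 * q2 = 0" "q2 * q1 = 0" "adj q1 = q1" "adj q2 = q2"
  by (simp_all add: q1_def q2_def mult.assoc vT pT)
 have qT: "q1 * (q1 * T) = q1 * T" "q2 * (q1 * T) = 0" for T using q by (simp_all flip: mult.assoc)
 have q0: "q1 ~= 0" "q2 ~= 0"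
 proof -
  have "adj v1 * q1 * v1 = p" "adj v2 * q2 * v2 = p" by (simp_all add: q1_def q2_def mult.assoc vT v p)
  thus "q1 ~= 0" "q2 ~= 0" using p(4) by auto
 qed
 have qB: "q1 : BB" "q2 : BB" unfolding q1_def q2_def by (intro BB vB)+
 \<comment> \<open>\<open>P\<close> embeds below \<open>q1\<close> alone, a proper part of it,
   because \<open>q2\<close> is nonzero. The embedding of \<open>P\<close> into the range of
   \<open>h\<close> then carries this over to \<open>Q\<close>.\<close>
 define P where "P = q1 + q2"
 have P: "P : BB" "adj P = P" "P * P = P" using q qB by (simp_all add: P_def BB algebra_simps)
 obtain r3 where r3: "r3 : BB" "adj (q1 * r3) * (q1 * r3) = P" using emb[OF P qB(1) q0(1)] by blast
 obtain r4 where r4: "r4 : BB" "adj (h * r4) * (h * r4) = P" using emb[OF P h] by blast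
 define v3 v4 where "v3 = q1 * r3" and "v4 = h * r4"
 have a3: "adj v3 * v3 = P" and a4: "adj v4 * v4 = P" unfolding v3_def v4_def by (rule r3(2), rule r4(2))
 have b3: "v3 * P = v3" and b4: "v4 * P = v4" by (rule partial_isometry[OF a3 P(2,3)], rule partial_isometry[OF a4 P(2,3)])
 have Pv3: "P * v3 = v3" by (simp add: P_def v3_def distrib_right qT)
 have q2v3: "q2 * v3 = 0" by (simp add: v3_def qT)
 have adjs: "P * adj v3 = adj v3" "P * adj v4 = adj v4" "adj v3 * P = adj v3"
  using arg_cong[OF b3, of adj] arg_cong[OF b4, of adj] arg_cong[OF Pv3, of adj] by (simp_all add: P(2))
 have T: "adj v3 * (v3 * T) = P * T" "v3 * (P * T) = v3 * T" "adj v4 * (v4 * T) = P * T" "v4 * (P * T) = v4 * T"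
  "P * (v3 * T) = v3 * T" "P * (adj v3 * T) = adj v3 * T" "P * (adj v4 * T) = adj v4 * T" "adj v3 * (P * T) = adj v3 * T"
  "P * (P * T) = P * T" for T using a3 a4 b3 b4 Pv3 adjs P(3) by (simp_all flip: mult.assoc)
 define u Q Q' where "u = v4 * v3 * adj v4" and "Q = v4 * adj v4" and "Q' = v4 * v3 * adj v3 * adj v4"
 note simps = mult.assoc T a3 a4 b3 b4 adjs Pv3 P(2,3)
 have F: "Q * Q = Q" "adj u * u = Q" "u * adj u = Q'" "Q' * Q' = Q'" "Q * Q' = Q'" "Q' * Q = Q'"
  by (simp_all add: u_def Q_def Q'_def simps)
 have ne: "Q ~= Q'"
 proof
  assume "Q = Q'"
  hence "adj v4 * Q * v4 = adj v4 * Q' * v4" by simp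
  hence "P = v3 * adj v3" by (simp add: Q_def Q'_def simps)
  hence "q2 * P = (q2 * v3) * adj v3" by (simp add: mult.assoc)
  thus False using q0(2) q2v3 q by (simp add: P_def distrib_left)
 qed
 have u: "u : BB" unfolding u_def v3_def v4_def by (intro BB qB r3 r4 h)
 have Q: "Q = (h * r4) * adj (h * r4)" by (simp only: Q_def v4_def)
 show ?thesis by (rule bexI[OF _ r4(1)], rule bexI[OF _ u], rule exI[of _ Q], rule exI[of _ Q']) (intro conjI Q F ne)
qed

text \<open>The infinite projection is \<open>h r\<close> times its adjoint, with \<open>h\<close>
  in the hereditary subalgebra. A multiple of \<open>h\<close> times its adjoint dominates it, which
  forces it into the subalgebra; the work lies in exhibiting the difference in the form that
  \<open>cs_le\<close> asks for.\<close>

lemma purely_infinite_case: assumes i: "i : {1..n}" "recurrent i" and aper: "!!L x. EX xi x'. good L xi & x = sw xi x'"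
 shows "purely_infinite B" unfolding purely_infinite_def
proof (intro conjI allI impI simple)
 fix H assume H: "hereditary_subalgebra H B & H ~= {\<zero>}"
 hence sub: "submodule H complex_ring B" and Hs: "!!x y. x : H ==> y : H ==> x \<otimes> y : H" "!!x. x : H ==> star B x : H"
  and her: "!!a b. a : carrier B ==> b : H ==> cs_le B \<zero> a ==> cs_le B a b ==> a : H"
  unfolding hereditary_subalgebra_def cstar_subalgebra_def by blast+
 note HE = B.submoduleE[OF sub]
 have HB: "H \<subseteq> carrier B" by (rule HE(1))
 obtain Ps where hom: "op_hom B Ps" and iso: "ALL b:carrier B. norm (Ps b) = nrm B b"
  and im: "Ps ` carrier B = BB" using isometric_hom by blast
 note Ps = op_homD[OF hom] op_hom_diff[OF cstar_B hom]
 have inj: "x = y" if "Ps x = Ps y" "x : carrier B" "y : carrier B" for x y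
 proof -
  have "nrm B (x \<ominus> y) = 0" using bspec[OF iso, of "x \<ominus> y"] that by (simp add: Ps)
  from B.minus_eq_zero[OF that(2,3) B.nrm_eq_zero[OF B.minus_cl[OF that(2,3)] this]] show ?thesis .
 qed
 have Ps0: "Ps \<zero> = 0" using Ps(2)[of "\<zero>" 0] by (simp add: opsc_simps)
 obtain h where h: "h : H" "h ~= \<zero>" using H HE(2) by blast
 have hB: "h : carrier B" using h HB by blast
 have "Ps h : BB" using hB im by blast
 moreover have "Ps h ~= 0" using inj[of h "\<zero>"] h hB Ps0 by auto
 ultimately have "EX r:BB. EX u:BB. EX Q Q'. Q = (Ps h * r) * adj (Ps h * r) & Q * Q = Q & adj u * u = Q & u * adj u = Q' &
  Q' * Q' = Q' & Q * Q' = Q' & Q' * Q = Q' & Q ~= Q'" by (rule infinite_element[OF i aper])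
 then obtain r' u' Q Q' where ru: "r' : BB" "u' : BB" and Q: "Q = (Ps h * r') * adj (Ps h * r')" "Q * Q = Q"
  "adj u' * u' = Q" "u' * adj u' = Q'" "Q' * Q' = Q'" "Q * Q' = Q'" "Q' * Q = Q'" "Q ~= Q'" by (elim bexE exE conjE)
 obtain r where r: "r : carrier B" "Ps r = r'" using ru(1) im by (metis imageE)
 obtain u where u: "u : carrier B" "Ps u = u'" using ru(2) im by (metis imageE)
 define p where "p = (h \<otimes> r) \<otimes> star B (h \<otimes> r)"
 define q where "q = u \<otimes> star B u"
 have pq: "p : carrier B" "q : carrier B" by (simp_all add: p_def q_def B.cl hB r u)
 have Psp: "Ps p = Q" and Psq: "Ps q = Q'" using hB r u Q(1,4) by (simp_all add: p_def q_def B.cl Ps)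
 have "adj ((Ps h * r') * adj (Ps h * r')) = (Ps h * r') * adj (Ps h * r')" "adj (u' * adj u') = u' * adj u'"
  by (simp_all add: mult.assoc)
 hence QQ: "adj Q = Q" "adj Q' = Q'" by (simp_all only: Q(1)[symmetric] Q(4))
 have pr: "projection B p" "projection B q"
  unfolding projection_def using pq by (auto intro!: inj simp: B.cl Ps Psp Psq Q(2,5) QQ)
 \<comment> \<open>The difference of nested projections is a projection and serves as its own square
   root.\<close>
 have "cs_le B q p" unfolding cs_le_def
 proof (intro conjI pq bexI[of _ "p \<ominus> q"])
  show "p \<ominus> q = star B (p \<ominus> q) \<otimes> (p \<ominus> q)"
   by (rule inj) (use pq in \<open>simp_all add: B.cl Ps Psp Psq QQ algebra_simps Q(2,5-7)\<close>)
 qed (use pq in simp)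
 moreover have "mvn_equiv B p q" unfolding mvn_equiv_def
  by (rule bexI[OF _ u(1)]) (auto intro!: inj simp: B.cl u pq Ps Psp Psq Q(3,4))
 moreover have "q ~= p" using Psp Psq Q(8) by auto
 ultimately have "infinite_projection B p" unfolding infinite_projection_def using pr by blast
 moreover have "p : H"
 proof (rule her[OF pq(1)])
  \<comment> \<open>Chosen so that \<open>e\<close> has norm at most \<open>1 / 2\<close>, as needed
    for its root; the summand 1 keeps \<open>K\<close> positive.\<close>
  define K where "K = 2 * (nrm B r)^2 + 1"
  have K: "0 < K" by (simp add: K_def add_nonneg_pos)
  define e where "e = cre (inverse K) \<odot> (r \<otimes> star B r)"
  have e: "e : carrier B" "star B e = e" using r by (simp_all add: e_def B.cl B.star_smult B.star_mult B.star_star)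
  have "nrm B e = inverse K * (nrm B r)^2"
   using r K B.nrm_cstar[of "star B r"] by (simp add: e_def B.nrm_smult B.cl B.star_star B.nrm_star norm_inverse)
  also have "... <= 1 / 2" using K by (simp add: K_def field_simps)
  finally obtain s where s: "s : carrier B" "star B s = s" "2 \<odot> s = e \<oplus> s \<otimes> s"
   using B.root_exists[OF e, of "1 / 2"] by auto
  define b where "b = cre K \<odot> (h \<otimes> star B h)"
  \<comment> \<open>With \<open>h'\<close> the adjoint of \<open>h\<close>, the difference
    \<open>K h h' - p\<close> equals \<open>K h (1 - e) h'\<close>, and \<open>1 - e\<close> is the
    square of \<open>1 - s\<close>. Thus \<open>y\<close> is \<open>sqrt K (1 - s) h'\<close>,
    written without a unit.\<close>
  define y where "y = cre (sqrt K) \<odot> (star B h \<ominus> s \<otimes> star B h)"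
  show "b : H" unfolding b_def by (intro HE(4) Hs h) simp
  have bB: "b : carrier B" "y : carrier B" by (simp_all add: b_def y_def hB s B.cl)
  have "Ps (2 \<odot> s) = Ps (e \<oplus> s \<otimes> s)" by (simp only: s(3))
  hence "opsc 2 (Ps s) = Ps e + Ps s * Ps s" using s(1) e(1) by (simp add: Ps B.cl)
  hence se: "Ps s + Ps s = Ps e + Ps s * Ps s" using opsc_simps(2)[of 1 1 "Ps s"] by (simp add: opsc_simps)
  have sa: "adj (Ps s) = Ps s" using s Ps(4)[OF s(1)] by simp
  have Ke: "K *\<^sub>R Ps e = r' * adj r'"
  proof -
   have "Ps e = opsc (cre (inverse K)) (r' * adj r')" using r by (simp add: e_def Ps B.cl)
   thus ?thesis using K by (simp only: opsc_simps) simp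
  qed
  have "Ps b = K *\<^sub>R (Ps h * adj (Ps h))" using hB by (simp add: b_def Ps B.cl opsc_simps)
  hence "Ps (b \<ominus> p) = K *\<^sub>R (Ps h * adj (Ps h)) - Ps h * (K *\<^sub>R Ps e) * adj (Ps h)"
   using bB pq unfolding Ke by (simp add: Ps(5) Psp Q(1) mult.assoc)
  also have "... = K *\<^sub>R (Ps h * (1 - Ps e) * adj (Ps h))" by (simp add: algebra_simps)
  also have "1 - Ps e = (1 - Ps s) * (1 - Ps s)" using se by (simp add: algebra_simps eq_diff_eq)
  also have "K *\<^sub>R (Ps h * ((1 - Ps s) * (1 - Ps s)) * adj (Ps h)) = Ps (star B y \<otimes> y)"
  proof -
   have "Ps y = opsc (cre (sqrt K)) ((1 - Ps s) * adj (Ps h))" using hB s(1) by (simp add: y_def Ps B.cl left_diff_distrib)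
   hence Psy: "Ps y = sqrt K *\<^sub>R ((1 - Ps s) * adj (Ps h))" by (simp only: opsc_simps)
   have "adj (Ps y) * Ps y = (sqrt K * sqrt K) *\<^sub>R (Ps h * ((1 - Ps s) * (1 - Ps s)) * adj (Ps h))"
    unfolding Psy by (simp add: sa mult.assoc)
   thus ?thesis using K bB by (simp add: Ps B.cl)
  qed
  finally have "b \<ominus> p = star B y \<otimes> y" by (rule inj) (simp_all add: bB pq B.cl)
  thus "cs_le B p b" unfolding cs_le_def using bB pq by blast
  have "p \<ominus> \<zero> = star B p \<otimes> p" using pr(1) pq by (simp add: projection_def)
  thus "cs_le B \<zero> p" unfolding cs_le_def using pq by auto
 qed
 ultimately show "EX p:H. infinite_projection B p" by blast
qed

end

section \<open>An aperiodic itinerary\<close>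

definition lacunary :: "nat => nat" where "lacunary k = (if EX a. k = 2 ^ a then 1 else 2)"

text \<open>The gap below \<open>2 ^ Suc L\<close> has length \<open>2 ^ L\<close>, which exceeds
  \<open>L\<close>, so no smaller power of two lies within distance \<open>L\<close>. A shift by at
  most \<open>L\<close> is therefore visible at this position.\<close>

lemma lacunary_aperiodic: assumes "0 < e" "e <= L" shows "lacunary (2 ^ Suc L - e) ~= lacunary (2 ^ Suc L)"
proof -
 have "L < 2 ^ L" by (rule less_exp)
 have "2 ^ Suc L - e ~= 2 ^ b" for b
 proof
  assume b: "2 ^ Suc L - e = 2 ^ b"
  have "(2 :: nat) ^ L < 2 ^ b" "(2 :: nat) ^ b < 2 ^ Suc L"
   using assms \<open>L < 2 ^ L\<close> unfolding b[symmetric] power_Suc by linarith+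
  hence "L < b" "b < Suc L" by (simp_all only: power_strict_increasing_iff one_less_numeral_iff semiring_norm)
  thus False by simp
 qed
 hence "lacunary (2 ^ Suc L - e) = 2" by (simp only: lacunary_def) simp
 moreover have "lacunary (2 ^ Suc L) = 1" unfolding lacunary_def by (subst if_P) (rule exI, rule refl, rule refl)
 ultimately show ?thesis by simp
qed

lemma incomparable_nth: assumes "i < length u" "i < length v" "u ! i ~= v ! i" shows "incomparable u v" "incomparable v u"
 using assms by (auto simp: incomparable_def nth_append)

context quasi_free
begin

lemma lacunary_range: "lacunary k : {1..n}" using n2 by (simp add: lacunary_def)

abbreviation "sx0 \<equiv> tidx n lacunary"

lemma tail_s_path: assumes "(u, m) : tail_set n lacunary"
 shows "foldr (%i k. sx0 (tail_s lacunary i (tail_enum n lacunary k))) u (sx0 ([], m)) = sx0 (u, m)" using assms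
proof (induction u)
 case (Cons i u)
 have "(u, m) : tail_set n lacunary" using Cons.prems by (auto simp: tail_set_def split: if_splits)
 moreover have "tail_s lacunary i (u, m) = (i # u, m)" using Cons.prems by (auto simp: tail_set_def tail_s_def)
 ultimately show ?case using Cons.IH tail_enum_idx[of lacunary n, OF lacunary_range] by simp
qed simp

lemma tail_s_shift:
 "foldr (%i k. sx0 (tail_s lacunary i (tail_enum n lacunary k))) (map lacunary [m..<m + M]) (sx0 ([], m + M)) = sx0 ([], m)"
proof (induction M arbitrary: m)
 case (Suc M)
 have "([], Suc m) : tail_set n lacunary" by (simp add: tail_set_def)
 hence "tail_enum n lacunary (sx0 ([], Suc m)) = ([], Suc m)" by (rule tail_enum_idx[of lacunary n, OF lacunary_range])
 moreover have "[m..<m + Suc M] = m # [Suc m..<Suc m + M]" by (simp add: upt_conv_Cons del: upt_Suc)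
 ultimately show ?case using Suc.IH[of "Suc m"] by (simp add: tail_s_def del: upt_Suc)
qed simp

text \<open>Every basis vector is a finite word followed by a shifted tail of the itinerary, so a
  long enough initial piece contains a letter that tells all shifts up to \<open>L\<close> apart.
  This supplies the words for the compression at any given basis vector.\<close>

lemma lacunary_words:
 "EX xi x'. xi : wd & L <= length xi & (ALL p<=L. ALL q<=L. p ~= q --> incomparable (drop p xi) (drop q xi)) &
  x = foldr (%i k. sx0 (tail_s lacunary i (tail_enum n lacunary k))) xi x'"
proof -
 obtain u m where um: "tail_enum n lacunary x = (u, m)" by (cases "tail_enum n lacunary x")
 have t: "(u, m) : tail_set n lacunary" using tail_enum_in[of lacunary n x, OF lacunary_range] um by simp
 \<comment> \<open>A power of two whose gap outlasts the \<open>m\<close> letters lost to the lag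
   and the up to \<open>L\<close> dropped letters; \<open>2 * (L + m) < N\<close> keeps the natural
   subtractions in \<open>k\<close> exact.\<close>
 define N :: nat where "N = 2 ^ Suc (L + m)"
 have "L + m < 2 ^ (L + m)" by (rule less_exp)
 hence N: "2 * (L + m) < N" unfolding N_def power_Suc by (intro mult_strict_left_mono) simp_all
 define xi where "xi = u @ map lacunary [m..<m + (N + 1)]"
 have xn: "xi ! (length u + y) = lacunary (m + y)" if "y <= N" for y using that by (simp add: xi_def nth_append)
 have lx: "length xi = length u + N + 1" by (simp add: xi_def)
 have inc: "incomparable (drop p xi) (drop q xi) & incomparable (drop q xi) (drop p xi)" if pq: "p < q" "q <= L" for p q
 proof -
  define e where "e = q - p"
  \<comment> \<open>At this position the tail from \<open>p\<close> shows letter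
    \<open>N - e\<close> of the itinerary and the tail from \<open>q\<close> shows letter
    \<open>N\<close>.\<close>
  define k where "k = length u + (N - m - e) - p"
  have e: "0 < e" "e <= L + m" "p + e = q" using pq by (auto simp: e_def)
  have k: "p + k = length u + (N - m - e)" "q + k = length u + (N - m)" using pq N e by (simp_all add: k_def)
  have "drop p xi ! k ~= drop q xi ! k"
  proof -
   have "xi ! (p + k) = lacunary (N - e)" unfolding k(1) using pq N e by (subst xn) simp_all
   moreover have "xi ! (q + k) = lacunary N" unfolding k(2) using N by (subst xn) simp_all
   ultimately show ?thesis using lacunary_aperiodic[OF e(1,2)] pq lx N by (simp add: N_def)
  qed
  moreover have "k < length (drop p xi)" "k < length (drop q xi)" using k pq N lx by simp_all
  ultimately show ?thesis using incomparable_nth by blast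
 qed
 have "incomparable (drop p xi) (drop q xi)" if "p <= L" "q <= L" "p ~= q" for p q
  using inc[of p q] inc[of q p] that by (meson linorder_neqE_nat)
 moreover have "xi : wd" using t lacunary_range by (auto simp: xi_def tail_set_def wd_def)
 moreover have "x = foldr (%i k. sx0 (tail_s lacunary i (tail_enum n lacunary k))) xi (sx0 ([], m + (N + 1)))"
  unfolding xi_def foldr_append tail_s_shift tail_s_path[OF t] using tidx_enum[of lacunary n x, OF lacunary_range] um by simp
 ultimately show ?thesis using lx N by (intro exI[of _ xi] exI[of _ "sx0 ([], m + (N + 1))"]) auto
qed

end

theorem corollary4p8:
  fixes n :: nat
    and \<omega> :: "nat \<Rightarrow> 'g :: {topological_ab_group_add, t2_space} \<Rightarrow> complex"
    and A :: "'a cstar" and S :: "nat \<Rightarrow> 'a"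
    and \<alpha> :: "'g \<Rightarrow> 'a \<Rightarrow> 'a"
    and \<mu> :: "'g measure"
    and B :: "'b cstar"
  assumes "n \<ge> 2"
    and "locally_compact_space (euclidean :: 'g topology)"
    and "\<forall>i\<in>{1..n}. \<omega> i \<in> dual_group"
    and "cuntz_algebra n A S"
    and "cstar_action \<alpha> A"
    and "\<forall>t. \<forall>i\<in>{1..n}. \<alpha> t (S i) = \<omega> i t \<odot>\<^bsub>A\<^esub> S i"
    and "haar_measure \<mu>"
    and "crossed_product \<mu> \<alpha> A B"
    and "simple_cstar B"
  shows "purely_infinite B \<or> AF_embeddable B"
proof -
 interpret quasi_free \<mu> n \<omega> A S \<alpha> by unfold_locales (use assms in auto)
 obtain j where "enveloping_cstar_algebra E B j" using assms(8) by (auto simp: crossed_product_def E_def)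
 then interpret simple_crossed_product \<mu> n \<omega> A S \<alpha> B j by unfold_locales (use assms(9) in auto)
 \<comment> \<open>One representation, along the lacunary itinerary with the trivial base character,
   serves both cases.\<close>
 interpret C: covariant \<mu> n \<omega> A S \<alpha> "%i k. sx0 (tail_s lacunary i (tail_enum n lacunary k))"
  "%k. tail_hd lacunary (tail_enum n lacunary k)" "%k. sx0 (tail_tl (tail_enum n lacunary k))" "tail_c lacunary (%_. 1)"
  by (rule tail_covariant[OF lacunary_range dual_one])
 interpret C: simple_rep \<mu> n \<omega> A S \<alpha> B j "%i k. sx0 (tail_s lacunary i (tail_enum n lacunary k))"
  "%k. tail_hd lacunary (tail_enum n lacunary k)" "%k. sx0 (tail_tl (tail_enum n lacunary k))" "tail_c lacunary (%_. 1)"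
  by unfold_locales
 show ?thesis
 proof (cases "EX i:{1..n}. recurrent i")
  case True
  then obtain i where i: "i : {1..n}" "recurrent i" by blast
  have "purely_infinite B" by (rule C.purely_infinite_case[OF i]) (simp only: C.good_def C.sw_def conj_assoc lacunary_words)
  thus ?thesis ..
 next
  case False
  have af: "finite {u : wd. om u : Y}" if "equi Y" for Y using dichotomy[OF that] False by blast
  obtain Ps where Ps: "op_hom B Ps" "ALL b:carrier B. norm (Ps b) = nrm B b"
   "Ps ` carrier B = closure (C.alg0 FC)" using C.isometric_hom by blast
  \<comment> \<open>The type of the AF-algebra is built over \<open>'b\<close>, which must admit an
    injection from \<open>nat\<close>; the integer multiples of a nonzero element of
    \<open>B\<close> are pairwise different.\<close>
  have "infinite (UNIV :: 'b set)"
  proof -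
   obtain b where b: "b : carrier B" "b ~= \<zero>\<^bsub>B\<^esub>"
    using simple B.zero_closed unfolding simple_cstar_def by blast
   hence "nrm B b ~= 0" using B.nrm_eq_zero by blast
   moreover have "nrm B (of_nat k \<odot>\<^bsub>B\<^esub> b) = real k * nrm B b" for k using b by (simp add: B.nrm_smult)
   ultimately have "inj (%k :: nat. of_nat k \<odot>\<^bsub>B\<^esub> b)" by (intro injI) (metis mult_right_cancel of_nat_eq_iff)
   thus ?thesis using infinite_UNIV_nat finite_subset[OF subset_UNIV] finite_imageD by blast
  qed
  from C.AF_case[OF af cstar_B Ps(1) _ Ps(3) this] Ps(2) show ?thesis by blast
 qed
qed

end
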